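(* Let $1\le p_1,p_2,q_1,q_2\le\infty$, $s_1,s_2,t_1,t_2\in\mathbb{R}$, and $\tau\in\{0,1\}$. Then $$(\ast)\qquad\forall\sigma\in W(\mathscr{F}L^1,L^\infty)(\mathbb{R}^{2d})\Longrightarrow OP_\tau(\sigma):\mathcal{M}^{p_1,q_1}_{v_{s_1,t_1}}(\mathbb{R}^d)\longrightarrow M^{p_2,q_2}_{v_{s_2,t_2}}(\mathbb{R}^d)$$ if and only if, in the case $\tau=0$, $$\begin{cases}s_2,t_2\le0\le s_1,t_1,\\ 0<\frac1{p_1}+\frac{s_1}d\ \text{ or }\ (p_1,s_1)=(\infty,0),\\ \frac1{p_2}+\frac{s_2}d<0\ \text{ or }\ (p_2,s_2)=(\infty,0),\\ 1<\frac1{q_1}+\frac{t_1}d\ \text{ or }\ (q_1,t_1)=(1,0),\\ \frac1{q_2}+\frac{t_2}d<1\ \text{ or }\ (q_2,t_2)=(1,0),\\ \frac1{q_2}+\frac{s_2+t_2}d<0\ \text{ or }\ (q_2,s_2,t_2)=(\infty,0,0),\end{cases}$$ and, in the case $\tau=1$, $$\begin{cases}s_2,t_2\le0\le s_1,t_1,\\ 1<\frac1{p_1}+\frac{s_1}d\ \text{ or }\ (p_1,s_1)=(1,0),\\ \frac1{p_2}+\frac{s_2}d<1\ \text{ or }\ (p_2,s_2)=(1,0),\\ 0<\frac1{q_1}+\frac{t_1}d\ \text{ or }\ (q_1,t_1)=(\infty,0),\\ \frac1{q_2}+\frac{t_2}d<0\ \text{ or }\ (q_2,t_2)=(\infty,0),\\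 1<\frac1{q_1}+\frac{s_1+t_1}d\ \text{ or }\ (q_1,s_1,t_1)=(1,0,0).\end{cases}$$ In particular, when $s_i=t_i=0$, $i=1,2$, $(\ast)$ holds if and only if $q_1=1$, $p_2=q_2=\infty$ in the case $\tau=0$, and $q_2=\infty$, $p_1=q_1=1$ in the case $\tau=1$.
   Context: $1/\infty=0$. $\langle\cdot,\cdot\rangle$ extends $\langle f,g\rangle=\int f\bar g$ to $\mathcal{S}'\times\mathcal{S}$. $\langle x\rangle=(1+|x|^2)^{1/2}$ and $v_{s,t}(z)=\langle z_1\rangle^s\langle z_2\rangle^t$ for $z=(z_1,z_2)\in\mathbb{R}^{2d}$. $\tau$-Wigner distribution: $W_\tau(f_1,f_2)(x,\xi)=\int_{\mathbb{R}^d}f_1(x+\tau t)\overline{f_2(x-(1-\tau)t)}e^{-2\pi i\xi\cdot t}\,dt$. $\tau$-pseudodifferential operator with symbol $\sigma\in\mathcal{S}'(\mathbb{R}^{2d})$: $\langle OP_\tau(\sigma)f,g\rangle=\langle\sigma,W_\tau(g,f)\rangle$ for $f,g\in\mathcal{S}(\mathbb{R}^d)$. Function spaces: for $f\in\mathcal{S}'(\mathbb{R}^n)$ and a fixed nonzero $\phi\in\mathcal{S}(\mathbb{R}^n)$, $V_\phi f(x,\xi)=\langle f,M_\xi T_x\phi\rangle$ with $T_xg(t)=g(t-x)$, $M_\xi g(t)=e^{2\pi it\cdot\xi}g(t)$. $M^{p,q}_m(\mathbb{R}^n)$ is the set of $f\in\mathcal{S}'(\mathbb{R}^n)$ with $\|f\|_{M^{p,q}_m}=\big(\int(\int|V_\phi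 f(x,\xi)|^pm(x,\xi)^pdx)^{q/p}d\xi\big)^{1/q}<\infty$ (usual modification if $p$ or $q$ is $\infty$; different $\phi$ give equivalent norms). $\mathcal{M}^{p,q}_m(\mathbb{R}^n)$ is the closure of $\mathcal{S}(\mathbb{R}^n)$ in $M^{p,q}_m(\mathbb{R}^n)$. The Wiener amalgam space $W(\mathscr{F}L^p,L^q)(\mathbb{R}^{2d})=\mathscr{F}M^{p,q}(\mathbb{R}^{2d})$ is the set of $F\in\mathcal{S}'(\mathbb{R}^{2d})$ with (up to equivalence) $\|F\|=\big(\int_{\mathbb{R}^{2d}}(\int_{\mathbb{R}^{2d}}|V_\Phi F(\zeta,-z)|^pdz)^{q/p}d\zeta\big)^{1/q}<\infty$ for a nonzero $\Phi\in\mathcal{S}(\mathbb{R}^{2d})$ (usual modifications). The notation "$\forall\sigma\in X\Longrightarrow OP_\tau(\sigma):\mathcal{M}^{p_1,q_1}_{m_1}\to M^{p_2,q_2}_{m_2}$" means that for every $\sigma\in X$ there is $C_\sigma$ with $\|OP_\tau(\sigma)f\|_{M^{p_2,q_2}_{m_2}}\le C_\sigma\|f\|_{M^{p_1,q_1}_{m_1}}$ for all $f\in\mathcal{S}(\mathbb{R}^d)$. *)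

theory Defs
  imports "HOL-Analysis.Analysis" "HOL-Probability.Essential_Supremum"
begin

definition japanese :: "'a::euclidean_space \<Rightarrow> real"
  where "japanese x = sqrt (1 + (norm x)\<^sup>2)"

definition weight :: "real \<Rightarrow> real \<Rightarrow> 'a::euclidean_space \<times> 'a \<Rightarrow> real"
  where "weight s t z = japanese (fst z) powr s * japanese (snd z) powr t"

text \<open>A multi-index is encoded as a list of basis vectors, one entry per partial derivative taken.\<close>

primrec partials :: "'a list \<Rightarrow> ('a::euclidean_space \<Rightarrow> complex) \<Rightarrow> 'a \<Rightarrow> complex" where
  "partials [] f = f"
| "partials (b # bs) f = (\<lambda>x. frechet_derivative (partials bs f) (at x) b)"

definition schwartz :: "('a::euclidean_space \<Rightarrow> complex) set"
  where "schwartz = {f. \<forall>bs. set bs \<subseteq> Basis \<longrightarrow>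
    (\<forall>x. partials bs f differentiable (at x)) \<and>
    (\<forall>N::nat. bounded (range (\<lambda>x. of_real (japanese x ^ N) * partials bs f x)))}"

definition schwartz_seminorm :: "nat \<Rightarrow> ('a::euclidean_space \<Rightarrow> complex) \<Rightarrow> real"
  where "schwartz_seminorm N f =
    (SUP (bs, x) \<in> {bs. set bs \<subseteq> Basis \<and> length bs \<le> N} \<times> UNIV.
       japanese x ^ N * cmod (partials bs f x))"

text \<open>The pairing of a tempered distribution with a Schwartz function extends
  \<open>\<integral> f * cnj g\<close>, so distributions are \<^emph>\<open>conjugate\<close>-linear continuous functionals on
  the Schwartz space.  A functional is represented by a function on all of
  \<open>'a \<Rightarrow> complex\<close>; its values outside \<open>schwartz\<close> are irrelevant.  Since the seminorms
  increase with \<open>N\<close>, continuity means domination by one of them.\<close>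

type_synonym 'a functional = "('a \<Rightarrow> complex) \<Rightarrow> complex"

definition tempered :: "'a::euclidean_space functional set"
  where "tempered = {u.
    (\<forall>f\<in>schwartz. \<forall>g\<in>schwartz. u (\<lambda>x. f x + g x) = u f + u g) \<and>
    (\<forall>c. \<forall>f\<in>schwartz. u (\<lambda>x. c * f x) = cnj c * u f) \<and>
    (\<exists>C N. \<forall>f\<in>schwartz. cmod (u f) \<le> C * schwartz_seminorm N f)}"

definition fun_distr :: "('a::euclidean_space \<Rightarrow> complex) \<Rightarrow> 'a functional"
  where "fun_distr f = (\<lambda>g. LINT x|lborel. f x * cnj (g x))"

definition stft :: "('a::euclidean_space \<Rightarrow> complex) \<Rightarrow> 'a functional \<Rightarrow> 'a \<Rightarrow> 'a \<Rightarrow> complex"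
  where "stft \<phi> u x \<xi> = u (\<lambda>t. cis (2 * pi * (t \<bullet> \<xi>)) * \<phi> (t - x))"

text \<open>Powers of extended nonnegative reals; used for \<open>r > 0\<close> only.\<close>

definition epowr :: "ennreal \<Rightarrow> real \<Rightarrow> ennreal"
  where "epowr y r = (if y = \<infinity> then \<infinity> else ennreal (enn2real y powr r))"

definition recip :: "ennreal \<Rightarrow> real"
  where "recip p = enn2real (1 / p)"

definition Lp_norm :: "ennreal \<Rightarrow> ('a::euclidean_space \<Rightarrow> ennreal) \<Rightarrow> ennreal"
  where "Lp_norm p g =
    (if p = \<infinity> then esssup lborel g
     else epowr (\<integral>\<^sup>+ x. epowr (g x) (enn2real p) \<partial>lborel) (recip p))"

definition modulation_norm ::
    "('a::euclidean_space \<Rightarrow> complex) \<Rightarrow> ennreal \<Rightarrow> ennreal \<Rightarrow> ('a \<times> 'a \<Rightarrow> real)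
      \<Rightarrow> 'a functional \<Rightarrow> ennreal"
  where "modulation_norm \<phi> p q m u =
    Lp_norm q (\<lambda>\<xi>. Lp_norm p (\<lambda>x. ennreal (cmod (stft \<phi> u x \<xi>) * m (x, \<xi>))))"

definition wiener_amalgam_norm ::
    "('a::euclidean_space \<Rightarrow> complex) \<Rightarrow> ennreal \<Rightarrow> ennreal \<Rightarrow> 'a functional \<Rightarrow> ennreal"
  where "wiener_amalgam_norm \<Phi> p q u =
    Lp_norm q (\<lambda>\<zeta>. Lp_norm p (\<lambda>z. ennreal (cmod (stft \<Phi> u \<zeta> (- z)))))"

definition wiener_amalgam ::
    "('a::euclidean_space \<Rightarrow> complex) \<Rightarrow> ennreal \<Rightarrow> ennreal \<Rightarrow> 'a functional set"
  where "wiener_amalgam \<Phi> p q = {u \<in> tempered. wiener_amalgam_norm \<Phi> p q u < \<infinity>}"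

definition wigner ::
    "real \<Rightarrow> ('a::euclidean_space \<Rightarrow> complex) \<Rightarrow> ('a \<Rightarrow> complex) \<Rightarrow> 'a \<times> 'a \<Rightarrow> complex"
  where "wigner \<tau> f1 f2 = (\<lambda>(x, \<xi>). LINT t|lborel.
    f1 (x + \<tau> *\<^sub>R t) * cnj (f2 (x - (1 - \<tau>) *\<^sub>R t)) * cis (- 2 * pi * (\<xi> \<bullet> t)))"

definition OP ::
    "real \<Rightarrow> ('a::euclidean_space \<times> 'a) functional \<Rightarrow> ('a \<Rightarrow> complex) \<Rightarrow> 'a functional"
  where "OP \<tau> \<sigma> f = (\<lambda>g. \<sigma> (wigner \<tau> g f))"

text \<open>Boundedness on the closure of the Schwartz space is by definition the norm estimate on
  Schwartz functions; the constant may depend on the symbol.\<close>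

definition OP_bounded ::
    "real \<Rightarrow> ('a::euclidean_space \<times> 'a) functional set \<Rightarrow> ('a \<Rightarrow> complex)
      \<Rightarrow> ennreal \<Rightarrow> ennreal \<Rightarrow> ('a \<times> 'a \<Rightarrow> real)
      \<Rightarrow> ennreal \<Rightarrow> ennreal \<Rightarrow> ('a \<times> 'a \<Rightarrow> real) \<Rightarrow> bool"
  where "OP_bounded \<tau> X \<phi> p1 q1 m1 p2 q2 m2 \<longleftrightarrow>
    (\<forall>\<sigma>\<in>X. \<exists>C::real. \<forall>f\<in>schwartz.
      modulation_norm \<phi> p2 q2 m2 (OP \<tau> \<sigma> f)
        \<le> ennreal C * modulation_norm \<phi> p1 q1 m1 (fun_distr f))"

end

theory Submission imports Defs begin

text \<open>Sufficiency: a Wigner distribution with \<open>\<tau> \<in> {0, 1}\<close> is a tensor product of a function and a Fourier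
 transform times a chirp, so after a linear substitution its short-time Fourier transform separates.
 Hence that of \<open>OP \<tau> \<sigma> f\<close> is at most a smoothing of \<open>\<integral> T F\<close>, where \<open>F\<close> is that of \<open>f\<close> and \<open>T (\<zeta>, \<cdot>)\<close> is
 integrable uniformly in \<open>\<zeta>\<close>. Under the conditions on \<open>p2, q2, s2, t2\<close> smoothings of functions that are integrable
 along slices have a finite mixed norm, and the conditions on \<open>p1, q1, s1, t1\<close> are the dual ones for the input.

 Necessity: the symbols \<open>\<Sum>\<^sub>n 2\<^sup>-\<^sup>n exp (2 \<pi> \<i> l\<^sub>n \<bullet> z) \<cdot> exp (\<plusminus> 2 \<pi> \<i> x \<bullet> \<xi>) \<cdot> exp (\<pi> \<i> k |x|\<^sup>2)\<close> belong to the
 amalgam space. If \<open>l\<^sub>n\<close> varies in one variable only, the operator has rank one, \<open>f \<mapsto> \<Lambda> f \<cdot> D\<close>, so that \<open>D\<close> has a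
 finite norm and \<open>\<Lambda>\<close> is bounded. Constant, quadratic (\<open>k = 1\<close>) and lacunary choices give all conditions, where \<open>\<Lambda>\<close> is
 tested on time-frequency shifts of one function and on their superpositions.\<close>

text \<open>The constant in the boundedness statement may depend on the symbol, so a sign condition
  such as \<open>t2 \<le> 0\<close> cannot be read off by moving a single symbol to infinity. The
  series packs infinitely many characters into one symbol: its coefficients 2^-n are outgrown by
  points at which the weight in question, or its reciprocal, is at least 4^n. This gliding hump
  stands in for a uniform boundedness argument. The bilinear phase of the symbols is the chirp of
  the Wigner distribution itself; the two cancel, and what remains under the integral is essentially
  a tensor product. The difficulty of the sufficiency is the order of integration. For \<tau> = 0
  the slice bound of the output controls integrals over \<xi> at fixed x, while the norm integrates
  over x first; for p2 > q2 this calls for an interpolation between two weights. On the input side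
  the slices run the other way, for \<tau> = 1 the roles are exchanged, and duality turns an input
  condition into an output condition. Hence one convolution estimate for each direction serves all
  four situations.\<close>

abbreviation Borel ("\<B>") where "\<B> \<equiv> borel_measurable borel"

abbreviation lebesgue_nn_integral (binder "\<integral>" 10) where "lebesgue_nn_integral f \<equiv> nn_integral lborel f"

section \<open>Schwartz functions and their multipliers\<close>

abbreviation pd :: "'a::euclidean_space => ('a => complex) => 'a => complex"
 where "pd b f \<equiv> (\<lambda>x. frechet_derivative f (at x) b)"

lemma japanese_ge_1: "1 \<le> japanese x"
 by (simp add: japanese_def)

lemma japanese_pos [simp]: "0 < japanese x" and japanese_nonneg [simp]: "0 \<le> japanese x"
 and japanese_neq_0 [simp]: "japanese x \<noteq> 0"
 using japanese_ge_1[of x] by linarith+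

lemma norm_le_japanese: "norm x \<le> japanese x"
 by (simp add: japanese_def real_le_rsqrt)

lemma japanese_le: "japanese x \<le> 1 + norm x"
 unfolding japanese_def by (rule real_le_lsqrt) (auto simp: power2_eq_square algebra_simps)

lemma japanese_minus [simp]: "japanese (- x) = japanese x"
 by (simp add: japanese_def)

lemma continuous_japanese [continuous_intros]:
 "continuous_on S f ==> continuous_on S (\<lambda>x. japanese (f x))"
 unfolding japanese_def by (intro continuous_intros)

lemma measurable_japanese [measurable]: "japanese \<in> \<B>"
 by (intro borel_measurable_continuous_onI continuous_intros)

lemma japanese_add: "japanese (x + y) \<le> 2 * japanese x * japanese y"
proof -
 have "(norm (x + y))\<^sup>2 \<le> (norm x + norm y)\<^sup>2"
  by (intro power_mono norm_triangle_ineq) auto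
 also have "\<dots> \<le> 2 * (norm x)\<^sup>2 + 2 * (norm y)\<^sup>2"
  using sum_squares_bound[of "norm x" "norm y"] by (simp add: power2_sum)
 also have "\<dots> \<le> 2\<^sup>2 * ((1 + (norm x)\<^sup>2) * (1 + (norm y)\<^sup>2)) - 1"
  by (simp add: algebra_simps)
 finally have "1 + (norm (x + y))\<^sup>2 \<le> 2\<^sup>2 * ((1 + (norm x)\<^sup>2) * (1 + (norm y)\<^sup>2))"
  by simp
 then have "japanese (x + y) \<le> sqrt (2\<^sup>2 * ((1 + (norm x)\<^sup>2) * (1 + (norm y)\<^sup>2)))"
  unfolding japanese_def by (rule real_sqrt_le_mono)
 then show ?thesis by (simp only: real_sqrt_mult japanese_def real_sqrt_abs mult.assoc abs_numeral)
qed

lemma japanese_Pair: "japanese (x, y) \<le> japanese x * japanese y"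
proof -
 have "1 + ((norm x)\<^sup>2 + (norm y)\<^sup>2) \<le> (1 + (norm x)\<^sup>2) * (1 + (norm y)\<^sup>2)"
  by (simp add: algebra_simps)
 then show ?thesis
  unfolding japanese_def real_sqrt_mult[symmetric] by (auto simp: norm_Pair)
qed

lemma japanese_fst_le: "japanese x \<le> japanese (x, y)"
 and japanese_snd_le: "japanese y \<le> japanese (x, y)"
 by (auto simp: japanese_def norm_Pair)

definition rapid :: "('a::euclidean_space => complex) => bool"
 where "rapid f \<longleftrightarrow> (\<forall>N::nat. \<exists>C. \<forall>x. japanese x ^ N * cmod (f x) \<le> C)"

definition polyb :: "('a::euclidean_space => complex) => bool"
 where "polyb f \<longleftrightarrow> (\<exists>N::nat. \<exists>C. \<forall>x. cmod (f x) \<le> C * japanese x ^ N)"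

text \<open>The multipliers of the Schwartz space (Schwartz's class \<open>O_M\<close>).\<close>

definition slow :: "('a::euclidean_space => complex) set"
 where "slow = {f. \<forall>bs. set bs \<subseteq> Basis \<longrightarrow>
  (\<forall>x. partials bs f differentiable (at x)) \<and> polyb (partials bs f)}"

lemma schwartz_iff: "f \<in> schwartz \<longleftrightarrow> (\<forall>bs. set bs \<subseteq> Basis \<longrightarrow>
  (\<forall>x. partials bs f differentiable (at x)) \<and> rapid (partials bs f))"
 unfolding schwartz_def rapid_def bounded_iff by (auto simp: norm_mult norm_power)

lemma partials_append: "partials bs (partials cs f) = partials (bs @ cs) f"
 by (induction bs) auto

lemma partials_in_coinduct:
 assumes "f \<in> X" "\<And>g b. g \<in> X ==> b \<in> Basis ==> pd b g \<in> X" "set bs \<subseteq> Basis"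
 shows "partials bs f \<in> X"
 using assms(3) by (induction bs) (auto simp: assms(1,2))

text \<open>Since \<open>partials\<close> iterates single derivatives, a set of functions closed
  under first derivatives contains all the higher ones. Membership is therefore shown by exhibiting
  an invariant set \<open>X\<close>, and no multi-index has to be handled.\<close>

lemma schwartz_coinduct:
 assumes "f \<in> X" "\<And>g b. g \<in> X ==> b \<in> Basis ==> pd b g \<in> X"
  "\<And>g x. g \<in> X ==> g differentiable (at x)" "\<And>g. g \<in> X ==> rapid g"
 shows "f \<in> schwartz"
 unfolding schwartz_iff using partials_in_coinduct[OF assms(1,2)] assms(3,4) by blast

lemma slow_coinduct:
 assumes "f \<in> X" "\<And>g b. g \<in> X ==> b \<in> Basis ==> pd b g \<in> X"
  "\<And>g x. g \<in> X ==> g differentiable (at x)" "\<And>g. g \<in> X ==> polyb g"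
 shows "f \<in> slow"
 unfolding slow_def using partials_in_coinduct[OF assms(1,2)] assms(3,4) by blast

lemma schwartz_partials: "f \<in> schwartz ==> set bs \<subseteq> Basis ==> partials bs f \<in> schwartz"
 unfolding schwartz_iff by (auto simp: partials_append)

lemma schwartz_pd: "f \<in> schwartz ==> b \<in> Basis ==> pd b f \<in> schwartz"
 using schwartz_partials[of f "[b]"] by simp

lemma slow_partials: "f \<in> slow ==> set bs \<subseteq> Basis ==> partials bs f \<in> slow"
 unfolding slow_def by (auto simp: partials_append)

lemma slow_pd: "f \<in> slow ==> b \<in> Basis ==> pd b f \<in> slow"
 using slow_partials[of f "[b]"] by simp

lemma schwartz_diff: "f \<in> schwartz ==> f differentiable (at x)"
 unfolding schwartz_iff by (auto dest: spec[of _ "[]"])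

lemma schwartz_rapid: "f \<in> schwartz ==> rapid f"
 unfolding schwartz_iff by (auto dest: spec[of _ "[]"])

lemma slow_diff: "f \<in> slow ==> f differentiable (at x)"
 unfolding slow_def by (auto dest: spec[of _ "[]"])

lemma slow_polyb: "f \<in> slow ==> polyb f"
 unfolding slow_def by (auto dest: spec[of _ "[]"])

lemma schwartz_has_derivative:
 "f \<in> schwartz ==> (f has_derivative frechet_derivative f (at x)) (at x)"
 using schwartz_diff frechet_derivative_works by blast

lemma slow_has_derivative:
 "f \<in> slow ==> (f has_derivative frechet_derivative f (at x)) (at x)"
 using slow_diff frechet_derivative_works by blast

lemma pd_eqI: "(\<And>x. (f has_derivative f' x) (at x)) ==> pd b f = (\<lambda>x. f' x b)"
 by (metis frechet_derivative_at)

lemma has_derivative_expand: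
 fixes f :: "'a::euclidean_space => 'b::real_normed_vector"
 assumes "(f has_derivative D) F"
 shows "D v = (\<Sum>b\<in>Basis. (v \<bullet> b) *\<^sub>R D b)"
proof -
 interpret bounded_linear D by (rule has_derivative_bounded_linear[OF assms])
 have "D v = D (\<Sum>b\<in>Basis. (v \<bullet> b) *\<^sub>R b)" by (simp add: euclidean_representation)
 then show ?thesis by (simp add: sum scaleR)
qed

lemma rapidD:
 assumes "rapid f" obtains C where "C \<ge> 0" "\<And>x. cmod (f x) \<le> C / japanese x ^ N"
proof -
 obtain C where C: "\<And>x. japanese x ^ N * cmod (f x) \<le> C"
  using assms unfolding rapid_def by blast
 have "C \<ge> 0" by (rule order_trans[OF _ C[of undefined]]) simp
 then show ?thesis using C by (intro that[of C]) (auto simp: field_simps)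
qed

lemma rapidI:
 assumes "\<And>N::nat. \<exists>C. \<forall>x. japanese x ^ N * cmod (f x) \<le> C" shows "rapid f"
 using assms unfolding rapid_def by blast

lemma rapid_add: assumes "rapid f" "rapid g" shows "rapid (\<lambda>x. f x + g x)"
proof (rule rapidI)
 fix N
 obtain C D where "\<And>x. japanese x ^ N * cmod (f x) \<le> C" "\<And>x. japanese x ^ N * cmod (g x) \<le> D"
  using assms unfolding rapid_def by meson
 then have "japanese x ^ N * cmod (f x) + japanese x ^ N * cmod (g x) \<le> C + D" for x
  by (intro add_mono)
 then have "japanese x ^ N * cmod (f x + g x) \<le> C + D" for x
  using mult_left_mono[OF norm_triangle_ineq[of "f x" "g x"], of "japanese x ^ N"]
  by (simp add: distrib_left order_trans)
 then show "\<exists>C. \<forall>x. japanese x ^ N * cmod (f x + g x) \<le> C" by blast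
qed

lemma rapid_mult: assumes "rapid f" "polyb g" shows "rapid (\<lambda>x. f x * g x)"
proof (rule rapidI)
 fix N
 obtain M D where D: "\<And>x. cmod (g x) \<le> D * japanese x ^ M"
  using assms unfolding polyb_def by meson
 obtain C where C: "\<And>x. japanese x ^ (N + M) * cmod (f x) \<le> C"
  using assms unfolding rapid_def by meson
 have D0: "D \<ge> 0" using order_trans[OF norm_ge_zero D[of 0]] by (simp add: japanese_def)
 have "japanese x ^ N * cmod (f x * g x) \<le> C * D" for x
 proof -
  have "japanese x ^ N * cmod (f x * g x) \<le> japanese x ^ N * (cmod (f x) * (D * japanese x ^ M))"
   unfolding norm_mult by (intro mult_left_mono D) auto
  also have "\<dots> = (japanese x ^ (N + M) * cmod (f x)) * D" by (simp add: power_add)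
  also have "\<dots> \<le> C * D" using C D0 by (intro mult_right_mono) auto
  finally show ?thesis .
 qed
 then show "\<exists>C. \<forall>x. japanese x ^ N * cmod (f x * g x) \<le> C" by blast
qed

lemma polybI_bounded: "(\<And>x. cmod (f x) \<le> C) ==> polyb f"
 unfolding polyb_def by (intro exI[of _ 0] exI[of _ C]) auto

lemma rapid_imp_polyb: "rapid f ==> polyb f"
 unfolding rapid_def by (metis polybI_bounded mult_1 power_0)

lemma polyb_raise:
 assumes "\<And>x. cmod (f x) \<le> C * japanese x ^ N" "N \<le> M" "C \<le> D" "0 \<le> D"
 shows "cmod (f x) \<le> D * japanese x ^ M"
proof -
 have "C * japanese x ^ N \<le> D * japanese x ^ M"
  using assms by (intro mult_mono power_increasing japanese_ge_1) auto
 then show ?thesis using assms(1)[of x] by linarith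
qed

lemma polyb_add: assumes "polyb f" "polyb g" shows "polyb (\<lambda>x. f x + g x)"
proof -
 obtain N C where f: "\<And>x. cmod (f x) \<le> C * japanese x ^ N" using assms unfolding polyb_def by meson
 obtain M D where g: "\<And>x. cmod (g x) \<le> D * japanese x ^ M" using assms unfolding polyb_def by meson
 have "cmod (f x + g x) \<le> (max 0 C + max 0 D) * japanese x ^ max N M" for x
  using norm_triangle_ineq[of "f x" "g x"]
   polyb_raise[OF f, of "max N M" "max 0 C" x] polyb_raise[OF g, of "max N M" "max 0 D" x]
  by (simp add: algebra_simps)
 then show ?thesis unfolding polyb_def by blast
qed

lemma polyb_mult: assumes "polyb f" "polyb g" shows "polyb (\<lambda>x. f x * g x)"
proof -
 obtain N C where f: "\<And>x. cmod (f x) \<le> C * japanese x ^ N" using assms unfolding polyb_def by meson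
 obtain M D where g: "\<And>x. cmod (g x) \<le> D * japanese x ^ M" using assms unfolding polyb_def by meson
 have "cmod (f x * g x) \<le> (C * D) * japanese x ^ (N + M)" for x
  using mult_mono[OF f g order_trans[OF norm_ge_zero f] norm_ge_zero, of x x]
  by (simp add: norm_mult power_add mult_ac)
 then show ?thesis unfolding polyb_def by blast
qed

lemma schwartz_add: fixes f g :: "'a::euclidean_space => complex"
 assumes "f \<in> schwartz" "g \<in> schwartz" shows "(\<lambda>x. f x + g x) \<in> schwartz"
proof (rule schwartz_coinduct)
 show "(\<lambda>x. f x + g x) \<in> {\<lambda>x. f x + g x | f g. f \<in> schwartz \<and> g \<in> schwartz}"
  using assms by blast
next
 fix h :: "'a => complex" and b :: 'a assume "h \<in> {\<lambda>x. f x + g x | f g. f \<in> schwartz \<and> g \<in> schwartz}" "b \<in> Basis"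
 then obtain f g where *: "h = (\<lambda>x. f x + g x)" "f \<in> schwartz" "g \<in> schwartz" by blast
 have "pd b h = (\<lambda>x. pd b f x + pd b g x)"
  unfolding * by (rule pd_eqI, rule has_derivative_add; rule schwartz_has_derivative, fact)
 then show "pd b h \<in> {\<lambda>x. f x + g x | f g. f \<in> schwartz \<and> g \<in> schwartz}"
  using schwartz_pd[OF *(2) \<open>b \<in> Basis\<close>] schwartz_pd[OF *(3) \<open>b \<in> Basis\<close>]
  by (intro CollectI exI[of _ "pd b f"] exI[of _ "pd b g"] conjI)
qed (auto intro: differentiable_add schwartz_diff rapid_add schwartz_rapid)

lemma slow_add: fixes f g :: "'a::euclidean_space => complex"
 assumes "f \<in> slow" "g \<in> slow" shows "(\<lambda>x. f x + g x) \<in> slow"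
proof (rule slow_coinduct)
 show "(\<lambda>x. f x + g x) \<in> {\<lambda>x. f x + g x | f g. f \<in> slow \<and> g \<in> slow}"
  using assms by blast
next
 fix h :: "'a => complex" and b :: 'a assume "h \<in> {\<lambda>x. f x + g x | f g. f \<in> slow \<and> g \<in> slow}" "b \<in> Basis"
 then obtain f g where *: "h = (\<lambda>x. f x + g x)" "f \<in> slow" "g \<in> slow" by blast
 have "pd b h = (\<lambda>x. pd b f x + pd b g x)"
  unfolding * by (rule pd_eqI, rule has_derivative_add; rule slow_has_derivative, fact)
 then show "pd b h \<in> {\<lambda>x. f x + g x | f g. f \<in> slow \<and> g \<in> slow}"
  using slow_pd[OF *(2) \<open>b \<in> Basis\<close>] slow_pd[OF *(3) \<open>b \<in> Basis\<close>]
  by (intro CollectI exI[of _ "pd b f"] exI[of _ "pd b g"] conjI)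
qed (auto intro: differentiable_add slow_diff polyb_add slow_polyb)

text \<open>Sums of products form a set closed under derivatives, which makes Leibniz' formula for
 higher derivatives unnecessary.\<close>

inductive_set sum_prod :: "('a::euclidean_space => complex) set => ('a => complex) set
  => ('a => complex) set" for A B where
 prod: "f \<in> A ==> g \<in> B ==> (\<lambda>x. f x * g x) \<in> sum_prod A B"
| add: "f \<in> sum_prod A B ==> g \<in> sum_prod A B ==> (\<lambda>x. f x + g x) \<in> sum_prod A B"

lemma sum_prod_pd:
 assumes "h \<in> sum_prod A B" and b: "b \<in> Basis"
  and "\<And>f b. f \<in> A ==> b \<in> Basis ==> pd b f \<in> A" "\<And>f b. f \<in> B ==> b \<in> Basis ==> pd b f \<in> B"
  and dA: "\<And>f x. f \<in> A ==> f differentiable (at x)" and dB: "\<And>f x. f \<in> B ==> f differentiable (at x)"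
 shows "pd b h \<in> sum_prod A B \<and> (\<forall>x. h differentiable (at x))"
 using assms(1)
proof induction
 case (prod f g)
 have "pd b (\<lambda>x. f x * g x) = (\<lambda>x. f x * pd b g x + pd b f x * g x)"
  using prod dA dB frechet_derivative_works by (intro pd_eqI has_derivative_mult) blast+
 then show ?case
  using prod assms by (auto intro!: sum_prod.intros differentiable_mult)
next
 case (add f g)
 have "pd b (\<lambda>x. f x + g x) = (\<lambda>x. pd b f x + pd b g x)"
  using add frechet_derivative_works by (intro pd_eqI has_derivative_add) blast+
 then show ?case
  using add assms by (auto intro!: sum_prod.intros differentiable_add)
qed

lemma schwartz_mult_slow: assumes "f \<in> schwartz" "g \<in> slow" shows "(\<lambda>x. f x * g x) \<in> schwartz"
proof (rule schwartz_coinduct)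
 show "(\<lambda>x. f x * g x) \<in> sum_prod schwartz slow" using assms by (rule sum_prod.intros)
 show "pd b h \<in> sum_prod schwartz slow" if "h \<in> sum_prod schwartz slow" "b \<in> Basis"
  for h and b :: 'a
  using sum_prod_pd[OF that] schwartz_pd slow_pd schwartz_diff slow_diff by blast
 show "h differentiable (at x)" if "h \<in> sum_prod schwartz slow" for h and x :: 'a
  using sum_prod_pd[OF that SOME_Basis] schwartz_pd slow_pd schwartz_diff slow_diff by blast
 show "rapid h" if "h \<in> sum_prod schwartz slow" for h :: "'a => complex"
  using that by induction (auto intro: rapid_add rapid_mult schwartz_rapid slow_polyb)
qed

lemma slow_mult: assumes "f \<in> slow" "g \<in> slow" shows "(\<lambda>x. f x * g x) \<in> slow"
proof (rule slow_coinduct)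
 show "(\<lambda>x. f x * g x) \<in> sum_prod slow slow" using assms by (rule sum_prod.intros)
 show "pd b h \<in> sum_prod slow slow" if "h \<in> sum_prod slow slow" "b \<in> Basis"
  for h and b :: 'a
  using sum_prod_pd[OF that] slow_pd slow_diff by blast
 show "h differentiable (at x)" if "h \<in> sum_prod slow slow" for h and x :: 'a
  using sum_prod_pd[OF that SOME_Basis] slow_pd slow_diff by blast
 show "polyb h" if "h \<in> sum_prod slow slow" for h :: "'a => complex"
  using that by induction (auto intro: polyb_add polyb_mult slow_polyb)
qed

lemma schwartz_imp_slow: "f \<in> schwartz ==> f \<in> slow"
 by (rule slow_coinduct[of _ schwartz]) (auto intro: schwartz_pd schwartz_diff rapid_imp_polyb schwartz_rapid)

lemma slow_const: "(\<lambda>_. c) \<in> slow"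
proof (rule slow_coinduct)
 show "(\<lambda>_::'a. c) \<in> {\<lambda>_. c | c. True}" by blast
 show "pd b g \<in> {\<lambda>_. c | c. True}" if "g \<in> {\<lambda>_. c | c. True}" for g :: "'a => complex" and b
  using that by auto
qed (auto intro: polybI_bounded)

text \<open>The derivatives of a linear function are constants, so the function together with all
  constants is an invariant set.\<close>

lemma slow_linear:
 assumes "bounded_linear l" shows "(\<lambda>x. complex_of_real (l x)) \<in> slow"
proof (rule slow_coinduct)
 show "(\<lambda>x. complex_of_real (l x)) \<in> insert (\<lambda>x. complex_of_real (l x)) {\<lambda>_. c | c. True}" by blast
 have d: "((\<lambda>x. complex_of_real (l x)) has_derivative (\<lambda>h. complex_of_real (l h))) (at x)" for x
  using bounded_linear_imp_has_derivative[OF bounded_linear_compose[OF bounded_linear_of_real assms]] .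
 show "pd b g \<in> insert (\<lambda>x. complex_of_real (l x)) {\<lambda>_. c | c. True}"
  if "g \<in> insert (\<lambda>x. complex_of_real (l x)) {\<lambda>_. c | c. True}" for g :: "'a => complex" and b
  using that pd_eqI[OF d] by auto
 show "g differentiable (at x)"
  if "g \<in> insert (\<lambda>x. complex_of_real (l x)) {\<lambda>_. c | c. True}" for g :: "'a => complex" and x
  using that d by (auto simp: differentiable_def intro: has_derivative_const)
 obtain K where "\<And>x. norm (l x) \<le> norm x * K"
  using bounded_linear.nonneg_bounded[OF assms] by blast
 moreover have "norm x * K \<le> \<bar>K\<bar> * japanese x ^ 1" for x
  using order_trans[OF mult_left_mono[OF abs_ge_self[of K] norm_ge_zero[of x]]
   mult_right_mono[OF norm_le_japanese[of x], of "\<bar>K\<bar>"]]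
  by (simp add: mult.commute)
 ultimately have "norm (l x) \<le> \<bar>K\<bar> * japanese x ^ 1" for x by (meson order_trans)
 then have "polyb (\<lambda>x. complex_of_real (l x))" unfolding polyb_def norm_of_real real_norm_def by blast
 then show "polyb g"
  if "g \<in> insert (\<lambda>x. complex_of_real (l x)) {\<lambda>_. c | c. True}" for g :: "'a => complex"
  using that by (auto intro: polybI_bounded)
qed

text \<open>Differentiation turns \<open>p * cis q\<close> into a slow function times the same
  \<open>cis q\<close>. As the phase factor has modulus 1, the growth is that of the amplitude.
  Quadratic phases are the main instance, their gradient being linear.\<close>

lemma slow_cis:
 fixes q :: "'a::euclidean_space => real"
 assumes d: "\<And>x. (q has_derivative q' x) (at x)"
  and s: "\<And>b. b \<in> Basis ==> (\<lambda>x. complex_of_real (q' x b)) \<in> slow"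
 shows "(\<lambda>x. cis (q x)) \<in> slow"
proof (rule slow_coinduct)
 let ?X = "{\<lambda>x. p x * cis (q x) | p. p \<in> slow}"
 show "(\<lambda>x. cis (q x)) \<in> ?X" using slow_const[of 1] by force
 have D: "((\<lambda>x. p x * cis (q x)) has_derivative (\<lambda>h. (frechet_derivative p (at x) h
   + \<i> * of_real (q' x h) * p x) * cis (q x))) (at x)" if "p \<in> slow" for p x
 proof -
  have "((\<lambda>x. cis (q x)) has_derivative (\<lambda>h. \<i> * of_real (q' x h) * cis (q x))) (at x)"
   using has_derivative_compose[OF bounded_linear.has_derivative[OF bounded_linear_mult_right
      [of \<i>] bounded_linear.has_derivative[OF bounded_linear_of_real d[of x]]],
     of exp "(*) (exp (\<i> * of_real (q x)))"] DERIV_exp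
   by (auto simp: cis_conv_exp has_field_derivative_def mult_ac)
  from has_derivative_mult[OF slow_has_derivative[OF that] this] show ?thesis
   by (simp add: algebra_simps)
 qed
 show "pd b h \<in> ?X" if h: "h \<in> ?X" and b: "b \<in> Basis" for h and b :: 'a
 proof -
  obtain p where p: "p \<in> slow" "h = (\<lambda>x. p x * cis (q x))" using h by blast
  have "(\<lambda>x. pd b p x + \<i> * of_real (q' x b) * p x) \<in> slow"
   by (intro slow_add slow_mult slow_pd slow_const s p b)
  then show ?thesis unfolding p(2) pd_eqI[OF D[OF p(1)], of b]
   by (intro CollectI exI[of _ "\<lambda>x. pd b p x + \<i> * of_real (q' x b) * p x"] conjI refl)
 qed
 show "h differentiable (at x)" if "h \<in> ?X" for h x
  using that D by (auto simp: differentiable_def)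
 show "polyb h" if "h \<in> ?X" for h
  using that polyb_mult[OF slow_polyb polybI_bounded[of "\<lambda>x. cis (q x)" 1]] by auto
qed

lemma slow_cis_linear:
 assumes "bounded_linear l" shows "(\<lambda>x. cis (l x)) \<in> slow"
 by (rule slow_cis[OF bounded_linear_imp_has_derivative[OF assms]]) (rule slow_const)

lemma schwartz_mult: "f \<in> schwartz ==> g \<in> schwartz ==> (\<lambda>x. f x * g x) \<in> schwartz"
 by (rule schwartz_mult_slow[OF _ schwartz_imp_slow])

lemma schwartz_cmult: "f \<in> schwartz ==> (\<lambda>x. c * f x) \<in> schwartz"
 using schwartz_mult_slow[OF _ slow_const, of f c] by (simp add: mult.commute)

lemma schwartz_cnj: assumes "f \<in> schwartz" shows "(\<lambda>x. cnj (f x)) \<in> schwartz"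
proof (rule schwartz_coinduct)
 show "(\<lambda>x. cnj (f x)) \<in> {\<lambda>x. cnj (f x) | f. f \<in> schwartz}" using assms by blast
 have D: "((\<lambda>x. cnj (f x)) has_derivative (\<lambda>h. cnj (frechet_derivative f (at x) h))) (at x)"
  if "f \<in> schwartz" for x and f :: "'a => complex"
  using has_derivative_cnj[OF schwartz_has_derivative[OF that]] .
 show "pd b h \<in> {\<lambda>x. cnj (f x) | f. f \<in> schwartz}"
  if h: "h \<in> {\<lambda>x. cnj (f x) | f. f \<in> schwartz}" and b: "b \<in> Basis" for h and b :: 'a
 proof -
  obtain f where f: "f \<in> schwartz" "h = (\<lambda>x. cnj (f x))" using h by blast
  show ?thesis unfolding f(2) pd_eqI[OF D[OF f(1)], of b]
   using schwartz_pd[OF f(1) b] by (intro CollectI exI[of _ "pd b f"]) auto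
 qed
 show "h differentiable (at x)" if "h \<in> {\<lambda>x. cnj (f x) | f. f \<in> schwartz}" for h and x :: 'a
  using that D by (auto simp: differentiable_def)
 show "rapid h" if "h \<in> {\<lambda>x. cnj (f x) | f. f \<in> schwartz}" for h :: "'a => complex"
  using that by (auto simp: rapid_def dest!: schwartz_rapid)
qed

lemma schwartz_sum:
 fixes f :: "'i => 'a::euclidean_space => complex"
 assumes "finite I" "\<And>i. i \<in> I ==> f i \<in> schwartz" shows "(\<lambda>x. \<Sum>i\<in>I. f i x) \<in> schwartz"
proof -
 have z: "(\<lambda>_::'a. 0) \<in> schwartz"
  by (rule schwartz_coinduct[of _ "{\<lambda>_. 0}"]) (auto simp: rapid_def)
 show ?thesis using assms by (induction I rule: finite_induct) (auto intro: z schwartz_add)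
qed

text \<open>The bound with \<open>K\<close> says that x cannot run to infinity while its image stays
  bounded. It takes the place of invertibility, so that translations, shears and the embeddings
  behind sections are all covered. Expanding \<open>L b\<close> in the basis keeps derivatives
  inside the family of functions \<open>f (L x + a)\<close>.\<close>

lemma schwartz_affine:
 fixes f :: "'b::euclidean_space => complex" and L :: "'a::euclidean_space => 'b"
 assumes f: "f \<in> schwartz" and L: "bounded_linear L" and K: "\<And>x. japanese x \<le> K * japanese (L x + a)"
 shows "(\<lambda>x. f (L x + a)) \<in> schwartz"
proof (rule schwartz_coinduct)
 let ?X = "{\<lambda>x. f (L x + a) | f. f \<in> schwartz}"
 show "(\<lambda>x. f (L x + a)) \<in> ?X" using f by blast
 have D: "((\<lambda>x. f (L x + a)) has_derivative (\<lambda>h. frechet_derivative f (at (L x + a)) (L h))) (at x)"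
  if "f \<in> schwartz" for f x
  using diff_chain_at[OF _ schwartz_has_derivative[OF that], of "\<lambda>x. L x + a" L x]
   has_derivative_add_const[OF bounded_linear_imp_has_derivative[OF L]] by (simp add: o_def)
 show "pd b h \<in> ?X" if h: "h \<in> ?X" and b: "b \<in> Basis" for h and b :: 'a
 proof -
  obtain f where f: "f \<in> schwartz" "h = (\<lambda>x. f (L x + a))" using h by blast
  let ?g = "\<lambda>y. \<Sum>c\<in>Basis. of_real (L b \<bullet> c) * pd c f y"
  have "pd b h = (\<lambda>x. ?g (L x + a))"
   using pd_eqI[OF D[OF f(1)], of b] f(2)
    has_derivative_expand[OF schwartz_has_derivative[OF f(1)], of _ "L b"]
   by (auto simp: scaleR_conv_of_real)
  moreover have "?g \<in> schwartz" by (intro schwartz_sum schwartz_cmult schwartz_pd f) auto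
  ultimately show ?thesis by (intro CollectI exI[of _ ?g]) auto
 qed
 show "h differentiable (at x)" if "h \<in> ?X" for h x
  using that D by (auto simp: differentiable_def)
 have K0: "K \<ge> 0"
  using K[of 0] japanese_pos[of "0::'a"] japanese_pos[of "L 0 + a"]
  by (metis (full_types) linorder_not_le mult_neg_pos order_less_trans)
 show "rapid h" if h: "h \<in> ?X" for h
 proof (rule rapidI)
  fix N
  obtain f where f: "f \<in> schwartz" "h = (\<lambda>x. f (L x + a))" using h by blast
  obtain C where C: "\<And>y. japanese y ^ N * cmod (f y) \<le> C"
   using schwartz_rapid[OF f(1)] unfolding rapid_def by meson
  have "japanese x ^ N * cmod (h x) \<le> K ^ N * C" for x
  proof -
   have "japanese x ^ N * cmod (h x) \<le> (K * japanese (L x + a)) ^ N * cmod (h x)"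
    by (intro mult_right_mono power_mono K) auto
   also have "\<dots> = K ^ N * (japanese (L x + a) ^ N * cmod (f (L x + a)))"
    unfolding f by (simp add: power_mult_distrib)
   also have "\<dots> \<le> K ^ N * C" using C K0 by (intro mult_left_mono) auto
   finally show ?thesis .
  qed
  then show "\<exists>C. \<forall>x. japanese x ^ N * cmod (h x) \<le> C" by blast
 qed
qed

lemma schwartz_translate: "f \<in> schwartz ==> (\<lambda>x. f (x + a)) \<in> schwartz"
proof (rule schwartz_affine[of f "\<lambda>x. x"])
 show "japanese x \<le> (2 * japanese a) * japanese (x + a)" for x
  using japanese_add[of "x + a" "- a"] by (simp add: mult_ac)
qed auto

lemma schwartz_linear:
 assumes f: "f \<in> schwartz" and L: "bounded_linear L" and K: "\<And>x. norm x \<le> K * norm (L x)"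
 shows "(\<lambda>x. f (L x)) \<in> schwartz"
proof -
 have "japanese x \<le> max 1 K * japanese (L x)" for x
 proof -
  have "norm x \<le> max 1 K * norm (L x)"
   by (rule order_trans[OF K[of x]], rule mult_right_mono) auto
  then have "(norm x)\<^sup>2 \<le> (max 1 K)\<^sup>2 * (norm (L x))\<^sup>2"
   unfolding power_mult_distrib[symmetric] by (intro power_mono) auto
  moreover have "1 \<le> (max 1 K)\<^sup>2" by (simp add: one_le_power)
  ultimately have "1 + (norm x)\<^sup>2 \<le> (max 1 K)\<^sup>2 * (1 + (norm (L x))\<^sup>2)"
   unfolding distrib_left mult_1_right by (intro add_mono)
  then have "japanese x \<le> sqrt ((max 1 K)\<^sup>2 * (1 + (norm (L x))\<^sup>2))"
   unfolding japanese_def by (rule real_sqrt_le_mono)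
  then show ?thesis by (simp add: real_sqrt_mult japanese_def real_sqrt_abs)
 qed
 then show ?thesis using schwartz_affine[OF f L, where a=0 and K="max 1 K"] by simp
qed

lemma schwartz_section_fst: "F \<in> schwartz ==> (\<lambda>x. F (x, y)) \<in> schwartz"
 using schwartz_affine[of F "\<lambda>x. (x, 0)" 1 "(0, y)"] bounded_linear_Pair[OF bounded_linear_ident bounded_linear_zero]
 by (simp add: japanese_fst_le)

lemma schwartz_section_snd: "F \<in> schwartz ==> (\<lambda>y. F (x, y)) \<in> schwartz"
 using schwartz_affine[of F "\<lambda>y. (0, y)" 1 "(x, 0)"] bounded_linear_Pair[OF bounded_linear_zero bounded_linear_ident]
 by (simp add: japanese_snd_le)

text \<open>A basis vector of the product space lies in one of the two factors, so a derivative acts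
  on one factor of the product only.\<close>

lemma schwartz_tensor:
 fixes f :: "'a::euclidean_space => complex" and g :: "'b::euclidean_space => complex"
 assumes "f \<in> schwartz" "g \<in> schwartz" shows "(\<lambda>z. f (fst z) * g (snd z)) \<in> schwartz"
proof (rule schwartz_coinduct)
 let ?X = "{\<lambda>z. f (fst z) * g (snd z) | (f :: 'a => complex) (g :: 'b => complex).
  f \<in> schwartz \<and> g \<in> schwartz}"
 show "(\<lambda>z. f (fst z) * g (snd z)) \<in> ?X" using assms by blast
 have D: "((\<lambda>z. f (fst z) * g (snd z)) has_derivative
   (\<lambda>h. f (fst z) * frechet_derivative g (at (snd z)) (snd h)
     + frechet_derivative f (at (fst z)) (fst h) * g (snd z))) (at z)"
  if fg: "f \<in> schwartz" "g \<in> schwartz" for f :: "'a => complex" and g :: "'b => complex" and z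
  using diff_chain_at[OF _ schwartz_has_derivative[OF fg(1)], of fst fst z]
   diff_chain_at[OF _ schwartz_has_derivative[OF fg(2)], of snd snd z]
  by (intro has_derivative_mult) (simp_all add: o_def has_derivative_fst has_derivative_snd)
 show "pd b h \<in> ?X" if h: "h \<in> ?X" and b: "b \<in> Basis" for h and b :: "'a \<times> 'b"
 proof -
  obtain f g where fg: "f \<in> schwartz" "g \<in> schwartz" "h = (\<lambda>z. f (fst z) * g (snd z))" using h by blast
  have lin: "frechet_derivative f (at x) 0 = 0" "frechet_derivative g (at y) 0 = 0" for x y
   using linear_0[OF linear_frechet_derivative] schwartz_diff fg by blast+
  consider c where "b = (c, 0)" "c \<in> Basis" | c where "b = (0, c)" "c \<in> Basis"
   using b by (auto simp: Basis_prod_def)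
  then show ?thesis
  proof cases
   case 1
   then have "pd b h = (\<lambda>z. pd c f (fst z) * g (snd z))"
    using pd_eqI[OF D[OF fg(1,2)], of b] fg(3) lin by simp
   then show ?thesis using 1 fg schwartz_pd by (intro CollectI exI[of _ "pd c f"] exI[of _ g]) auto
  next
   case 2
   then have "pd b h = (\<lambda>z. f (fst z) * pd c g (snd z))"
    using pd_eqI[OF D[OF fg(1,2)], of b] fg(3) lin by simp
   then show ?thesis using 2 fg schwartz_pd by (intro CollectI exI[of _ f] exI[of _ "pd c g"]) auto
  qed
 qed
 show "h differentiable (at x)" if h: "h \<in> ?X" for h x
 proof -
  obtain f g where fg: "f \<in> schwartz" "g \<in> schwartz" "h = (\<lambda>z. f (fst z) * g (snd z))" using h by blast
  show ?thesis unfolding fg(3) by (rule differentiableI[OF D[OF fg(1,2)]])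
 qed
 show "rapid h" if h: "h \<in> ?X" for h
 proof (rule rapidI)
  fix N
  obtain f g where fg: "f \<in> schwartz" "g \<in> schwartz" "h = (\<lambda>z. f (fst z) * g (snd z))" using h by blast
  obtain C where C: "\<And>y. japanese y ^ N * cmod (f y) \<le> C"
   using schwartz_rapid[OF fg(1)] unfolding rapid_def by meson
  obtain D where D: "\<And>y. japanese y ^ N * cmod (g y) \<le> D"
   using schwartz_rapid[OF fg(2)] unfolding rapid_def by meson
  have "japanese z ^ N * cmod (h z) \<le> C * D" for z
  proof -
   have "japanese z ^ N * cmod (h z) \<le> (japanese (fst z) * japanese (snd z)) ^ N * cmod (h z)"
    using japanese_Pair[of "fst z" "snd z"] by (intro mult_right_mono power_mono) auto
   also have "\<dots> = (japanese (fst z) ^ N * cmod (f (fst z))) * (japanese (snd z) ^ N * cmod (g (snd z)))"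
    unfolding fg by (simp add: power_mult_distrib norm_mult mult_ac)
   also have "\<dots> \<le> C * D"
    using C[of "fst z"] D order_trans[OF _ C[of "fst z"]] by (intro mult_mono) auto
   finally show ?thesis .
  qed
  then show "\<exists>C. \<forall>x. japanese x ^ N * cmod (h x) \<le> C" by blast
 qed
qed

section \<open>Integrals over Euclidean space and differentiation under the integral\<close>

lemma nn_integral_lborel_affine:
 fixes f :: "'a::euclidean_space => ennreal"
 assumes [measurable]: "f \<in> \<B>" and c: "c \<noteq> 0"
 shows "(\<integral>x. f x) = ennreal (\<bar>c\<bar> ^ DIM('a)) * (\<integral>x. f (t + c *\<^sub>R x))"
 by (subst lborel_affine[OF c, of t])
   (simp add: nn_integral_density nn_integral_distr nn_integral_cmult)

lemma nn_integral_lborel_shift: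
 fixes f :: "'a::euclidean_space => ennreal"
 assumes "f \<in> \<B>"
 shows "(\<integral>x. f (x + t)) = (\<integral>x. f x)"
 using nn_integral_lborel_affine[OF assms, of 1 t] by (simp add: add.commute)

lemma nn_integral_lborel_reflect:
 fixes f :: "'a::euclidean_space => ennreal"
 assumes "f \<in> \<B>"
 shows "(\<integral>x. f (t - x)) = (\<integral>x. f x)"
 using nn_integral_lborel_affine[OF assms, of "-1" t] by simp

lemma integral_lborel_affine:
 fixes f :: "'a::euclidean_space => complex"
 assumes [measurable]: "f \<in> \<B>" and c: "c \<noteq> 0"
 shows "(LINT x|lborel. f x) = complex_of_real (\<bar>c\<bar> ^ DIM('a)) * (LINT x|lborel. f (t + c *\<^sub>R x))"
 by (subst lborel_affine[OF c, of t]) (simp add: integral_density integral_distr scaleR_conv_of_real)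

lemma integral_lborel_shift:
 fixes f :: "'a::euclidean_space => complex"
 assumes "f \<in> \<B>"
 shows "(LINT x|lborel. f (x + t)) = (LINT x|lborel. f x)"
 using integral_lborel_affine[OF assms, of 1 t] by (simp add: add.commute)

text \<open>The integrand is dominated by a dyadic sum of balls: the ball of radius 2^(n+1) carries
  the factor 2^(-n u), and its volume turns the sum into a geometric series of ratio
  \<open>q\<close>.\<close>

lemma nn_integral_japanese_finite:
 fixes u :: real
 assumes u: "u > DIM('a::euclidean_space)"
 shows "(\<integral>(x::'a). ennreal (japanese x powr (- u))) < \<infinity>"
proof -
 define V where "V = unit_ball_vol (real DIM('a))"
 have V0: "V \<ge> 0" by (simp add: V_def)
 define q where "q = 2 powr (real DIM('a) - u)"
 have q: "0 < q" "q < 1" using u powr_less_mono[of "real DIM('a) - u" 0 2] by (auto simp: q_def)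
 have single: "F n \<le> suminf F" for F :: "nat => ennreal" and n
  using sum_le_suminf[of F "{n}"] by simp
 have le: "ennreal (japanese x powr (- u)) \<le>
   (\<Sum>n. ennreal (2 powr (- real n * u)) * indicator (cball 0 (2 ^ Suc n)) x)" for x :: 'a
 proof -
  obtain n where n: "2 ^ n \<le> japanese x" "japanese x < 2 ^ Suc n"
  proof -
   have "\<exists>m. japanese x < 2 ^ m" by (rule real_arch_pow) simp
   then have *: "japanese x < 2 ^ (LEAST m. japanese x < 2 ^ m)" by (rule LeastI_ex)
   have "(LEAST m. japanese x < 2 ^ m) \<noteq> 0" using * japanese_ge_1[of x] by (metis not_le power_0)
   then obtain k where k: "(LEAST m. japanese x < 2 ^ m) = Suc k" by (metis not0_implies_Suc)
   then have "\<not> japanese x < 2 ^ k" by (metis lessI not_less_Least)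
   then show ?thesis using * k that[of k] by simp
  qed
  have "japanese x powr (- u) \<le> (2 ^ n) powr (- u)"
   using n u by (intro powr_mono2') auto
  also have "\<dots> = 2 powr (- real n * u)" by (simp add: powr_powr flip: powr_realpow)
  finally have "ennreal (japanese x powr (- u)) \<le> ennreal (2 powr (- real n * u)) * indicator (cball 0 (2 ^ Suc n)) x"
   using n norm_le_japanese[of x] by (simp add: ennreal_leI)
  also have "\<dots> \<le> (\<Sum>n. ennreal (2 powr (- real n * u)) * indicator (cball 0 (2 ^ Suc n)) x)"
   by (rule single[of "\<lambda>n. ennreal (2 powr (- real n * u)) * indicator (cball 0 (2 ^ Suc n)) x"])
  finally show ?thesis .
 qed
 have "(\<integral>(x::'a). ennreal (japanese x powr (- u))) \<le>
   (\<integral>(x::'a). (\<Sum>n. ennreal (2 powr (- real n * u)) * indicator (cball 0 (2 ^ Suc n)) x))"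
  by (intro nn_integral_mono le)
 also have "\<dots> = (\<Sum>n. ennreal (2 powr (- real n * u)) * emeasure lborel (cball (0::'a) (2 ^ Suc n)))"
 proof (subst nn_integral_suminf)
  show "(\<lambda>x. ennreal (2 powr (- real n * u)) * indicator (cball (0::'a) (2 ^ Suc n)) x) \<in> borel_measurable lborel" for n
  proof -
   have [measurable]: "cball (0::'a) (2 ^ Suc n) \<in> sets borel" by simp
   show ?thesis by measurable
  qed
 qed (simp only: nn_integral_cmult_indicator sets_lborel borel_closed closed_cball)
 also have "\<dots> = (\<Sum>n. ennreal (V * 2 ^ DIM('a) * q ^ n))"
 proof (rule arg_cong[where f=suminf], rule ext)
  fix n
  have "2 powr (- real n * u) * (2 ^ Suc n) ^ DIM('a) = 2 ^ DIM('a) * q ^ n"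
  proof -
   have "q = 2 ^ DIM('a) * 2 powr (- u)"
    unfolding q_def diff_conv_add_uminus powr_add by (simp add: powr_realpow)
   moreover have "2 powr (- real n * u) = (2 powr (- u)) ^ n"
    by (simp add: powr_power)
   moreover have "((2::real) ^ Suc n) ^ DIM('a) = 2 ^ DIM('a) * (2 ^ DIM('a)) ^ n"
    by (simp add: power_mult_distrib mult.commute flip: power_mult)
   ultimately show ?thesis by (simp add: power_mult_distrib)
  qed
  then show "ennreal (2 powr (- real n * u)) * emeasure lborel (cball (0::'a) (2 ^ Suc n)) = ennreal (V * 2 ^ DIM('a) * q ^ n)"
   by (simp add: emeasure_cball V_def[symmetric] ennreal_mult'[symmetric] V0 mult_ac del: power_Suc)
 qed
 also have "\<dots> = ennreal (\<Sum>n. V * 2 ^ DIM('a) * q ^ n)"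
  using q V0 by (intro suminf_ennreal2) (auto intro!: summable_mult)
 finally show ?thesis using le_less_trans by (metis ennreal_less_top infinity_ennreal_def)
qed

text \<open>For \<open>u\<close> up to and including the dimension, every dyadic shell
  \<open>A n\<close> carries at least the same mass \<open>c\<close>, and infinitely many disjoint
  shells make the integral infinite.\<close>

lemma nn_integral_japanese_infinite:
 fixes u :: real
 assumes u: "u \<le> DIM('a::euclidean_space)"
 shows "(\<integral>(x::'a). ennreal (japanese x powr (- u))) = \<infinity>"
proof -
 define V where "V = unit_ball_vol (real DIM('a))"
 have V0: "V > 0" by (simp add: V_def)
 define A where "A n = {x::'a. 2 ^ n \<le> norm x \<and> norm x < 2 ^ Suc n}" for n :: nat
 have [measurable]: "A n \<in> sets borel" for n unfolding A_def by measurable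
 define \<mu> where "\<mu> = density lborel (\<lambda>x::'a. ennreal (japanese x powr (- u)))"
 have dis: "disjoint_family A"
  unfolding disjoint_family_on_def
 proof (intro ballI impI, goal_cases)
  case (1 m n)
  have "A m \<inter> A n = {}" if "m < n" for m n
  proof -
   have "(2::real) ^ Suc m \<le> 2 ^ n" using that by (intro power_increasing) auto
   then show ?thesis by (auto simp: A_def)
  qed
  then show ?case using 1 by (metis Int_commute linorder_neqE_nat)
 qed
 \<comment> \<open>On \<open>A n\<close> the value \<open>japanese x\<close> is at most 4 * 2^n,
   while the shell has at least the volume of the ball of radius 2^n, because doubling a radius at
   least doubles a volume. The quotient of that volume by the DIM-th power of 4 * 2^n is
   \<open>c\<close>.\<close>
 define c where "c = V / 4 ^ DIM('a)"
 have c: "ennreal c \<le> emeasure \<mu> (A n)" for n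
 proof -
  have low: "1 / (4 * 2 ^ n) ^ DIM('a) \<le> japanese x powr (- u)" if "x \<in> A n" for x
  proof -
   have x: "japanese x \<le> 4 * 2 ^ n"
   proof -
    have "1 \<le> (2::real) ^ n" by simp
    moreover have "norm x < 2 * 2 ^ n" using that by (simp add: A_def)
    ultimately show ?thesis using japanese_le[of x] by linarith
   qed
   have "1 / (4 * 2 ^ n) ^ DIM('a) \<le> 1 / japanese x ^ DIM('a)"
    using x by (intro divide_left_mono power_mono) auto
   also have "\<dots> = japanese x powr (- real DIM('a))"
    by (simp add: powr_minus powr_realpow divide_inverse)
   also have "\<dots> \<le> japanese x powr (- u)"
    using u by (intro powr_mono japanese_ge_1) auto
   finally show ?thesis .
  qed
  have "(2::real) ^ n \<le> 2 ^ Suc n" by simp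
  then have "y < 2 ^ Suc n" if "y < 2 ^ n" for y :: real using that by (rule order_less_le_trans[rotated])
  then have "ball 0 (2 ^ Suc n) = A n \<union> ball 0 (2 ^ n)" "A n \<inter> ball (0::'a) (2 ^ n) = {}"
   unfolding A_def by (auto simp del: power_Suc)
  then have "emeasure lborel (ball (0::'a) (2 ^ Suc n)) = emeasure lborel (A n) + emeasure lborel (ball (0::'a) (2 ^ n))"
   by (simp add: plus_emeasure)
  moreover have "emeasure lborel (ball (0::'a) r) = ennreal (V * r ^ DIM('a))" if "r \<ge> 0" for r
   using that by (simp add: emeasure_ball V_def)
  ultimately have e: "ennreal (V * (2 ^ Suc n) ^ DIM('a)) = emeasure lborel (A n) + ennreal (V * (2 ^ n) ^ DIM('a))"
   by simp
  have "V * (2 ^ n) ^ DIM('a) + V * (2 ^ n) ^ DIM('a) \<le> V * (2 ^ Suc n) ^ DIM('a)"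
  proof -
   have "(2::real) * 1 \<le> 2 ^ DIM('a)"
    using power_increasing[of 1 "DIM('a)" "2::real"] by (simp add: Suc_le_eq)
   then have "2 * (V * (2 ^ n) ^ DIM('a)) \<le> 2 ^ DIM('a) * (V * (2 ^ n) ^ DIM('a))"
    using V0 by (intro mult_right_mono) auto
   then show ?thesis by (simp add: power_mult_distrib mult_ac)
  qed
  then have "ennreal (V * (2 ^ n) ^ DIM('a)) + ennreal (V * (2 ^ n) ^ DIM('a)) \<le> emeasure lborel (A n) + ennreal (V * (2 ^ n) ^ DIM('a))"
   unfolding e[symmetric] using V0 by (simp add: ennreal_leI flip: ennreal_plus)
  then have A: "ennreal (V * (2 ^ n) ^ DIM('a)) \<le> emeasure lborel (A n)"
   by (simp add: add.commute ennreal_add_left_cancel_le)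
  have "ennreal c = ennreal (1 / (4 * 2 ^ n) ^ DIM('a)) * ennreal (V * (2 ^ n) ^ DIM('a))"
   using V0 by (simp add: ennreal_mult'[symmetric] c_def power_mult_distrib field_simps)
  also have "\<dots> \<le> ennreal (1 / (4 * 2 ^ n) ^ DIM('a)) * emeasure lborel (A n)"
   by (intro mult_left_mono A) auto
  also have "\<dots> = (\<integral>x. ennreal (1 / (4 * 2 ^ n) ^ DIM('a)) * indicator (A n) x)"
   by (simp add: nn_integral_cmult_indicator)
  also have "\<dots> \<le> (\<integral>x. ennreal (japanese x powr (- u)) * indicator (A n) x)"
   using low by (intro nn_integral_mono) (simp add: indicator_def ennreal_leI)
  also have "\<dots> = emeasure \<mu> (A n)" by (simp add: \<mu>_def emeasure_density)
  finally show ?thesis .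
 qed
 have "c > 0" using V0 by (simp add: c_def)
 have "ennreal (c * real N) \<le> emeasure \<mu> UNIV" for N
 proof -
  have "ennreal (c * real N) = (\<Sum>n<N. ennreal c)"
   using \<open>c > 0\<close> by (simp add: ennreal_of_nat_eq_real_of_nat ennreal_mult'[symmetric] mult.commute)
  also have "\<dots> \<le> (\<Sum>n<N. emeasure \<mu> (A n))" by (intro sum_mono c)
  also have "\<dots> \<le> (\<Sum>n. emeasure \<mu> (A n))" by (intro sum_le_suminf) auto
  also have "\<dots> = emeasure \<mu> (\<Union>n. A n)"
   using dis by (intro suminf_emeasure) (auto simp: \<mu>_def)
  also have "\<dots> \<le> emeasure \<mu> UNIV" by (intro emeasure_mono) (auto simp: \<mu>_def)
  finally show ?thesis .
 qed
 note * = this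
 have "emeasure \<mu> UNIV = \<infinity>"
 proof (rule ccontr)
  assume "emeasure \<mu> UNIV \<noteq> \<infinity>"
  then obtain r where r: "emeasure \<mu> UNIV = ennreal r" "r \<ge> 0" by (metis ennreal_cases infinity_ennreal_def)
  obtain N where "r / c < real N" using reals_Archimedean2 by blast
  then show False using *[of N] r \<open>c > 0\<close> by (auto simp: field_simps)
 qed
 then show ?thesis by (simp add: \<mu>_def emeasure_density)
qed

lemma integrable_japanese:
 assumes "u > real DIM('a::euclidean_space)"
 shows "integrable lborel (\<lambda>x::'a. japanese x powr (- u))"
 using nn_integral_japanese_finite[OF assms] by (intro integrableI_nonneg) auto

lemma integrable_japanese_power:
 "integrable lborel (\<lambda>x::'a::euclidean_space. C / japanese x ^ (N + Suc DIM('a)))"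
proof -
 have "integrable lborel (\<lambda>x::'a. C * japanese x powr (- real (N + Suc DIM('a))))"
  by (intro integrable_mult_right integrable_japanese) auto
 then show ?thesis by (simp only: powr_minus powr_realpow japanese_pos divide_inverse)
qed

lemma schwartz_continuous: "f \<in> schwartz ==> continuous_on S f"
 by (meson continuous_at_imp_continuous_on differentiable_imp_continuous_within schwartz_diff)

lemma schwartz_measurable [measurable (raw)]: "f \<in> schwartz ==> f \<in> \<B>"
 by (intro borel_measurable_continuous_onI schwartz_continuous)

lemma rapid_integrable:
 assumes "rapid f" "f \<in> \<B>" shows "integrable lborel f"
proof -
 obtain C where "C \<ge> 0" "\<And>x. cmod (f x) \<le> C / japanese x ^ (0 + Suc DIM('a))"
  using rapidD[OF assms(1)] by metis
 then show ?thesis using assms(2)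
  by (intro Bochner_Integration.integrable_bound[OF integrable_japanese_power[of C 0]]) auto
qed

lemma schwartz_integrable: "f \<in> schwartz ==> integrable lborel f"
 by (intro rapid_integrable schwartz_rapid schwartz_measurable)

text \<open>Difference quotients along a sequence tending to 0 are treated by dominated convergence:
  by the mean value inequality they are dominated by the bound on the partial derivatives in the
  unit ball around \<open>x0\<close>. The index shift \<open>k\<close> discards the increments of
  norm 1 or more.\<close>

lemma has_derivative_integral:
 fixes F :: "'y => 'x::euclidean_space => complex"
 assumes D: "\<And>y x. (F y has_derivative F' y x) (at x)"
  and F: "\<And>x. integrable M (\<lambda>y. F y x)"
  and m: "\<And>b. b \<in> Basis ==> (\<lambda>y. F' y x0 b) \<in> borel_measurable M"
  and bd: "\<And>y x b. x \<in> ball x0 1 ==> b \<in> Basis ==> norm (F' y x b) \<le> w y"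
  and w: "integrable M w"
 shows "((\<lambda>x. LINT y|M. F y x) has_derivative (\<lambda>h. LINT y|M. F' y x0 h)) (at x0)"
proof -
 define W where "W y = real DIM('x) * w y" for y
 have expand: "F' y x h = (\<Sum>b\<in>Basis. (h \<bullet> b) *\<^sub>R F' y x b)" for y x h
  by (rule has_derivative_expand[OF D])
 have w0: "0 \<le> w y" for y
  using order_trans[OF norm_ge_zero bd[of x0 "SOME b. b \<in> Basis" y]] by (simp add: SOME_Basis)
 have bdh: "norm (F' y x h) \<le> W y * norm h" if "x \<in> ball x0 1" for y x h
 proof -
  have "norm (F' y x h) \<le> (\<Sum>b\<in>Basis. \<bar>h \<bullet> b\<bar> * norm (F' y x b))"
   unfolding expand[of y x h] by (rule order_trans[OF norm_sum]) simp
  also have "\<dots> \<le> (\<Sum>b\<in>(Basis::'x set). norm h * w y)"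
   by (intro sum_mono mult_mono Basis_le_norm bd that w0) auto
  finally show ?thesis by (simp add: W_def mult_ac)
 qed
 have int: "integrable M (\<lambda>y. F' y x0 b)" if "b \<in> Basis" for b
  using bd[of x0 b] m that w0 by (intro Bochner_Integration.integrable_bound[OF w]) auto
 have inth: "integrable M (\<lambda>y. F' y x0 h)" for h
  unfolding expand[of _ _ h] by (intro Bochner_Integration.integrable_sum integrable_scaleR_right int)
 have eq: "(LINT y|M. F' y x0 h) = (\<Sum>b\<in>Basis. (h \<bullet> b) *\<^sub>R (LINT y|M. F' y x0 b))" for h
  unfolding expand[of _ _ h] by (subst Bochner_Integration.integral_sum) (auto intro: int)
 have bl: "bounded_linear (\<lambda>h. LINT y|M. F' y x0 h)"
  by (subst ext[OF eq]) (intro bounded_linear_sum bounded_linear_scaleR_const bounded_linear_inner_left)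
 show ?thesis
  unfolding has_derivative_at
 proof (intro conjI bl)
  show "(\<lambda>h. norm ((LINT y|M. F y (x0 + h)) - (LINT y|M. F y x0) - (LINT y|M. F' y x0 h)) / norm h) \<midarrow>0\<rightarrow> 0"
   unfolding tendsto_at_iff_sequentially o_def
  proof (intro allI impI)
   fix X :: "nat => 'x" assume X0: "\<forall>i. X i \<in> UNIV - {0}" and X: "X \<longlonglongrightarrow> 0"
   define s where "s i y = (F y (x0 + X i) - F y x0 - F' y x0 (X i)) /\<^sub>R norm (X i)" for i y
   have "eventually (\<lambda>i. X i \<in> ball 0 1) sequentially"
    using X by (rule topological_tendstoD) auto
   then obtain k where k: "\<And>i. i \<ge> k ==> norm (X i) < 1"
    by (auto simp: eventually_sequentially)
   have bds: "norm (s (i + k) y) \<le> 2 * W y" for i y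
   proof -
    let ?h = "X (i + k)"
    have h: "norm ?h < 1" "?h \<noteq> 0" using k X0 by auto
    have "norm (F y (x0 + ?h) - F y x0) \<le> W y * norm (x0 + ?h - x0)"
    proof (rule differentiable_bound[of "ball x0 1" "F y" "F' y"])
     show "onorm (F' y x) \<le> W y" if "x \<in> ball x0 1" for x
      using bdh[OF that] w0 by (intro onorm_bound) (auto simp: W_def)
     show "(F y has_derivative F' y x) (at x within ball x0 1)" for x
      by (rule has_derivative_at_withinI[OF D])
    qed (use h in \<open>auto simp: dist_norm\<close>)
    then have "norm (F y (x0 + ?h) - F y x0 - F' y x0 ?h) \<le> W y * norm ?h + W y * norm ?h"
     using bdh[of x0 y ?h] norm_triangle_ineq4[of "F y (x0 + ?h) - F y x0" "F' y x0 ?h"] by simp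
    then show ?thesis using h by (simp only: s_def norm_scaleR) (simp add: divide_simps mult_ac)
   qed
   have "(\<lambda>i. LINT y|M. s (i + k) y) \<longlonglongrightarrow> (LINT y|M. 0)"
   proof (rule integral_dominated_convergence[where w="\<lambda>y. 2 * W y"])
    show "integrable M (\<lambda>y. 2 * W y)" unfolding W_def by (intro integrable_mult_right w)
    show "AE y in M. (\<lambda>i. s (i + k) y) \<longlonglongrightarrow> 0"
    proof (intro AE_I2 LIMSEQ_ignore_initial_segment)
     fix y
     have "(\<lambda>h. norm (F y (x0 + h) - F y x0 - F' y x0 h) / norm h) \<midarrow>0\<rightarrow> 0"
      using D unfolding has_derivative_at by blast
     then have "(\<lambda>i. norm (s i y)) \<longlonglongrightarrow> 0"
      using X X0 unfolding tendsto_at_iff_sequentially o_def s_def by (auto simp: divide_inverse mult.commute)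
     then show "(\<lambda>i. s i y) \<longlonglongrightarrow> 0" by (rule tendsto_norm_zero_cancel)
    qed
    show "(\<lambda>y. s (i + k) y) \<in> borel_measurable M" for i
     unfolding s_def by (intro borel_measurable_scaleR borel_measurable_diff borel_measurable_const
       borel_measurable_integrable F inth)
   qed (use bds in auto)
   moreover have "norm (LINT y|M. s i y) = norm ((LINT y|M. F y (x0 + X i)) - (LINT y|M. F y x0) - (LINT y|M. F' y x0 (X i))) / norm (X i)" for i
    unfolding s_def by (simp add: F inth divide_inverse mult.commute)
   ultimately show "(\<lambda>i. norm ((LINT y|M. F y (x0 + X i)) - (LINT y|M. F y x0) - (LINT y|M. F' y x0 (X i))) / norm (X i)) \<longlonglongrightarrow> 0"
    using LIMSEQ_offset[OF tendsto_norm_zero[of "\<lambda>i. LINT y|M. s (i + k) y"]] by simp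
  qed
 qed
qed

text \<open>The integral of a translate does not depend on the translation, and differentiating it
  under the integral sign produces the integral of the derivative. This takes the place of a
  one-dimensional fundamental theorem in each coordinate.\<close>

lemma schwartz_integral_pd:
 assumes g: "g \<in> schwartz" and b: "b \<in> Basis"
 shows "(LINT t|lborel. pd b g t) = 0"
proof -
 let ?N = "0 + Suc DIM('a)"
 have "\<exists>C\<ge>0. \<forall>x. cmod (pd c g x) \<le> C / japanese x ^ ?N" if "c \<in> Basis" for c
  using rapidD[OF schwartz_rapid[OF schwartz_pd[OF g that]]] by metis
 then obtain C where C: "\<And>c. c \<in> Basis ==> C c \<ge> 0" "\<And>c x. c \<in> Basis ==> cmod (pd c g x) \<le> C c / japanese x ^ ?N"
  by metis
 define K where "K = (\<Sum>c\<in>Basis. C c)"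
 have K: "C c \<le> K" if "c \<in> Basis" for c
  unfolding K_def using that C by (intro member_le_sum) auto
 have "((\<lambda>x. LINT t|lborel. g (t + x)) has_derivative
   (\<lambda>h. LINT t|lborel. frechet_derivative g (at (t + 0)) h)) (at 0)"
 proof (rule has_derivative_integral[where w="\<lambda>t. K * 4 ^ ?N / japanese t ^ ?N"])
  show "((\<lambda>x. g (t + x)) has_derivative frechet_derivative g (at (t + x))) (at x)" for t x
  proof -
   have "((\<lambda>x. t + x) has_derivative (\<lambda>h. h)) (at x)"
    by (auto intro!: derivative_eq_intros)
   then show ?thesis
    using diff_chain_at[OF _ schwartz_has_derivative[OF g], of "\<lambda>x. t + x" "\<lambda>h. h" x]
    by (simp add: o_def)
  qed
  show "integrable lborel (\<lambda>t. g (t + x))" for x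
   by (intro schwartz_integrable schwartz_translate g)
  show "(\<lambda>t. pd c g (t + 0)) \<in> borel_measurable lborel" if "c \<in> Basis" for c
   using schwartz_measurable[OF schwartz_pd[OF g that]] by simp
  show "integrable lborel (\<lambda>t::'a. K * 4 ^ ?N / japanese t ^ ?N)"
   by (rule integrable_japanese_power)
  \<comment> \<open>The factor 4 collects the 2 of \<open>japanese_add\<close> and the bound
    \<open>japanese x \<le> 2\<close> in the unit ball.\<close>
  show "cmod (pd c g (t + x)) \<le> K * 4 ^ ?N / japanese t ^ ?N"
   if x: "x \<in> ball 0 1" and c: "c \<in> Basis" for t x c
  proof -
   have "japanese t ^ ?N \<le> (2 * japanese (t + x) * japanese (- x)) ^ ?N"
    using japanese_add[of "t + x" "- x"] by (intro power_mono) auto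
   also have "\<dots> \<le> (2 * japanese (t + x) * 2) ^ ?N"
    using x japanese_le[of x] by (intro power_mono mult_mono) auto
   finally have *: "japanese t ^ ?N \<le> 4 ^ ?N * japanese (t + x) ^ ?N" by (simp add: power_mult_distrib mult_ac)
   have "cmod (pd c g (t + x)) \<le> K / japanese (t + x) ^ ?N"
    by (rule order_trans[OF C(2)[OF c]]) (intro divide_right_mono K c, simp)
   also have "\<dots> \<le> K * 4 ^ ?N / japanese t ^ ?N"
    using * C K[OF c] C(1)[OF c] by (simp add: divide_simps mult.assoc mult_left_mono)
   finally show ?thesis .
  qed
 qed
 moreover have "(\<lambda>x. LINT t|lborel. g (t + x)) = (\<lambda>x. LINT t|lborel. g t)"
  by (intro ext integral_lborel_shift schwartz_measurable g)
 ultimately have "(\<lambda>h. LINT t|lborel. frechet_derivative g (at t) h) = (\<lambda>h. 0)"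
  using has_derivative_unique[OF _ has_derivative_const] by auto
 then show ?thesis by meson
qed

lemma has_derivative_cis:
 assumes "(q has_derivative q') (at x)"
 shows "((\<lambda>x. cis (q x)) has_derivative (\<lambda>h. \<i> * of_real (q' h) * cis (q x))) (at x)"
 using has_derivative_compose[OF bounded_linear.has_derivative[OF bounded_linear_mult_right
    [of \<i>] bounded_linear.has_derivative[OF bounded_linear_of_real assms]],
   of exp "(*) (exp (\<i> * of_real (q x)))"] DERIV_exp
 by (auto simp: cis_conv_exp has_field_derivative_def mult_ac)

lemma slow_cis_inner:
 fixes L M :: "'a::euclidean_space => 'b::euclidean_space"
 assumes L: "bounded_linear L" and M: "bounded_linear M"
 shows "(\<lambda>x. cis (c * (L x \<bullet> M x))) \<in> slow"
proof (rule slow_cis)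
 show "((\<lambda>x. c * (L x \<bullet> M x)) has_derivative (\<lambda>h. c * (L x \<bullet> M h + L h \<bullet> M x))) (at x)" for x
  by (intro has_derivative_mult_right has_derivative_inner bounded_linear_imp_has_derivative L M)
 show "(\<lambda>x. complex_of_real (c * (L x \<bullet> M b + L b \<bullet> M x))) \<in> slow" for b
  by (intro slow_linear bounded_linear_const_mult bounded_linear_add bounded_linear_inner_left_comp
    bounded_linear_inner_right_comp L M)
qed

lemma slow_cis_inner_const:
 fixes L :: "'a::euclidean_space => 'b::euclidean_space"
 assumes L: "bounded_linear L"
 shows "(\<lambda>x. cis (c * (L x \<bullet> z))) \<in> slow"
 by (intro slow_cis_linear bounded_linear_const_mult bounded_linear_inner_left_comp L)

section \<open>The Fourier transform\<close>

text \<open>The partial Fourier transform, with the first variable as a parameter. Integration over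
  one variable, the Fourier transform itself and the short-time Fourier transform are all obtained
  from it by sections and substitutions, so that one proof of the Schwartz property serves for all
  of them.\<close>

definition ft2 :: "('a::euclidean_space \<times> 'b::euclidean_space => complex) => 'a \<times> 'b => complex"
 where "ft2 G p = (LINT t|lborel. G (fst p, t) * cis (- (2 * pi) * (t \<bullet> snd p)))"

text \<open>The function whose partial Fourier transform is the derivative of \<open>ft2 G\<close>
  in the direction h: the parameter is differentiated directly, the frequency by multiplication with
  a linear factor.\<close>

definition ft2_pd :: "('a::euclidean_space \<times> 'b::euclidean_space => complex) => 'a \<times> 'b => 'a \<times> 'b => complex"
 where "ft2_pd G h = (\<lambda>x. frechet_derivative G (at x) (fst h, 0)
  + (- 2 * pi * \<i>) * (of_real (snd x \<bullet> snd h) * G x))"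

lemma schwartz_ft2_pd: assumes G: "G \<in> schwartz" and h: "h \<in> Basis" shows "ft2_pd G h \<in> schwartz"
proof -
 have "(\<lambda>x. frechet_derivative G (at x) (fst h, 0)) \<in> schwartz"
 proof -
  consider "snd h = 0" | "fst h = 0" using h by (auto simp: Basis_prod_def)
  then show ?thesis
  proof cases
   case 1
   then have "(fst h, 0) = h" by (metis prod.collapse)
   then show ?thesis using schwartz_pd[OF G h] by simp
  next
   case 2
   have "frechet_derivative G (at x) (0, 0) = 0" for x
    using linear_0[OF linear_frechet_derivative[OF schwartz_diff[OF G]]] by (simp add: zero_prod_def)
   then show ?thesis using schwartz_cmult[OF G, of 0] by (simp add: 2)
  qed
 qed
 moreover have "(\<lambda>x. of_real (snd x \<bullet> snd h) * G x) \<in> schwartz"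
  using schwartz_mult_slow[OF G slow_linear[OF bounded_linear_inner_left_comp[OF bounded_linear_snd]], of "snd h"]
  by (simp add: mult.commute)
 ultimately show ?thesis unfolding ft2_pd_def by (intro schwartz_add schwartz_cmult)
qed

lemma schwartz_ft_integrable:
 assumes "G \<in> schwartz"
 shows "integrable lborel (\<lambda>t. G (\<zeta>, t) * cis (- (2 * pi) * (t \<bullet> z)))"
 by (intro schwartz_integrable schwartz_mult_slow schwartz_section_snd assms
   slow_cis_inner_const bounded_linear_ident)

lemma schwartz_bound_Pair:
 assumes "G \<in> schwartz"
 obtains C where "C \<ge> 0" "\<And>x y. cmod (G (x, y)) \<le> C / (japanese x ^ M * japanese y ^ N)"
proof -
 obtain C where C: "C \<ge> 0" "\<And>p. cmod (G p) \<le> C / japanese p ^ (M + N)"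
  using rapidD[OF schwartz_rapid[OF assms]] by metis
 have "cmod (G (x, y)) \<le> C / (japanese x ^ M * japanese y ^ N)" for x y
  by (rule order_trans[OF C(2)]) (auto simp: power_add C intro!: divide_left_mono mult_mono
    power_mono japanese_fst_le japanese_snd_le mult_pos_pos)
 then show ?thesis using that C(1) by blast
qed

lemma schwartz_bound_Basis:
 assumes "\<And>h. h \<in> Basis ==> H h \<in> schwartz"
 obtains C where "C \<ge> 0"
  "\<And>h x y. h \<in> (Basis :: ('a::euclidean_space \<times> 'b::euclidean_space) set) ==>
   cmod (H h (x :: 'c::euclidean_space, y :: 'd::euclidean_space)) \<le> C / (japanese x ^ M * japanese y ^ N)"
proof -
 have "\<exists>C\<ge>0. \<forall>x y. cmod (H h (x, y)) \<le> C / (japanese x ^ M * japanese y ^ N)" if "h \<in> Basis" for h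
  using schwartz_bound_Pair[OF assms[OF that]] by metis
 then obtain C where C: "\<And>h. h \<in> Basis ==> C h \<ge> 0"
  "\<And>h x y. h \<in> Basis ==> cmod (H h (x, y)) \<le> C h / (japanese x ^ M * japanese y ^ N)" by metis
 have "cmod (H h (x, y)) \<le> sum C Basis / (japanese x ^ M * japanese y ^ N)" if "h \<in> Basis" for h x y
  by (rule order_trans[OF C(2)[OF that]], rule divide_right_mono)
    (use that C in \<open>auto intro!: member_le_sum\<close>)
 then show ?thesis using that[of "sum C Basis"] C by (simp add: sum_nonneg)
qed

lemma ft2_has_derivative:
 fixes G :: "'a::euclidean_space \<times> 'b::euclidean_space => complex"
 assumes G: "G \<in> schwartz"
 shows "(ft2 G has_derivative (\<lambda>h. ft2 (ft2_pd G h) p)) (at p)"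
proof -
 obtain C where C: "C \<ge> 0" "\<And>h x y. h \<in> Basis ==> cmod (ft2_pd G h (x, y))
   \<le> C / (japanese x ^ 0 * japanese y ^ (0 + Suc DIM('b)))"
  using schwartz_bound_Basis[where H="ft2_pd G", OF schwartz_ft2_pd[OF G]] by metis
 have "((\<lambda>p. LINT t|lborel. G (fst p, t) * cis (- (2 * pi) * (t \<bullet> snd p))) has_derivative
   (\<lambda>h. LINT t|lborel. ft2_pd G h (fst p, t) * cis (- (2 * pi) * (t \<bullet> snd p)))) (at p)"
 proof (rule has_derivative_integral[where w="\<lambda>t. C / japanese t ^ (0 + Suc DIM('b))"])
  show "((\<lambda>p. G (fst p, t) * cis (- (2 * pi) * (t \<bullet> snd p))) has_derivative
    (\<lambda>h. ft2_pd G h (fst p, t) * cis (- (2 * pi) * (t \<bullet> snd p)))) (at p)" for t p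
  proof -
   have 1: "((\<lambda>p. G (fst p, t)) has_derivative (\<lambda>h. frechet_derivative G (at (fst p, t)) (fst h, 0))) (at p)"
   proof -
    have "((\<lambda>p. (fst p, t)) has_derivative (\<lambda>h. (fst h, 0))) (at p)"
     by (intro has_derivative_Pair has_derivative_fst has_derivative_ident has_derivative_const)
    from diff_chain_at[OF this schwartz_has_derivative[OF G]] show ?thesis by (simp add: o_def)
   qed
   have 2: "((\<lambda>p. cis (- (2 * pi) * (t \<bullet> snd p))) has_derivative
     (\<lambda>h. \<i> * of_real (- (2 * pi) * (t \<bullet> snd h)) * cis (- (2 * pi) * (t \<bullet> snd p)))) (at p)"
    by (intro has_derivative_cis has_derivative_mult_right has_derivative_inner_right
      has_derivative_snd has_derivative_ident)
   show ?thesis using has_derivative_mult[OF 1 2] by (simp add: ft2_pd_def algebra_simps)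
  qed
  show "integrable lborel (\<lambda>t. G (fst p, t) * cis (- (2 * pi) * (t \<bullet> snd p)))" for p
   by (rule schwartz_ft_integrable[OF G])
  show "(\<lambda>t. ft2_pd G h (fst p, t) * cis (- (2 * pi) * (t \<bullet> snd p))) \<in> borel_measurable lborel" if "h \<in> Basis" for h
   by (intro borel_measurable_integrable schwartz_ft_integrable schwartz_ft2_pd G that)
  show "integrable lborel (\<lambda>t::'b. C / japanese t ^ (0 + Suc DIM('b)))"
   by (rule integrable_japanese_power)
  show "cmod (ft2_pd G h (fst x, t) * cis (- (2 * pi) * (t \<bullet> snd x))) \<le> C / japanese t ^ (0 + Suc DIM('b))"
   if "h \<in> Basis" for h t x
   using C(2)[OF that] by (simp add: norm_mult)
 qed
 then show ?thesis unfolding ft2_def[abs_def] .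
qed

text \<open>Integration by parts: the whole integrand, phase included, is a Schwartz function of t,
  so the integral of its derivative vanishes by \<open>schwartz_integral_pd\<close>.\<close>

lemma ft2_parts:
 fixes G :: "'a::euclidean_space \<times> 'b::euclidean_space => complex"
 assumes G: "G \<in> schwartz" and b: "b \<in> Basis"
 shows "ft2 (pd (0, b) G) (\<zeta>, z) = 2 * pi * \<i> * of_real (z \<bullet> b) * ft2 G (\<zeta>, z)"
proof -
 define g where "g t = G (\<zeta>, t) * cis (- (2 * pi) * (t \<bullet> z))" for t
 have g: "g \<in> schwartz" unfolding g_def
  by (intro schwartz_mult_slow schwartz_section_snd G slow_cis_inner_const bounded_linear_ident)
 have b': "(0, b) \<in> Basis" using b by (simp add: Basis_prod_def)
 have "(g has_derivative (\<lambda>h. frechet_derivative G (at (\<zeta>, t)) (0, h) * cis (- (2 * pi) * (t \<bullet> z))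
   + G (\<zeta>, t) * (\<i> * of_real (- (2 * pi) * (h \<bullet> z)) * cis (- (2 * pi) * (t \<bullet> z))))) (at t)" for t
 proof -
  have 1: "((\<lambda>t. G (\<zeta>, t)) has_derivative (\<lambda>h. frechet_derivative G (at (\<zeta>, t)) (0, h))) (at t)"
  proof -
   have "((\<lambda>t. (\<zeta>, t)) has_derivative (\<lambda>h. (0, h))) (at t)"
    by (intro has_derivative_Pair has_derivative_ident has_derivative_const)
   from diff_chain_at[OF this schwartz_has_derivative[OF G]] show ?thesis by (simp add: o_def)
  qed
  have 2: "((\<lambda>t. cis (- (2 * pi) * (t \<bullet> z))) has_derivative
    (\<lambda>h. \<i> * of_real (- (2 * pi) * (h \<bullet> z)) * cis (- (2 * pi) * (t \<bullet> z)))) (at t)"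
   by (intro has_derivative_cis has_derivative_mult_right has_derivative_inner_left has_derivative_ident)
  show ?thesis using has_derivative_mult[OF 1 2] by (simp add: g_def[abs_def] add.commute)
 qed
 from pd_eqI[OF this, of b]
 have "pd b g = (\<lambda>t. pd (0, b) G (\<zeta>, t) * cis (- (2 * pi) * (t \<bullet> z))
   + (- (2 * pi * \<i> * of_real (z \<bullet> b))) * g t)"
  by (simp add: g_def inner_commute algebra_simps)
 then have "0 = (LINT t|lborel. pd (0, b) G (\<zeta>, t) * cis (- (2 * pi) * (t \<bullet> z))
   + (- (2 * pi * \<i> * of_real (z \<bullet> b))) * g t)"
  using schwartz_integral_pd[OF g b] by metis
 also have "\<dots> = ft2 (pd (0, b) G) (\<zeta>, z) + (- (2 * pi * \<i> * of_real (z \<bullet> b))) * ft2 G (\<zeta>, z)"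
  unfolding ft2_def fst_conv snd_conv integral_mult_right_zero[symmetric] g_def[symmetric]
  by (rule Bochner_Integration.integral_add[OF schwartz_ft_integrable[OF schwartz_pd[OF G b']]
    integrable_mult_right[OF schwartz_integrable[OF g]]])
 finally show ?thesis by (simp add: algebra_simps)
qed

text \<open>Each power of \<open>japanese z\<close> is traded for one derivative:
  \<open>japanese z\<close> is at most 1 plus the sum of the coordinates of z in modulus, and
  multiplication by a coordinate amounts, up to the factor 2 pi > 1, to the partial Fourier
  transform of a derivative.\<close>

lemma ft2_bound:
 fixes G :: "'a::euclidean_space \<times> 'b::euclidean_space => complex"
 assumes G: "G \<in> schwartz"
 shows "\<exists>C. \<forall>\<zeta> z. japanese z ^ n * japanese \<zeta> ^ M * cmod (ft2 G (\<zeta>, z)) \<le> C"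
 using G
proof (induction n arbitrary: G)
 case 0
 obtain C where C: "C \<ge> 0" "\<And>x y. cmod (G (x, y)) \<le> C / (japanese x ^ M * japanese y ^ (0 + Suc DIM('b)))"
  using schwartz_bound_Pair[OF 0] by metis
 define I where "I = (LINT t::'b|lborel. C / japanese t ^ (0 + Suc DIM('b)))"
 have "japanese \<zeta> ^ M * cmod (ft2 G (\<zeta>, z)) \<le> I" for \<zeta> z
 proof -
  have "cmod (ft2 G (\<zeta>, z)) \<le> (LINT t::'b|lborel. (1 / japanese \<zeta> ^ M) * (C / japanese t ^ (0 + Suc DIM('b))))"
   unfolding ft2_def fst_conv snd_conv
  proof (rule Bochner_Integration.integral_norm_bound_integral)
   show "integrable lborel (\<lambda>t::'b. (1 / japanese \<zeta> ^ M) * (C / japanese t ^ (0 + Suc DIM('b))))"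
    by (intro integrable_mult_right integrable_japanese_power)
   show "cmod (G (\<zeta>, t) * cis (- (2 * pi) * (t \<bullet> z))) \<le> (1 / japanese \<zeta> ^ M) * (C / japanese t ^ (0 + Suc DIM('b)))" for t
    using C(2)[of \<zeta> t] by (simp add: norm_mult)
  qed (rule schwartz_ft_integrable[OF 0])
  also have "\<dots> = (1 / japanese \<zeta> ^ M) * I" unfolding I_def by (rule integral_mult_right_zero)
  finally show ?thesis by (simp add: field_simps)
 qed
 then show ?case by auto
next
 case (Suc n)
 have mem: "pd (0, b) G \<in> schwartz" if "b \<in> Basis" for b :: 'b
  using that by (intro schwartz_pd Suc.prems) (simp add: Basis_prod_def)
 have "\<exists>C. \<forall>\<zeta> z. japanese z ^ n * japanese \<zeta> ^ M * cmod (ft2 (pd (0, b) G) (\<zeta>, z)) \<le> C" if "b \<in> Basis" for b :: 'b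
  using Suc.IH[OF mem[OF that]] .
 then obtain C where C: "\<And>b \<zeta> z. b \<in> Basis ==> japanese z ^ n * japanese \<zeta> ^ M * cmod (ft2 (pd (0, b) G) (\<zeta>, z)) \<le> C b"
  by metis
 obtain C0 where C0: "\<And>\<zeta> z. japanese z ^ n * japanese \<zeta> ^ M * cmod (ft2 G (\<zeta>, z)) \<le> C0"
  using Suc.IH[OF Suc.prems] by blast
 have "japanese z ^ Suc n * japanese \<zeta> ^ M * cmod (ft2 G (\<zeta>, z)) \<le> C0 + (\<Sum>b\<in>Basis. C b)" for \<zeta> z
 proof -
  define A where "A = japanese z ^ n * japanese \<zeta> ^ M"
  have A: "A \<ge> 0" by (simp add: A_def)
  have le: "A * (\<bar>z \<bullet> b\<bar> * cmod (ft2 G (\<zeta>, z))) \<le> C b" if "b \<in> Basis" for b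
  proof -
   have "1 * (\<bar>z \<bullet> b\<bar> * cmod (ft2 G (\<zeta>, z))) \<le> (2 * pi) * (\<bar>z \<bullet> b\<bar> * cmod (ft2 G (\<zeta>, z)))"
    using pi_gt3 by (intro mult_right_mono) auto
   also have "\<dots> = cmod (ft2 (pd (0, b) G) (\<zeta>, z))"
    unfolding ft2_parts[OF Suc.prems that] by (simp add: norm_mult)
   finally have "A * (\<bar>z \<bullet> b\<bar> * cmod (ft2 G (\<zeta>, z))) \<le> A * cmod (ft2 (pd (0, b) G) (\<zeta>, z))"
    using A by (intro mult_left_mono) auto
   then show ?thesis using C[OF that, of z \<zeta>] unfolding A_def by (rule order_trans)
  qed
  have "japanese z ^ Suc n * japanese \<zeta> ^ M * cmod (ft2 G (\<zeta>, z)) = japanese z * (A * cmod (ft2 G (\<zeta>, z)))"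
   by (simp add: A_def mult_ac)
  also have "\<dots> \<le> (1 + (\<Sum>b\<in>Basis. \<bar>z \<bullet> b\<bar>)) * (A * cmod (ft2 G (\<zeta>, z)))"
   using japanese_le[of z] norm_le_l1[of z] A by (intro mult_right_mono) auto
  also have "\<dots> = A * cmod (ft2 G (\<zeta>, z)) + (\<Sum>b\<in>Basis. A * (\<bar>z \<bullet> b\<bar> * cmod (ft2 G (\<zeta>, z))))"
   unfolding distrib_right sum_distrib_right mult_1_left
   by (intro arg_cong2[where f="(+)"] sum.cong refl) (simp add: mult.left_commute)
  also have "\<dots> \<le> C0 + (\<Sum>b\<in>Basis. C b)"
   using C0[of z \<zeta>] le unfolding A_def by (intro add_mono sum_mono) auto
  finally show ?thesis .
 qed
 then show ?case by blast
qed

lemma schwartz_ft2: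
 fixes G :: "'a::euclidean_space \<times> 'b::euclidean_space => complex"
 assumes G: "G \<in> schwartz" shows "ft2 G \<in> schwartz"
proof (rule schwartz_coinduct[where X="ft2 ` schwartz"])
 show "pd h g \<in> ft2 ` schwartz" if g: "g \<in> ft2 ` schwartz" and h: "h \<in> Basis"
  for g :: "'a \<times> 'b => complex" and h
 proof -
  obtain G where G: "G \<in> schwartz" "g = ft2 G" using g by blast
  show ?thesis unfolding G(2) pd_eqI[OF ft2_has_derivative[OF G(1)], of h]
   by (intro imageI schwartz_ft2_pd G h)
 qed
 show "g differentiable (at p)" if "g \<in> ft2 ` schwartz" for g :: "'a \<times> 'b => complex" and p
  using that differentiableI[OF ft2_has_derivative] by blast
 show "rapid g" if g: "g \<in> ft2 ` schwartz" for g :: "'a \<times> 'b => complex"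
 proof (rule rapidI)
  fix N
  obtain G where G: "G \<in> schwartz" "g = ft2 G" using g by blast
  obtain C where C: "\<And>\<zeta> z. japanese z ^ N * japanese \<zeta> ^ N * cmod (ft2 G (\<zeta>, z)) \<le> C"
   using ft2_bound[OF G(1)] by blast
  have "japanese p ^ N * cmod (g p) \<le> C" for p
  proof -
   have "japanese p ^ N * cmod (g p) \<le> (japanese (snd p) * japanese (fst p)) ^ N * cmod (g p)"
    using japanese_Pair[of "fst p" "snd p"] by (intro mult_right_mono power_mono) (auto simp: mult.commute)
   also have "\<dots> \<le> C" using C[of "snd p" "fst p"] by (simp add: G power_mult_distrib)
   finally show ?thesis .
  qed
  then show "\<exists>C. \<forall>p. japanese p ^ N * cmod (g p) \<le> C" by blast
 qed
qed (use G in blast)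

lemma schwartz_integral_snd:
 assumes "G \<in> schwartz" shows "(\<lambda>x. LINT t|lborel. G (x, t)) \<in> schwartz"
 using schwartz_section_fst[OF schwartz_ft2[OF assms], of 0] by (simp add: ft2_def)

definition ft :: "('a::euclidean_space => complex) => 'a => complex"
 where "ft f z = (LINT t|lborel. f t * cis (- (2 * pi) * (t \<bullet> z)))"

text \<open>\<open>ft\<close> has no parameter, so one is added artificially: the partial transform
  of f (x) f (t), taken at a point x where f does not vanish, is a nonzero multiple of
  \<open>ft f\<close>.\<close>

lemma schwartz_ft:
 assumes f: "f \<in> schwartz" shows "ft f \<in> schwartz"
proof (cases "\<exists>x. f x \<noteq> 0")
 case True
 then obtain x where x: "f x \<noteq> 0" by blast
 have "(\<lambda>z. ft2 (\<lambda>p. f (fst p) * f (snd p)) (x, z)) \<in> schwartz"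
  by (intro schwartz_section_snd schwartz_ft2 schwartz_tensor f)
 moreover have "ft2 (\<lambda>p. f (fst p) * f (snd p)) (x, z) = f x * ft f z" for z
  by (simp add: ft2_def mult.assoc ft_def)
 ultimately have "(\<lambda>z. inverse (f x) * (f x * ft f z)) \<in> schwartz"
  using schwartz_cmult by simp
 then show ?thesis using x by (simp add: mult.assoc[symmetric])
next
 case False
 then have "f = (\<lambda>_. 0)" by auto
 then have "ft f = f" by (simp add: ft_def[abs_def])
 then show ?thesis using f by simp
qed

lemma integrable_schwartz_pair:
 fixes F :: "'a::euclidean_space \<times> 'b::euclidean_space => complex"
 assumes "F \<in> schwartz" shows "integrable (lborel \<Otimes>\<^sub>M lborel) F"
 using schwartz_integrable[OF assms] by (simp add: lborel_prod)

lemma schwartz_Fubini: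
 fixes F :: "'a::euclidean_space \<times> 'b::euclidean_space => complex"
 assumes F: "F \<in> schwartz"
 shows "(LINT p|lborel. F p) = (LINT x|lborel. LINT y|lborel. F (x, y))"
  and "(LINT x|lborel. LINT y|lborel. F (x, y)) = (LINT y|lborel. LINT x|lborel. F (x, y))"
 using lborel_pair.integral_fst'[OF integrable_schwartz_pair[OF F]]
  lborel_pair.Fubini_integral[of "\<lambda>x y. F (x, y)"] integrable_schwartz_pair[OF F]
 by (simp_all add: lborel_prod)

lemma schwartz_tensor_cis:
 assumes "f \<in> schwartz" "g \<in> schwartz"
 shows "(\<lambda>p. f (fst p) * g (snd p) * cis (c * (fst p \<bullet> snd p))) \<in> schwartz"
 by (intro schwartz_mult_slow schwartz_tensor assms slow_cis_inner bounded_linear_fst bounded_linear_snd)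

lemma ft_multiplication:
 assumes f: "f \<in> schwartz" and g: "g \<in> schwartz"
 shows "(LINT z|lborel. ft f z * g z) = (LINT t|lborel. f t * ft g t)"
proof -
 have "(LINT t|lborel. LINT z|lborel. f t * g z * cis (- (2 * pi) * (t \<bullet> z))) =
   (LINT z|lborel. LINT t|lborel. f t * g z * cis (- (2 * pi) * (t \<bullet> z)))"
  using schwartz_Fubini(2)[OF schwartz_tensor_cis[OF f g, of "- (2 * pi)"]] by simp
 moreover have "(LINT t|lborel. f t * g z * cis (- (2 * pi) * (t \<bullet> z))) = ft f z * g z" for z
  unfolding ft_def integral_mult_left_zero[symmetric]
  by (rule Bochner_Integration.integral_cong) (simp_all add: mult_ac)
 moreover have "(LINT z|lborel. f t * g z * cis (- (2 * pi) * (t \<bullet> z))) = f t * ft g t" for t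
  unfolding ft_def integral_mult_right_zero[symmetric]
  by (rule Bochner_Integration.integral_cong) (simp_all add: mult_ac inner_commute)
 ultimately show ?thesis by simp
qed

lemma schwartz_scale:
 assumes "f \<in> schwartz" "c \<noteq> 0" shows "(\<lambda>x. f (c *\<^sub>R x)) \<in> schwartz"
proof (rule schwartz_linear[OF assms(1), where L="\<lambda>x. c *\<^sub>R x" and K="1 / \<bar>c\<bar>"])
 show "norm x \<le> 1 / \<bar>c\<bar> * norm (c *\<^sub>R x)" for x :: 'a using assms(2) by simp
qed (rule bounded_linear_scaleR_right)

text \<open>The Jacobian of the dilation is absorbed by the dilation of the Fourier transform, so
  the two sides agree without any factor and the scale may tend to 0.\<close>

lemma ft_scale:
 assumes f: "f \<in> schwartz" and g: "g \<in> schwartz" and c: "c > 0"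
 shows "(LINT z|lborel. ft f z * g (c *\<^sub>R z)) = (LINT x|lborel. f (c *\<^sub>R x) * ft g x)"
proof -
 have gc: "(\<lambda>z. g (c *\<^sub>R z)) \<in> schwartz" using c by (intro schwartz_scale g) auto
 have m: "(\<lambda>t. g t * cis (- (2 * pi) * (t \<bullet> x))) \<in> \<B>" for x
  by (intro schwartz_measurable schwartz_mult_slow g slow_cis_inner_const bounded_linear_ident)
 have e: "ft g x = complex_of_real (c ^ DIM('a)) * ft (\<lambda>z. g (c *\<^sub>R z)) (c *\<^sub>R x)" for x
  unfolding ft_def using integral_lborel_affine[OF m[of x], of c 0] c by simp
 have "(LINT z|lborel. ft f z * g (c *\<^sub>R z)) = (LINT t|lborel. f t * ft (\<lambda>z. g (c *\<^sub>R z)) t)"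
  by (rule ft_multiplication[OF f gc])
 also have "\<dots> = complex_of_real (c ^ DIM('a)) * (LINT t|lborel. f (c *\<^sub>R t) * ft (\<lambda>z. g (c *\<^sub>R z)) (c *\<^sub>R t))"
  using integral_lborel_affine[OF schwartz_measurable[OF schwartz_mult[OF f schwartz_ft[OF gc]]], of c 0] c by simp
 also have "\<dots> = (LINT x|lborel. f (c *\<^sub>R x) * ft g x)"
  unfolding integral_mult_right_zero[symmetric]
  by (rule Bochner_Integration.integral_cong) (simp_all add: e mult_ac)
 finally show ?thesis .
qed

lemma schwartz_bounded:
 assumes "f \<in> schwartz" obtains B where "B \<ge> 0" "\<And>x. cmod (f x) \<le> B"
proof -
 obtain C where "C \<ge> 0" "\<And>x. cmod (f x) \<le> C / japanese x ^ 0"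
  using rapidD[OF schwartz_rapid[OF assms]] by metis
 then show ?thesis using that[of C] by simp
qed

text \<open>Zooming in at \<open>x0\<close> makes f constant on the region where h lives. The limit
  serves twice: for Fourier inversion and for finding a window that is not orthogonal to a given
  one.\<close>

lemma schwartz_dilation_limit:
 assumes f: "f \<in> schwartz" and h: "h \<in> schwartz"
 shows "(\<lambda>k. LINT x|lborel. f (x0 + (1 / real (Suc k)) *\<^sub>R x) * h x) \<longlonglongrightarrow> f x0 * (LINT x|lborel. h x)"
proof -
 obtain B where B: "B \<ge> 0" "\<And>x. cmod (f x) \<le> B" using schwartz_bounded[OF f] by blast
 have "(\<lambda>k. LINT x|lborel. f (x0 + (1 / real (Suc k)) *\<^sub>R x) * h x) \<longlonglongrightarrow> (LINT x|lborel. f x0 * h x)"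
 proof (rule integral_dominated_convergence[where w="\<lambda>x. B * cmod (h x)"])
  show "(\<lambda>x. f (x0 + (1 / real (Suc k)) *\<^sub>R x) * h x) \<in> borel_measurable lborel" for k
   using schwartz_measurable[OF schwartz_mult[OF schwartz_scale[OF schwartz_translate[OF f], of "1 / real (Suc k)" x0] h]]
   by (simp add: add.commute)
  show "AE x in lborel. (\<lambda>k. f (x0 + (1 / real (Suc k)) *\<^sub>R x) * h x) \<longlonglongrightarrow> f x0 * h x"
  proof (intro AE_I2 tendsto_mult tendsto_const)
   fix x
   have "(\<lambda>k. x0 + (1 / real (Suc k)) *\<^sub>R x) \<longlonglongrightarrow> x0 + 0 *\<^sub>R x"
    using LIMSEQ_inverse_real_of_nat by (intro tendsto_intros) (simp add: divide_inverse)
   then show "(\<lambda>k. f (x0 + (1 / real (Suc k)) *\<^sub>R x)) \<longlonglongrightarrow> f x0"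
    using isCont_tendsto_compose[OF differentiable_imp_continuous_within[OF schwartz_diff[OF f], of x0]] by simp
  qed
  show "(\<lambda>x. f x0 * h x) \<in> borel_measurable lborel"
   using schwartz_measurable[OF schwartz_cmult[OF h]] by simp
  show "integrable lborel (\<lambda>x. B * cmod (h x))"
   by (intro integrable_mult_right integrable_norm schwartz_integrable h)
  show "AE x in lborel. cmod (f (x0 + (1 / real (Suc k)) *\<^sub>R x) * h x) \<le> B * cmod (h x)" for k
   by (intro AE_I2) (auto simp: norm_mult intro!: mult_right_mono B)
 qed
 then show ?thesis by simp
qed

text \<open>The two sides are the limits of the two sides of \<open>ft_scale\<close> as the scale
  tends to 0. So the integral of \<open>ft f\<close> is proportional to \<open>f 0\<close> with a
  factor independent of f, which is Fourier inversion at the origin.\<close>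

lemma ft_integral_ratio:
 fixes f g :: "'a::euclidean_space => complex"
 assumes f: "f \<in> schwartz" and g: "g \<in> schwartz"
 shows "g 0 * (LINT z|lborel. ft f z) = f 0 * (LINT z|lborel. ft g z)"
proof (rule LIMSEQ_unique)
 show "(\<lambda>k. LINT x|lborel. g (0 + (1 / real (Suc k)) *\<^sub>R x) * ft f x) \<longlonglongrightarrow> g 0 * (LINT z|lborel. ft f z)"
  by (intro schwartz_dilation_limit g schwartz_ft f)
 have "(\<lambda>k. LINT x|lborel. f (0 + (1 / real (Suc k)) *\<^sub>R x) * ft g x) \<longlonglongrightarrow> f 0 * (LINT z|lborel. ft g z)"
  by (intro schwartz_dilation_limit f schwartz_ft g)
 then show "(\<lambda>k. LINT x|lborel. g (0 + (1 / real (Suc k)) *\<^sub>R x) * ft f x) \<longlonglongrightarrow> f 0 * (LINT z|lborel. ft g z)"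
  using ft_scale[OF f g, of "1 / real (Suc _)"] by (simp add: mult.commute)
qed

lemma schwartz_norm_sq_pos:
 assumes f: "f \<in> schwartz" and x: "f x \<noteq> 0"
 shows "(LINT t|lborel. f t * cnj (f t)) \<noteq> 0"
proof
 assume 0: "(LINT t|lborel. f t * cnj (f t)) = 0"
 have e: "f t * cnj (f t) = complex_of_real ((cmod (f t))\<^sup>2)" for t by (rule complex_norm_square[symmetric])
 have i: "integrable lborel (\<lambda>t. (cmod (f t))\<^sup>2)"
  using integrable_norm[OF schwartz_integrable[OF schwartz_mult[OF f f]]] by (simp add: norm_mult power2_eq_square)
 have "(LINT t|lborel. (cmod (f t))\<^sup>2) = 0" using 0 unfolding e integral_complex_of_real by simp
 then have "AE t in lborel. (cmod (f t))\<^sup>2 = 0"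
  using integral_nonneg_eq_0_iff_AE[OF i] by simp
 then have "AE t in lborel. t \<notin> {t. f t \<noteq> 0}" by simp
 moreover have op: "open {t. f t \<noteq> 0}"
  using open_Collect_neq[of f "\<lambda>_. 0"] schwartz_continuous[OF f] by (auto intro: continuous_intros)
 ultimately have "{t. f t \<noteq> 0} \<in> null_sets lborel"
  using AE_iff_null_sets[of "{t. f t \<noteq> 0}" lborel] by auto
 then have "negligible {t. f t \<noteq> 0}"
  using negligible_iff_null_sets null_sets_completionI by blast
 then show False using open_not_negligible[OF op] x by blast
qed

lemma ft_translate:
 assumes f: "f \<in> schwartz" shows "ft (\<lambda>t. f (t + x)) z = cis (2 * pi * (x \<bullet> z)) * ft f z"
proof -
 have "(\<lambda>t. f t * cis (- (2 * pi) * (t \<bullet> z))) \<in> \<B>"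
  by (intro schwartz_measurable schwartz_mult_slow f slow_cis_inner_const bounded_linear_ident)
 from integral_lborel_shift[OF this, of x]
 have "ft f z = (LINT t|lborel. f (t + x) * cis (- (2 * pi) * ((t + x) \<bullet> z)))" by (simp add: ft_def)
 also have "\<dots> = (LINT t|lborel. cis (- (2 * pi * (x \<bullet> z))) * (f (t + x) * cis (- (2 * pi) * (t \<bullet> z))))"
 proof (rule Bochner_Integration.integral_cong[OF refl])
  fix t
  have "cis (- (2 * pi) * ((t + x) \<bullet> z)) = cis (- (2 * pi * (x \<bullet> z))) * cis (- (2 * pi) * (t \<bullet> z))"
   unfolding cis_mult by (rule arg_cong[where f=cis]) (simp add: inner_add_left algebra_simps)
  then show "f (t + x) * cis (- (2 * pi) * ((t + x) \<bullet> z))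
    = cis (- (2 * pi * (x \<bullet> z))) * (f (t + x) * cis (- (2 * pi) * (t \<bullet> z)))" by (simp only: mult_ac)
 qed
 also have "\<dots> = cis (- (2 * pi * (x \<bullet> z))) * ft (\<lambda>t. f (t + x)) z" by (simp add: ft_def)
 finally show ?thesis by (simp add: mult.assoc[symmetric] cis_mult)
qed

lemma ft_reflect_cnj:
 assumes f: "f \<in> schwartz" shows "ft (\<lambda>t. cnj (f (- t))) z = cnj (ft f z)"
proof -
 have m: "(\<lambda>t. cnj (f t) * cis (2 * pi * (t \<bullet> z))) \<in> \<B>"
  by (intro schwartz_measurable schwartz_mult_slow schwartz_cnj f slow_cis_inner_const bounded_linear_ident)
 have "cnj (ft f z) = (LINT t|lborel. cnj (f t) * cis (2 * pi * (t \<bullet> z)))"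
  unfolding ft_def by (subst Bochner_Integration.integral_cnj[symmetric]) (simp add: cis_cnj)
 also have "\<dots> = ft (\<lambda>t. cnj (f (- t))) z"
  using integral_lborel_affine[OF m, of "-1" 0] by (simp add: ft_def)
 finally show ?thesis by simp
qed

text \<open>The normalisation of the Fourier transform makes the constant 1, but only its being nonzero
 matters here, so that no explicit Gaussian integral is needed.\<close>

lemma fourier_inversion:
 "\<exists>c. c \<noteq> 0 \<and> (\<forall>f \<in> schwartz. \<forall>x::'a::euclidean_space.
   (LINT z|lborel. ft f z * cis (2 * pi * (x \<bullet> z))) = c * f x)"
proof (cases "\<exists>f\<in>schwartz. \<exists>x::'a. f x \<noteq> 0")
 \<comment> \<open>No nonzero Schwartz function has been exhibited so far, so the degenerate case is
   split off; there any nonzero constant serves.\<close>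
 case False
 then have "f = (\<lambda>_. 0)" if "f \<in> schwartz" for f :: "'a => complex" using that by blast
 show ?thesis
 proof (intro exI[of _ 1] conjI ballI allI)
  fix f :: "'a => complex" and x assume "f \<in> schwartz"
  then have "f = (\<lambda>_. 0)" using False by blast
  then show "(LINT z|lborel. ft f z * cis (2 * pi * (x \<bullet> z))) = 1 * f x" by (simp add: ft_def)
 qed simp
next
 case True
 then obtain f0 and x0 :: 'a where f0: "f0 \<in> schwartz" "f0 x0 \<noteq> 0" by blast
 define g where "g = (\<lambda>x. f0 (x + x0))"
 have g: "g \<in> schwartz" "g 0 \<noteq> 0" using f0 by (auto simp: g_def schwartz_translate)
 define c where "c = (LINT z|lborel. ft g z) / g 0"
 have inv: "(LINT z|lborel. ft f z * cis (2 * pi * (x \<bullet> z))) = c * f x" if f: "f \<in> schwartz" for f and x :: 'a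
  using ft_integral_ratio[OF schwartz_translate[OF f, of x] g(1)] ft_translate[OF f, of x] g(2)
  by (simp add: c_def field_simps)
 \<comment> \<open>If c were 0, the double transform of h = |f0|^2 would vanish. By the
   multiplication formula the square integral of \<open>ft h\<close> would then be 0, although
   \<open>ft h 0\<close> is the integral of |f0|^2.\<close>
 have "c \<noteq> 0"
 proof
  assume c: "c = 0"
  define h where "h = (\<lambda>x. f0 x * cnj (f0 x))"
  have h: "h \<in> schwartz" unfolding h_def by (intro schwartz_mult schwartz_cnj f0)
  have "ft (ft h) x = 0" for x
   using inv[OF h, of "- x"] c by (simp add: ft_def[of "ft h"] inner_commute)
  then have "0 = (LINT z|lborel. ft (ft h) z * cnj (h (- z)))" by simp
  also have "\<dots> = (LINT t|lborel. ft h t * ft (\<lambda>z. cnj (h (- z))) t)"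
   using schwartz_scale[OF schwartz_cnj[OF h], of "-1"]
   by (intro ft_multiplication schwartz_ft h) auto
  also have "\<dots> = (LINT t|lborel. ft h t * cnj (ft h t))" by (simp add: ft_reflect_cnj[OF h])
  finally have "ft h 0 = 0" using schwartz_norm_sq_pos[OF schwartz_ft[OF h], of 0] by auto
  moreover have "ft h 0 = (LINT t|lborel. f0 t * cnj (f0 t))" by (simp add: ft_def h_def)
  ultimately show False using schwartz_norm_sq_pos[OF f0] by simp
 qed
 then show ?thesis using inv by blast
qed

section \<open>Parameter-dependent Schwartz functions and tempered distributions\<close>

lemma schwartz_diff_mem: "f \<in> schwartz ==> g \<in> schwartz ==> (\<lambda>x. f x - g x) \<in> schwartz"
 using schwartz_add[of f "\<lambda>x. (- 1) * g x"] schwartz_cmult[of g "- 1"] by simp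

lemma partials_diff:
 assumes "f \<in> schwartz" "g \<in> schwartz" "set bs \<subseteq> Basis"
 shows "partials bs (\<lambda>x. f x - g x) = (\<lambda>x. partials bs f x - partials bs g x)"
 using assms(3)
proof (induction bs)
 case (Cons b bs)
 have D: "((\<lambda>x. partials bs f x - partials bs g x) has_derivative (\<lambda>h.
   frechet_derivative (partials bs f) (at x) h - frechet_derivative (partials bs g) (at x) h)) (at x)" for x
  using Cons.prems assms by (intro has_derivative_diff schwartz_has_derivative schwartz_partials) auto
 show ?case using Cons pd_eqI[OF D] by simp
qed simp

lemma partials_sum:
 fixes f :: "'i => 'a::euclidean_space => complex"
 assumes "\<And>i. i \<in> I ==> f i \<in> schwartz" "set bs \<subseteq> Basis"
 shows "partials bs (\<lambda>x. \<Sum>i\<in>I. c i * f i x) = (\<lambda>x. \<Sum>i\<in>I. c i * partials bs (f i) x)"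
 using assms(2)
proof (induction bs)
 case (Cons b bs)
 have D: "((\<lambda>x. \<Sum>i\<in>I. c i * partials bs (f i) x) has_derivative (\<lambda>h.
   \<Sum>i\<in>I. c i * frechet_derivative (partials bs (f i)) (at x) h)) (at x)" for x
  using Cons.prems assms
  by (intro has_derivative_sum has_derivative_mult_right schwartz_has_derivative schwartz_partials) auto
 show ?case using Cons pd_eqI[OF D] by simp
qed simp

lemma Pair_Basis: "set bs \<subseteq> Basis ==> set (map (Pair 0) bs) \<subseteq> Basis"
 by (auto simp: Basis_prod_def)

lemma partials_section:
 fixes F :: "'y::euclidean_space \<times> 'x::euclidean_space => complex"
 assumes F: "F \<in> schwartz" and "set bs \<subseteq> Basis"
 shows "partials bs (\<lambda>x. F (y, x)) = (\<lambda>x. partials (map (Pair 0) bs) F (y, x))"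
 using assms(2)
proof (induction bs)
 case (Cons b bs)
 let ?P = "partials (map (Pair 0) bs) F"
 have D: "((\<lambda>x. ?P (y, x)) has_derivative (\<lambda>h. frechet_derivative ?P (at (y, x)) (0, h))) (at x)" for x
 proof -
  have "((\<lambda>x. (y, x)) has_derivative (\<lambda>h. (0, h))) (at x)"
   by (intro has_derivative_Pair has_derivative_ident has_derivative_const)
  moreover have "?P \<in> schwartz" using Cons.prems by (intro schwartz_partials F Pair_Basis) auto
  ultimately show ?thesis
   using diff_chain_at[OF _ schwartz_has_derivative, of "\<lambda>x. (y, x)" "\<lambda>h. (0, h)" x ?P] by (simp add: o_def)
 qed
 show ?case using Cons pd_eqI[OF D] by simp
qed simp

lemma has_derivative_integral_fst:
 fixes P :: "'y::euclidean_space \<times> 'x::euclidean_space => complex"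
 assumes P: "P \<in> schwartz"
 shows "((\<lambda>x. LINT y|lborel. P (y, x)) has_derivative
  (\<lambda>h. LINT y|lborel. frechet_derivative P (at (y, x)) (0, h))) (at x)"
proof -
 have pdP: "(\<lambda>p. frechet_derivative P (at p) (0, snd h)) \<in> schwartz"
  if "h \<in> Basis" "fst h = 0" for h :: "'y \<times> 'x"
  using schwartz_pd[OF P that(1)] that(2) by (metis (no_types, lifting) prod.collapse ext)
 have "\<exists>C\<ge>0. \<forall>y x. cmod (frechet_derivative P (at (y, x)) (0, b)) \<le> C / (japanese y ^ (0 + Suc DIM('y)) * japanese x ^ 0)"
  if "b \<in> Basis" for b :: 'x
  using schwartz_bound_Pair[OF pdP[of "(0, b)"], of "0 + Suc DIM('y)" 0] that by (simp add: Basis_prod_def) metis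
 then obtain C where C: "\<And>b. b \<in> Basis ==> C b \<ge> 0"
  "\<And>b y x. b \<in> Basis ==> cmod (frechet_derivative P (at (y, x)) (0, b)) \<le> C b / (japanese y ^ (0 + Suc DIM('y)) * japanese x ^ 0)"
  by metis
 show ?thesis
 proof (rule has_derivative_integral[where w="\<lambda>y. sum C Basis / japanese y ^ (0 + Suc DIM('y))"])
  show "((\<lambda>x. P (y, x)) has_derivative (\<lambda>h. frechet_derivative P (at (y, x)) (0, h))) (at x)" for y x
  proof -
   have "((\<lambda>x. (y, x)) has_derivative (\<lambda>h. (0, h))) (at x)"
    by (intro has_derivative_Pair has_derivative_ident has_derivative_const)
   then show ?thesis
    using diff_chain_at[OF _ schwartz_has_derivative[OF P], of "\<lambda>x. (y, x)" "\<lambda>h. (0, h)" x] by (simp add: o_def)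
  qed
  show "integrable lborel (\<lambda>y. P (y, x))" for x
   by (intro schwartz_integrable schwartz_section_fst P)
  show "(\<lambda>y. frechet_derivative P (at (y, x)) (0, b)) \<in> borel_measurable lborel" if "b \<in> Basis" for b
   using schwartz_measurable[OF schwartz_section_fst[OF pdP[of "(0, b)"]]] that by (simp add: Basis_prod_def)
  show "integrable lborel (\<lambda>y::'y. sum C Basis / japanese y ^ (0 + Suc DIM('y)))"
   by (rule integrable_japanese_power)
  show "cmod (frechet_derivative P (at (y, x)) (0, b)) \<le> sum C Basis / japanese y ^ (0 + Suc DIM('y))"
   if "b \<in> Basis" for y x b
  proof -
   have "cmod (frechet_derivative P (at (y, x)) (0, b)) \<le> C b / japanese y ^ (0 + Suc DIM('y))"
    using C(2)[OF that, of y x] by simp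
   also have "\<dots> \<le> sum C Basis / japanese y ^ (0 + Suc DIM('y))"
    using that C by (intro divide_right_mono member_le_sum) auto
   finally show ?thesis .
  qed
 qed
qed

lemma partials_integral_fst:
 fixes F :: "'y::euclidean_space \<times> 'x::euclidean_space => complex"
 assumes F: "F \<in> schwartz" and "set bs \<subseteq> Basis"
 shows "partials bs (\<lambda>x. LINT y|lborel. F (y, x)) = (\<lambda>x. LINT y|lborel. partials (map (Pair 0) bs) F (y, x))"
 using assms(2)
proof (induction bs)
 case (Cons b bs)
 have P: "partials (map (Pair 0) bs) F \<in> schwartz" using Cons.prems by (intro schwartz_partials F Pair_Basis) auto
 show ?case using Cons pd_eqI[OF has_derivative_integral_fst[OF P], of b] by simp
qed simp

lemma schwartz_swap: "F \<in> schwartz ==> (\<lambda>(x, y). F (y, x)) \<in> schwartz"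
proof -
 assume F: "F \<in> schwartz"
 have "(\<lambda>p. F (snd p, fst p)) \<in> schwartz"
  by (rule schwartz_linear[OF F, where L="\<lambda>p. (snd p, fst p)" and K=1])
    (auto intro: bounded_linear_Pair bounded_linear_fst bounded_linear_snd simp: norm_prod_def)
 then show ?thesis by (simp add: case_prod_unfold)
qed

lemma schwartz_integral_fst:
 fixes F :: "'y::euclidean_space \<times> 'x::euclidean_space => complex"
 assumes "F \<in> schwartz" shows "(\<lambda>x. LINT y|lborel. F (y, x)) \<in> schwartz"
 using schwartz_integral_snd[OF schwartz_swap[OF assms]] by simp

lemma seminorm_le:
 assumes "\<And>bs x. set bs \<subseteq> Basis ==> length bs \<le> N ==> japanese x ^ N * cmod (partials bs f x) \<le> B"
 shows "schwartz_seminorm N f \<le> B"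
 unfolding schwartz_seminorm_def
proof (rule cSUP_least)
 show "{bs. set bs \<subseteq> Basis \<and> length bs \<le> N} \<times> UNIV \<noteq> {}"
  by (auto intro!: exI[of _ "[]"])
qed (use assms in auto)

lemma section_lipschitz:
 fixes P :: "'y::euclidean_space \<times> 'x::euclidean_space => complex"
 assumes P: "P \<in> schwartz"
 obtains L where "L \<ge> 0" "\<And>y y' x. japanese x ^ N * cmod (P (y, x) - P (y', x)) \<le> L * norm (y - y')"
proof -
 have mem: "pd (b, 0) P \<in> schwartz" if "b \<in> Basis" for b :: 'y
  using that by (intro schwartz_pd P) (simp add: Basis_prod_def)
 have "\<exists>C\<ge>0. \<forall>y x. cmod (pd (b, 0) P (y, x)) \<le> C / (japanese y ^ 0 * japanese x ^ N)" if "b \<in> Basis" for b :: 'y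
  using schwartz_bound_Pair[OF mem[OF that], of 0 N] by metis
 then obtain C where C: "\<And>b. b \<in> Basis ==> C b \<ge> 0"
  "\<And>b y x. b \<in> Basis ==> cmod (pd (b, 0) P (y, x)) \<le> C b / (japanese y ^ 0 * japanese x ^ N)" by metis
 have "japanese x ^ N * cmod (P (y, x) - P (y', x)) \<le> sum C Basis * norm (y - y')" for y y' x
 proof -
  have D: "((\<lambda>y. P (y, x)) has_derivative (\<lambda>h. frechet_derivative P (at (y, x)) (h, 0))) (at y)" for y
  proof -
   have "((\<lambda>y. (y, x)) has_derivative (\<lambda>h. (h, 0))) (at y)"
    by (intro has_derivative_Pair has_derivative_ident has_derivative_const)
   then show ?thesis
    using diff_chain_at[OF _ schwartz_has_derivative[OF P], of "\<lambda>y. (y, x)" "\<lambda>h. (h, 0)" y] by (simp add: o_def)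
  qed
  have "cmod (P (y, x) - P (y', x)) \<le> sum C Basis / japanese x ^ N * norm (y - y')"
  proof (rule differentiable_bound[OF convex_UNIV])
   show "((\<lambda>y. P (y, x)) has_derivative (\<lambda>h. frechet_derivative P (at (y, x)) (h, 0))) (at y within UNIV)" for y
    using D by simp
   show "onorm (\<lambda>h. frechet_derivative P (at (y, x)) (h, 0)) \<le> sum C Basis / japanese x ^ N" for y
   proof (rule onorm_bound)
    show "cmod (frechet_derivative P (at (y, x)) (h, 0)) \<le> sum C Basis / japanese x ^ N * norm h" for h
    proof -
     have "cmod (frechet_derivative P (at (y, x)) (h, 0)) = cmod (\<Sum>b\<in>Basis. (h \<bullet> b) *\<^sub>R pd (b, 0) P (y, x))"
      using has_derivative_expand[OF D, of y h] by simp
     also have "\<dots> \<le> (\<Sum>b\<in>Basis. norm h * (C b / japanese x ^ N))"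
     proof (rule order_trans[OF norm_sum], rule sum_mono)
      fix b :: 'y assume b: "b \<in> Basis"
      show "cmod ((h \<bullet> b) *\<^sub>R pd (b, 0) P (y, x)) \<le> norm h * (C b / japanese x ^ N)"
       unfolding norm_scaleR using C(2)[OF b, of y x] Basis_le_norm[OF b, of h] by (intro mult_mono) auto
     qed
     also have "\<dots> = sum C Basis / japanese x ^ N * norm h"
      by (simp add: sum_distrib_left[symmetric] sum_divide_distrib[symmetric])
     finally show ?thesis .
    qed
    show "0 \<le> sum C Basis / japanese x ^ N" using C by (simp add: sum_nonneg)
   qed
  qed auto
  then show ?thesis by (simp add: field_simps)
 qed
 then show ?thesis using that[of "sum C Basis"] C by (simp add: sum_nonneg)
qed

lemma finite_multi_indices: "finite {bs :: 'a::euclidean_space list. set bs \<subseteq> Basis \<and> length bs \<le> N}"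
 by (rule finite_lists_length_le) simp

lemma finite_uniform_bound:
 assumes "finite I" "\<And>i. i \<in> I ==> \<exists>C. \<forall>D\<ge>C. P i (D::real)"
 shows "\<exists>D\<ge>0. \<forall>i\<in>I. P i D"
proof -
 obtain C where C: "\<And>i D. i \<in> I ==> D \<ge> C i ==> P i D" using assms(2) by metis
 have "C i \<le> (\<Sum>i\<in>I. \<bar>C i\<bar>)" if "i \<in> I" for i
  using member_le_sum[of i I "\<lambda>i. \<bar>C i\<bar>"] assms(1) that by fastforce
 then show ?thesis by (intro exI[of _ "\<Sum>i\<in>I. \<bar>C i\<bar>"]) (auto intro: sum_nonneg C)
qed

text \<open>Only finitely many multi-indices enter the seminorm of order \<open>N\<close>, so single
  constants serve for all of them: the map from y to the section of \<open>F\<close> at y is bounded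
  and Lipschitz for that seminorm.\<close>

lemma sections_uniform:
 fixes F :: "'y::euclidean_space \<times> 'x::euclidean_space => complex"
 assumes F: "F \<in> schwartz"
 obtains L B where "L \<ge> 0" "B \<ge> 0"
  "\<And>bs y y' x. set bs \<subseteq> Basis ==> length bs \<le> N ==>
   japanese x ^ N * cmod (partials (map (Pair 0) bs) F (y, x) - partials (map (Pair 0) bs) F (y', x)) \<le> L * norm (y - y')"
  "\<And>bs y x. set bs \<subseteq> Basis ==> length bs \<le> N ==>
   japanese x ^ N * cmod (partials (map (Pair 0) bs) F (y, x)) \<le> B"
proof -
 let ?I = "{bs :: 'x list. set bs \<subseteq> Basis \<and> length bs \<le> N}"
 have P: "partials (map (Pair 0) bs) F \<in> schwartz" if "bs \<in> ?I" for bs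
  using that by (intro schwartz_partials F Pair_Basis) auto
 have "\<exists>L\<ge>0. \<forall>bs\<in>?I. \<forall>y y' x. japanese x ^ N * cmod (partials (map (Pair 0) bs) F (y, x)
   - partials (map (Pair 0) bs) F (y', x)) \<le> L * norm (y - y')"
 proof (rule finite_uniform_bound[OF finite_multi_indices], goal_cases)
  case (1 bs)
  obtain L where L: "\<And>y y' x. japanese x ^ N * cmod (partials (map (Pair 0) bs) F (y, x)
    - partials (map (Pair 0) bs) F (y', x)) \<le> L * norm (y - y')"
   using section_lipschitz[OF P[OF 1], where N=N] by metis
  show ?case
   by (intro exI[of _ L] allI impI, rule order_trans[OF L], rule mult_right_mono) auto
 qed
 moreover have "\<exists>B\<ge>0. \<forall>bs\<in>?I. \<forall>y x. japanese x ^ N * cmod (partials (map (Pair 0) bs) F (y, x)) \<le> B"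
 proof (rule finite_uniform_bound[OF finite_multi_indices], goal_cases)
  case (1 bs)
  obtain C where C: "\<And>x y. cmod (partials (map (Pair 0) bs) F (y, x)) \<le> C / (japanese y ^ 0 * japanese x ^ N)"
   using schwartz_bound_Pair[OF P[OF 1]] by metis
  have C': "japanese x ^ N * cmod (partials (map (Pair 0) bs) F (y, x)) \<le> C" for x y
   using C[where x=x and y=y] by (simp add: field_simps)
  show ?case
   by (intro exI[of _ C] allI impI, rule order_trans[OF C'])
 qed
 ultimately show ?thesis
 proof (elim exE conjE, goal_cases)
  case (1 L B)
  show ?thesis using 1 by (intro that[of L B]) auto
 qed
qed

lemma tempered_add: "u \<in> tempered ==> f \<in> schwartz ==> g \<in> schwartz ==> u (\<lambda>x. f x + g x) = u f + u g"
 by (simp add: tempered_def)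

lemma tempered_cmult: "u \<in> tempered ==> f \<in> schwartz ==> u (\<lambda>x. c * f x) = cnj c * u f"
 by (simp add: tempered_def)

text \<open>Continuity in the form in which it is applied: any common bound of the weighted
  derivatives may be inserted, so that the supremum in the seminorm need not be evaluated.\<close>

lemma tempered_bound:
 assumes "u \<in> tempered"
 obtains C N where "C \<ge> 0" "\<And>f B. f \<in> schwartz ==> (\<And>bs x. set bs \<subseteq> Basis ==> length bs \<le> N ==>
  japanese x ^ N * cmod (partials bs f x) \<le> B) ==> cmod (u f) \<le> C * B"
proof -
 obtain C N where C: "\<And>f. f \<in> schwartz ==> cmod (u f) \<le> C * schwartz_seminorm N f"
  using assms unfolding tempered_def by blast
 have "cmod (u f) \<le> \<bar>C\<bar> * B" if f: "f \<in> schwartz" and b: "\<And>bs x. set bs \<subseteq> Basis ==> length bs \<le> N ==>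
  japanese x ^ N * cmod (partials bs f x) \<le> B" for f B
 proof -
  have le: "schwartz_seminorm N f \<le> B" by (rule seminorm_le[OF b])
  have "japanese (0::'a) ^ N * cmod (partials [] f 0) \<le> schwartz_seminorm N f"
   unfolding schwartz_seminorm_def
   by (rule cSUP_upper2[where x="([], 0::'a)"]) (auto intro!: bdd_aboveI2[where M=B] b)
  moreover have "0 \<le> japanese (0::'a) ^ N * cmod (partials [] f 0)" by simp
  ultimately have ge: "0 \<le> schwartz_seminorm N f" by linarith
  have "cmod (u f) \<le> C * schwartz_seminorm N f" by (rule C[OF f])
  also have "\<dots> \<le> \<bar>C\<bar> * schwartz_seminorm N f" using ge by (intro mult_right_mono) auto
  also have "\<dots> \<le> \<bar>C\<bar> * B" using le by (intro mult_left_mono) auto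
  finally show ?thesis .
 qed
 then show ?thesis using that[of "\<bar>C\<bar>" N] by simp
qed

lemma tempered_diff: "u \<in> tempered ==> f \<in> schwartz ==> g \<in> schwartz ==> u (\<lambda>x. f x - g x) = u f - u g"
 using tempered_add[of u f "\<lambda>x. (- 1) * g x"] schwartz_cmult[of g "- 1"] tempered_cmult[of u g "- 1"] by simp

lemma tempered_sum:
 assumes u: "u \<in> tempered" and "finite I" "\<And>i. i \<in> I ==> f i \<in> schwartz"
 shows "u (\<lambda>x. \<Sum>i\<in>I. c i * f i x) = (\<Sum>i\<in>I. cnj (c i) * u (f i))"
 using assms(2,3)
proof (induction I rule: finite_induct)
 case empty
 obtain f :: "'a => complex" where "f \<in> schwartz"
  using schwartz_sum[of "{} :: 'a set"] by blast
 then show ?case using tempered_cmult[OF u, of f 0] by simp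
next
 case (insert i I)
 have S: "(\<lambda>x. \<Sum>i\<in>I. c i * f i x) \<in> schwartz"
  using insert.prems by (intro schwartz_sum schwartz_cmult insert.hyps) auto
 have i: "f i \<in> schwartz" using insert.prems by simp
 show ?case
  using tempered_add[OF u schwartz_cmult[OF i, of "c i"] S] tempered_cmult[OF u i] insert by simp
qed

lemma slow_sum:
 assumes "finite I" "\<And>i. i \<in> I ==> f i \<in> slow" shows "(\<lambda>x. \<Sum>i\<in>I. f i x) \<in> slow"
 using assms by (induction I rule: finite_induct) (auto intro: slow_add slow_const)

lemma slow_power: "f \<in> slow ==> (\<lambda>x. f x ^ n) \<in> slow"
 by (induction n) (auto intro: slow_mult slow_const)

lemma slow_japanese_fst:
 "(\<lambda>p :: 'y::euclidean_space \<times> 'x::euclidean_space. complex_of_real (japanese (fst p) ^ (2 * n))) \<in> slow"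
proof -
 have "(\<lambda>p :: 'y \<times> 'x. 1 + (\<Sum>b\<in>Basis. complex_of_real (fst p \<bullet> b) * complex_of_real (fst p \<bullet> b))) \<in> slow"
  by (intro slow_add slow_const slow_sum slow_mult slow_linear bounded_linear_inner_left_comp bounded_linear_fst finite_Basis)
 moreover have "1 + (\<Sum>b\<in>Basis. complex_of_real (fst p \<bullet> b) * complex_of_real (fst p \<bullet> b)) = complex_of_real ((japanese (fst p))\<^sup>2)"
  for p :: "'y \<times> 'x"
 proof -
  have "(japanese (fst p))\<^sup>2 = 1 + (norm (fst p))\<^sup>2"
   unfolding japanese_def by (rule real_sqrt_pow2) simp
  also have "\<dots> = 1 + (\<Sum>b\<in>Basis. (fst p \<bullet> b) * (fst p \<bullet> b))"
   by (simp add: power2_norm_eq_inner euclidean_inner[of "fst p" "fst p"])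
  finally show ?thesis by simp
 qed
 ultimately have "(\<lambda>p :: 'y \<times> 'x. complex_of_real ((japanese (fst p))\<^sup>2) ^ n) \<in> slow"
  using slow_power by simp
 then show ?thesis by (simp add: power_mult)
qed

text \<open>After composition with a simple function the integral is a finite linear combination,
  weighted by the \<open>w\<close>-masses of the fibres. A functional that is merely additive and
  homogeneous can be pulled through it.\<close>

lemma integral_simple_compose:
 fixes s :: "'a::euclidean_space => 'a" and h :: "'a => complex"
 assumes s: "simple_function lborel s" and w: "integrable lborel w"
 shows "(LINT y|lborel. complex_of_real (w y) * h (s y))
  = (\<Sum>v\<in>range s. complex_of_real (LINT y|lborel. w y * indicator (s -` {v}) y) * h v)"
  and "integrable lborel (\<lambda>y. complex_of_real (w y) * h (s y))"
proof -
 have fin: "finite (range s)" using simple_functionD(1)[OF s] by simp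
 have meas: "s -` {v} \<in> sets lborel" for v using simple_functionD(2)[OF s, of "{v}"] by simp
 have i: "integrable lborel (\<lambda>y. w y * indicator (s -` {v}) y)" for v
  using integrable_mult_indicator[OF meas w] by (simp add: mult.commute)
 then have i': "integrable lborel (\<lambda>y. complex_of_real (w y * indicator (s -` {v}) y) * h v)" for v
  by (intro integrable_mult_left integrable_of_real)
 have e: "complex_of_real (w y) * h (s y) = (\<Sum>v\<in>range s. complex_of_real (w y * indicator (s -` {v}) y) * h v)" for y
 proof -
  have "(\<Sum>v\<in>range s. complex_of_real (w y * indicator (s -` {v}) y) * h v)
    = (\<Sum>v\<in>range s. if v = s y then complex_of_real (w y) * h v else 0)"
   by (intro sum.cong refl) (auto simp: indicator_def)
  then show ?thesis using fin by simp
 qed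
 show "integrable lborel (\<lambda>y. complex_of_real (w y) * h (s y))"
  unfolding e by (intro Bochner_Integration.integrable_sum i')
 have "(LINT y|lborel. complex_of_real (w y) * h (s y))
   = (\<Sum>v\<in>range s. LINT y|lborel. complex_of_real (w y * indicator (s -` {v}) y) * h v)"
  unfolding e by (rule Bochner_Integration.integral_sum[OF i'])
 also have "\<dots> = (\<Sum>v\<in>range s. complex_of_real (LINT y|lborel. w y * indicator (s -` {v}) y) * h v)"
  by (intro sum.cong refl) (simp only: integral_mult_left_zero integral_complex_of_real)
 finally show "(LINT y|lborel. complex_of_real (w y) * h (s y))
  = (\<Sum>v\<in>range s. complex_of_real (LINT y|lborel. w y * indicator (s -` {v}) y) * h v)" .
qed

lemma tempered_section_continuous:
 fixes F :: "'y::euclidean_space \<times> 'x::euclidean_space => complex"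
 assumes u: "u \<in> tempered" and F: "F \<in> schwartz"
 shows "continuous_on UNIV (\<lambda>y. u (\<lambda>x. F (y, x)))" and "\<exists>B\<ge>0. \<forall>y. cmod (u (\<lambda>x. F (y, x))) \<le> B"
proof -
 obtain C N where C: "C \<ge> 0" "\<And>f B. f \<in> schwartz ==> (\<And>bs x. set bs \<subseteq> Basis ==> length bs \<le> N ==>
  japanese x ^ N * cmod (partials bs f x) \<le> B) ==> cmod (u f) \<le> C * B"
  using tempered_bound[OF u] by metis
 obtain L B where LB: "L \<ge> 0" "B \<ge> 0"
  "\<And>bs y y' x. set bs \<subseteq> Basis ==> length bs \<le> N ==>
   japanese x ^ N * cmod (partials (map (Pair 0) bs) F (y, x) - partials (map (Pair 0) bs) F (y', x)) \<le> L * norm (y - y')"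
  "\<And>bs y x. set bs \<subseteq> Basis ==> length bs \<le> N ==>
   japanese x ^ N * cmod (partials (map (Pair 0) bs) F (y, x)) \<le> B"
  using sections_uniform[OF F] by metis
 have sec: "(\<lambda>x. F (y, x)) \<in> schwartz" for y by (rule schwartz_section_snd[OF F])
 have lip: "cmod (u (\<lambda>x. F (y, x)) - u (\<lambda>x. F (y', x))) \<le> C * (L * norm (y - y'))" for y y'
  unfolding tempered_diff[OF u sec sec, symmetric]
  by (rule C(2)[OF schwartz_diff_mem[OF sec sec]])
    (simp add: partials_diff[OF sec sec] partials_section[OF F] LB(3))
 show "continuous_on UNIV (\<lambda>y. u (\<lambda>x. F (y, x)))"
 proof (rule lipschitz_on_continuous_on[OF lipschitz_onI])
  show "dist (u (\<lambda>x. F (y, x))) (u (\<lambda>x. F (y', x))) \<le> (C * L) * dist y y'" for y y'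
   using lip[of y y'] by (simp add: dist_norm mult.assoc)
  show "0 \<le> C * L" using C(1) LB(1) by simp
 qed
 show "\<exists>B\<ge>0. \<forall>y. cmod (u (\<lambda>x. F (y, x))) \<le> B"
  using C(2)[OF sec, of _ B] LB(2,4) C(1) by (intro exI[of _ "C * B"]) (auto simp: partials_section[OF F])
qed

lemma partials_cmult:
 assumes "f \<in> schwartz" "set bs \<subseteq> Basis"
 shows "partials bs (\<lambda>x. c * f x) = (\<lambda>x. c * partials bs f x)"
 using partials_sum[of "{()}" "\<lambda>_. f" bs "\<lambda>_. c"] assms by simp

text \<open>A tempered distribution commutes with the integral of a Schwartz function over some of its
 variables: approximating the identity by simple functions turns the integral into a finite sum.\<close>

lemma tempered_integral:
 fixes F :: "'y::euclidean_space \<times> 'x::euclidean_space => complex"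
 assumes u: "u \<in> tempered" and F: "F \<in> schwartz"
 shows "integrable lborel (\<lambda>y. u (\<lambda>x. F (y, x)))"
  and "u (\<lambda>x. LINT y|lborel. F (y, x)) = (LINT y|lborel. u (\<lambda>x. F (y, x)))"
proof -
 define n where "n = Suc DIM('y)"
 \<comment> \<open>The simple approximations of y have no decay of their own, so an integrable
   weight is split off beforehand. The even exponent makes 1 / \<open>w\<close> a polynomial, hence
   \<open>G\<close> is again a Schwartz function.\<close>
 define w where "w y = 1 / japanese y ^ (2 * n)" for y :: 'y
 have w: "integrable lborel w"
  using integrable_japanese_power[where 'a='y, of 1 "Suc DIM('y)"] by (simp add: w_def[abs_def] n_def mult_2)
 have w0: "w y \<ge> 0" for y by (simp add: w_def)
 define G where "G p = F p * complex_of_real (japanese (fst p) ^ (2 * n))" for p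
 have G: "G \<in> schwartz" unfolding G_def by (rule schwartz_mult_slow[OF F slow_japanese_fst])
 have FG: "F (y, x) = complex_of_real (w y) * G (y, x)" for y x by (simp add: w_def G_def)
 have secG: "(\<lambda>x. G (y, x)) \<in> schwartz" for y by (rule schwartz_section_snd[OF G])
 have uF: "u (\<lambda>x. F (y, x)) = complex_of_real (w y) * u (\<lambda>x. G (y, x))" for y
  unfolding FG tempered_cmult[OF u secG] by simp
 obtain B where B: "B \<ge> 0" "\<And>y. cmod (u (\<lambda>x. G (y, x))) \<le> B"
  using tempered_section_continuous(2)[OF u G] by blast
 have cont: "continuous_on UNIV (\<lambda>y. u (\<lambda>x. G (y, x)))" by (rule tempered_section_continuous(1)[OF u G])
 then have [measurable]: "(\<lambda>y. u (\<lambda>x. G (y, x))) \<in> \<B>" by (rule borel_measurable_continuous_onI)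
 have [measurable]: "w \<in> \<B>" using w by simp
 show int: "integrable lborel (\<lambda>y. u (\<lambda>x. F (y, x)))"
  unfolding uF
 proof (rule Bochner_Integration.integrable_bound[OF integrable_mult_right[OF w, of B]])
  show "AE y in lborel. cmod (complex_of_real (w y) * u (\<lambda>x. G (y, x))) \<le> norm (B * w y)"
   using B w0 by (intro AE_I2) (simp add: norm_mult mult.commute[of B] mult_left_mono)
 qed simp
 obtain s where s: "\<And>i. simple_function lborel (s i)" "\<And>y. (\<lambda>i. s i y) \<longlonglongrightarrow> (y::'y)"
  using borel_measurable_implies_sequence_metric[of "\<lambda>y::'y. y" lborel 0] by auto
 have [measurable]: "s i \<in> \<B>" for i
  using borel_measurable_simple_function[OF s(1)] by simp
 define m where "m i v = (LINT y|lborel. w y * indicator (s i -` {v}) y)" for i v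
 \<comment> \<open>This is the integral of \<open>w y * G (s i y, x)\<close> over y, written as a
   finite sum because \<open>s i\<close> takes finitely many values; \<open>u\<close> passes through
   it by linearity.\<close>
 define I where "I i x = (\<Sum>v\<in>range (s i). complex_of_real (m i v) * G (v, x))" for i x
 have fin: "finite (range (s i))" for i using simple_functionD(1)[OF s(1)] by simp
 have I: "I i \<in> schwartz" for i unfolding I_def by (intro schwartz_sum fin schwartz_cmult secG)
 define \<Psi> where "\<Psi> = (\<lambda>x. LINT y|lborel. F (y, x))"
 have \<Psi>: "\<Psi> \<in> schwartz" unfolding \<Psi>_def by (rule schwartz_integral_fst[OF F])
 have uI: "u (I i) = (LINT y|lborel. complex_of_real (w y) * u (\<lambda>x. G (s i y, x)))" for i
  unfolding I_def tempered_sum[OF u fin secG]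
  using integral_simple_compose(1)[OF s(1) w, where h="\<lambda>v. u (\<lambda>x. G (v, x))"] by (simp add: m_def)
 have lim1: "(\<lambda>i. u (I i)) \<longlonglongrightarrow> (LINT y|lborel. u (\<lambda>x. F (y, x)))"
  unfolding uI uF
 proof (rule integral_dominated_convergence[where w="\<lambda>y. B * w y"])
  show "AE y in lborel. (\<lambda>i. complex_of_real (w y) * u (\<lambda>x. G (s i y, x))) \<longlonglongrightarrow> complex_of_real (w y) * u (\<lambda>x. G (y, x))"
  proof (intro AE_I2 tendsto_mult tendsto_const)
   fix y
   show "(\<lambda>i. u (\<lambda>x. G (s i y, x))) \<longlonglongrightarrow> u (\<lambda>x. G (y, x))"
    using continuous_on_tendsto_compose[OF cont s(2)[of y]] by simp
  qed
  show "integrable lborel (\<lambda>y. B * w y)" by (rule integrable_mult_right[OF w])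
  show "AE y in lborel. cmod (complex_of_real (w y) * u (\<lambda>x. G (s i y, x))) \<le> B * w y" for i
   using B w0 by (intro AE_I2) (simp add: norm_mult mult.commute[of B] mult_left_mono)
  show "(\<lambda>y. complex_of_real (w y) * u (\<lambda>x. G (s i y, x))) \<in> borel_measurable lborel" for i
   by (intro borel_measurable_integrable integral_simple_compose(2)[OF s(1) w])
 qed simp
 obtain C N where C: "C \<ge> 0" "\<And>f B. f \<in> schwartz ==> (\<And>bs x. set bs \<subseteq> Basis ==> length bs \<le> N ==>
  japanese x ^ N * cmod (partials bs f x) \<le> B) ==> cmod (u f) \<le> C * B"
  using tempered_bound[OF u] by metis
 obtain L K where LK: "L \<ge> 0" "K \<ge> 0"
  "\<And>bs y y' x. set bs \<subseteq> Basis ==> length bs \<le> N ==>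
   japanese x ^ N * cmod (partials (map (Pair 0) bs) G (y, x) - partials (map (Pair 0) bs) G (y', x)) \<le> L * norm (y - y')"
  "\<And>bs y x. set bs \<subseteq> Basis ==> length bs \<le> N ==>
   japanese x ^ N * cmod (partials (map (Pair 0) bs) G (y, x)) \<le> K"
  using sections_uniform[OF G] by metis
 \<comment> \<open>\<open>e i\<close> bounds the error of \<open>I i\<close> in the seminorm of
   order \<open>N\<close>: the Lipschitz bound makes the integrand tend to 0, and the truncation at
   \<open>2 * K\<close>, available because the sections are bounded, supplies the dominating
   function.\<close>
 define e where "e i = (LINT y|lborel. w y * min (2 * K) (L * norm (y - s i y)))" for i
 have min_le: "norm (w y * min (2 * K) (L * norm (y - s i y))) \<le> 2 * K * w y" for i y
 proof -
  have "\<bar>min (2 * K) (L * norm (y - s i y))\<bar> \<le> 2 * K" using LK by (simp add: min_def)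
  then show ?thesis using w0[of y] LK(2) by (simp add: abs_mult mult.commute mult_left_mono)
 qed
 have eint: "integrable lborel (\<lambda>y. w y * min (2 * K) (L * norm (y - s i y)))" for i
 proof (rule Bochner_Integration.integrable_bound[OF integrable_mult_right[OF w, of "2 * K"]])
  show "AE y in lborel. norm (w y * min (2 * K) (L * norm (y - s i y))) \<le> norm (2 * K * w y)"
   using min_le by (intro AE_I2) (simp add: order_trans[OF _ abs_ge_self])
 qed simp
 have e0: "e \<longlonglongrightarrow> 0"
 proof -
  have "(\<lambda>i. LINT y|lborel. w y * min (2 * K) (L * norm (y - s i y))) \<longlonglongrightarrow> (LINT y::'y|lborel. 0)"
  proof (rule integral_dominated_convergence[where w="\<lambda>y. 2 * K * w y"])
   show "AE y in lborel. (\<lambda>i. w y * min (2 * K) (L * norm (y - s i y))) \<longlonglongrightarrow> 0"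
   proof (rule AE_I2)
    fix y
    have "(\<lambda>i. w y * min (2 * K) (L * norm (y - s i y))) \<longlonglongrightarrow> w y * min (2 * K) (L * norm (y - y))"
     by (intro tendsto_mult tendsto_min tendsto_const tendsto_norm tendsto_diff s(2))
    then show "(\<lambda>i. w y * min (2 * K) (L * norm (y - s i y))) \<longlonglongrightarrow> 0" using LK(2) by simp
   qed
   show "integrable lborel (\<lambda>y. 2 * K * w y)" by (rule integrable_mult_right[OF w])
   show "AE y in lborel. norm (w y * min (2 * K) (L * norm (y - s i y))) \<le> 2 * K * w y" for i
    by (intro AE_I2 min_le)
   show "(\<lambda>y. w y * min (2 * K) (L * norm (y - s i y))) \<in> borel_measurable lborel" for i
    using eint[of i] by (rule borel_measurable_integrable)
  qed simp
  then show ?thesis by (simp add: e_def[abs_def])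
 qed
 have "cmod (u \<Psi> - u (I i)) \<le> C * e i" for i
  unfolding tempered_diff[OF u \<Psi> I, symmetric]
 proof (rule C(2)[OF schwartz_diff_mem[OF \<Psi> I]])
  fix bs :: "'x list" and x assume bs: "set bs \<subseteq> Basis" "length bs \<le> N"
  let ?P = "\<lambda>y x. partials (map (Pair 0) bs) G (y, x)"
  have PF: "partials (map (Pair 0) bs) F (y, x) = complex_of_real (w y) * ?P y x" for y
   using partials_section[OF F bs(1), of y] partials_section[OF G bs(1), of y]
    partials_cmult[OF secG bs(1), of "complex_of_real (w y)" y] unfolding FG by metis
  have Pi: "integrable lborel (\<lambda>y. complex_of_real (w y) * ?P y x)"
   unfolding PF[symmetric] by (intro schwartz_integrable schwartz_section_fst schwartz_partials F Pair_Basis bs)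
  have "partials bs \<Psi> x = (LINT y|lborel. complex_of_real (w y) * ?P y x)"
   unfolding \<Psi>_def partials_integral_fst[OF F bs(1)] PF ..
  moreover have "partials bs (I i) x = (LINT y|lborel. complex_of_real (w y) * ?P (s i y) x)"
   unfolding I_def partials_sum[OF secG bs(1)] partials_section[OF G bs(1)]
   using integral_simple_compose(1)[OF s(1) w, where h="\<lambda>v. ?P v x"] by (simp add: m_def)
  ultimately have "partials bs (\<lambda>x. \<Psi> x - I i x) x
    = (LINT y|lborel. complex_of_real (w y) * ?P y x) - (LINT y|lborel. complex_of_real (w y) * ?P (s i y) x)"
   unfolding partials_diff[OF \<Psi> I bs(1)] by simp
  also have "\<dots> = (LINT y|lborel. complex_of_real (w y) * ?P y x - complex_of_real (w y) * ?P (s i y) x)"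
   by (rule Bochner_Integration.integral_diff[symmetric, OF Pi integral_simple_compose(2)[OF s(1) w]])
  finally have d: "partials bs (\<lambda>x. \<Psi> x - I i x) x = (LINT y|lborel. complex_of_real (w y) * (?P y x - ?P (s i y) x))"
   by (simp add: right_diff_distrib)
  have i: "integrable lborel (\<lambda>y. complex_of_real (w y) * (?P y x - ?P (s i y) x))"
   unfolding right_diff_distrib by (rule Bochner_Integration.integrable_diff[OF Pi integral_simple_compose(2)[OF s(1) w]])
  have "cmod (partials bs (\<lambda>x. \<Psi> x - I i x) x) \<le> (LINT y|lborel. (1 / japanese x ^ N) * (w y * min (2 * K) (L * norm (y - s i y))))"
   unfolding d
  proof (rule Bochner_Integration.integral_norm_bound_integral[OF i integrable_mult_right[OF eint]])
   fix y
   have "japanese x ^ N * cmod (?P y x - ?P (s i y) x) \<le> L * norm (y - s i y)" by (rule LK(3)[OF bs])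
   moreover have "japanese x ^ N * cmod (?P y x - ?P (s i y) x) \<le> 2 * K"
   proof -
    have "japanese x ^ N * cmod (?P y x - ?P (s i y) x)
      \<le> japanese x ^ N * cmod (?P y x) + japanese x ^ N * cmod (?P (s i y) x)"
     unfolding distrib_left[symmetric] by (intro mult_left_mono norm_triangle_ineq4) simp
    then show ?thesis using LK(4)[OF bs, of x y] LK(4)[OF bs, of x "s i y"] by simp
   qed
   ultimately have "japanese x ^ N * cmod (?P y x - ?P (s i y) x) \<le> min (2 * K) (L * norm (y - s i y))" by simp
   then have "w y * (japanese x ^ N * cmod (?P y x - ?P (s i y) x)) \<le> w y * min (2 * K) (L * norm (y - s i y))"
    by (rule mult_left_mono[OF _ w0])
   then show "cmod (complex_of_real (w y) * (?P y x - ?P (s i y) x)) \<le> 1 / japanese x ^ N * (w y * min (2 * K) (L * norm (y - s i y)))"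
    unfolding norm_mult norm_of_real abs_of_nonneg[OF w0] by (simp add: divide_simps mult_ac)
  qed
  also have "\<dots> = 1 / japanese x ^ N * e i" unfolding e_def by (rule integral_mult_right_zero)
  finally show "japanese x ^ N * cmod (partials bs (\<lambda>x. \<Psi> x - I i x) x) \<le> e i" by (simp add: field_simps)
 qed
 moreover have "(\<lambda>i. C * e i) \<longlonglongrightarrow> 0" using tendsto_mult_right_zero[OF e0] .
 ultimately have "(\<lambda>i. u \<Psi> - u (I i)) \<longlonglongrightarrow> 0"
  by (intro Lim_null_comparison[of "\<lambda>i. u \<Psi> - u (I i)" "\<lambda>i. C * e i"]) auto
 from tendsto_diff[OF tendsto_const[of "u \<Psi>"] this] have "(\<lambda>i. u (I i)) \<longlonglongrightarrow> u \<Psi>" by simp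
 from LIMSEQ_unique[OF this lim1] show "u (\<lambda>x. LINT y|lborel. F (y, x)) = (LINT y|lborel. u (\<lambda>x. F (y, x)))"
  unfolding \<Psi>_def .
qed

text \<open>The sections over a fixed first component are multiples of time-frequency shifts of
  \<Phi>, so results on sections apply to the short-time Fourier transform. The factor h is there
  because the shifts do not decay in their parameters. A shear reduces the function to a tensor
  product times a quadratic phase.\<close>

lemma schwartz_time_frequency:
 assumes h: "h \<in> schwartz" and \<Phi>: "\<Phi> \<in> schwartz"
 shows "(\<lambda>q. h (fst q) * (cis (2 * pi * (snd q \<bullet> snd (fst q))) * \<Phi> (snd q - fst (fst q)))) \<in> schwartz"
proof -
 let ?L = "\<lambda>q :: ('a \<times> 'a) \<times> 'a. (fst q, snd q - fst (fst q))"
 have "(\<lambda>q. (\<lambda>p. h (fst p) * \<Phi> (snd p)) (?L q)) \<in> schwartz"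
 proof (rule schwartz_linear[OF schwartz_tensor[OF h \<Phi>], where L="?L" and K=3])
  show "bounded_linear ?L"
   by (intro bounded_linear_Pair bounded_linear_sub bounded_linear_fst bounded_linear_snd
     bounded_linear_compose[OF bounded_linear_fst bounded_linear_fst])
  fix q :: "('a \<times> 'a) \<times> 'a"
  have "norm (snd q) \<le> norm (snd q - fst (fst q)) + norm (fst (fst q))"
   using norm_triangle_ineq[of "snd q - fst (fst q)" "fst (fst q)"] by simp
  moreover have "norm (fst (fst q)) \<le> norm (fst q)" using norm_fst_le[of "fst (fst q)" "snd (fst q)"] by simp
  moreover have "norm (fst q) \<le> norm (?L q)" "norm (snd q - fst (fst q)) \<le> norm (?L q)"
   using norm_fst_le[of "fst q" "snd q - fst (fst q)"] norm_snd_le[of "snd q - fst (fst q)" "fst q"] by simp_all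
  moreover have "norm q \<le> norm (fst q) + norm (snd q)" using norm_Pair_le[of "fst q" "snd q"] by simp
  ultimately show "norm q \<le> 3 * norm (?L q)" by linarith
 qed
 from schwartz_mult_slow[OF this slow_cis_inner[OF bounded_linear_snd
   bounded_linear_compose[OF bounded_linear_snd bounded_linear_fst], of "2 * pi"]]
 show ?thesis by (simp add: mult_ac)
qed

lemma stft_fun_distr: "stft \<Gamma> (fun_distr \<Psi>) \<zeta> z = ft (\<lambda>t. \<Psi> t * cnj (\<Gamma> (t - \<zeta>))) z"
 by (simp add: stft_def fun_distr_def ft_def cis_cnj mult_ac)

lemma schwartz_mult_cnj_shift:
 "\<Psi> \<in> schwartz ==> \<Gamma> \<in> schwartz ==> (\<lambda>t. \<Psi> t * cnj (\<Gamma> (t - \<zeta>))) \<in> schwartz"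
 using schwartz_mult[OF _ schwartz_cnj[OF schwartz_translate], of \<Psi> \<Gamma> "- \<zeta>"] by simp

text \<open>Jointly in both variables the transform is the partial Fourier transform of \<Psi> (t)
  times the conjugate of \<Gamma> (t - \<zeta>), which a shear turns into a tensor product.\<close>

lemma schwartz_stft:
 assumes \<Psi>: "\<Psi> \<in> schwartz" and \<Gamma>: "\<Gamma> \<in> schwartz"
 shows "(\<lambda>p. stft \<Gamma> (fun_distr \<Psi>) (fst p) (snd p)) \<in> schwartz"
proof -
 let ?L = "\<lambda>q :: 'a \<times> 'a. (snd q - fst q, snd q)"
 have "(\<lambda>q. (\<lambda>p. cnj (\<Gamma> (fst p)) * \<Psi> (snd p)) (?L q)) \<in> schwartz"
 proof (rule schwartz_linear[OF schwartz_tensor[OF schwartz_cnj[OF \<Gamma>] \<Psi>], where L="?L" and K=3])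
  show "bounded_linear ?L"
   by (intro bounded_linear_Pair bounded_linear_sub bounded_linear_fst bounded_linear_snd)
  fix q :: "'a \<times> 'a"
  have "norm (fst q) \<le> norm (snd q - fst q) + norm (snd q)"
   using norm_triangle_ineq4[of "snd q" "snd q - fst q"] by simp
  moreover have "norm (snd q) \<le> norm (?L q)" "norm (snd q - fst q) \<le> norm (?L q)"
   using norm_fst_le[of "snd q - fst q" "snd q"] norm_snd_le[of "snd q" "snd q - fst q"] by simp_all
  moreover have "norm q \<le> norm (fst q) + norm (snd q)" using norm_Pair_le[of "fst q" "snd q"] by simp
  ultimately show "norm q \<le> 3 * norm (?L q)" by linarith
 qed
 from schwartz_ft2[OF this] show ?thesis
  by (simp add: stft_fun_distr ft2_def[abs_def] ft_def mult_ac)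
qed

text \<open>Continuity of sections is available for Schwartz dependence on the parameter only, hence
  after multiplication by a cutoff h. Near a given point h is taken as a translate of \<Phi> tensor
  \<Phi> that does not vanish there, and is divided out again.\<close>

lemma continuous_on_cutoff:
 fixes \<Phi> :: "'a::euclidean_space => complex" and G :: "'a \<times> 'a => complex"
 assumes \<Phi>: "\<Phi> \<in> schwartz" and a: "\<Phi> a \<noteq> 0"
  and G: "\<And>h. h \<in> schwartz ==> continuous_on UNIV (\<lambda>p. cnj (h p) * G p)"
 shows "continuous_on UNIV G"
 unfolding continuous_on_eq_continuous_at[OF open_UNIV]
proof
 fix p0 :: "'a \<times> 'a"
 define h where "h p = \<Phi> (fst p + a - fst p0) * \<Phi> (snd p + a - snd p0)" for p
 have h: "h \<in> schwartz"
  using schwartz_translate[OF schwartz_tensor[OF \<Phi> \<Phi>], of "(a, a) - p0"] by (simp add: h_def[abs_def] algebra_simps)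
 define U where "U p = cnj (h p) * G p" for p
 have "continuous_on UNIV U" using G[OF h] by (simp add: U_def[abs_def])
 then have "isCont U p0" using continuous_on_eq_continuous_at[OF open_UNIV, of U] by blast
 moreover have "isCont h p0" by (rule differentiable_imp_continuous_within[OF schwartz_diff[OF h]])
 moreover have "cnj (h p0) \<noteq> 0" using a by (simp add: h_def)
 ultimately have "isCont (\<lambda>p. U p / cnj (h p)) p0"
  by (intro continuous_at_within_divide continuous_cnj)
 moreover have "eventually (\<lambda>p. U p / cnj (h p) = G p) (nhds p0)"
 proof -
  have "open {p. h p \<noteq> 0}"
   using open_Collect_neq[of h "\<lambda>_. 0"] schwartz_continuous[OF h] by (auto intro: continuous_intros)
  moreover have "p0 \<in> {p. h p \<noteq> 0}" using a by (simp add: h_def)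
  ultimately show ?thesis unfolding eventually_nhds U_def by force
 qed
 ultimately show "isCont G p0" by (rule iffD1[OF isCont_cong, rotated])
qed

lemma schwartz_modulate_translate:
 assumes "\<Phi> \<in> schwartz" shows "(\<lambda>t. cis (2 * pi * (t \<bullet> z)) * \<Phi> (t - x)) \<in> schwartz"
 using schwartz_mult_slow[OF schwartz_translate[OF assms, of "- x"] slow_cis_inner_const[OF bounded_linear_ident, of "2 * pi" z]]
 by (simp add: mult.commute)

lemma stft_continuous:
 assumes u: "u \<in> tempered" and \<Phi>: "\<Phi> \<in> schwartz"
 shows "continuous_on UNIV (\<lambda>p. stft \<Phi> u (fst p) (snd p))"
proof (cases "\<exists>a. \<Phi> a \<noteq> 0")
 case False
 then have "\<Phi> = (\<lambda>_. 0)" by auto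
 then show ?thesis by (simp add: stft_def)
next
 case True
 then obtain a where a: "\<Phi> a \<noteq> 0" by blast
 show ?thesis
 proof (rule continuous_on_cutoff[OF \<Phi> a])
  fix h :: "'a \<times> 'a => complex" assume h: "h \<in> schwartz"
  have "u (\<lambda>t. h p * (cis (2 * pi * (t \<bullet> snd p)) * \<Phi> (t - fst p))) = cnj (h p) * stft \<Phi> u (fst p) (snd p)" for p
   unfolding stft_def by (rule tempered_cmult[OF u schwartz_modulate_translate[OF \<Phi>]])
  then show "continuous_on UNIV (\<lambda>p. cnj (h p) * stft \<Phi> u (fst p) (snd p))"
   using tempered_section_continuous(1)[OF u schwartz_time_frequency[OF h \<Phi>]] by simp
 qed
qed

text \<open>For fixed t the integral of \<open>F\<close> is computed in two stages: Fourier
  inversion in the frequency restores \<Psi> (t), and the remaining integral over the position is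
  the inner product of the windows. \<open>tempered_integral\<close> then moves \<open>u\<close>
  under the integral. Two windows are allowed so that one of them can be adapted to the structure of
  \<Psi>.\<close>

lemma stft_inversion:
 fixes \<Phi> \<Gamma> \<Psi> :: "'a::euclidean_space => complex"
 assumes u: "u \<in> tempered" and \<Phi>: "\<Phi> \<in> schwartz" and \<Gamma>: "\<Gamma> \<in> schwartz" and \<Psi>: "\<Psi> \<in> schwartz"
  and inv: "\<And>f x. f \<in> schwartz ==> (LINT z|lborel. ft f z * cis (2 * pi * (x \<bullet> z))) = c * f (x :: 'a)"
 shows "integrable lborel (\<lambda>p. cnj (stft \<Gamma> (fun_distr \<Psi>) (fst p) (snd p)) * stft \<Phi> u (fst p) (snd p))"
  and "cnj (c * (LINT t|lborel. \<Phi> t * cnj (\<Gamma> t))) * u \<Psi> =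
   (LINT p|lborel. cnj (stft \<Gamma> (fun_distr \<Psi>) (fst p) (snd p)) * stft \<Phi> u (fst p) (snd p))"
proof -
 define v where "v p = stft \<Gamma> (fun_distr \<Psi>) (fst p) (snd p)" for p
 have v: "v \<in> schwartz" unfolding v_def by (rule schwartz_stft[OF \<Psi> \<Gamma>])
 define F where "F q = v (fst q) * (cis (2 * pi * (snd q \<bullet> snd (fst q))) * \<Phi> (snd q - fst (fst q)))" for q
 have F: "F \<in> schwartz" unfolding F_def by (rule schwartz_time_frequency[OF v \<Phi>])
 have tf: "(\<lambda>t. cis (2 * pi * (t \<bullet> snd p)) * \<Phi> (t - fst p)) \<in> schwartz" for p
  using schwartz_mult_slow[OF schwartz_translate[OF \<Phi>, of "- fst p"] slow_cis_inner_const[OF bounded_linear_ident, of "2 * pi" "snd p"]]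
  by (simp add: mult.commute)
 have uF: "u (\<lambda>t. F (p, t)) = cnj (v p) * stft \<Phi> u (fst p) (snd p)" for p
  unfolding F_def stft_def fst_conv snd_conv by (rule tempered_cmult[OF u tf])
 show "integrable lborel (\<lambda>p. cnj (stft \<Gamma> (fun_distr \<Psi>) (fst p) (snd p)) * stft \<Phi> u (fst p) (snd p))"
  using tempered_integral(1)[OF u F] unfolding uF v_def .
 have "(LINT p|lborel. F (p, t)) = c * (LINT t|lborel. \<Phi> t * cnj (\<Gamma> t)) * \<Psi> t" for t
 proof -
  have inner: "(LINT z|lborel. F ((\<zeta>, z), t)) = c * \<Psi> t * (\<Phi> (t - \<zeta>) * cnj (\<Gamma> (t - \<zeta>)))" for \<zeta>
  proof -
   have "(LINT z|lborel. F ((\<zeta>, z), t)) = (LINT z|lborel. \<Phi> (t - \<zeta>) * (ft (\<lambda>t. \<Psi> t * cnj (\<Gamma> (t - \<zeta>))) z * cis (2 * pi * (t \<bullet> z))))"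
    unfolding F_def v_def stft_fun_distr by (simp add: mult_ac)
   also have "\<dots> = \<Phi> (t - \<zeta>) * (c * (\<Psi> t * cnj (\<Gamma> (t - \<zeta>))))"
    unfolding integral_mult_right_zero inv[OF schwartz_mult_cnj_shift[OF \<Psi> \<Gamma>]] ..
   finally show ?thesis by (simp add: mult_ac)
  qed
  have m: "(\<lambda>\<zeta>. \<Phi> \<zeta> * cnj (\<Gamma> \<zeta>)) \<in> \<B>"
   by (intro schwartz_measurable schwartz_mult schwartz_cnj \<Phi> \<Gamma>)
  have "(LINT p|lborel. F (p, t)) = (LINT \<zeta>|lborel. c * \<Psi> t * (\<Phi> (t - \<zeta>) * cnj (\<Gamma> (t - \<zeta>))))"
   using schwartz_Fubini(1)[OF schwartz_section_fst[OF F, of t]] by (simp add: inner)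
  also have "\<dots> = c * \<Psi> t * (LINT \<zeta>|lborel. \<Phi> \<zeta> * cnj (\<Gamma> \<zeta>))"
   using integral_lborel_affine[OF m, of "-1" t] by (simp add: integral_mult_right_zero)
  finally show ?thesis by (simp add: mult_ac)
 qed
 then have "u (\<lambda>t. c * (LINT t|lborel. \<Phi> t * cnj (\<Gamma> t)) * \<Psi> t) = (LINT p|lborel. cnj (v p) * stft \<Phi> u (fst p) (snd p))"
  using tempered_integral(2)[OF u F] unfolding uF by simp
 then show "cnj (c * (LINT t|lborel. \<Phi> t * cnj (\<Gamma> t))) * u \<Psi> =
   (LINT p|lborel. cnj (stft \<Gamma> (fun_distr \<Psi>) (fst p) (snd p)) * stft \<Phi> u (fst p) (snd p))"
  unfolding tempered_cmult[OF u \<Psi>] v_def .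
qed

lemma seminorm_ge:
 assumes f: "f \<in> schwartz" and bs: "set bs \<subseteq> Basis" "length bs \<le> N"
 shows "japanese x ^ N * cmod (partials bs f x) \<le> schwartz_seminorm N f"
proof -
 let ?I = "{bs :: 'a list. set bs \<subseteq> Basis \<and> length bs \<le> N}"
 have "\<exists>B\<ge>0. \<forall>bs\<in>?I. \<forall>x. japanese x ^ N * cmod (partials bs f x) \<le> B"
 proof (rule finite_uniform_bound[OF finite_multi_indices], goal_cases)
  case (1 bs)
  then obtain C where C: "\<And>x. japanese x ^ N * cmod (partials bs f x) \<le> C"
   using schwartz_rapid[OF schwartz_partials[OF f, of bs]] unfolding rapid_def by blast
  show ?case by (intro exI[of _ C] allI impI, rule order_trans[OF C])
 qed
 then obtain B where B: "\<And>bs x. bs \<in> ?I ==> japanese x ^ N * cmod (partials bs f x) \<le> B" by blast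
 show ?thesis
  unfolding schwartz_seminorm_def
  by (rule cSUP_upper2[where x="(bs, x)"]) (use bs B in \<open>auto intro!: bdd_aboveI2[where M=B]\<close>)
qed

lemma temperedI:
 assumes "\<And>f g. f \<in> schwartz ==> g \<in> schwartz ==> u (\<lambda>x. f x + g x) = u f + u g"
  "\<And>c f. f \<in> schwartz ==> u (\<lambda>x. c * f x) = cnj c * u f"
  "\<And>f M. f \<in> schwartz ==> (\<And>x. japanese x ^ N * cmod (f x) \<le> M) ==> cmod (u f) \<le> C * M"
 shows "u \<in> tempered"
proof -
 have "cmod (u f) \<le> C * schwartz_seminorm N f" if "f \<in> schwartz" for f
  using assms(3)[OF that] seminorm_ge[OF that, of "[]" N] by simp
 then show ?thesis unfolding tempered_def using assms(1,2) by blast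
qed

lemma integrable_bounded_mult_schwartz:
 assumes "f \<in> \<B>" "\<And>x. cmod (f x) \<le> B" "g \<in> schwartz"
 shows "integrable lborel (\<lambda>x. f x * g x)"
proof (rule Bochner_Integration.integrable_bound[OF integrable_mult_right[OF integrable_norm[OF schwartz_integrable[OF assms(3)]], of B]])
 show "AE x in lborel. cmod (f x * g x) \<le> norm (B * cmod (g x))"
  using assms(2) order_trans[OF norm_ge_zero assms(2)] by (intro AE_I2) (simp add: norm_mult mult_right_mono)
 show "(\<lambda>x. f x * g x) \<in> borel_measurable lborel"
  using assms(1) schwartz_measurable[OF assms(3)] by simp
qed

lemma tempered_fun_distr:
 assumes f: "f \<in> \<B>" and B: "\<And>x. cmod (f x) \<le> B"
 shows "fun_distr f \<in> tempered"
proof (rule temperedI)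
 let ?N = "0 + Suc DIM('a)"
 have int: "integrable lborel (\<lambda>x. f x * cnj (g x))" if "g \<in> schwartz" for g
  by (rule integrable_bounded_mult_schwartz[OF f B schwartz_cnj[OF that]])
 show "fun_distr f (\<lambda>x. g x + h x) = fun_distr f g + fun_distr f h" if "g \<in> schwartz" "h \<in> schwartz" for g h
  unfolding fun_distr_def complex_cnj_add distrib_left
  by (rule Bochner_Integration.integral_add[OF int[OF that(1)] int[OF that(2)]])
 show "fun_distr f (\<lambda>x. c * g x) = cnj c * fun_distr f g" for c g
  unfolding fun_distr_def by (simp add: mult.left_commute)
 fix g :: "'a => complex" and M assume g: "g \<in> schwartz" and M: "\<And>x. japanese x ^ ?N * cmod (g x) \<le> M"
 have "cmod (fun_distr f g) \<le> (LINT x::'a|lborel. (B * M) * (1 / japanese x ^ ?N))"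
  unfolding fun_distr_def
 proof (rule Bochner_Integration.integral_norm_bound_integral[OF int[OF g] integrable_mult_right[OF integrable_japanese_power]])
  fix x
  have "cmod (f x * cnj (g x)) \<le> B * (M / japanese x ^ ?N)"
   unfolding norm_mult using B M[of x] order_trans[OF norm_ge_zero B[of x]]
   by (intro mult_mono) (auto simp: field_simps)
  then show "cmod (f x * cnj (g x)) \<le> B * M * (1 / japanese x ^ ?N)" by simp
 qed
 also have "\<dots> = (B * (LINT x::'a|lborel. 1 / japanese x ^ ?N)) * M"
  by (simp only: integral_mult_right_zero mult_ac)
 finally show "cmod (fun_distr f g) \<le> (B * (LINT x::'a|lborel. 1 / japanese x ^ ?N)) * M" .
qed

lemma tempered_fun_distr_schwartz: "f \<in> schwartz ==> fun_distr f \<in> tempered"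
 by (meson schwartz_bounded schwartz_measurable tempered_fun_distr)

section \<open>Weighted mixed norms\<close>

lemma epowr_top [simp]: "epowr top r = top"
 by (simp add: epowr_def)

lemma epowr_ennreal: "0 \<le> x ==> epowr (ennreal x) r = ennreal (x powr r)"
 by (simp add: epowr_def)

lemma epowr_0 [simp]: "epowr 0 r = 0"
 using epowr_ennreal[of 0 r] by simp

lemma epowr_1 [simp]: "epowr x 1 = x"
 by (cases x) (auto simp: epowr_ennreal)

lemma epowr_mono: "0 \<le> r ==> x \<le> y ==> epowr x r \<le> epowr y r"
 by (cases x; cases y) (auto simp: epowr_ennreal top_unique intro!: ennreal_leI powr_mono2)

lemma epowr_epowr: "epowr (epowr x r) s = epowr x (r * s)"
 by (cases x) (auto simp: epowr_ennreal powr_powr)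

lemma epowr_mult: "0 < r ==> epowr (x * y) r = epowr x r * epowr y r"
proof (cases x; cases y)
 fix a b assume "0 < r" "x = ennreal a" "0 \<le> a" "y = ennreal b" "0 \<le> b"
 then show ?thesis by (simp add: epowr_ennreal powr_mult flip: ennreal_mult)
next
 fix a assume *: "0 < r" "x = ennreal a" "0 \<le> a" "y = top"
 then show ?thesis by (cases "a = 0") (auto simp: epowr_ennreal ennreal_mult_top)
next
 fix b assume *: "0 < r" "y = ennreal b" "0 \<le> b" "x = top"
 then show ?thesis by (cases "b = 0") (auto simp: epowr_ennreal ennreal_top_mult)
qed auto

lemma epowr_add: "0 < r ==> 0 < s ==> epowr x (r + s) = epowr x r * epowr x s"
 by (cases x) (auto simp: epowr_ennreal powr_add ennreal_mult)

lemma epowr_less_top: "x < top ==> epowr x r < top"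
 by (cases x) (auto simp: epowr_ennreal)

lemma epowr_eq_top_iff [simp]: "epowr x r = top \<longleftrightarrow> x = top"
 by (cases x) (auto simp: epowr_ennreal)

lemma epowr_eq_0_iff: "epowr x r = 0 \<longleftrightarrow> x = 0"
 by (cases x) (auto simp: epowr_ennreal)

lemma measurable_epowr [measurable]:
 assumes [measurable]: "f \<in> borel_measurable M" shows "(\<lambda>x. epowr (f x) r) \<in> borel_measurable M"
 unfolding epowr_def by measurable

lemma recip_top [simp]: "recip top = 0"
 by (simp add: recip_def)

lemma recip_1 [simp]: "recip 1 = 1"
 by (simp add: recip_def)

lemma recip_ennreal: "0 < r ==> recip (ennreal r) = 1 / r"
 unfolding recip_def using divide_ennreal[of 1 r] by simp

lemma exponent_finite:
 assumes "1 \<le> p" "p \<noteq> \<infinity>"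
 obtains r where "p = ennreal r" "1 \<le> r" "enn2real p = r" "recip p = 1 / r"
proof -
 obtain r where r: "p = ennreal r" "0 \<le> r" using assms(2) by (cases p) auto
 then have "1 \<le> r" using assms(1) by (simp flip: ennreal_1 add: ennreal_le_iff)
 then show ?thesis using that[of r] r recip_ennreal[of r] by simp
qed

lemma recip_cases:
 assumes "1 \<le> p" shows "0 \<le> recip p" "recip p \<le> 1" "recip p = 0 \<longleftrightarrow> p = \<infinity>" "recip p = 1 \<longleftrightarrow> p = 1"
proof -
 consider "p = \<infinity>" | r where "p = ennreal r" "1 \<le> r" "recip p = 1 / r"
  using exponent_finite[OF assms] by metis
 then have "0 \<le> recip p \<and> recip p \<le> 1 \<and> (recip p = 0 \<longleftrightarrow> p = \<infinity>) \<and> (recip p = 1 \<longleftrightarrow> p = 1)"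
 proof cases
  case 2
  have "0 \<le> 1 / r" "1 / r \<le> 1" "1 / r \<noteq> 0" "1 / r = 1 \<longleftrightarrow> r = 1" using 2(2) by auto
  then show ?thesis using 2 by (auto simp: ennreal_eq_1)
 qed simp
 then show "0 \<le> recip p" "recip p \<le> 1" "recip p = 0 \<longleftrightarrow> p = \<infinity>" "recip p = 1 \<longleftrightarrow> p = 1" by auto
qed

lemma conjugate_exponent:
 assumes "1 \<le> p" obtains p' where "1 \<le> p'" "recip p' = 1 - recip p"
proof -
 consider "recip p = 1" | "recip p < 1" using recip_cases[OF assms] by linarith
 then show ?thesis
 proof cases
  case 1
  then show ?thesis using that[of \<infinity>] by simp
 next
  case 2
  then have "recip (ennreal (1 / (1 - recip p))) = 1 - recip p" by (subst recip_ennreal) auto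
  moreover have "1 \<le> 1 / (1 - recip p)" using 2 recip_cases[OF assms] by simp
  ultimately show ?thesis
   using that[of "ennreal (1 / (1 - recip p))"] ennreal_leI[of 1 "1 / (1 - recip p)"] by simp
 qed
qed

lemma Lp_norm_top: "Lp_norm \<infinity> g = esssup lborel g"
 by (simp add: Lp_norm_def)

lemma Lp_norm_finite: "p \<noteq> \<infinity> ==> Lp_norm p g = epowr (\<integral>x. epowr (g x) (enn2real p)) (recip p)"
 by (simp add: Lp_norm_def)

lemma Lp_norm_mono_AE:
 assumes p: "1 \<le> p" and g: "g \<in> \<B>" and le: "AE x in lborel. g x \<le> h x"
 shows "Lp_norm p g \<le> Lp_norm p h"
proof (cases "p = \<infinity>")
 case True
 then show ?thesis using g le by (simp only: Lp_norm_top) (intro esssup_AE_mono, auto)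
next
 case False
 obtain r where "1 \<le> r" "enn2real p = r" using exponent_finite[OF p False] by metis
 then show ?thesis
  using le recip_cases[OF p] unfolding Lp_norm_finite[OF False]
  by (intro epowr_mono nn_integral_mono_AE) (auto elim!: eventually_mono intro: epowr_mono)
qed

lemma Lp_norm_mono:
 assumes "1 \<le> p" "g \<in> \<B>" "\<And>x. g x \<le> h x"
 shows "Lp_norm p g \<le> Lp_norm p h"
 using assms by (intro Lp_norm_mono_AE) auto

lemma Lp_norm_cmult_le:
 assumes p: "1 \<le> p" and [measurable]: "g \<in> \<B>"
 shows "Lp_norm p (\<lambda>x. c * g x) \<le> c * Lp_norm p g"
proof (cases "p = \<infinity>")
 case True
 have "AE x in lborel. c * g x \<le> c * esssup lborel g"
  using esssup_AE[of g lborel] by (auto elim!: eventually_mono intro: mult_left_mono)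
 then show ?thesis unfolding True Lp_norm_top by (intro esssup_I) auto
next
 case False
 obtain r where r: "1 \<le> r" "enn2real p = r" "recip p = 1 / r" using exponent_finite[OF p False] by metis
 then show ?thesis
  unfolding Lp_norm_finite[OF False]
  by (simp add: epowr_mult nn_integral_cmult epowr_epowr)
qed

lemma Lp_norm_cmult:
 assumes p: "1 \<le> p" and g: "g \<in> \<B>" and c: "0 < c"
 shows "Lp_norm p (\<lambda>x. ennreal c * g x) = ennreal c * Lp_norm p g"
proof (rule antisym[OF Lp_norm_cmult_le[OF p g]])
 have gc: "(\<lambda>x. ennreal c * g x) \<in> \<B>" using g by measurable
 have id: "ennreal (1 / c) * (ennreal c * y) = y" for y
  using c by (simp add: mult.assoc[symmetric] flip: ennreal_mult)
 have id': "ennreal c * (ennreal (1 / c) * y) = y" for y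
  using c by (simp add: mult.assoc[symmetric] flip: ennreal_mult)
 have "ennreal c * Lp_norm p g = ennreal c * Lp_norm p (\<lambda>x. ennreal (1 / c) * (ennreal c * g x))"
  by (simp add: id)
 also have "\<dots> \<le> ennreal c * (ennreal (1 / c) * Lp_norm p (\<lambda>x. ennreal c * g x))"
  by (intro mult_left_mono Lp_norm_cmult_le p gc) auto
 also have "\<dots> = Lp_norm p (\<lambda>x. ennreal c * g x)" by (rule id')
 finally show "ennreal c * Lp_norm p g \<le> Lp_norm p (\<lambda>x. ennreal c * g x)" .
qed

lemma measurable_swap_borel:
 "(\<lambda>p :: 'b::euclidean_space \<times> 'a::euclidean_space. (snd p, fst p)) \<in> \<B>"
 by (intro borel_measurable_continuous_onI continuous_intros)

text \<open>The essential supremum is at most c exactly when the set where c is exceeded has measure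
  0, and the measure of that set depends measurably on y by Tonelli's theorem.\<close>

lemma measurable_esssup:
 fixes F :: "'a::euclidean_space => 'b::euclidean_space => ennreal"
 assumes [measurable]: "(\<lambda>p. F (fst p) (snd p)) \<in> \<B>"
 shows "(\<lambda>y. esssup lborel (\<lambda>x. F x y)) \<in> \<B>"
proof (rule borel_measurableI_le)
 fix c
 have sec: "(\<lambda>x. F x y) \<in> \<B>" for y
  using measurable_compose[OF _ assms, of "\<lambda>x. (x, y)" borel] by simp
 have [measurable]: "(\<lambda>p. F (snd p) (fst p)) \<in> borel_measurable (lborel \<Otimes>\<^sub>M lborel)"
  using measurable_compose[OF measurable_swap_borel assms] by (simp add: lborel_prod)
 have "(\<lambda>y. \<integral>x. indicator {c<..} (F x y)) \<in> borel_measurable lborel"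
  by measurable
 then have m: "{y. (\<integral>x. indicator {c<..} (F x y)) = (0::ennreal)} \<in> sets borel"
  by (simp add: measurable_lborel1)
 have "(esssup lborel (\<lambda>x. F x y) \<le> c) = ((\<integral>x. indicator {c<..} (F x y)) = (0::ennreal))" for y
 proof -
  have [measurable]: "(\<lambda>x. F x y) \<in> \<B>" by (rule sec)
  have "((\<integral>x. indicator {c<..} (F x y)) = (0::ennreal)) = (AE x in lborel. F x y \<le> c)"
   by (subst nn_integral_0_iff_AE) (auto simp: indicator_def not_less)
  also have "\<dots> = (esssup lborel (\<lambda>x. F x y) \<le> c)"
  proof
   assume "esssup lborel (\<lambda>x. F x y) \<le> c"
   then show "AE x in lborel. F x y \<le> c"
    using esssup_AE[of "\<lambda>x. F x y" lborel] by (auto elim!: eventually_mono)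
  qed (auto intro!: esssup_I)
  finally show ?thesis ..
 qed
 then show "{y \<in> space borel. esssup lborel (\<lambda>x. F x y) \<le> c} \<in> sets borel" using m by simp
qed

lemma measurable_Lp_norm:
 fixes F :: "'a::euclidean_space => 'b::euclidean_space => ennreal"
 assumes m[measurable]: "(\<lambda>p. F (fst p) (snd p)) \<in> \<B>"
 shows "(\<lambda>y. Lp_norm p (\<lambda>x. F x y)) \<in> \<B>"
proof (cases "p = \<infinity>")
 case True
 then show ?thesis unfolding True Lp_norm_top by (intro measurable_esssup m)
next
 case False
 have [measurable]: "(\<lambda>p. F (snd p) (fst p)) \<in> borel_measurable (lborel \<Otimes>\<^sub>M lborel)"
  using measurable_compose[OF measurable_swap_borel m] by (simp add: lborel_prod)
 have "(\<lambda>y. \<integral>x. epowr (F x y) (enn2real p)) \<in> borel_measurable lborel" by measurable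
 then show ?thesis unfolding Lp_norm_finite[OF False] by measurable
qed

text \<open>Both factors are replaced by the maximum. The loss against the weighted arithmetic mean
  is harmless where constants do not matter.\<close>

lemma young_epowr:
 assumes "0 < \<theta>" "\<theta> < 1"
 shows "epowr x \<theta> * epowr y (1 - \<theta>) \<le> x + y"
proof -
 have "epowr x \<theta> * epowr y (1 - \<theta>) \<le> epowr (max x y) \<theta> * epowr (max x y) (1 - \<theta>)"
  using assms by (intro mult_mono epowr_mono) auto
 also have "\<dots> = max x y" using epowr_add[of \<theta> "1 - \<theta>" "max x y"] assms by simp
 also have "\<dots> \<le> x + y" by (simp add: max_def add_increasing add_increasing2)
 finally show ?thesis .
qed

text \<open>Hoelder's inequality with the powers \<theta> and 1 - \<theta> of two integrands. After
  the degenerate values 0 and infinity are removed, both integrals are normalised to 1 and the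
  weighted arithmetic-geometric mean inequality is integrated.\<close>

lemma nn_integral_Holder_exponent:
 assumes \<theta>: "0 < \<theta>" "\<theta> < 1" and [measurable]: "f \<in> borel_measurable M" "g \<in> borel_measurable M"
 shows "(\<integral>\<^sup>+x. epowr (f x) \<theta> * epowr (g x) (1 - \<theta>) \<partial>M)
  \<le> epowr (\<integral>\<^sup>+x. f x \<partial>M) \<theta> * epowr (\<integral>\<^sup>+x. g x \<partial>M) (1 - \<theta>)"
proof -
 consider "(\<integral>\<^sup>+x. f x \<partial>M) = 0 \<or> (\<integral>\<^sup>+x. g x \<partial>M) = 0"
  | "(\<integral>\<^sup>+x. f x \<partial>M) \<noteq> 0" "(\<integral>\<^sup>+x. g x \<partial>M) \<noteq> 0" "(\<integral>\<^sup>+x. f x \<partial>M) = top \<or> (\<integral>\<^sup>+x. g x \<partial>M) = top"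
  | "(\<integral>\<^sup>+x. f x \<partial>M) \<noteq> 0" "(\<integral>\<^sup>+x. g x \<partial>M) \<noteq> 0" "(\<integral>\<^sup>+x. f x \<partial>M) \<noteq> top" "(\<integral>\<^sup>+x. g x \<partial>M) \<noteq> top"
  by blast
 then show ?thesis
 proof cases
  case 1
  then have "AE x in M. f x = 0 \<or> g x = 0"
   by (auto simp: nn_integral_0_iff_AE elim!: eventually_mono)
  then have "(\<integral>\<^sup>+x. epowr (f x) \<theta> * epowr (g x) (1 - \<theta>) \<partial>M) = 0"
   by (subst nn_integral_0_iff_AE) (auto elim!: eventually_mono)
  then show ?thesis by simp
 next
  case 2
  then have "epowr (\<integral>\<^sup>+x. f x \<partial>M) \<theta> * epowr (\<integral>\<^sup>+x. g x \<partial>M) (1 - \<theta>) = top"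
   by (auto simp: ennreal_mult_eq_top_iff epowr_eq_0_iff)
  then show ?thesis by simp
 next
  case 3
  obtain A where A: "(\<integral>\<^sup>+x. f x \<partial>M) = ennreal A" "0 < A"
   using 3 by (cases "\<integral>\<^sup>+x. f x \<partial>M") (auto simp: less_le)
  obtain B where B: "(\<integral>\<^sup>+x. g x \<partial>M) = ennreal B" "0 < B"
   using 3 by (cases "\<integral>\<^sup>+x. g x \<partial>M") (auto simp: less_le)
  define K where "K = ennreal (A powr \<theta> * B powr (1 - \<theta>))"
  have young: "epowr x \<theta> * epowr y (1 - \<theta>) \<le> ennreal \<theta> * x + ennreal (1 - \<theta>) * y" for x y
  proof (cases x; cases y)
   fix a b assume ab: "x = ennreal a" "0 \<le> a" "y = ennreal b" "0 \<le> b"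
   have "a powr \<theta> * b powr (1 - \<theta>) \<le> \<theta> * a + (1 - \<theta>) * b"
    using Youngs_inequality_0[of \<theta> "1 - \<theta>" a b] ab \<theta> by (cases "a = 0"; cases "b = 0") auto
   then show ?thesis using ab \<theta> by (simp add: epowr_ennreal ennreal_leI flip: ennreal_mult ennreal_plus)
  qed (use \<theta> in \<open>auto simp: ennreal_mult_top ennreal_top_mult\<close>)
  have pt: "epowr (f x) \<theta> * epowr (g x) (1 - \<theta>)
    \<le> K * (ennreal (\<theta> / A) * f x + ennreal ((1 - \<theta>) / B) * g x)" for x
  proof -
   have 1: "f x = ennreal A * (ennreal (1 / A) * f x)" "g x = ennreal B * (ennreal (1 / B) * g x)"
    using A B by (simp_all add: mult.assoc[symmetric] flip: ennreal_mult)
   have "epowr (f x) \<theta> * epowr (g x) (1 - \<theta>)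
     = K * (epowr (ennreal (1 / A) * f x) \<theta> * epowr (ennreal (1 / B) * g x) (1 - \<theta>))"
    using \<theta> A B by (subst (1) 1, subst (1) 1(2))
     (simp add: K_def epowr_mult[of \<theta> "ennreal A"] epowr_mult[of "1 - \<theta>" "ennreal B"] epowr_ennreal ennreal_mult mult_ac)
   also have "\<dots> \<le> K * (ennreal \<theta> * (ennreal (1 / A) * f x) + ennreal (1 - \<theta>) * (ennreal (1 / B) * g x))"
    by (intro mult_left_mono young) auto
   also have "\<dots> = K * (ennreal (\<theta> / A) * f x + ennreal ((1 - \<theta>) / B) * g x)"
    using \<theta> A B by (simp add: mult.assoc[symmetric] flip: ennreal_mult)
   finally show ?thesis .
  qed
  have "(\<integral>\<^sup>+x. epowr (f x) \<theta> * epowr (g x) (1 - \<theta>) \<partial>M)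
    \<le> (\<integral>\<^sup>+x. K * (ennreal (\<theta> / A) * f x + ennreal ((1 - \<theta>) / B) * g x) \<partial>M)"
   by (intro nn_integral_mono pt)
  also have "\<dots> = K * (ennreal (\<theta> / A) * ennreal A + ennreal ((1 - \<theta>) / B) * ennreal B)"
   by (simp add: nn_integral_cmult nn_integral_add A B)
  also have "\<dots> = K" using \<theta> A B by (simp flip: ennreal_mult ennreal_plus)
  also have "\<dots> = epowr (\<integral>\<^sup>+x. f x \<partial>M) \<theta> * epowr (\<integral>\<^sup>+x. g x \<partial>M) (1 - \<theta>)"
   using A B by (simp add: K_def epowr_ennreal ennreal_mult)
  finally show ?thesis .
 qed
qed

lemma Lp_norm_1: "Lp_norm 1 g = (\<integral>x. g x)"
 by (simp add: Lp_norm_finite)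

lemma Lp_Holder:
 assumes p: "1 \<le> p" "1 \<le> p'" "recip p' = 1 - recip p"
  and [measurable]: "f \<in> \<B>" "g \<in> \<B>"
 shows "(\<integral>x. f x * g x) \<le> Lp_norm p f * Lp_norm p' g"
proof -
 have top1: "(\<integral>x. f x * g x) \<le> Lp_norm 1 f * Lp_norm \<infinity> g"
  if [measurable]: "f \<in> \<B>" "g \<in> \<B>" for f g :: "'a => ennreal"
 proof -
  have "(\<integral>x. f x * g x) \<le> (\<integral>x. f x * esssup lborel g)"
   using esssup_AE[of g lborel] by (intro nn_integral_mono_AE) (auto elim!: eventually_mono intro: mult_left_mono)
  then show ?thesis by (simp add: nn_integral_multc Lp_norm_1 Lp_norm_top[unfolded infinity_ennreal_def])
 qed
 consider "p = 1" "p' = \<infinity>" | "p = \<infinity>" "p' = 1" | "p \<noteq> 1" "p \<noteq> \<infinity>"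
  using recip_cases[OF p(1)] recip_cases[OF p(2)] p(3) by (metis diff_0_right diff_self)
 then show ?thesis
 proof cases
  case 1
  then show ?thesis using top1[of f g] by simp
 next
  case 2
  then show ?thesis using top1[of g f] by (simp add: mult.commute)
 next
  case 3
  obtain r where r: "1 \<le> r" "enn2real p = r" "recip p = 1 / r" using exponent_finite[OF p(1) 3(2)] by metis
  have "r \<noteq> 1" using 3(1) recip_cases(4)[OF p(1)] r by simp
  then have r1: "r > 1" using r by simp
  have "p' \<noteq> \<infinity>" using p(3) recip_cases[OF p(2)] r r1 by auto
  then obtain r' where r': "1 \<le> r'" "enn2real p' = r'" "recip p' = 1 / r'" using exponent_finite[OF p(2)] by metis
  have \<theta>: "0 < 1 / r" "1 / r < 1" "1 - 1 / r = 1 / r'" using r1 p(3) r r' by auto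
  have id: "f x = epowr (epowr (f x) r) (1 / r)" "g x = epowr (epowr (g x) r') (1 / r')" for x
   using r1 r' by (simp_all add: epowr_epowr)
  have "(\<integral>x. f x * g x) = (\<integral>x. epowr (epowr (f x) r) (1 / r) * epowr (epowr (g x) r') (1 - 1 / r))"
   unfolding \<theta>(3) id[symmetric] ..
  also have "\<dots> \<le> epowr (\<integral>x. epowr (f x) r) (1 / r) * epowr (\<integral>x. epowr (g x) r') (1 - 1 / r)"
   by (rule nn_integral_Holder_exponent[OF \<theta>(1,2)]) auto
  finally show ?thesis
   using 3 \<open>p' \<noteq> \<infinity>\<close> r r' \<theta> by (simp add: Lp_norm_finite)
 qed
qed

definition mixed_norm :: "ennreal => ennreal => ('a::euclidean_space \<times> 'b::euclidean_space => ennreal) => ennreal"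
 where "mixed_norm p q F = Lp_norm q (\<lambda>\<xi>. Lp_norm p (\<lambda>x. F (x, \<xi>)))"

lemma measurable_section_fst:
 fixes F :: "'a::euclidean_space \<times> 'b::euclidean_space => ennreal"
 assumes "F \<in> \<B>" shows "(\<lambda>x. F (x, y)) \<in> \<B>"
 using measurable_compose[OF _ assms, of "\<lambda>x. (x, y)" borel] by simp

lemma mixed_norm_mono:
 fixes F G :: "'a::euclidean_space \<times> 'b::euclidean_space => ennreal"
 assumes "1 \<le> p" "1 \<le> q" "F \<in> \<B>" "\<And>z. F z \<le> G z"
 shows "mixed_norm p q F \<le> mixed_norm p q G"
 unfolding mixed_norm_def using assms
 by (intro Lp_norm_mono measurable_Lp_norm measurable_section_fst) auto

lemma mixed_norm_cmult_le:
 fixes F :: "'a::euclidean_space \<times> 'b::euclidean_space => ennreal"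
 assumes pq: "1 \<le> p" "1 \<le> q" and F: "F \<in> \<B>"
 shows "mixed_norm p q (\<lambda>z. c * F z) \<le> c * mixed_norm p q F"
proof -
 have F': "(\<lambda>z. c * F z) \<in> \<B>" using F by measurable
 have N: "(\<lambda>\<xi>. Lp_norm p (\<lambda>x. G (x, \<xi>))) \<in> \<B>"
  if "G \<in> \<B>" for G :: "'a \<times> 'b => ennreal"
  using that by (intro measurable_Lp_norm) auto
 have "mixed_norm p q (\<lambda>z. c * F z) \<le> Lp_norm q (\<lambda>\<xi>. c * Lp_norm p (\<lambda>x. F (x, \<xi>)))"
  unfolding mixed_norm_def
  by (intro Lp_norm_mono pq N[OF F'] Lp_norm_cmult_le measurable_section_fst F)
 also have "\<dots> \<le> c * mixed_norm p q F"
  unfolding mixed_norm_def by (rule Lp_norm_cmult_le[OF pq(2) N[OF F]])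
 finally show ?thesis .
qed

lemma nn_integral_pair:
 fixes F :: "'a::euclidean_space \<times> 'b::euclidean_space => ennreal"
 assumes "F \<in> \<B>"
 shows "(\<integral>z. F z) = (\<integral>x. \<integral>y. F (x, y))"
  and "(\<integral>z. F z) = (\<integral>y. \<integral>x. F (x, y))"
proof -
 have m: "F \<in> borel_measurable (lborel \<Otimes>\<^sub>M lborel)" using assms by (simp add: lborel_prod)
 show "(\<integral>z. F z) = (\<integral>x. \<integral>y. F (x, y))"
  using lborel.nn_integral_fst[OF m] by (simp add: lborel_prod)
 then show "(\<integral>z. F z) = (\<integral>y. \<integral>x. F (x, y))"
  using lborel_pair.Fubini[OF m] by simp
qed

lemma mixed_Holder:
 fixes F G :: "'a::euclidean_space \<times> 'b::euclidean_space => ennreal"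
 assumes p: "1 \<le> p" "1 \<le> p'" "recip p' = 1 - recip p" and q: "1 \<le> q" "1 \<le> q'" "recip q' = 1 - recip q"
  and F: "F \<in> \<B>" and G: "G \<in> \<B>"
 shows "(\<integral>z. F z * G z) \<le> mixed_norm p q F * mixed_norm p' q' G"
proof -
 have FG: "(\<lambda>z. F z * G z) \<in> \<B>" using F G by measurable
 have "(\<integral>z. F z * G z) = (\<integral>y. \<integral>x. F (x, y) * G (x, y))"
  by (rule nn_integral_pair(2)[OF FG])
 also have "\<dots> \<le> (\<integral>y. Lp_norm p (\<lambda>x. F (x, y)) * Lp_norm p' (\<lambda>x. G (x, y)))"
  by (intro nn_integral_mono Lp_Holder p measurable_section_fst F G)
 also have "\<dots> \<le> mixed_norm p q F * mixed_norm p' q' G"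
  unfolding mixed_norm_def using F G by (intro Lp_Holder q measurable_Lp_norm) auto
 finally show ?thesis .
qed

text \<open>The source of every threshold in the theorem. For finite p the p-th power is integrable
  exactly if its exponent lies strictly below minus the dimension; for p = \<infinity> boundedness
  means \<open>s \<le> 0\<close>, which the right-hand side splits into s < 0 and s = 0.\<close>

lemma Lp_norm_japanese:
 assumes p: "1 \<le> p"
 shows "Lp_norm p (\<lambda>x::'a::euclidean_space. ennreal (japanese x powr s)) < \<infinity> \<longleftrightarrow>
  recip p + s / DIM('a) < 0 \<or> (p = \<infinity> \<and> s = 0)"
proof (cases "p = \<infinity>")
 case True
 have [measurable]: "(\<lambda>x::'a. ennreal (japanese x powr s)) \<in> \<B>" by measurable
 have "esssup lborel (\<lambda>x::'a. ennreal (japanese x powr s)) < \<infinity> \<longleftrightarrow> s \<le> 0"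
 proof
  assume s: "s \<le> 0"
  have "esssup lborel (\<lambda>x::'a. ennreal (japanese x powr s)) \<le> 1"
   using s powr_mono[OF s japanese_ge_1] by (intro esssup_I) (auto intro!: AE_I2)
  then show "esssup lborel (\<lambda>x::'a. ennreal (japanese x powr s)) < \<infinity>"
   using le_less_trans by fastforce
 next
  assume fin: "esssup lborel (\<lambda>x::'a. ennreal (japanese x powr s)) < \<infinity>"
  show "s \<le> 0"
  proof (rule ccontr)
   assume "\<not> s \<le> 0"
   then have s: "s > 0" by simp
   obtain M where M: "esssup lborel (\<lambda>x::'a. ennreal (japanese x powr s)) = ennreal M" "M \<ge> 0"
    using fin by (cases "esssup lborel (\<lambda>x::'a. ennreal (japanese x powr s))") auto
   have "AE x in lborel. japanese (x::'a) powr s \<le> M"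
    using esssup_AE[of "\<lambda>x::'a. ennreal (japanese x powr s)" lborel] M
    by (auto elim!: eventually_mono)
   then have ae: "AE x in lborel. x \<notin> {x::'a. norm x > M powr (1 / s)}"
   proof (rule eventually_mono)
    fix x :: 'a assume "japanese x powr s \<le> M"
    then have "(japanese x powr s) powr (1 / s) \<le> M powr (1 / s)"
     using s by (intro powr_mono2) auto
    then have "japanese x \<le> M powr (1 / s)" using s by (simp add: powr_powr)
    then show "x \<notin> {x. norm x > M powr (1 / s)}" using norm_le_japanese[of x] by simp
   qed
   have op: "open {x::'a. norm x > M powr (1 / s)}" by (intro open_Collect_less continuous_intros)
   obtain b :: 'a where b: "b \<in> Basis" using nonempty_Basis by blast
   have ne: "(M powr (1 / s) + 1) *\<^sub>R b \<in> {x::'a. norm x > M powr (1 / s)}" using b by simp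
   have "{x::'a. norm x > M powr (1 / s)} \<in> null_sets lborel"
    using AE_iff_null_sets[of "{x::'a. norm x > M powr (1 / s)}" lborel] ae op by auto
   then have "negligible {x::'a. norm x > M powr (1 / s)}"
    using negligible_iff_null_sets null_sets_completionI by blast
   then show False using open_not_negligible[OF op] ne by blast
  qed
 qed
 then show ?thesis unfolding True Lp_norm_top by (auto simp: divide_less_0_iff)
next
 case False
 obtain r where r: "1 \<le> r" "enn2real p = r" "recip p = 1 / r" using exponent_finite[OF p False] by metis
 have "Lp_norm p (\<lambda>x::'a. ennreal (japanese x powr s)) < \<infinity> \<longleftrightarrow> (\<integral>(x::'a). ennreal (japanese x powr - (- s * r))) < \<infinity>"
  unfolding Lp_norm_finite[OF False] r
  by (auto simp: epowr_ennreal powr_powr epowr_less_top less_top[symmetric])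
 also have "\<dots> \<longleftrightarrow> - s * r > DIM('a)"
  using nn_integral_japanese_finite[where 'a='a, of "- s * r"] nn_integral_japanese_infinite[where 'a='a, of "- s * r"] by force
 also have "\<dots> \<longleftrightarrow> recip p + s / DIM('a) < 0"
 proof -
  have D: "0 < real DIM('a)" by simp
  have "1 / r + s / DIM('a) = (DIM('a) + s * r) / (r * DIM('a))"
   using r(1) D by (simp add: add_divide_distrib)
  moreover have "0 < r * DIM('a)" using r(1) D by simp
  ultimately show ?thesis unfolding r(3) by (auto simp: divide_less_0_iff)
 qed
 finally show ?thesis using False by simp
qed

lemma borel_fst [measurable]: "fst \<in> \<B>" and borel_snd [measurable]: "snd \<in> \<B>"
 and borel_swap [measurable]: "prod.swap \<in> \<B>"
 unfolding prod.swap_def[abs_def] by (intro borel_measurable_continuous_onI continuous_intros)+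

lemma nn_integral_swap:
 fixes F :: "'a::euclidean_space \<times> 'b::euclidean_space => ennreal"
 assumes [measurable]: "F \<in> \<B>"
 shows "(\<integral>z. F (prod.swap z)) = (\<integral>z. F z)"
 using nn_integral_pair(1)[of "\<lambda>z. F (prod.swap z)"] nn_integral_pair(2)[of F] by simp

section \<open>Convolution with decaying kernels\<close>

definition jp :: "real => 'a::euclidean_space => ennreal"
 where "jp s x = ennreal (japanese x powr s)"

lemma measurable_jp [measurable]: "jp s \<in> \<B>"
 unfolding jp_def by measurable

lemma jp_0 [simp]: "jp 0 x = 1"
 by (simp add: jp_def)

lemma jp_add: "jp (a + b) x = jp a x * jp b x"
 by (simp add: jp_def powr_add ennreal_mult)

lemma jp_epowr: "epowr (jp a x) r = jp (a * r) x"
 by (simp add: jp_def epowr_ennreal powr_powr)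

lemma jp_mono: "a \<le> b ==> jp a x \<le> jp b x"
 unfolding jp_def by (intro ennreal_leI powr_mono japanese_ge_1)

lemma jp_le_1: "a \<le> 0 ==> jp a x \<le> 1"
 using jp_mono[of a 0 x] by simp

lemma jp_antimono: "a \<le> 0 ==> japanese x \<le> japanese y ==> jp a y \<le> jp a x"
 unfolding jp_def by (intro ennreal_leI powr_mono2') auto

lemma jp_minus [simp]: "jp a (- x) = jp a x"
 by (simp add: jp_def)

lemma jp_commute: "jp a (x - y) = jp a (y - x)"
 using jp_minus[of a "x - y"] by simp

lemma jp_less_top [simp]: "jp a x < top" and jp_neq_top [simp]: "jp a x \<noteq> top" and jp_pos [simp]: "0 < jp a x"
 by (simp_all add: jp_def)

text \<open>Peetre's inequality. For a nonnegative exponent it is submultiplicativity of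
  \<open>japanese\<close>; for a negative one the roles of x and y are exchanged.\<close>

lemma jp_peetre: "jp a x \<le> ennreal (2 powr \<bar>a\<bar>) * (jp a y * jp \<bar>a\<bar> (x - y))"
proof -
 have *: "japanese x powr b \<le> 2 powr b * (japanese y powr b * japanese (x - y) powr b)" if "b \<ge> 0" for b and x y :: 'a
 proof -
  have "japanese x powr b \<le> (2 * japanese y * japanese (x - y)) powr b"
   using japanese_add[of y "x - y"] that by (intro powr_mono2) auto
  then show ?thesis by (simp add: powr_mult mult.assoc)
 qed
 have "japanese x powr a \<le> 2 powr \<bar>a\<bar> * (japanese y powr a * japanese (x - y) powr \<bar>a\<bar>)"
 proof (cases "a \<ge> 0")
  case True
  then show ?thesis using *[of a x y] by simp
 next
  case False
  have "japanese y powr (- a) \<le> 2 powr (- a) * (japanese x powr (- a) * japanese (x - y) powr (- a))"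
   using *[of "- a" y x] False japanese_minus[of "x - y"] by simp
  then have "japanese x powr a * (japanese y powr a * japanese y powr (- a))
    \<le> japanese x powr a * (japanese y powr a * (2 powr (- a) * (japanese x powr (- a) * japanese (x - y) powr (- a))))"
   by (intro mult_left_mono) auto
  also have "\<dots> = (japanese x powr a * japanese x powr (- a)) * (2 powr (- a) * (japanese y powr a * japanese (x - y) powr (- a)))"
   by (simp add: mult_ac)
  finally show ?thesis using False by (simp add: powr_add[symmetric])
 qed
 then show ?thesis
  unfolding jp_def by (simp add: ennreal_leI flip: ennreal_mult)
qed

definition jint :: "'a::euclidean_space itself => real => ennreal"
 where "jint _ s = (\<integral>(x::'a). jp s x)"

lemma jint_finite: "s < - real DIM('a::euclidean_space) ==> jint TYPE('a) s < top"
 using nn_integral_japanese_finite[where 'a='a, of "- s"] by (simp add: jint_def jp_def)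

lemma nn_integral_jp_shift: "(\<integral>x. jp s (y - x)) = jint TYPE('a) s"
 "(\<integral>x. jp s (x - y)) = jint TYPE('a) s" for y :: "'a::euclidean_space"
 using nn_integral_lborel_reflect[of "jp s" y] nn_integral_lborel_shift[of "jp s" "- y"]
 by (simp_all add: jint_def)

text \<open>A kernel pays \<open>\<bar>s\<bar>\<close> powers of its decay in order to move a weight
  from one argument to the other.\<close>

lemma jp_peetre_factor:
 "jp (- N) (x - y) * jp s x \<le> ennreal (2 powr \<bar>s\<bar>) * (jp s y * jp (- (N - \<bar>s\<bar>)) (x - y))"
proof -
 have "jp (- N) (x - y) * jp s x \<le> jp (- N) (x - y) * (ennreal (2 powr \<bar>s\<bar>) * (jp s y * jp \<bar>s\<bar> (x - y)))"
  by (intro mult_left_mono jp_peetre) simp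
 also have "jp (- N) (x - y) * jp \<bar>s\<bar> (x - y) = jp (- (N - \<bar>s\<bar>)) (x - y)"
  by (simp flip: jp_add)
 then have "jp (- N) (x - y) * (ennreal (2 powr \<bar>s\<bar>) * (jp s y * jp \<bar>s\<bar> (x - y)))
   = ennreal (2 powr \<bar>s\<bar>) * (jp s y * jp (- (N - \<bar>s\<bar>)) (x - y))"
  by (metis mult.commute mult.left_commute)
 finally show ?thesis .
qed

lemma epowr_le_self: "x \<le> 1 ==> 1 \<le> r ==> epowr x r \<le> x"
proof -
 assume x: "x \<le> 1" and r: "1 \<le> r"
 then obtain y where y: "x = ennreal y" "0 \<le> y" "y \<le> 1" by (cases x) (auto simp: top_unique)
 then have "y powr r \<le> y powr 1" using r by (intro powr_mono') auto
 then show ?thesis using y by (simp add: epowr_ennreal ennreal_leI)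
qed

text \<open>A replacement for interpolation between the exponents 1 and \<infinity>: values at most
  1 only decrease under powers with exponent at least 1, so one normalisation serves for all
  p.\<close>

lemma Lp_norm_le_1:
 assumes p: "1 \<le> p" and g[measurable]: "g \<in> \<B>" and "\<And>x. g x \<le> 1" "(\<integral>x. g x) \<le> 1"
 shows "Lp_norm p g \<le> 1"
proof (cases "p = \<infinity>")
 case True
 then show ?thesis using assms unfolding True Lp_norm_top by (intro esssup_I) auto
next
 case False
 obtain r where r: "1 \<le> r" "enn2real p = r" "recip p = 1 / r" using exponent_finite[OF p False] by metis
 have "(\<integral>x. epowr (g x) r) \<le> (\<integral>x. g x)"
  using assms r by (intro nn_integral_mono epowr_le_self) auto
 also have "\<dots> \<le> 1" by fact
 finally have "epowr (\<integral>x. epowr (g x) r) (1 / r) \<le> epowr 1 (1 / r)" using r by (intro epowr_mono) auto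
 then show ?thesis unfolding Lp_norm_finite[OF False] r using epowr_ennreal[of 1 "1 / r"] by simp
qed

definition wnorm :: "ennreal => ennreal => real => real => ('a::euclidean_space \<times> 'a => ennreal) => ennreal"
 where "wnorm p q s t F = mixed_norm p q (\<lambda>z. F z * (jp s (fst z) * jp t (snd z)))"

lemma wnorm_mono:
 assumes "1 \<le> p" "1 \<le> q" and [measurable]: "F \<in> \<B>" and "\<And>z. F z \<le> G z"
 shows "wnorm p q s t F \<le> wnorm p q s t G"
 unfolding wnorm_def by (rule mixed_norm_mono) (auto intro: assms mult_right_mono)

lemma wnorm_cmult_le:
 assumes "1 \<le> p" "1 \<le> q" and [measurable]: "F \<in> \<B>"
 shows "wnorm p q s t (\<lambda>z. c * F z) \<le> c * wnorm p q s t F"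
 unfolding wnorm_def mult.assoc by (rule mixed_norm_cmult_le) (use assms in auto)

text \<open>Smoothing with a polynomially decaying tensor kernel. The order \<open>N\<close> stays
  free because short-time Fourier transforms of Schwartz functions decay faster than any
  power.\<close>

definition conv :: "real => ('a::euclidean_space \<times> 'a => ennreal) => 'a \<times> 'a => ennreal"
 where "conv N S z = (\<integral>w. jp (- N) (fst z - fst w) * jp (- N) (snd z - snd w) * S w)"

lemma measurable_conv [measurable]:
 assumes [measurable]: "S \<in> \<B>" shows "conv N S \<in> \<B>"
 unfolding conv_def[abs_def] by measurable

lemma conv_cmult:
 assumes [measurable]: "S \<in> \<B>" shows "conv N (\<lambda>z. c * S z) z = c * conv N S z"
 unfolding conv_def by (subst nn_integral_cmult[symmetric]) (simp_all add: mult_ac)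

lemma conv_swap:
 assumes [measurable]: "S \<in> \<B>"
 shows "conv N (\<lambda>w. S (prod.swap w)) (prod.swap z) = conv N S z"
 unfolding conv_def
 by (subst nn_integral_swap[of "\<lambda>w. jp (- N) (fst z - fst w) * jp (- N) (snd z - snd w) * S w", symmetric])
  (simp_all add: mult_ac)

text \<open>The map \<open>g\<close> is the identity or the exchange of the two variables, which selects the direction
 of integration.\<close>

definition slice :: "('a::euclidean_space \<times> 'a => 'a \<times> 'a) => ('a \<times> 'a => ennreal) => ennreal => bool"
 where "slice g S A \<longleftrightarrow> (\<forall>y. (\<integral>\<eta>. S (g (y, \<eta>))) \<le> A)"

lemma slice_cmult:
 assumes g: "g \<in> {id, prod.swap}" and [measurable]: "S \<in> \<B>" and "slice g S A"
 shows "slice g (\<lambda>z. c * S z) (c * A)"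
 using assms(3) g by (auto simp: slice_def nn_integral_cmult intro!: mult_left_mono)

text \<open>Dropping the kernel factor in the slice variable, which is at most 1, leaves slice
  integrals of \<open>S\<close> smoothed in the other variable; this is the pointwise bound.
  Integrating along a slice costs one more kernel integral. The kernel is symmetric, so the
  exchanged direction follows from the direct one.\<close>

lemma conv_slice:
 fixes S :: "'a::euclidean_space \<times> 'a => ennreal"
 assumes [measurable]: "S \<in> \<B>" and g: "g \<in> {id, prod.swap}" and A: "slice g S A" and N: "0 \<le> N"
 shows "conv N S z \<le> jint TYPE('a) (- N) * A"
  and "slice g (conv N S) (jint TYPE('a) (- N) * (jint TYPE('a) (- N) * A))"
proof -
 let ?J = "jint TYPE('a) (- N)"
 have fst: "conv N S z \<le> ?J * A" "slice id (conv N S) (?J * (?J * A))"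
  if [measurable]: "S \<in> \<B>" and A: "slice id S A" for S :: "'a \<times> 'a => ennreal" and z
 proof -
  have base: "(\<integral>w. jp (- N) (x - fst w) * S w) \<le> ?J * A" for x
  proof -
   have "(\<integral>w. jp (- N) (x - fst w) * S w) = (\<integral>y. jp (- N) (x - y) * (\<integral>\<eta>. S (y, \<eta>)))"
    by (simp add: nn_integral_pair(1) nn_integral_cmult)
   also have "\<dots> \<le> (\<integral>y. jp (- N) (x - y) * A)"
    using A by (intro nn_integral_mono mult_left_mono) (auto simp: slice_def)
   finally show ?thesis by (simp add: nn_integral_multc nn_integral_jp_shift)
  qed
  have "conv N S z \<le> (\<integral>w. jp (- N) (fst z - fst w) * 1 * S w)"
   unfolding conv_def using N by (intro nn_integral_mono mult_right_mono mult_left_mono jp_le_1) auto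
  then show "conv N S z \<le> ?J * A" using base[of "fst z"] by simp
  have "(\<integral>\<xi>. conv N S (x, \<xi>)) = ?J * (\<integral>w. jp (- N) (x - fst w) * S w)" for x
  proof -
   have "(\<integral>\<xi>. conv N S (x, \<xi>)) = (\<integral>w. \<integral>\<xi>. (jp (- N) (x - fst w) * S w) * jp (- N) (\<xi> - snd w))"
    using nn_integral_pair[of "\<lambda>p. (jp (- N) (x - fst (snd p)) * S (snd p)) * jp (- N) (fst p - snd (snd p))"]
    by (simp add: conv_def mult_ac)
   then show ?thesis by (simp add: nn_integral_cmult nn_integral_multc nn_integral_jp_shift mult.commute)
  qed
  then show "slice id (conv N S) (?J * (?J * A))" using base by (simp add: slice_def mult_left_mono)
 qed
 have eq: "conv N S z = conv N (\<lambda>w. S (g w)) (g z)" for z using g conv_swap[of S N z] by auto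
 have A': "slice id (\<lambda>w. S (g w)) A" using A by (simp add: slice_def)
 have m: "(\<lambda>w. S (g w)) \<in> \<B>" using g by auto
 have gg: "g (g z) = z" for z using g by auto
 show "conv N S z \<le> ?J * A" unfolding eq by (rule fst(1)[OF m A'])
 show "slice g (conv N S) (?J * (?J * A))" using fst(2)[OF m A'] by (simp add: slice_def eq[of "g _"] gg)
qed

text \<open>Where \<open>\<langle>x\<rangle> \<ge> \<langle>\<xi>\<rangle>\<close> the weight is at most \<open>\<langle>\<xi>\<rangle>\<^sup>s\<^sup>+\<^sup>t\<close>; elsewhere it is at most
 \<open>\<langle>x\<rangle>\<^sup>s\<^sup>+\<^sup>t\<close>, which the kernel transfers to the variable \<open>y\<close>.\<close>

lemma conv_sup_bound:
 fixes S :: "'a::euclidean_space \<times> 'a => ennreal"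
 assumes [measurable]: "S \<in> \<B>" and A: "slice id S 1"
  and h1: "\<And>z. conv N S z \<le> 1" and b: "1 \<le> b" and s: "s \<le> 0" and t: "t \<le> 0"
  and \<sigma>: "\<sigma> = (s + t) * b" and N: "\<bar>\<sigma>\<bar> \<le> N"
 obtains M where "M \<in> \<B>"
  "\<And>x \<xi>. epowr (conv N S (x, \<xi>) * (jp s x * jp t \<xi>)) b \<le> M \<xi>"
  "(\<integral>\<xi>. M \<xi>) \<le> jint TYPE('a) \<sigma> + ennreal (2 powr \<bar>\<sigma>\<bar>) * (jint TYPE('a) (- N) * jint TYPE('a) \<sigma>)"
proof -
 \<comment> \<open>\<open>R \<xi>\<close> bounds the smoothing times the weight of exponent \<sigma>
   in x, uniformly in x: once the weight has moved to the integration variable, the kernel factor in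
   x is at most 1. Its integral over \<xi> is finite because the kernel in \<xi>, the slices of
   \<open>S\<close> and the weight can be integrated one after the other.\<close>
 define R where "R \<xi> = (\<integral>w. jp \<sigma> (fst w) * S w * jp (- N) (\<xi> - snd w))" for \<xi>
 define M where "M \<xi> = jp \<sigma> \<xi> + ennreal (2 powr \<bar>\<sigma>\<bar>) * R \<xi>" for \<xi>
 have [measurable]: "R \<in> \<B>" unfolding R_def by measurable
 have pt: "epowr (conv N S (x, \<xi>) * (jp s x * jp t \<xi>)) b \<le> M \<xi>" for x \<xi>
 proof -
  let ?h = "conv N S (x, \<xi>)"
  have w: "jp (s * b) x * jp (t * b) \<xi> \<le> jp \<sigma> \<xi> + jp \<sigma> x"
  proof (cases "japanese \<xi> \<le> japanese x")
   case True
   then have "jp (s * b) x * jp (t * b) \<xi> \<le> jp (s * b) \<xi> * jp (t * b) \<xi>"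
    using s b by (intro mult_right_mono jp_antimono) (auto simp: mult_nonpos_nonneg)
   then show ?thesis by (simp add: jp_add[symmetric] \<sigma> algebra_simps add_increasing2)
  next
   case False
   then have "jp (s * b) x * jp (t * b) \<xi> \<le> jp (s * b) x * jp (t * b) x"
    using t b by (intro mult_left_mono jp_antimono) (auto simp: mult_nonpos_nonneg)
   then show ?thesis by (simp add: jp_add[symmetric] \<sigma> algebra_simps add_increasing)
  qed
  have "?h * jp \<sigma> x = (\<integral>w. (jp (- N) (x - fst w) * jp \<sigma> x) * (S w * jp (- N) (\<xi> - snd w)))"
   unfolding conv_def by (subst nn_integral_multc[symmetric]) (simp_all add: mult_ac)
  also have "\<dots> \<le> (\<integral>w. (ennreal (2 powr \<bar>\<sigma>\<bar>) * (jp \<sigma> (fst w) * 1)) * (S w * jp (- N) (\<xi> - snd w)))"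
  proof (intro nn_integral_mono mult_right_mono)
   show "jp (- N) (x - fst w) * jp \<sigma> x \<le> ennreal (2 powr \<bar>\<sigma>\<bar>) * (jp \<sigma> (fst w) * 1)" for w
    by (rule order_trans[OF jp_peetre_factor]) (use N in \<open>intro mult_left_mono jp_le_1, auto\<close>)
  qed simp
  also have "\<dots> = ennreal (2 powr \<bar>\<sigma>\<bar>) * R \<xi>"
   unfolding R_def by (subst nn_integral_cmult[symmetric]) (simp_all add: mult_ac)
  finally have hR: "?h * jp \<sigma> x \<le> ennreal (2 powr \<bar>\<sigma>\<bar>) * R \<xi>" .
  have "epowr (?h * (jp s x * jp t \<xi>)) b = epowr ?h b * (jp (s * b) x * jp (t * b) \<xi>)"
   using b by (simp add: epowr_mult jp_epowr)
  also have "\<dots> \<le> ?h * (jp \<sigma> \<xi> + jp \<sigma> x)" by (intro mult_mono epowr_le_self h1 b w) auto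
  also have "\<dots> \<le> 1 * jp \<sigma> \<xi> + ennreal (2 powr \<bar>\<sigma>\<bar>) * R \<xi>"
   unfolding distrib_left by (intro add_mono mult_right_mono h1 hR) auto
  finally show ?thesis by (simp add: M_def)
 qed
 have "(\<integral>\<xi>. R \<xi>) = (\<integral>w. \<integral>\<xi>. jp \<sigma> (fst w) * S w * jp (- N) (\<xi> - snd w))"
  unfolding R_def using nn_integral_pair[of "\<lambda>p. jp \<sigma> (fst (snd p)) * S (snd p) * jp (- N) (fst p - snd (snd p))"] by simp
 also have "\<dots> = jint TYPE('a) (- N) * (\<integral>w. jp \<sigma> (fst w) * S w)"
  by (simp add: nn_integral_cmult nn_integral_multc nn_integral_jp_shift mult.commute)
 also have "(\<integral>w. jp \<sigma> (fst w) * S w) = (\<integral>y. jp \<sigma> y * (\<integral>\<eta>. S (y, \<eta>)))"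
  by (simp add: nn_integral_pair(1) nn_integral_cmult)
 also have "\<dots> \<le> (\<integral>(y::'a). jp \<sigma> y * 1)"
  using A by (intro nn_integral_mono mult_left_mono) (auto simp: slice_def)
 finally have Rint: "(\<integral>\<xi>. R \<xi>) \<le> jint TYPE('a) (- N) * jint TYPE('a) \<sigma>"
  by (simp add: mult_left_mono jint_def)
 have "(\<integral>\<xi>. M \<xi>) = jint TYPE('a) \<sigma> + ennreal (2 powr \<bar>\<sigma>\<bar>) * (\<integral>\<xi>. R \<xi>)"
  unfolding M_def by (simp add: nn_integral_add nn_integral_cmult jint_def)
 also have "\<dots> \<le> jint TYPE('a) \<sigma> + ennreal (2 powr \<bar>\<sigma>\<bar>) * (jint TYPE('a) (- N) * jint TYPE('a) \<sigma>)"
  by (intro add_mono mult_left_mono Rint) auto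
 finally show ?thesis using pt by (intro that[of M]) (simp_all add: M_def[abs_def])
qed

text \<open>The required decay \<open>L\<close> is left open, because an input and an output
  estimate demand different amounts and are later used with the same kernel.\<close>

definition conv_bounded :: "('a::euclidean_space \<times> 'a => 'a \<times> 'a) => ennreal => ennreal => real => real => bool"
 where "conv_bounded g p q s t \<longleftrightarrow> (\<exists>L. \<forall>N\<ge>L. \<exists>C<top. \<forall>S\<in>borel_measurable borel. \<forall>A.
  slice g S A \<longrightarrow> wnorm p q s t (conv N S) \<le> C * A)"

text \<open>By homogeneity it is enough to treat \<open>S\<close> for which \<open>conv N S\<close> and its slice integrals are
 bounded by 1; then powers with exponents at least 1 only decrease \<open>conv N S\<close>.\<close>

lemma conv_boundedI:
 fixes g :: "'a::euclidean_space \<times> 'a => 'a \<times> 'a"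
 assumes pq: "1 \<le> p" "1 \<le> q" and g: "g \<in> {id, prod.swap}"
  and core: "\<And>N. N \<ge> L ==> N > real DIM('a) ==> \<exists>C<top. \<forall>S\<in>borel_measurable borel.
   slice g S 1 \<longrightarrow> (\<forall>z. conv N S z \<le> 1) \<longrightarrow> slice g (conv N S) 1 \<longrightarrow> wnorm p q s t (conv N S) \<le> C"
 shows "conv_bounded g p q s t"
 unfolding conv_bounded_def
proof (rule exI[of _ "max L (real DIM('a) + 1)"], intro allI impI)
 fix N assume "max L (real DIM('a) + 1) \<le> N"
 then have N: "N \<ge> L" "N > real DIM('a)" "N \<ge> 0" by auto
 obtain I where I: "jint TYPE('a) (- N) = ennreal I" "0 \<le> I"
  using jint_finite[where 'a='a, of "- N"] N by (cases "jint TYPE('a) (- N)") auto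
 \<comment> \<open>With \<open>I\<close> the integral of the kernel, this choice makes \<delta>, I
   \<delta> and I^2 \<delta> at most 1. These are the bounds of \<open>conv_slice\<close> for the
   slices of the normalised function, for its smoothing and for the slices of that.\<close>
 define \<delta> where "\<delta> = 1 / (1 + I)\<^sup>2"
 have \<delta>0: "\<delta> > 0" using I by (simp add: \<delta>_def)
 have eI: "(1 + I)\<^sup>2 = 1 + 2 * I + I * I" by (simp add: power2_eq_square algebra_simps)
 have "0 \<le> I * I" using I by simp
 then have "1 \<le> (1 + I)\<^sup>2" "I \<le> (1 + I)\<^sup>2" "I * I \<le> (1 + I)\<^sup>2" unfolding eI using I(2) by linarith+
 then have \<delta>: "\<delta> \<le> 1" "I * \<delta> \<le> 1" "I * (I * \<delta>) \<le> 1" by (simp_all add: \<delta>_def divide_le_eq)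
 obtain C where C: "C < top" "\<And>S. S \<in> \<B> ==> slice g S 1 ==> (\<And>z. conv N S z \<le> 1) ==>
   slice g (conv N S) 1 ==> wnorm p q s t (conv N S) \<le> C"
  using core[OF N(1,2)] by blast
 show "\<exists>C<top. \<forall>S\<in>borel_measurable borel. \<forall>A. slice g S A \<longrightarrow> wnorm p q s t (conv N S) \<le> C * A"
 \<comment> \<open>The summand 1 keeps the product infinite for \<open>A = top\<close> when
   \<open>C\<close> is 0.\<close>
 proof (intro exI[of _ "ennreal (1 / \<delta>) * C + 1"] conjI ballI allI impI)
  show "ennreal (1 / \<delta>) * C + 1 < top" using C by (simp add: ennreal_mult_less_top)
  fix S A assume S[measurable]: "S \<in> \<B>" and A: "slice g S A"
  consider "A = top" | "A = 0" | a where "A = ennreal a" "a > 0" by (cases A) (auto simp: less_le)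
  then show "wnorm p q s t (conv N S) \<le> (ennreal (1 / \<delta>) * C + 1) * A"
  proof cases
   case 2
   then have "conv N S = (\<lambda>z. 0 * conv N S z)" using conv_slice(1)[OF S g A N(3)] by (auto intro!: ext)
   then show ?thesis using wnorm_cmult_le[OF pq measurable_conv[OF S], of s t 0 N] by simp
  next
   case 3
   define S' where "S' z = ennreal (\<delta> / a) * S z" for z
   have S'[measurable]: "S' \<in> \<B>" unfolding S'_def by measurable
   have "ennreal (\<delta> / a) * A = ennreal \<delta>" using 3 \<delta>0 by (simp flip: ennreal_mult)
   then have s: "slice g S' (ennreal \<delta>)" using slice_cmult[OF g S A, of "ennreal (\<delta> / a)"] by (simp add: S'_def[abs_def])
   have le: "slice g F 1" if "slice g F B" "B \<le> 1" for F B using that by (auto simp: slice_def intro: order_trans)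
   have "wnorm p q s t (conv N S') \<le> C"
   proof (rule C(2)[OF S'])
    show "slice g S' 1" by (rule le[OF s]) (use \<delta> in simp)
    show "conv N S' z \<le> 1" for z
     by (rule order_trans[OF conv_slice(1)[OF S' g s N(3)]]) (use \<delta> \<delta>0 I in \<open>simp flip: ennreal_mult\<close>)
    show "slice g (conv N S') 1"
     by (rule le[OF conv_slice(2)[OF S' g s N(3)]]) (use \<delta> \<delta>0 I in \<open>simp flip: ennreal_mult\<close>)
   qed
   moreover have "conv N S = (\<lambda>z. ennreal (a / \<delta>) * conv N S' z)"
    unfolding S'_def conv_cmult[OF S] using 3 \<delta>0 by (simp add: mult.assoc[symmetric] flip: ennreal_mult)
   ultimately have "wnorm p q s t (conv N S) \<le> ennreal (a / \<delta>) * C"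
    using wnorm_cmult_le[OF pq measurable_conv[OF S'], of s t "ennreal (a / \<delta>)" N] mult_left_mono[of _ C "ennreal (a / \<delta>)"]
    by (metis order_trans zero_le)
   also have "ennreal (a / \<delta>) * C = (ennreal (1 / \<delta>) * C) * A"
    using 3 \<delta>0 by (simp add: mult_ac flip: ennreal_mult)
   also have "\<dots> \<le> (ennreal (1 / \<delta>) * C + 1) * A" by (intro mult_right_mono) auto
   finally show ?thesis .
  qed (simp add: ennreal_mult_top)
 qed
qed

text \<open>The easy direction: the slices are integrals over x at fixed \<xi>, just like the inner
  norm. After normalisation the inner norm is at most 1 for every p, and only the weight in \<xi>
  has to have a finite outer norm.\<close>

lemma conv_bounded_snd:
 assumes pq: "1 \<le> p" "1 \<le> q" and s: "s \<le> 0" and t: "Lp_norm q (jp t :: 'a::euclidean_space => ennreal) < top"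
 shows "conv_bounded (prod.swap :: 'a \<times> 'a => _) p q s t"
proof (rule conv_boundedI[where L=0, OF pq])
 fix N :: real
 show "\<exists>C<top. \<forall>S\<in>borel_measurable borel. slice prod.swap S 1 \<longrightarrow> (\<forall>z. conv N S z \<le> 1) \<longrightarrow>
   slice prod.swap (conv N S) 1 \<longrightarrow> wnorm p q s t (conv N S :: 'a \<times> 'a => ennreal) \<le> C"
 proof (intro exI[of _ "Lp_norm q (jp t :: 'a => ennreal)"] conjI t ballI impI)
  fix S :: "'a \<times> 'a => ennreal"
  assume [measurable]: "S \<in> \<B>" and h1: "\<forall>z. conv N S z \<le> 1" and sl: "slice prod.swap (conv N S) 1"
  have "Lp_norm p (\<lambda>x. conv N S (x, \<xi>) * (jp s x * jp t \<xi>)) \<le> jp t \<xi>" for \<xi>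
  proof -
   have "Lp_norm p (\<lambda>x. conv N S (x, \<xi>) * (jp s x * jp t \<xi>)) \<le> Lp_norm p (\<lambda>x. jp t \<xi> * conv N S (x, \<xi>))"
   proof (rule Lp_norm_mono[OF pq(1)])
    show "conv N S (x, \<xi>) * (jp s x * jp t \<xi>) \<le> jp t \<xi> * conv N S (x, \<xi>)" for x
     using mult_right_mono[OF jp_le_1[OF s, of x], of "conv N S (x, \<xi>) * jp t \<xi>"] by (simp add: mult_ac)
   qed measurable
   also have "\<dots> \<le> jp t \<xi> * Lp_norm p (\<lambda>x. conv N S (x, \<xi>))" by (rule Lp_norm_cmult_le[OF pq(1)]) measurable
   also have "\<dots> \<le> jp t \<xi> * 1"
    using h1 sl by (intro mult_left_mono Lp_norm_le_1 pq) (auto simp: slice_def)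
   finally show ?thesis by simp
  qed
  then show "wnorm p q s t (conv N S) \<le> Lp_norm q (jp t :: 'a => ennreal)"
   unfolding wnorm_def mixed_norm_def by (intro Lp_norm_mono pq measurable_Lp_norm) auto
 qed
qed simp

lemma slice_weighted:
 fixes h :: "'a::euclidean_space \<times> 'a => ennreal"
 assumes [measurable]: "h \<in> \<B>" and "slice id h 1"
 shows "(\<integral>\<xi>. \<integral>x. h (x, \<xi>) * jp r x) \<le> jint TYPE('a) r"
proof -
 have "(\<integral>\<xi>. \<integral>x. h (x, \<xi>) * jp r x) = (\<integral>x. \<integral>\<xi>. h (x, \<xi>) * jp r x)"
  using nn_integral_pair[of "\<lambda>z. h z * jp r (fst z)"] by simp
 also have "\<dots> = (\<integral>x. (\<integral>\<xi>. h (x, \<xi>)) * jp r x)" by (simp add: nn_integral_multc)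
 also have "\<dots> \<le> (\<integral>(x::'a). 1 * jp r x)"
  using assms(2) by (intro nn_integral_mono mult_right_mono) (auto simp: slice_def)
 finally show ?thesis by (simp add: jint_def)
qed

lemma conv_boundedI_fst:
 assumes p: "1 \<le> p" and q: "q = ennreal b" "1 \<le> b"
  and core: "\<And>N. N \<ge> L ==> N > real DIM('a) ==> \<exists>C<top. \<forall>S\<in>borel_measurable borel.
   slice id S 1 \<longrightarrow> (\<forall>z. conv N S z \<le> 1) \<longrightarrow> slice id (conv N S) 1 \<longrightarrow>
   (\<exists>M. (\<forall>\<xi>. epowr (Lp_norm p (\<lambda>x::'a. conv N S (x, \<xi>) * (jp s x * jp t \<xi>))) b \<le> M \<xi>) \<and> (\<integral>\<xi>. M \<xi>) \<le> C)"
 shows "conv_bounded (id :: 'a::euclidean_space \<times> 'a => _) p q s t"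
proof (rule conv_boundedI[where L=L, OF p])
 have r: "recip q = 1 / b" "enn2real q = b" "q \<noteq> \<infinity>" using q recip_ennreal[of b] by auto
 show "1 \<le> q" using q by (simp add: ennreal_leI[of 1, simplified])
 fix N assume "N \<ge> L" "N > real DIM('a)"
 from core[OF this] obtain C where C: "C < top" "\<And>S. S \<in> \<B> ==> slice id S 1 ==> (\<And>z. conv N S z \<le> 1) ==>
   slice id (conv N S) 1 ==>
   \<exists>M. (\<forall>\<xi>. epowr (Lp_norm p (\<lambda>x::'a. conv N S (x, \<xi>) * (jp s x * jp t \<xi>))) b \<le> M \<xi>) \<and> (\<integral>\<xi>. M \<xi>) \<le> C"
  by blast
 show "\<exists>C<top. \<forall>S\<in>borel_measurable borel. slice id S 1 \<longrightarrow> (\<forall>z. conv N S z \<le> 1) \<longrightarrow> slice id (conv N S) 1 \<longrightarrow>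
   wnorm p q s t (conv N S :: 'a \<times> 'a => ennreal) \<le> C"
 proof (intro exI[of _ "epowr C (1 / b)"] conjI ballI impI epowr_less_top C(1))
  fix S :: "'a \<times> 'a => ennreal"
  assume S: "S \<in> \<B>" "slice id S 1" "\<forall>z. conv N S z \<le> 1" "slice id (conv N S) 1"
  obtain M where M: "\<And>\<xi>. epowr (Lp_norm p (\<lambda>x::'a. conv N S (x, \<xi>) * (jp s x * jp t \<xi>))) b \<le> M \<xi>" "(\<integral>\<xi>. M \<xi>) \<le> C"
   using C(2)[OF S(1,2) _ S(4)] S(3) by blast
  have "wnorm p q s t (conv N S) \<le> epowr (\<integral>\<xi>. M \<xi>) (1 / b)"
   unfolding wnorm_def mixed_norm_def Lp_norm_finite[OF r(3)] r fst_conv snd_conv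
   using q by (intro epowr_mono nn_integral_mono M) auto
  also have "\<dots> \<le> epowr C (1 / b)" using q M by (intro epowr_mono) auto
  finally show "wnorm p q s t (conv N S) \<le> epowr C (1 / b)" .
 qed
qed simp

text \<open>The hard direction: the slices are integrals over \<xi>, but the norm integrates over x
  first. For q = \<infinity> the pointwise bound suffices. For finite q and p = \<infinity> the
  majorant of \<open>conv_sup_bound\<close> is used, for p \<le> q Tonelli's theorem with the weight
  in x, and for p > q an interpolation between these two arguments.\<close>

lemma conv_bounded_fst:
 fixes p q :: ennreal
 assumes pq: "1 \<le> p" "1 \<le> q" and s: "s \<le> 0" and t: "t \<le> 0"
  and p: "recip p + s / DIM('a::euclidean_space) < 0 \<or> p = \<infinity>"
  and q: "recip q + (s + t) / DIM('a) < 0 \<or> q = \<infinity>"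
 shows "conv_bounded (id :: 'a \<times> 'a => _) p q s t"
proof (cases "q = \<infinity>")
 case True
 have "s / DIM('a) \<le> 0" using s by (simp add: divide_nonpos_pos)
 then have fin: "Lp_norm p (jp s :: 'a => ennreal) < top"
  using Lp_norm_japanese[OF pq(1), where 'a='a and s=s] p s by (cases "s = 0") (auto simp: jp_def[abs_def] divide_neg_pos)
 show ?thesis
 proof (rule conv_boundedI[where L=0, OF pq])
  fix N :: real
  show "\<exists>C<top. \<forall>S\<in>borel_measurable borel. slice id S 1 \<longrightarrow> (\<forall>z. conv N S z \<le> 1) \<longrightarrow> slice id (conv N S) 1 \<longrightarrow>
   wnorm p q s t (conv N S :: 'a \<times> 'a => ennreal) \<le> C"
  proof (intro exI[of _ "Lp_norm p (jp s :: 'a => ennreal)"] conjI fin ballI impI)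
   fix S :: "'a \<times> 'a => ennreal" assume [measurable]: "S \<in> \<B>" and h1: "\<forall>z. conv N S z \<le> 1"
   have "conv N S (x, \<xi>) * (jp s x * jp t \<xi>) \<le> jp s x" for x \<xi>
    using mult_mono[OF h1[rule_format] mult_left_mono[OF jp_le_1[OF t, of \<xi>], of "jp s x"]] by simp
   then have "Lp_norm p (\<lambda>x. conv N S (x, \<xi>) * (jp s x * jp t \<xi>)) \<le> Lp_norm p (jp s :: 'a => ennreal)" for \<xi>
    by (intro Lp_norm_mono pq) auto
   moreover have "(\<lambda>\<xi>. Lp_norm p (\<lambda>x. conv N S (x, \<xi>) * (jp s x * jp t \<xi>))) \<in> \<B>"
    by (rule measurable_Lp_norm) measurable
   ultimately show "wnorm p q s t (conv N S) \<le> Lp_norm p (jp s :: 'a => ennreal)"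
    unfolding wnorm_def mixed_norm_def True Lp_norm_top fst_conv snd_conv by (intro esssup_I) auto
  qed
 qed simp
next
 case qf: False
 define d where "d = real DIM('a)"
 have d: "d > 0" by (simp add: d_def)
 have jf: "jint TYPE('a) r < top" if "r < - d" for r using jint_finite[where 'a='a] that by (simp add: d_def)
 have neg: "u * r < - d" if "1 / r + u / d < 0" "1 \<le> r" for u r
  using mult_strict_right_mono[OF that(1), of "r * d"] that(2) d by (simp add: distrib_right)
 obtain b where b: "q = ennreal b" "1 \<le> b" "recip q = 1 / b" using exponent_finite[OF pq(2) qf] by metis
 have fin: "jint TYPE('a) \<sigma> + ennreal (2 powr \<bar>\<sigma>\<bar>) * (jint TYPE('a) (- N) * jint TYPE('a) \<sigma>) < top"
  if "\<sigma> < - d" "real DIM('a) < N" for \<sigma> N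
  using jf[OF that(1)] jf[of "- N"] that(2) by (simp add: ennreal_mult_less_top d_def)
 consider (top) "p = \<infinity>" | (le) a where "p = ennreal a" "1 \<le> a" "recip p = 1 / a" "p \<noteq> \<infinity>" "a \<le> b"
  | (gt) a where "p = ennreal a" "1 \<le> a" "recip p = 1 / a" "p \<noteq> \<infinity>" "b < a"
 proof (cases "p = \<infinity>")
  case False
  obtain a where a: "p = ennreal a" "1 \<le> a" "recip p = 1 / a" by (rule exponent_finite[OF pq(1) False])
  show ?thesis using that(2)[OF a False] that(3)[OF a False] by (cases "a \<le> b") simp_all
 qed (rule that(1))
 then show ?thesis
 proof cases
  case top
  define \<sigma> where "\<sigma> = (s + t) * b"
  have \<sigma>: "\<sigma> < - d" unfolding \<sigma>_def using q qf b by (intro neg) (auto simp: d_def)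
  show ?thesis
  proof (rule conv_boundedI_fst[OF pq(1) b(1,2), where L="\<bar>\<sigma>\<bar>"])
   fix N assume N: "\<bar>\<sigma>\<bar> \<le> N" "real DIM('a) < N"
   show "\<exists>C<top. \<forall>S\<in>borel_measurable borel. slice id S 1 \<longrightarrow> (\<forall>z. conv N S z \<le> 1) \<longrightarrow> slice id (conv N S) 1 \<longrightarrow>
    (\<exists>M. (\<forall>\<xi>. epowr (Lp_norm p (\<lambda>x::'a. conv N S (x, \<xi>) * (jp s x * jp t \<xi>))) b \<le> M \<xi>) \<and> (\<integral>\<xi>. M \<xi>) \<le> C)"
   proof (intro exI[of _ "jint TYPE('a) \<sigma> + ennreal (2 powr \<bar>\<sigma>\<bar>) * (jint TYPE('a) (- N) * jint TYPE('a) \<sigma>)"] conjI fin \<sigma> N(2) ballI impI)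
    fix S :: "'a \<times> 'a => ennreal" assume S[measurable]: "S \<in> \<B>" and A: "slice id S 1" and h1: "\<forall>z. conv N S z \<le> 1"
    obtain M where M0: "M \<in> \<B>" and M: "\<And>x \<xi>. epowr (conv N S (x, \<xi>) * (jp s x * jp t \<xi>)) b \<le> M \<xi>"
     "(\<integral>\<xi>. M \<xi>) \<le> jint TYPE('a) \<sigma> + ennreal (2 powr \<bar>\<sigma>\<bar>) * (jint TYPE('a) (- N) * jint TYPE('a) \<sigma>)"
     by (rule conv_sup_bound[OF S A h1[rule_format] b(2) s t \<sigma>_def N(1)]) (rule that)
    have "epowr (Lp_norm p (\<lambda>x. conv N S (x, \<xi>) * (jp s x * jp t \<xi>))) b \<le> M \<xi>" for \<xi>
    proof -
     have "conv N S (x, \<xi>) * (jp s x * jp t \<xi>) \<le> epowr (M \<xi>) (1 / b)" for x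
      using epowr_mono[OF _ M(1)[of x \<xi>], of "1 / b"] b by (simp add: epowr_epowr)
     then have "Lp_norm p (\<lambda>x. conv N S (x, \<xi>) * (jp s x * jp t \<xi>)) \<le> epowr (M \<xi>) (1 / b)"
      unfolding top Lp_norm_top by (intro esssup_I) auto
     from epowr_mono[OF _ this, of b] show ?thesis using b by (simp add: epowr_epowr)
    qed
    then show "\<exists>M. (\<forall>\<xi>. epowr (Lp_norm p (\<lambda>x::'a. conv N S (x, \<xi>) * (jp s x * jp t \<xi>))) b \<le> M \<xi>) \<and>
      (\<integral>\<xi>. M \<xi>) \<le> jint TYPE('a) \<sigma> + ennreal (2 powr \<bar>\<sigma>\<bar>) * (jint TYPE('a) (- N) * jint TYPE('a) \<sigma>)"
     using M(2) by blast
   qed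
  qed
 next
  case (le a)
  define W where "W = jint TYPE('a) (s * a)"
  have W: "W < top" unfolding W_def using p le by (intro jf neg) (auto simp: d_def)
  show ?thesis
  proof (rule conv_boundedI_fst[OF pq(1) b(1,2), where L=0])
   fix N :: real
   show "\<exists>C<top. \<forall>S\<in>borel_measurable borel. slice id S 1 \<longrightarrow> (\<forall>z. conv N S z \<le> 1) \<longrightarrow> slice id (conv N S) 1 \<longrightarrow>
    (\<exists>M. (\<forall>\<xi>. epowr (Lp_norm p (\<lambda>x::'a. conv N S (x, \<xi>) * (jp s x * jp t \<xi>))) b \<le> M \<xi>) \<and> (\<integral>\<xi>. M \<xi>) \<le> C)"
   proof (intro exI[of _ "W * (1 + epowr W (b / a - 1))"] conjI ballI impI)
    show "W * (1 + epowr W (b / a - 1)) < top" using W epowr_less_top[OF W] by (simp add: ennreal_mult_less_top)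
    fix S :: "'a \<times> 'a => ennreal" assume [measurable]: "S \<in> \<B>"
     and h1: "\<forall>z. conv N S z \<le> 1" and sl: "slice id (conv N S) 1"
    \<comment> \<open>\<open>Q\<close> dominates the a-th power of the inner norm. It is both
      integrable over \<xi>, through the slices, and bounded by \<open>W\<close>, through the
      pointwise bound, so its power with exponent b / a \<ge> 1 is again integrable.\<close>
    define Q where "Q \<xi> = (\<integral>x. conv N S (x, \<xi>) * jp (s * a) x)" for \<xi>
    have [measurable]: "Q \<in> \<B>" unfolding Q_def by measurable
    have QW: "Q \<xi> \<le> W" for \<xi>
     unfolding Q_def W_def jint_def using h1 mult_right_mono[of _ 1] by (intro nn_integral_mono) fastforce
    have "epowr (Lp_norm p (\<lambda>x. conv N S (x, \<xi>) * (jp s x * jp t \<xi>))) b \<le> Q \<xi> * (1 + epowr W (b / a - 1))" for \<xi>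
    proof -
     have "epowr (conv N S (x, \<xi>) * (jp s x * jp t \<xi>)) a \<le> conv N S (x, \<xi>) * (jp (s * a) x * 1)" for x
      using le t h1 by (simp only: epowr_mult jp_epowr zero_less_one order.strict_trans2)
       (intro mult_mono mult_left_mono epowr_le_self jp_le_1, auto simp: mult_nonpos_nonneg)
     then have "(\<integral>x. epowr (conv N S (x, \<xi>) * (jp s x * jp t \<xi>)) a) \<le> Q \<xi>"
      unfolding Q_def by (intro nn_integral_mono) simp
     then have "epowr (Lp_norm p (\<lambda>x. conv N S (x, \<xi>) * (jp s x * jp t \<xi>))) b \<le> epowr (Q \<xi>) (b / a)"
      unfolding Lp_norm_finite[OF le(4)] le(3) epowr_epowr using le b by (auto intro: epowr_mono)
     also have "\<dots> \<le> Q \<xi> * (1 + epowr W (b / a - 1))"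
     proof (cases "a = b")
      case True
      then show ?thesis using le by (simp add: distrib_left)
     next
      case False
      then have 1: "0 < b / a - 1" using le by auto
      have "epowr (Q \<xi>) (b / a) = Q \<xi> * epowr (Q \<xi>) (b / a - 1)" using epowr_add[OF zero_less_one 1, of "Q \<xi>"] by simp
      also have "\<dots> \<le> Q \<xi> * (1 + epowr W (b / a - 1))"
       using 1 by (intro mult_left_mono order_trans[OF epowr_mono[OF _ QW]]) auto
      finally show ?thesis .
     qed
     finally show ?thesis .
    qed
    moreover have "(\<integral>\<xi>. Q \<xi> * (1 + epowr W (b / a - 1))) \<le> W * (1 + epowr W (b / a - 1))"
     using slice_weighted[OF _ sl, of "s * a"] by (simp add: nn_integral_multc mult_right_mono Q_def W_def)
    ultimately show "\<exists>M. (\<forall>\<xi>. epowr (Lp_norm p (\<lambda>x::'a. conv N S (x, \<xi>) * (jp s x * jp t \<xi>))) b \<le> M \<xi>) \<and>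
      (\<integral>\<xi>. M \<xi>) \<le> W * (1 + epowr W (b / a - 1))"
     by (intro exI[of _ "\<lambda>\<xi>. Q \<xi> * (1 + epowr W (b / a - 1))"]) simp
   qed
  qed
 next
  case (gt a)
  define \<theta> where "\<theta> = b / a"
  have \<theta>: "0 < \<theta>" "\<theta> < 1" using gt b by (auto simp: \<theta>_def)
  have st: "s + t < - d / b" 
  proof -
   have "1 / b + (s + t) / d < 0" using q qf b by (simp add: d_def)
   from neg[OF this b(2)] show ?thesis using b by (simp add: field_simps)
  qed
  have sa: "s < - d / a" 
  proof -
   have "1 / a + s / d < 0" using p gt by (simp add: d_def)
   from neg[OF this gt(2)] show ?thesis using gt by (simp add: field_simps)
  qed
  \<comment> \<open>The weight exponents are split as s = (1 - \<theta>) s1 + \<theta> s0 and t = (1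
    - \<theta>) t1, with x = (1 - \<theta>) s1. The lower bound on x makes the weight with exponent
    s0 b integrable, x < 0 gives s1 \<le> 0, and the last bound puts (s1 + t1) b below minus the
    dimension. Such an x exists precisely because of the two strict conditions \<open>sa\<close> and
    \<open>st\<close>.\<close>
  obtain x where x: "s + d / a < x" "x < 0" "x < - d / b + d / a - t"
   using dense[of "s + d / a" "min 0 (- d / b + d / a - t)"] st sa by auto
  define s1 where "s1 = x / (1 - \<theta>)"
  define t1 where "t1 = t / (1 - \<theta>)"
  define s0 where "s0 = (s - x) / \<theta>"
  have st1: "s1 \<le> 0" "t1 \<le> 0" using x t \<theta> by (auto simp: s1_def t1_def divide_le_0_iff)
  have a1: "a * (1 - \<theta>) = a - b" "a * \<theta> = b" using gt by (auto simp: \<theta>_def field_simps)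
  have eqs: "s * a = s1 * (a - b) + s0 * b" "t * a = t1 * (a - b)"
   unfolding a1[symmetric] s1_def t1_def s0_def using \<theta> by (auto simp: field_simps)
  define \<sigma> where "\<sigma> = (s1 + t1) * b"
  have \<sigma>: "\<sigma> < - d"
  proof -
   have "x + t < (- d / b) * (1 - \<theta>)" using x(3) gt b by (simp add: \<theta>_def field_simps)
   then have "(x + t) / (1 - \<theta>) < - d / b" using \<theta> by (simp add: divide_less_eq)
   then show ?thesis using b by (simp add: \<sigma>_def s1_def t1_def add_divide_distrib[symmetric] field_simps)
  qed
  have s0: "s0 * b < - d"
  proof -
   have "s0 * b = (s - x) * a" unfolding a1(2)[symmetric] s0_def using \<theta> by simp
   also have "\<dots> < (- d / a) * a" using x(1) gt by (intro mult_strict_right_mono) auto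
   finally show ?thesis using gt by simp
  qed
  have ab: "0 < a" "0 < b" "0 < a - b" "0 < 1 - b / a" "1 - b / a < 1" using b gt by auto
  show ?thesis
  proof (rule conv_boundedI_fst[OF pq(1) b(1,2), where L="\<bar>\<sigma>\<bar>"])
   fix N assume N: "\<bar>\<sigma>\<bar> \<le> N" "real DIM('a) < N"
   let ?C = "jint TYPE('a) \<sigma> + ennreal (2 powr \<bar>\<sigma>\<bar>) * (jint TYPE('a) (- N) * jint TYPE('a) \<sigma>)"
   show "\<exists>C<top. \<forall>S\<in>borel_measurable borel. slice id S 1 \<longrightarrow> (\<forall>z. conv N S z \<le> 1) \<longrightarrow> slice id (conv N S) 1 \<longrightarrow>
    (\<exists>M. (\<forall>\<xi>. epowr (Lp_norm p (\<lambda>x::'a. conv N S (x, \<xi>) * (jp s x * jp t \<xi>))) b \<le> M \<xi>) \<and> (\<integral>\<xi>. M \<xi>) \<le> C)"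
   proof (intro exI[of _ "?C + jint TYPE('a) (s0 * b)"] conjI ballI impI)
    show "?C + jint TYPE('a) (s0 * b) < top" using fin[OF \<sigma> N(2)] jf[OF s0] by simp
    fix S :: "'a \<times> 'a => ennreal" assume S[measurable]: "S \<in> \<B>" and A: "slice id S 1"
     and h1: "\<forall>z. conv N S z \<le> 1" and sl: "slice id (conv N S) 1"
    obtain M where [measurable]: "M \<in> \<B>" and M: "\<And>x \<xi>. epowr (conv N S (x, \<xi>) * (jp s1 x * jp t1 \<xi>)) b \<le> M \<xi>"
     "(\<integral>\<xi>. M \<xi>) \<le> ?C"
     by (rule conv_sup_bound[OF S A h1[rule_format] b(2) st1 \<sigma>_def N(1)]) (rule that)
    define h where "h = conv N S"
    have [measurable]: "h \<in> \<B>" unfolding h_def by measurable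
    define Q where "Q \<xi> = (\<integral>x. h (x, \<xi>) * jp (s0 * b) x)" for \<xi>
    have [measurable]: "Q \<in> \<B>" unfolding Q_def by measurable
    have "epowr (Lp_norm p (\<lambda>x. h (x, \<xi>) * (jp s x * jp t \<xi>))) b \<le> M \<xi> + Q \<xi>" for \<xi>
    proof -
     \<comment> \<open>The a-th power is the product of an (a - b)-th power carrying the weights s1,
       t1, which is bounded uniformly in x by \<open>M\<close>, and a b-th power carrying the weight
       s0, which integrates over x to at most \<open>Q\<close>.\<close>
     have "epowr (h (x, \<xi>) * (jp s x * jp t \<xi>)) a \<le> epowr (M \<xi>) ((a - b) / b) * (h (x, \<xi>) * jp (s0 * b) x)" for x
     proof -
      have "epowr (h (x, \<xi>) * (jp s x * jp t \<xi>)) a = epowr (h (x, \<xi>)) a * (jp (s * a) x * jp (t * a) \<xi>)"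
       using ab by (simp add: epowr_mult jp_epowr)
      also have "\<dots> = (epowr (h (x, \<xi>)) (a - b) * (jp (s1 * (a - b)) x * jp (t1 * (a - b)) \<xi>)) * (epowr (h (x, \<xi>)) b * jp (s0 * b) x)"
       unfolding eqs jp_add using epowr_add[of "a - b" b "h (x, \<xi>)"] ab by (simp add: mult_ac)
      also have "epowr (h (x, \<xi>)) (a - b) * (jp (s1 * (a - b)) x * jp (t1 * (a - b)) \<xi>)
        = epowr (epowr (h (x, \<xi>) * (jp s1 x * jp t1 \<xi>)) b) ((a - b) / b)"
       using ab by (simp add: epowr_mult jp_epowr epowr_epowr)
      also have "\<dots> * (epowr (h (x, \<xi>)) b * jp (s0 * b) x) \<le> epowr (M \<xi>) ((a - b) / b) * (h (x, \<xi>) * jp (s0 * b) x)"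
       unfolding h_def using ab b h1 by (intro mult_mono mult_right_mono epowr_mono M(1) epowr_le_self) auto
      finally show ?thesis .
     qed
     then have "(\<integral>x. epowr (h (x, \<xi>) * (jp s x * jp t \<xi>)) a) \<le> (\<integral>x. epowr (M \<xi>) ((a - b) / b) * (h (x, \<xi>) * jp (s0 * b) x))"
      by (rule nn_integral_mono)
     also have "\<dots> = epowr (M \<xi>) ((a - b) / b) * Q \<xi>" unfolding Q_def by (rule nn_integral_cmult) measurable
     finally have "epowr (\<integral>x. epowr (h (x, \<xi>) * (jp s x * jp t \<xi>)) a) (b / a)
       \<le> epowr (epowr (M \<xi>) ((a - b) / b) * Q \<xi>) (b / a)" using ab by (intro epowr_mono) auto
     also have "\<dots> = epowr (M \<xi>) (1 - b / a) * epowr (Q \<xi>) (1 - (1 - b / a))"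
     proof -
      have "(a - b) / b * (b / a) = 1 - b / a" using ab by (simp add: field_simps)
      then show ?thesis using ab by (simp add: epowr_mult epowr_epowr)
     qed
     also have "\<dots> \<le> M \<xi> + Q \<xi>" by (rule young_epowr) (use ab in auto)
     finally show ?thesis using ab gt by (simp add: Lp_norm_finite epowr_epowr)
    qed
    moreover have "(\<integral>\<xi>. M \<xi> + Q \<xi>) \<le> ?C + jint TYPE('a) (s0 * b)"
     using M(2) slice_weighted[OF _ sl, of "s0 * b"] by (simp add: nn_integral_add add_mono Q_def h_def)
    ultimately show "\<exists>M. (\<forall>\<xi>. epowr (Lp_norm p (\<lambda>x::'a. conv N S (x, \<xi>) * (jp s x * jp t \<xi>))) b \<le> M \<xi>) \<and>
      (\<integral>\<xi>. M \<xi>) \<le> ?C + jint TYPE('a) (s0 * b)" unfolding h_def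
     by (intro exI[of _ "\<lambda>\<xi>. M \<xi> + Q \<xi>"]) simp
   qed
  qed
 qed
qed

section \<open>Short-time Fourier transforms and Wigner distributions\<close>

definition stft_abs :: "('a::euclidean_space => complex) => 'a functional => 'a \<times> 'a => ennreal"
 where "stft_abs \<phi> u z = ennreal (cmod (stft \<phi> u (fst z) (snd z)))"

lemma measurable_stft_abs:
 assumes "continuous_on UNIV (\<lambda>p. stft \<Phi> u (fst p) (snd p))" shows "stft_abs \<Phi> u \<in> \<B>"
proof -
 have "(\<lambda>p. stft \<Phi> u (fst p) (snd p)) \<in> \<B>"
  using assms by (rule borel_measurable_continuous_onI)
 then show ?thesis unfolding stft_abs_def[abs_def] by measurable
qed

lemma ft_modulate: "ft (\<lambda>t. cis (2 * pi * (t \<bullet> \<eta>)) * g t) \<xi> = ft g (\<xi> - \<eta>)"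
 unfolding ft_def
proof (rule Bochner_Integration.integral_cong[OF refl])
 fix t
 have "cis (2 * pi * (t \<bullet> \<eta>)) * cis (- (2 * pi) * (t \<bullet> \<xi>)) = cis (- (2 * pi) * (t \<bullet> (\<xi> - \<eta>)))"
  unfolding cis_mult by (rule arg_cong[where f=cis]) (simp add: inner_diff_right algebra_simps)
 then show "cis (2 * pi * (t \<bullet> \<eta>)) * g t * cis (- (2 * pi) * (t \<bullet> \<xi>)) = g t * cis (- (2 * pi) * (t \<bullet> (\<xi> - \<eta>)))"
  by (metis mult.commute mult.left_commute)
qed

lemma norm_stft_modulate_translate:
 assumes \<theta>: "\<theta> \<in> schwartz" and \<phi>: "\<phi> \<in> schwartz"
 shows "cmod (stft \<phi> (fun_distr (\<lambda>t. cis (2 * pi * (t \<bullet> \<eta>)) * \<theta> (t - w))) x \<xi>)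
  = cmod (stft \<phi> (fun_distr \<theta>) (x - w) (\<xi> - \<eta>))"
proof -
 define g where "g = (\<lambda>t. \<theta> t * cnj (\<phi> (t - (x - w))))"
 have g: "g \<in> schwartz" unfolding g_def by (rule schwartz_mult_cnj_shift[OF \<theta> \<phi>])
 have "stft \<phi> (fun_distr (\<lambda>t. cis (2 * pi * (t \<bullet> \<eta>)) * \<theta> (t - w))) x \<xi>
   = ft (\<lambda>t. cis (2 * pi * (t \<bullet> \<eta>)) * g (t + - w)) \<xi>"
  unfolding stft_fun_distr by (simp add: g_def mult.assoc)
 also have "\<dots> = cis (2 * pi * (- w \<bullet> (\<xi> - \<eta>))) * ft g (\<xi> - \<eta>)"
  unfolding ft_modulate by (rule ft_translate[OF g])
 finally show ?thesis by (simp add: norm_mult stft_fun_distr g_def)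
qed

lemma schwartz_jp_bound:
 fixes F :: "'a::euclidean_space \<times> 'b::euclidean_space => complex"
 assumes "F \<in> schwartz"
 obtains C where "C \<ge> 0" "\<And>x y. ennreal (cmod (F (x, y))) \<le> ennreal C * (jp (- N) x * jp (- N) y)"
proof -
 obtain n :: nat where n: "N \<le> real n" using real_arch_simple by blast
 obtain C where C: "C \<ge> 0" "\<And>x y. cmod (F (x, y)) \<le> C / (japanese x ^ n * japanese y ^ n)"
  using schwartz_bound_Pair[OF assms] by metis
 have j: "ennreal (1 / japanese x ^ n) \<le> jp (- N) x" for x :: "'c::euclidean_space"
 proof -
  have "1 / japanese x ^ n = japanese x powr (- real n)" by (simp add: powr_minus powr_realpow divide_inverse)
  also have "\<dots> \<le> japanese x powr (- N)" using n by (intro powr_mono japanese_ge_1) auto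
  finally show ?thesis unfolding jp_def by (rule ennreal_leI)
 qed
 have "ennreal (cmod (F (x, y))) \<le> ennreal C * (jp (- N) x * jp (- N) y)" for x y
 proof -
  have "ennreal (cmod (F (x, y))) \<le> ennreal (C * (1 / japanese x ^ n * (1 / japanese y ^ n)))"
   using C(2)[of x y] by (intro ennreal_leI) simp
  also have "\<dots> = ennreal C * (ennreal (1 / japanese x ^ n) * ennreal (1 / japanese y ^ n))"
   using C(1) by (simp flip: ennreal_mult)
  also have "\<dots> \<le> ennreal C * (jp (- N) x * jp (- N) y)" by (intro mult_left_mono mult_mono j) auto
  finally show ?thesis .
 qed
 then show ?thesis using that C(1) by blast
qed

lemma stft_jp_bound:
 assumes "\<Psi> \<in> schwartz" "\<Gamma> \<in> schwartz"
 obtains C where "C \<ge> 0" "\<And>x \<xi>. ennreal (cmod (stft \<Gamma> (fun_distr \<Psi>) x \<xi>)) \<le> ennreal C * (jp (- N) x * jp (- N) \<xi>)"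
 using schwartz_jp_bound[OF schwartz_stft[OF assms], of N] by auto

lemma stft_inversion_norm:
 assumes \<Phi>: "\<Phi> \<in> schwartz" and \<Gamma>: "\<Gamma> \<in> schwartz" and nz: "(LINT t|lborel. \<Phi> t * cnj (\<Gamma> t)) \<noteq> 0"
 obtains C where "C > 0" "\<And>u \<Psi>. u \<in> tempered ==> \<Psi> \<in> schwartz ==>
  ennreal (cmod (u \<Psi>)) \<le> ennreal C * (\<integral>p. stft_abs \<Gamma> (fun_distr \<Psi>) p * stft_abs \<Phi> u p)"
proof -
 obtain c where c: "c \<noteq> 0" "\<And>f x. f \<in> schwartz ==> (LINT z|lborel. ft f z * cis (2 * pi * (x \<bullet> z))) = c * f (x :: 'a)"
  using fourier_inversion by blast
 define K where "K = cmod (c * (LINT t|lborel. \<Phi> t * cnj (\<Gamma> t)))"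
 have K: "K > 0" using c(1) nz by (simp add: K_def)
 have "ennreal (cmod (u \<Psi>)) \<le> ennreal (1 / K) * (\<integral>p. stft_abs \<Gamma> (fun_distr \<Psi>) p * stft_abs \<Phi> u p)"
  if u: "u \<in> tempered" and \<Psi>: "\<Psi> \<in> schwartz" for u \<Psi>
 proof -
  note inv = stft_inversion[OF u \<Phi> \<Gamma> \<Psi> c(2)]
  have "K * cmod (u \<Psi>) = cmod (cnj (c * (LINT t|lborel. \<Phi> t * cnj (\<Gamma> t))) * u \<Psi>)"
   unfolding K_def norm_mult complex_mod_cnj ..
  also have "\<dots> = cmod (LINT p|lborel. cnj (stft \<Gamma> (fun_distr \<Psi>) (fst p) (snd p)) * stft \<Phi> u (fst p) (snd p))"
   by (rule arg_cong[where f=cmod], rule inv(2))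
  finally have "ennreal (K * cmod (u \<Psi>)) \<le> (\<integral>p. norm (cnj (stft \<Gamma> (fun_distr \<Psi>) (fst p) (snd p)) * stft \<Phi> u (fst p) (snd p)))"
   using integral_norm_bound_ennreal[OF inv(1)] by simp
  also have "\<dots> = (\<integral>p. stft_abs \<Gamma> (fun_distr \<Psi>) p * stft_abs \<Phi> u p)"
   by (simp add: stft_abs_def norm_mult ennreal_mult)
  finally have "ennreal (1 / K) * ennreal (K * cmod (u \<Psi>)) \<le> ennreal (1 / K) * (\<integral>p. stft_abs \<Gamma> (fun_distr \<Psi>) p * stft_abs \<Phi> u p)"
   by (rule mult_left_mono) simp
  then show ?thesis using K by (simp flip: ennreal_mult)
 qed
 then show ?thesis using that[of "1 / K"] K by simp
qed

text \<open>The transform with window \<theta> is u at a time-frequency shift of \<theta>. By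
  inversion this is an average of the transform with window \<phi> against a shifted Schwartz
  function, whose decay yields the kernel. The constant does not depend on u.\<close>

lemma stft_window_change:
 assumes \<phi>: "\<phi> \<in> schwartz" and nz: "\<phi> x0 \<noteq> 0" and \<theta>: "\<theta> \<in> schwartz"
 obtains C where "C > 0" "\<And>u z. u \<in> tempered ==> stft_abs \<theta> u z \<le> ennreal C * conv N (stft_abs \<phi> u) z"
proof -
 obtain C where C: "C > 0" "\<And>u \<Psi>. u \<in> tempered ==> \<Psi> \<in> schwartz ==>
  ennreal (cmod (u \<Psi>)) \<le> ennreal C * (\<integral>p. stft_abs \<phi> (fun_distr \<Psi>) p * stft_abs \<phi> u p)"
  using stft_inversion_norm[OF \<phi> \<phi> schwartz_norm_sq_pos[OF \<phi> nz]] by blast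
 obtain D where D: "D \<ge> 0" "\<And>x \<xi>. ennreal (cmod (stft \<phi> (fun_distr \<theta>) x \<xi>)) \<le> ennreal D * (jp (- N) x * jp (- N) \<xi>)"
  using stft_jp_bound[OF \<theta> \<phi>] by blast
 have "stft_abs \<theta> u z \<le> ennreal (C * D + 1) * conv N (stft_abs \<phi> u) z" if u: "u \<in> tempered" for u z
 proof -
  have m[measurable]: "stft_abs \<phi> u \<in> \<B>"
   by (rule measurable_stft_abs[OF stft_continuous[OF u \<phi>]])
  let ?\<Psi> = "\<lambda>t. cis (2 * pi * (t \<bullet> snd z)) * \<theta> (t - fst z)"
  have "stft_abs \<theta> u z = ennreal (cmod (u ?\<Psi>))" by (simp add: stft_abs_def stft_def)
  also have "\<dots> \<le> ennreal C * (\<integral>p. stft_abs \<phi> (fun_distr ?\<Psi>) p * stft_abs \<phi> u p)"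
   by (rule C(2)[OF u schwartz_modulate_translate[OF \<theta>]])
  also have "\<dots> \<le> ennreal C * (\<integral>p. ennreal D * (jp (- N) (fst z - fst p) * jp (- N) (snd z - snd p) * stft_abs \<phi> u p))"
  proof (intro mult_left_mono nn_integral_mono)
   fix p
   have "stft_abs \<phi> (fun_distr ?\<Psi>) p = ennreal (cmod (stft \<phi> (fun_distr \<theta>) (fst p - fst z) (snd p - snd z)))"
    unfolding stft_abs_def norm_stft_modulate_translate[OF \<theta> \<phi>] ..
   also have "\<dots> \<le> ennreal D * (jp (- N) (fst z - fst p) * jp (- N) (snd z - snd p))"
    using D(2)[of "fst p - fst z" "snd p - snd z"] by (simp add: jp_commute[of _ "fst p"] jp_commute[of _ "snd p"])
   finally have "stft_abs \<phi> (fun_distr ?\<Psi>) p * stft_abs \<phi> u p \<le> ennreal D * (jp (- N) (fst z - fst p) * jp (- N) (snd z - snd p)) * stft_abs \<phi> u p"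
    by (rule mult_right_mono) simp
   then show "stft_abs \<phi> (fun_distr ?\<Psi>) p * stft_abs \<phi> u p \<le> ennreal D * (jp (- N) (fst z - fst p) * jp (- N) (snd z - snd p) * stft_abs \<phi> u p)"
    by (simp only: mult.assoc)
  qed simp
  also have "\<dots> = ennreal (C * D) * conv N (stft_abs \<phi> u) z"
  proof -
   have "(\<lambda>p. jp (- N) (fst z - fst p) * jp (- N) (snd z - snd p) * stft_abs \<phi> u p) \<in> borel_measurable lborel"
    by measurable
   then show ?thesis using C(1) D(1) by (simp add: nn_integral_cmult conv_def ennreal_mult mult.assoc)
  qed
  also have "\<dots> \<le> ennreal (C * D + 1) * conv N (stft_abs \<phi> u) z" by (intro mult_right_mono ennreal_leI) auto
  finally show ?thesis .
 qed
 moreover have "C * D + 1 > 0" using C(1) D(1) by (simp add: add_nonneg_pos)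
 ultimately show ?thesis using that by blast
qed

text \<open>The common shape of the Wigner distributions of both cases: e = -1 for \<tau> = 0 and e
  = 1 for \<tau> = 1.\<close>

definition chirp :: "real => ('a::euclidean_space => complex) => ('a => complex) => 'a \<times> 'a => complex"
 where "chirp e A B p = A (fst p) * B (snd p) * cis (e * (2 * pi) * (fst p \<bullet> snd p))"

lemma schwartz_chirp: "A \<in> schwartz ==> B \<in> schwartz ==> chirp e A B \<in> schwartz"
 unfolding chirp_def[abs_def] by (rule schwartz_tensor_cis)

lemma wigner_0: 
 assumes f: "f \<in> schwartz" shows "wigner 0 g f = chirp (- 1) g (\<lambda>\<xi>. cnj (ft f \<xi>))"
proof (rule ext)
 fix p :: "'a \<times> 'a"
 obtain x \<xi> where p: "p = (x, \<xi>)" by force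
 have m: "(\<lambda>t. cnj (f t) * cis (2 * pi * (t \<bullet> \<xi>))) \<in> \<B>"
  by (intro schwartz_measurable schwartz_mult_slow schwartz_cnj f slow_cis_inner_const bounded_linear_ident)
 have "wigner 0 g f p = (LINT t|lborel. g x * cis (- (2 * pi) * (x \<bullet> \<xi>)) * (cnj (f (x - t)) * cis (2 * pi * ((x - t) \<bullet> \<xi>))))"
  unfolding wigner_def p prod.case
 proof (rule Bochner_Integration.integral_cong[OF refl])
  fix t
  have "cis (- 2 * pi * (\<xi> \<bullet> t)) = cis (- (2 * pi) * (x \<bullet> \<xi>)) * cis (2 * pi * ((x - t) \<bullet> \<xi>))"
   unfolding cis_mult by (rule arg_cong[where f=cis]) (simp add: inner_diff_left inner_commute algebra_simps)
  then show "g (x + 0 *\<^sub>R t) * cnj (f (x - (1 - 0) *\<^sub>R t)) * cis (- 2 * pi * (\<xi> \<bullet> t))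
    = g x * cis (- (2 * pi) * (x \<bullet> \<xi>)) * (cnj (f (x - t)) * cis (2 * pi * ((x - t) \<bullet> \<xi>)))"
   by (simp add: mult_ac)
 qed
 also have "\<dots> = g x * cis (- (2 * pi) * (x \<bullet> \<xi>)) * (LINT t|lborel. cnj (f t) * cis (2 * pi * (t \<bullet> \<xi>)))"
  using integral_lborel_affine[OF m, of "-1" x] by simp
 also have "(LINT t|lborel. cnj (f t) * cis (2 * pi * (t \<bullet> \<xi>))) = cnj (ft f \<xi>)"
  unfolding ft_def by (subst Bochner_Integration.integral_cnj[symmetric]) (simp add: cis_cnj)
 finally show "wigner 0 g f p = chirp (- 1) g (\<lambda>\<xi>. cnj (ft f \<xi>)) p"
  by (simp add: p chirp_def mult_ac)
qed

lemma wigner_1: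
 assumes g: "g \<in> schwartz" shows "wigner 1 g f = chirp 1 (\<lambda>x. cnj (f x)) (ft g)"
proof (rule ext)
 fix p :: "'a \<times> 'a"
 obtain x \<xi> where p: "p = (x, \<xi>)" by force
 have "wigner 1 g f p = (LINT t|lborel. cnj (f x) * (g (t + x) * cis (- (2 * pi) * (t \<bullet> \<xi>))))"
  unfolding wigner_def p prod.case by (simp add: mult_ac inner_commute add.commute)
 also have "\<dots> = cnj (f x) * ft (\<lambda>t. g (t + x)) \<xi>" by (simp add: ft_def)
 finally show "wigner 1 g f p = chirp 1 (\<lambda>x. cnj (f x)) (ft g) p"
  by (simp add: p chirp_def ft_translate[OF g] mult_ac)
qed

text \<open>The window of the amalgam norm is arbitrary, whereas the Wigner distribution calls for a
  window with the same chirp. Inversion permits two different windows provided that they are not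
  orthogonal, and bumps concentrating at a point where \<Phi> does not vanish achieve this. The
  factors are real so that conjugation and Fourier transform act simply on the transforms
  below.\<close>

lemma chirp_window:
 fixes \<Phi> :: "'a::euclidean_space \<times> 'a => complex" and \<phi> :: "'a => complex"
 assumes \<Phi>: "\<Phi> \<in> schwartz" and p0: "\<Phi> p0 \<noteq> 0" and \<phi>: "\<phi> \<in> schwartz" and x0: "\<phi> x0 \<noteq> 0"
 obtains \<gamma>1 \<gamma>2 :: "'a => complex" where "\<gamma>1 \<in> schwartz" "\<gamma>2 \<in> schwartz" "\<And>x. cnj (\<gamma>1 x) = \<gamma>1 x" "\<And>x. cnj (\<gamma>2 x) = \<gamma>2 x"
  "(LINT p|lborel. \<Phi> p * cnj (chirp e \<gamma>1 \<gamma>2 p)) \<noteq> 0"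
proof -
 define g where "g x = \<phi> x * cnj (\<phi> x)" for x
 have g: "g \<in> schwartz" unfolding g_def by (intro schwartz_mult schwartz_cnj \<phi>)
 have gr: "cnj (g x) = g x" for x by (simp add: g_def)
 define h where "h p = g (fst p) * g (snd p)" for p
 have h: "h \<in> schwartz" unfolding h_def by (rule schwartz_tensor[OF g g])
 have "(LINT p|lborel. h p) = (LINT x|lborel. g x) * (LINT x|lborel. g x)"
  using schwartz_Fubini(1)[OF h] by (simp add: h_def)
 then have h0: "(LINT p|lborel. h p) \<noteq> 0"
  using schwartz_norm_sq_pos[OF \<phi> x0] by (simp add: g_def)
 \<comment> \<open>The chirp of the window is absorbed here, so the dilation limit only sees the
   bumps; the substitution by \<open>c\<close> and \<open>p0\<close> later moves the dilation from
   \<open>F\<close> to the window.\<close>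
 define F where "F p = \<Phi> p * cis (- e * (2 * pi) * (fst p \<bullet> snd p))" for p
 have F: "F \<in> schwartz" unfolding F_def
  by (intro schwartz_mult_slow \<Phi> slow_cis_inner bounded_linear_fst bounded_linear_snd)
 have lim: "(\<lambda>k. LINT p|lborel. F (p0 + (1 / real (Suc k)) *\<^sub>R p) * h p) \<longlonglongrightarrow> F p0 * (LINT p|lborel. h p)"
  by (rule schwartz_dilation_limit[OF F h])
 have "F p0 * (LINT p|lborel. h p) \<noteq> 0" using p0 h0 by (simp add: F_def)
 then have "eventually (\<lambda>k. (LINT p|lborel. F (p0 + (1 / real (Suc k)) *\<^sub>R p) * h p) \<noteq> 0) sequentially"
  using lim by (rule tendsto_imp_eventually_ne[rotated])
 then obtain k where k: "(LINT p|lborel. F (p0 + (1 / real (Suc k)) *\<^sub>R p) * h p) \<noteq> 0"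
  by (auto simp: eventually_sequentially)
 define c where "c = real (Suc k)"
 have c: "c > 0" by (simp add: c_def)
 have gc: "(\<lambda>x. g (c *\<^sub>R (x - a))) \<in> schwartz" for a
  using schwartz_translate[OF schwartz_scale[OF g, of c], of "- a"] c by simp
 have m: "(\<lambda>p. F (p0 + (1 / c) *\<^sub>R p) * h p) \<in> \<B>"
  using schwartz_measurable[OF schwartz_mult[OF schwartz_scale[OF schwartz_translate[OF F], of "1 / c" p0] h]] c
  by (simp add: add.commute)
 have "(LINT p|lborel. F (p0 + (1 / c) *\<^sub>R p) * h p) = complex_of_real (\<bar>c\<bar> ^ DIM('a \<times> 'a)) *
   (LINT p|lborel. F (p0 + (1 / c) *\<^sub>R (- (c *\<^sub>R p0) + c *\<^sub>R p)) * h (- (c *\<^sub>R p0) + c *\<^sub>R p))"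
  using c by (intro integral_lborel_affine m) auto
 also have "(LINT p|lborel. F (p0 + (1 / c) *\<^sub>R (- (c *\<^sub>R p0) + c *\<^sub>R p)) * h (- (c *\<^sub>R p0) + c *\<^sub>R p))
   = (LINT p|lborel. \<Phi> p * cnj (chirp e (\<lambda>x. g (c *\<^sub>R (x - fst p0))) (\<lambda>x. g (c *\<^sub>R (x - snd p0))) p))"
 proof (rule Bochner_Integration.integral_cong[OF refl])
  fix p
  have "(1 / c) *\<^sub>R (- (c *\<^sub>R p0) + c *\<^sub>R p) = p - p0" using c by (simp add: scaleR_diff_right)
  then have "p0 + (1 / c) *\<^sub>R (- (c *\<^sub>R p0) + c *\<^sub>R p) = p" by (simp only:) simp
  then show "F (p0 + (1 / c) *\<^sub>R (- (c *\<^sub>R p0) + c *\<^sub>R p)) * h (- (c *\<^sub>R p0) + c *\<^sub>R p)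
    = \<Phi> p * cnj (chirp e (\<lambda>x. g (c *\<^sub>R (x - fst p0))) (\<lambda>x. g (c *\<^sub>R (x - snd p0))) p)"
   by (simp add: F_def h_def chirp_def gr cis_cnj scaleR_diff_right mult_ac)
 qed
 finally have "(LINT p|lborel. \<Phi> p * cnj (chirp e (\<lambda>x. g (c *\<^sub>R (x - fst p0))) (\<lambda>x. g (c *\<^sub>R (x - snd p0))) p)) \<noteq> 0"
  using k by (auto simp: c_def)
 then show ?thesis using that[OF gc gc] gr by blast
qed

text \<open>With equal chirps in function and window the bilinear phases leave u \<bullet> v - (u -
  y) \<bullet> (v - \<eta>), which equals u \<bullet> \<eta> + y \<bullet> v - y \<bullet> \<eta>.
  No mixed term in u and v survives: the integral factorises and the frequencies are shifted by e
  \<eta> and e y.\<close>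

lemma stft_chirp:
 assumes A: "A \<in> schwartz" "B \<in> schwartz" and \<gamma>: "\<gamma>1 \<in> schwartz" "\<gamma>2 \<in> schwartz"
 shows "cmod (stft (chirp e \<gamma>1 \<gamma>2) (fun_distr (chirp e A B)) (y, \<eta>) (z1, z2))
  = cmod (stft \<gamma>1 (fun_distr A) y (z1 - e *\<^sub>R \<eta>)) * cmod (stft \<gamma>2 (fun_distr B) \<eta> (z2 - e *\<^sub>R y))"
proof -
 define a where "a u = A u * cnj (\<gamma>1 (u - y)) * cis (- (2 * pi) * (u \<bullet> (z1 - e *\<^sub>R \<eta>)))" for u
 define b where "b v = B v * cnj (\<gamma>2 (v - \<eta>)) * cis (- (2 * pi) * (v \<bullet> (z2 - e *\<^sub>R y)))" for v
 have ab: "a \<in> schwartz" "b \<in> schwartz" unfolding a_def b_def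
  by (intro schwartz_mult_slow schwartz_mult_cnj_shift A \<gamma> slow_cis_inner_const bounded_linear_ident)+
 have "stft (chirp e \<gamma>1 \<gamma>2) (fun_distr (chirp e A B)) (y, \<eta>) (z1, z2)
   = (LINT p|lborel. cis (- e * (2 * pi) * (y \<bullet> \<eta>)) * (a (fst p) * b (snd p)))"
  unfolding stft_fun_distr ft_def
 proof (rule Bochner_Integration.integral_cong[OF refl])
  fix p :: "'a \<times> 'a"
  obtain u v where p: "p = (u, v)" by force
  have "cis (e * (2 * pi) * (u \<bullet> v)) * cis (- (e * (2 * pi) * ((u - y) \<bullet> (v - \<eta>)))) * cis (- (2 * pi) * (u \<bullet> z1 + v \<bullet> z2))
    = cis (- e * (2 * pi) * (y \<bullet> \<eta>)) * (cis (- (2 * pi) * (u \<bullet> (z1 - e *\<^sub>R \<eta>))) * cis (- (2 * pi) * (v \<bullet> (z2 - e *\<^sub>R y))))"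
   unfolding cis_mult
   by (rule arg_cong[where f=cis]) (simp add: inner_diff_left inner_diff_right inner_commute algebra_simps)
  then have "(A u * B v * cnj (\<gamma>1 (u - y)) * cnj (\<gamma>2 (v - \<eta>))) * (cis (e * (2 * pi) * (u \<bullet> v)) * cis (- (e * (2 * pi) * ((u - y) \<bullet> (v - \<eta>)))) * cis (- (2 * pi) * (u \<bullet> z1 + v \<bullet> z2)))
    = (A u * B v * cnj (\<gamma>1 (u - y)) * cnj (\<gamma>2 (v - \<eta>))) * (cis (- e * (2 * pi) * (y \<bullet> \<eta>)) * (cis (- (2 * pi) * (u \<bullet> (z1 - e *\<^sub>R \<eta>))) * cis (- (2 * pi) * (v \<bullet> (z2 - e *\<^sub>R y)))))"
   by simp
  then show "chirp e A B p * cnj (chirp e \<gamma>1 \<gamma>2 (p - (y, \<eta>))) * cis (- (2 * pi) * (p \<bullet> (z1, z2)))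
    = cis (- e * (2 * pi) * (y \<bullet> \<eta>)) * (a (fst p) * b (snd p))"
   by (simp only: p chirp_def a_def b_def fst_conv snd_conv diff_Pair complex_cnj_mult cis_cnj inner_Pair mult_ac)
 qed
 also have "\<dots> = cis (- e * (2 * pi) * (y \<bullet> \<eta>)) * ((LINT u|lborel. a u) * (LINT v|lborel. b v))"
  using schwartz_Fubini(1)[OF schwartz_tensor[OF ab]] by simp
 finally show ?thesis by (simp add: norm_mult stft_fun_distr ft_def a_def b_def)
qed

text \<open>The Fourier transform rotates the time-frequency plane by a right angle. The
  multiplication formula moves it from g to the shifted window, and a unimodular factor disappears
  in the modulus.\<close>

lemma stft_ft:
 assumes g: "g \<in> schwartz" and \<gamma>: "\<gamma> \<in> schwartz" and r: "\<And>x. cnj (\<gamma> x) = \<gamma> x"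
 shows "cmod (stft \<gamma> (fun_distr (ft g)) \<eta> \<zeta>) = cmod (stft (\<lambda>x. cnj (ft \<gamma> x)) (fun_distr g) (- \<zeta>) \<eta>)"
proof -
 define h where "h v = cis (2 * pi * (v \<bullet> - \<zeta>)) * \<gamma> (v - \<eta>)" for v
 have h: "h \<in> schwartz" unfolding h_def by (rule schwartz_modulate_translate[OF \<gamma>])
 have fth: "ft h t = cis (2 * pi * (- \<eta> \<bullet> (t + \<zeta>))) * ft \<gamma> (t + \<zeta>)" for t
  unfolding h_def ft_modulate using ft_translate[OF \<gamma>, of "- \<eta>" "t - (- \<zeta>)"] by simp
 have "stft \<gamma> (fun_distr (ft g)) \<eta> \<zeta> = (LINT v|lborel. ft g v * h v)"
  unfolding stft_fun_distr ft_def[of "\<lambda>t. ft g t * cnj (\<gamma> (t - \<eta>))"] by (simp add: h_def r mult_ac)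
 also have "\<dots> = (LINT t|lborel. g t * ft h t)" by (rule ft_multiplication[OF g h])
 also have "\<dots> = (LINT t|lborel. cis (- (2 * pi) * (\<eta> \<bullet> \<zeta>)) * (g t * ft \<gamma> (t + \<zeta>) * cis (- (2 * pi) * (t \<bullet> \<eta>))))"
 proof (rule Bochner_Integration.integral_cong[OF refl])
  fix t
  have "cis (2 * pi * (- \<eta> \<bullet> (t + \<zeta>))) = cis (- (2 * pi) * (\<eta> \<bullet> \<zeta>)) * cis (- (2 * pi) * (t \<bullet> \<eta>))"
   unfolding cis_mult by (rule arg_cong[where f=cis]) (simp add: inner_add_right inner_commute algebra_simps)
  then show "g t * ft h t = cis (- (2 * pi) * (\<eta> \<bullet> \<zeta>)) * (g t * ft \<gamma> (t + \<zeta>) * cis (- (2 * pi) * (t \<bullet> \<eta>)))"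
   unfolding fth by (simp only: mult_ac)
 qed
 also have "\<dots> = cis (- (2 * pi) * (\<eta> \<bullet> \<zeta>)) * stft (\<lambda>x. cnj (ft \<gamma> x)) (fun_distr g) (- \<zeta>) \<eta>"
  unfolding stft_fun_distr ft_def[of "\<lambda>t. g t * cnj (cnj (ft \<gamma> (t - - \<zeta>)))"] by simp
 finally show ?thesis by (simp add: norm_mult)
qed

lemma stft_cnj:
 assumes r: "\<And>x. cnj (\<gamma> x) = \<gamma> x"
 shows "cmod (stft \<gamma> (fun_distr (\<lambda>x. cnj (g x))) \<eta> \<zeta>) = cmod (stft \<gamma> (fun_distr g) \<eta> (- \<zeta>))"
proof -
 have "stft \<gamma> (fun_distr (\<lambda>x. cnj (g x))) \<eta> \<zeta> = cnj (stft \<gamma> (fun_distr g) \<eta> (- \<zeta>))"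
  unfolding stft_fun_distr ft_def
  by (subst Bochner_Integration.integral_cnj[symmetric]) (simp add: r cis_cnj)
 then show ?thesis by simp
qed

text \<open>Provides measurability of the output transform, directly from the continuity of
  \<sigma>: the Wigner distribution of a time-frequency shift depends on the shift in a Schwartz way
  once the cutoff h is attached.\<close>

lemma OP_continuous:
 assumes \<sigma>: "\<sigma> \<in> tempered" and \<phi>: "\<phi> \<in> schwartz" and x0: "\<phi> x0 \<noteq> 0" and f: "f \<in> schwartz" and \<tau>: "\<tau> \<in> {0, 1}"
 shows "continuous_on UNIV (\<lambda>p. stft \<phi> (OP \<tau> \<sigma> f) (fst p) (snd p))"
proof (rule continuous_on_cutoff[OF \<phi> x0])
 fix h :: "'a \<times> 'a => complex" assume h: "h \<in> schwartz"
 define M where "M q = (\<lambda>t. cis (2 * pi * (t \<bullet> snd q)) * \<phi> (t - fst q))" for q :: "'a \<times> 'a"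
 have M: "M q \<in> schwartz" for q unfolding M_def by (rule schwartz_modulate_translate[OF \<phi>])
 define A where "A q = h (fst q) * M (fst q) (snd q)" for q
 have A: "A \<in> schwartz" unfolding A_def M_def by (rule schwartz_time_frequency[OF h \<phi>])
 have W: "wigner \<tau> (M q) f \<in> schwartz" for q
  using \<tau> by (auto simp: wigner_0[OF f] wigner_1[OF M] intro!: schwartz_chirp schwartz_ft schwartz_cnj f M)
 define F where "F q = h (fst q) * wigner \<tau> (M (fst q)) f (snd q)" for q
 have F: "F \<in> schwartz"
 proof -
  \<comment> \<open>Both cases are covered: for \<tau> = 0 the shift enters directly and f through
    its Fourier transform; for \<tau> = 1 the shift enters through a partial Fourier transform, with
    the two variables in exchanged roles.\<close>
  have chain: "(\<lambda>q. A' (fst q, L (snd q)) * B (L' (snd q)) * cis (c * (fst (snd q) \<bullet> snd (snd q)))) \<in> schwartz"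
   if A': "A' \<in> schwartz" and B: "B \<in> schwartz" and L: "(L = fst \<and> L' = snd) \<or> (L = snd \<and> L' = fst)"
   for A' :: "('a \<times> 'a) \<times> 'a => complex" and B :: "'a => complex" and L L' :: "'a \<times> 'a => 'a" and c
  proof -
   have bl: "bounded_linear L" "bounded_linear L'" using L bounded_linear_fst bounded_linear_snd by auto
   let ?T = "\<lambda>q :: ('a \<times> 'a) \<times> ('a \<times> 'a). ((fst q, L (snd q)), L' (snd q))"
   have "(\<lambda>q. (\<lambda>p. A' (fst p) * B (snd p)) (?T q)) \<in> schwartz"
   proof (rule schwartz_linear[OF schwartz_tensor[OF A' B], where L="?T" and K=1])
    show "bounded_linear ?T"
     by (intro bounded_linear_Pair bounded_linear_fst bounded_linear_compose[OF bl(1) bounded_linear_snd]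
       bounded_linear_compose[OF bl(2) bounded_linear_snd])
    show "norm q \<le> 1 * norm (?T q)" for q using L by (auto simp: norm_prod_def add_ac)
   qed
   from schwartz_mult_slow[OF this slow_cis_inner[OF bounded_linear_compose[OF bounded_linear_fst bounded_linear_snd]
     bounded_linear_compose[OF bounded_linear_snd bounded_linear_snd], of c]]
   show ?thesis by simp
  qed
  show ?thesis
  proof (cases "\<tau> = 0")
   case True
   have "F = (\<lambda>q. A (fst q, fst (snd q)) * cnj (ft f (snd (snd q))) * cis (- (2 * pi) * (fst (snd q) \<bullet> snd (snd q))))"
    by (rule ext) (simp add: F_def A_def True wigner_0[OF f] chirp_def)
   then show ?thesis using chain[OF A schwartz_cnj[OF schwartz_ft[OF f]], of fst snd "- (2 * pi)"] by simp
  next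
   case False
   then have \<tau>1: "\<tau> = 1" using \<tau> by simp
   have "ft2 A (q, v) = h q * ft (M q) v" for q v
    by (simp add: ft2_def A_def ft_def mult.assoc)
   then have "F = (\<lambda>q. ft2 A (fst q, snd (snd q)) * cnj (f (fst (snd q))) * cis (2 * pi * (fst (snd q) \<bullet> snd (snd q))))"
    by (intro ext) (simp add: F_def \<tau>1 wigner_1[OF M] chirp_def mult_ac)
   then show ?thesis using chain[OF schwartz_ft2[OF A] schwartz_cnj[OF f], of snd fst "2 * pi"] by simp
  qed
 qed
 have "\<sigma> (\<lambda>p. F (q, p)) = cnj (h q) * stft \<phi> (OP \<tau> \<sigma> f) (fst q) (snd q)" for q
  unfolding F_def fst_conv snd_conv tempered_cmult[OF \<sigma> W] by (simp add: stft_def OP_def M_def)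
 then show "continuous_on UNIV (\<lambda>p. cnj (h p) * stft \<phi> (OP \<tau> \<sigma> f) (fst p) (snd p))"
  using tempered_section_continuous(1)[OF \<sigma> F] by simp
qed

section \<open>Sufficiency\<close>

lemma modulation_norm_eq: "modulation_norm \<phi> p q (weight s t) u = wnorm p q s t (stft_abs \<phi> u)"
 unfolding modulation_norm_def wnorm_def mixed_norm_def weight_def stft_abs_def jp_def
 by (simp add: ennreal_mult)

lemma measurable_stft_tempered [measurable]:
 "u \<in> tempered ==> \<Phi> \<in> schwartz ==> stft_abs \<Phi> u \<in> \<B>"
 by (rule measurable_stft_abs[OF stft_continuous])

text \<open>The four variables, grouped as position and frequency of the symbol plane, are regrouped
  by components. One group will be the variable of the output and the other that of the
  input.\<close>

lemma nn_integral_quad: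
 fixes X :: "('a::euclidean_space \<times> 'a) \<times> ('a \<times> 'a) => ennreal"
 assumes [measurable]: "X \<in> \<B>"
 shows "(\<integral>p. X p) = (\<integral>v. \<integral>w. X ((fst v, fst w), (snd v, snd w)))"
proof -
 have 1: "(\<integral>z. X (\<zeta>, z)) = (\<integral>a. \<integral>b. X (\<zeta>, (a, b)))" for \<zeta>
  by (rule nn_integral_pair(1)) measurable
 have 2: "(\<integral>\<eta>. \<integral>a. \<integral>b. X ((y, \<eta>), (a, b)))
   = (\<integral>a. \<integral>\<eta>. \<integral>b. X ((y, \<eta>), (a, b)))" for y
 proof -
  have "(\<lambda>q. \<integral>b. X ((y, fst q), (snd q, b))) \<in> \<B>" by measurable
  from nn_integral_pair[OF this] show ?thesis by simp
 qed
 have 3: "(\<integral>w. X ((y, fst w), (a, snd w))) = (\<integral>\<eta>. \<integral>b. X ((y, \<eta>), (a, b)))" for y a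
 proof -
  have "(\<lambda>w. X ((y, fst w), (a, snd w))) \<in> \<B>" by measurable
  from nn_integral_pair(1)[OF this] show ?thesis by simp
 qed
 have "(\<integral>p. X p) = (\<integral>\<zeta>. \<integral>z. X (\<zeta>, z))"
  by (rule nn_integral_pair(1)) measurable
 also have "\<dots> = (\<integral>y. \<integral>\<eta>. \<integral>z. X ((y, \<eta>), z))"
  by (rule nn_integral_pair(1)) measurable
 also have "\<dots> = (\<integral>y. \<integral>a. \<integral>w. X ((y, fst w), (a, snd w)))"
  by (simp only: 1 2 3)
 also have "\<dots> = (\<integral>v. \<integral>w. X ((fst v, fst w), (snd v, snd w)))"
 proof -
  have "(\<lambda>v. \<integral>w. X ((fst v, fst w), (snd v, snd w))) \<in> \<B>" by measurable
  from nn_integral_pair(1)[OF this] show ?thesis by simp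
 qed
 finally show ?thesis .
qed

lemma conv_pairing:
 assumes [measurable]: "S \<in> \<B>" "F \<in> \<B>"
 shows "(\<integral>z. S z * conv N F z) = (\<integral>w. F w * conv N S w)"
proof -
 define J :: "'a \<times> 'a => 'a \<times> 'a => ennreal" where "J z w = jp (- N) (fst z - fst w) * jp (- N) (snd z - snd w)" for z w
 have [measurable]: "(\<lambda>p. J (fst p) (snd p)) \<in> \<B>" "J z \<in> \<B>" for z
  unfolding J_def[abs_def] by measurable
 have J: "J z w = J w z" for z w
  unfolding J_def jp_commute[of _ "fst z"] jp_commute[of _ "snd z"] ..
 have m: "(\<lambda>p. S (fst p) * (J (fst p) (snd p) * F (snd p))) \<in> \<B>" by measurable
 have "(\<integral>z. S z * conv N F z) = (\<integral>z. \<integral>w. S z * (J z w * F w))"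
  unfolding conv_def J_def[symmetric] by (intro nn_integral_cong nn_integral_cmult[symmetric]) measurable
 also have "\<dots> = (\<integral>w. \<integral>z. F w * (J w z * S z))"
  using nn_integral_pair[OF m] unfolding fst_conv snd_conv J[of "fst _"] by (simp only: J mult_ac)
 also have "\<dots> = (\<integral>w. F w * conv N S w)"
  unfolding conv_def J_def[symmetric] by (intro nn_integral_cong nn_integral_cmult) measurable
 finally show ?thesis .
qed

text \<open>The duality step: the smoothing is symmetric and moves to \<open>S\<close>, opposite
  weights are inserted, and Hoelder's inequality for mixed norms leaves the estimate
  \<open>C\<close> for the conjugate exponents and reciprocal weights.\<close>

lemma pairing_bound:
 assumes p: "1 \<le> p" "1 \<le> p'" "recip p' = 1 - recip p" and q: "1 \<le> q" "1 \<le> q'" "recip q' = 1 - recip q"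
  and C: "\<And>S A. S \<in> \<B> ==> slice g S A ==> wnorm p' q' (- s) (- t) (conv N S) \<le> C * A"
  and [measurable]: "S \<in> \<B>" "F \<in> \<B>" and A: "slice g S A"
 shows "(\<integral>z. S z * conv N F z) \<le> wnorm p q s t F * (C * A)"
proof -
 have one: "jp r x * jp (- r) x = 1" for r and x :: 'a by (simp add: jp_add[symmetric])
 have "F w * conv N S w = (F w * (jp s (fst w) * jp t (snd w))) * (conv N S w * (jp (- s) (fst w) * jp (- t) (snd w)))" for w
 proof -
  have "(F w * (jp s (fst w) * jp t (snd w))) * (conv N S w * (jp (- s) (fst w) * jp (- t) (snd w)))
    = F w * conv N S w * ((jp s (fst w) * jp (- s) (fst w)) * (jp t (snd w) * jp (- t) (snd w)))" by (simp only: mult_ac)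
  then show ?thesis by (simp add: one)
 qed
 then have "(\<integral>z. S z * conv N F z)
   = (\<integral>w. (F w * (jp s (fst w) * jp t (snd w))) * (conv N S w * (jp (- s) (fst w) * jp (- t) (snd w))))"
  by (simp add: conv_pairing)
 also have "\<dots> \<le> wnorm p q s t F * wnorm p' q' (- s) (- t) (conv N S)"
  unfolding wnorm_def by (rule mixed_Holder[OF p q]) measurable
 also have "\<dots> \<le> wnorm p q s t F * (C * A)" by (intro mult_left_mono C A) auto
 finally show ?thesis .
qed

lemma AE_lborel_dense:
 assumes ae: "AE x in lborel. P (x::'a::euclidean_space)" and e: "0 < e" obtains y where "dist y x < e" "P y"
proof -
 have "\<exists>y\<in>ball x e. P y"
 proof (rule ccontr)
  assume "\<not> ?thesis"
  with ae have "AE y in lborel. y \<notin> ball x e" by (auto elim: eventually_mono)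
  from emeasure_eq_0_AE[OF this] have "emeasure lborel (ball x e) = 0" by (simp add: ball_def)
  then show False using e unit_ball_vol_pos[of "real DIM('a)"] by (simp add: emeasure_ball)
 qed
 then show ?thesis using that by (auto simp: dist_commute)
qed

text \<open>By Fatou's lemma the essential bound over \<open>\<zeta>\<close> holds for every \<open>\<zeta>\<close>.\<close>

lemma wiener_amalgamD:
 assumes \<sigma>: "\<sigma> \<in> wiener_amalgam \<Phi> 1 \<infinity>" and \<Phi>: "\<Phi> \<in> schwartz"
 obtains A where "A < top" "\<And>\<zeta>. (\<integral>z. stft_abs \<Phi> \<sigma> (\<zeta>, z)) \<le> A"
proof -
 have t: "\<sigma> \<in> tempered" using \<sigma> by (simp add: wiener_amalgam_def)
 note [measurable] = measurable_stft_tempered[OF t \<Phi>]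
 define I where "I \<zeta> = (\<integral>z. stft_abs \<Phi> \<sigma> (\<zeta>, z))" for \<zeta>
 have "(\<integral>z. stft_abs \<Phi> \<sigma> (\<zeta>, - z)) = I \<zeta>" for \<zeta>
  unfolding I_def using nn_integral_lborel_reflect[of "\<lambda>z. stft_abs \<Phi> \<sigma> (\<zeta>, z)" 0] by simp
 then have fin: "esssup lborel I < top"
  using \<sigma> unfolding wiener_amalgam_def wiener_amalgam_norm_def Lp_norm_top Lp_norm_1 stft_abs_def by simp
 have "I \<zeta> \<le> esssup lborel I" for \<zeta>
 proof -
  have "\<exists>y. dist y \<zeta> < 1 / real (Suc n) \<and> I y \<le> esssup lborel I" for n
   using AE_lborel_dense[OF esssup_AE[of I lborel], of "1 / real (Suc n)" \<zeta>] by auto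
  then obtain y where y: "\<And>n. dist (y n) \<zeta> < 1 / real (Suc n)" "\<And>n. I (y n) \<le> esssup lborel I" by metis
  have y\<zeta>: "y \<longlonglongrightarrow> \<zeta>"
   by (rule tendsto_dist_iff[THEN iffD2], rule tendsto_sandwich[OF _ _ tendsto_const LIMSEQ_Suc[OF lim_1_over_n]])
    (auto intro!: always_eventually less_imp_le y(1) simp del: of_nat_Suc)
  have "(\<lambda>n. stft_abs \<Phi> \<sigma> (y n, z)) \<longlonglongrightarrow> stft_abs \<Phi> \<sigma> (\<zeta>, z)" for z
  proof -
   have "continuous_on UNIV (\<lambda>x. stft \<Phi> \<sigma> x z)"
    using continuous_on_compose2[OF stft_continuous[OF t \<Phi>], of UNIV "\<lambda>x. (x, z)"] by (simp add: continuous_intros)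
   from continuous_on_tendsto_compose[OF this y\<zeta>]
   show ?thesis unfolding stft_abs_def by (intro tendsto_ennrealI tendsto_norm) simp
  qed
  then have "I \<zeta> = (\<integral>z. liminf (\<lambda>n. stft_abs \<Phi> \<sigma> (y n, z)))"
   unfolding I_def by (intro nn_integral_cong lim_imp_Liminf[symmetric]) auto
  also have "\<dots> \<le> liminf (\<lambda>n. I (y n))" unfolding I_def by (rule nn_integral_liminf) measurable
  also have "\<dots> \<le> esssup lborel I"
   by (rule order_trans[OF Liminf_le_Limsup]) (auto intro!: Limsup_bounded always_eventually y(2))
  finally show ?thesis .
 qed
 then show ?thesis using that[OF fin] by (simp add: I_def)
qed

text \<open>The substitution turns the argument \<open>z\<close> of the short-time Fourier transform of the symbol into the
 variables in which that of a Wigner distribution separates.\<close>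

lemma symbol_kernel:
 assumes \<Phi>: "\<Phi> \<in> schwartz" "\<Gamma> \<in> schwartz" "(LINT p|lborel. \<Phi> p * cnj (\<Gamma> p)) \<noteq> 0" and \<sigma>: "\<sigma> \<in> tempered"
  and A: "\<And>\<zeta>. (\<integral>z. stft_abs \<Phi> \<sigma> (\<zeta>, z)) \<le> A" and e: "e \<in> {1, - 1}"
 obtains C T where "C < top" "T \<in> \<B>" "\<And>\<zeta>. (\<integral>u. T (\<zeta>, u)) \<le> A"
  "\<forall>W\<in>schwartz. \<forall>K\<in>borel_measurable borel.
   (\<forall>\<zeta> z. stft_abs \<Gamma> (fun_distr W) (\<zeta>, z) \<le> K (\<zeta>, prod.swap \<zeta> - e *\<^sub>R z)) \<longrightarrow>
   ennreal (cmod (\<sigma> W)) \<le> C * (\<integral>p. K p * T p)"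
proof -
 obtain C where C: "C > 0" "\<And>\<Psi>. \<Psi> \<in> schwartz ==>
  ennreal (cmod (\<sigma> \<Psi>)) \<le> ennreal C * (\<integral>p. stft_abs \<Gamma> (fun_distr \<Psi>) p * stft_abs \<Phi> \<sigma> p)"
  using stft_inversion_norm[OF \<Phi>] \<sigma> by metis
 define Sg where "Sg = stft_abs \<Phi> \<sigma>"
 have [measurable]: "Sg \<in> \<B>" unfolding Sg_def by (rule measurable_stft_tempered[OF \<sigma> \<Phi>(1)])
 \<comment> \<open>The substitution is u = swap \<zeta> - e z; as e^2 = 1, its inverse is z = e
   (swap \<zeta> - u).\<close>
 define T where "T p = Sg (fst p, e *\<^sub>R (prod.swap (fst p) - snd p))" for p
 have [measurable]: "T \<in> \<B>" unfolding T_def[abs_def] by measurable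
 have inv: "(\<integral>u. h (e *\<^sub>R (c - u))) = (\<integral>z. h z)"
  if h: "h \<in> \<B>" for h and c :: "'a \<times> 'a"
  using e nn_integral_lborel_reflect[OF h, of c] nn_integral_lborel_shift[OF h, of "- c"] by auto
 show ?thesis
 proof (rule that[of "ennreal C" T])
  show "(\<integral>u. T (\<zeta>, u)) \<le> A" for \<zeta> using A[of \<zeta>, folded Sg_def] inv[of "\<lambda>z. Sg (\<zeta>, z)" "prod.swap \<zeta>"] by (simp add: T_def)
  show "\<forall>W\<in>schwartz. \<forall>K\<in>borel_measurable borel.
   (\<forall>\<zeta> z. stft_abs \<Gamma> (fun_distr W) (\<zeta>, z) \<le> K (\<zeta>, prod.swap \<zeta> - e *\<^sub>R z)) \<longrightarrow>
   ennreal (cmod (\<sigma> W)) \<le> C * (\<integral>p. K p * T p)"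
  proof (intro ballI impI)
  fix W :: "'a \<times> 'a => complex" and K assume W: "W \<in> schwartz" and [measurable]: "K \<in> \<B>"
   and K: "\<forall>\<zeta> z. stft_abs \<Gamma> (fun_distr W) (\<zeta>, z) \<le> K (\<zeta>, prod.swap \<zeta> - e *\<^sub>R z)"
  note [measurable] = measurable_stft_tempered[OF tempered_fun_distr_schwartz[OF W] \<Phi>(2)]
  have ee: "e * e = 1" using e by auto
  have "(\<integral>p. stft_abs \<Gamma> (fun_distr W) p * Sg p) = (\<integral>\<zeta>. \<integral>z. stft_abs \<Gamma> (fun_distr W) (\<zeta>, z) * Sg (\<zeta>, z))"
   by (rule nn_integral_pair(1)) measurable
  also have "\<dots> \<le> (\<integral>\<zeta>. \<integral>z. K (\<zeta>, prod.swap \<zeta> - e *\<^sub>R z) * Sg (\<zeta>, z))"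
   by (intro nn_integral_mono mult_right_mono K[rule_format]) simp
  also have "\<dots> = (\<integral>\<zeta>. \<integral>u. K (\<zeta>, u) * T (\<zeta>, u))"
  proof (rule nn_integral_cong)
   fix \<zeta> show "(\<integral>z. K (\<zeta>, prod.swap \<zeta> - e *\<^sub>R z) * Sg (\<zeta>, z)) = (\<integral>u. K (\<zeta>, u) * T (\<zeta>, u))"
    using inv[of "\<lambda>z. K (\<zeta>, prod.swap \<zeta> - e *\<^sub>R z) * Sg (\<zeta>, z)" "prod.swap \<zeta>"] by (simp add: T_def ee)
  qed
  also have "\<dots> = (\<integral>p. K p * T p)" by (rule nn_integral_pair(1)[symmetric]) measurable
  finally show "ennreal (cmod (\<sigma> W)) \<le> ennreal C * (\<integral>p. K p * T p)"
   by (intro order_trans[OF C(2)[OF W]] mult_left_mono) (simp_all add: Sg_def)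
  qed
 qed simp_all
qed

text \<open>Integrating out the components that belong to the input gives \<open>H\<close>. At a
  fixed output position the output frequency is one half of the variable u in which \<open>T\<close>
  is integrable, and the other half is the input position; so the slice of \<open>H\<close> is a
  pairing of \<open>F\<close> with a function whose slices in the exchanged direction are
  bounded.\<close>

lemma kernel_duality_0:
 fixes T :: "('a::euclidean_space \<times> 'a) \<times> ('a \<times> 'a) => ennreal" and F :: "'a \<times> 'a => ennreal"
 assumes [measurable]: "T \<in> \<B>" "F \<in> \<B>"
  and A: "\<And>\<zeta>. (\<integral>u. T (\<zeta>, u)) \<le> A"
  and B: "\<And>S. S \<in> \<B> ==> slice prod.swap S A ==> (\<integral>w. S w * F w) \<le> B"
 obtains H where "H \<in> \<B>" "slice id H B"
  "\<And>x \<xi>. (\<integral>p. jp (- N) (x - fst (fst p)) * jp (- N) (\<xi> - fst (snd p)) * F (snd (snd p), snd (fst p)) * T p) = conv N H (x, \<xi>)"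
proof -
 define H where "H v = (\<integral>w. T ((fst v, fst w), (snd v, snd w)) * F (prod.swap w))" for v
 have [measurable]: "H \<in> \<B>" unfolding H_def[abs_def] by measurable
 have "(\<integral>\<gamma>. H (\<alpha>, \<gamma>)) \<le> B" for \<alpha>
 proof -
  \<comment> \<open>At fixed \<alpha> and fixed \<open>snd w\<close>, integrating over the first
    component of w together with \<gamma> exhausts the variable u of \<open>T\<close>, which gives
    the bound \<open>A\<close>.\<close>
  define S where "S w = (\<integral>\<gamma>. T ((\<alpha>, snd w), (\<gamma>, fst w)))" for w
  have [measurable]: "S \<in> \<B>" unfolding S_def[abs_def] by measurable
  have "(\<integral>\<eta>. \<integral>\<gamma>. T ((\<alpha>, y), (\<gamma>, \<eta>))) = (\<integral>z. T ((\<alpha>, y), z))" for y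
   by (rule nn_integral_pair(2)[symmetric]) measurable
  then have "slice prod.swap S A" using A by (simp add: slice_def S_def)
  then have "(\<integral>w. S w * F w) \<le> B" by (intro B) measurable
  moreover have "(\<integral>\<gamma>. H (\<alpha>, \<gamma>)) = (\<integral>w. S (prod.swap w) * F (prod.swap w))"
   using nn_integral_pair[of "\<lambda>q. T ((\<alpha>, fst (snd q)), (fst q, snd (snd q))) * F (prod.swap (snd q))"]
   by (simp add: H_def S_def nn_integral_multc)
  ultimately show ?thesis using nn_integral_swap[of "\<lambda>w. S w * F w"] by simp
 qed
 then have "slice id H B" by (simp add: slice_def)
 moreover have "(\<integral>p. jp (- N) (x - fst (fst p)) * jp (- N) (\<xi> - fst (snd p)) * F (snd (snd p), snd (fst p)) * T p) = conv N H (x, \<xi>)" for x \<xi>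
  by (subst nn_integral_quad) (simp_all add: conv_def H_def nn_integral_cmult[symmetric] mult_ac prod.swap_def)
 ultimately show ?thesis by (intro that[of H]) auto
qed

text \<open>Exchanging the components of both pairs reduces this to the previous case, with
  \<open>F\<close> and \<open>H\<close> read in exchanged variables.\<close>

lemma kernel_duality_1:
 fixes T :: "('a::euclidean_space \<times> 'a) \<times> ('a \<times> 'a) => ennreal" and F :: "'a \<times> 'a => ennreal"
 assumes T[measurable]: "T \<in> \<B>" "F \<in> \<B>"
  and A: "\<And>\<zeta>. (\<integral>u. T (\<zeta>, u)) \<le> A"
  and B: "\<And>S. S \<in> \<B> ==> slice id S A ==> (\<integral>w. S w * F w) \<le> B"
 obtains H where "H \<in> \<B>" "slice prod.swap H B"
  "\<And>x \<xi>. (\<integral>p. jp (- N) (x - snd (snd p)) * jp (- N) (\<xi> - snd (fst p)) * F (fst (fst p), fst (snd p)) * T p) = conv N H (x, \<xi>)"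
proof -
 define T' where "T' p = T (prod.swap (fst p), prod.swap (snd p))" for p
 have T'[measurable]: "T' \<in> \<B>" unfolding T'_def[abs_def] by measurable
 have sw: "(\<integral>p. X (prod.swap (fst p), prod.swap (snd p))) = (\<integral>p. X p)"
  if [measurable]: "X \<in> \<B>" for X :: "('a \<times> 'a) \<times> ('a \<times> 'a) => ennreal"
 proof -
  have "(\<integral>p. X (prod.swap (fst p), prod.swap (snd p))) = (\<integral>\<zeta>. \<integral>z. X (prod.swap \<zeta>, z))"
   using nn_integral_swap[of "\<lambda>z. X (prod.swap _, z)"] by (simp add: nn_integral_pair(1))
  then show ?thesis using nn_integral_swap[of "\<lambda>\<zeta>. \<integral>z. X (\<zeta>, z)"] by (simp add: nn_integral_pair(1))
 qed
 have A': "(\<integral>u. T' (\<zeta>, u)) \<le> A" for \<zeta>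
  using A nn_integral_swap[of "\<lambda>u. T (prod.swap \<zeta>, u)"] by (simp add: T'_def)
 have B': "(\<integral>w. S w * F (prod.swap w)) \<le> B" if [measurable]: "S \<in> \<B>" and "slice prod.swap S A" for S
  using B[of "\<lambda>w. S (prod.swap w)"] that(2) nn_integral_swap[of "\<lambda>w. S (prod.swap w) * F w"] by (simp add: slice_def)
 obtain H where [measurable]: "H \<in> \<B>" and H: "slice id H B"
  "\<And>x \<xi>. (\<integral>p. jp (- N) (x - fst (fst p)) * jp (- N) (\<xi> - fst (snd p)) * F (prod.swap (snd (snd p), snd (fst p))) * T' p) = conv N H (x, \<xi>)"
  by (rule kernel_duality_0[OF T' _ A' B', where N=N]) (measurable, assumption, assumption, rule that)
 show ?thesis
 proof (rule that[of "\<lambda>w. H (prod.swap w)"])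
  show "slice prod.swap (\<lambda>w. H (prod.swap w)) B" using H(1) by (simp add: slice_def)
  fix x \<xi>
  have "(\<integral>p. jp (- N) (x - snd (snd p)) * jp (- N) (\<xi> - snd (fst p)) * F (fst (fst p), fst (snd p)) * T p) = conv N H (\<xi>, x)"
   unfolding H(2)[symmetric] T'_def by (subst sw[symmetric]) (simp_all add: mult_ac)
  then show "(\<integral>p. jp (- N) (x - snd (snd p)) * jp (- N) (\<xi> - snd (fst p)) * F (fst (fst p), fst (snd p)) * T p)
    = conv N (\<lambda>w. H (prod.swap w)) (x, \<xi>)" using conv_swap[of H N "(\<xi>, x)"] by simp
 qed measurable
qed

text \<open>The short-time Fourier transform of \<open>OP \<tau> \<sigma> f\<close> is dominated by a smoothing of some \<open>H\<close> whose slice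
 integrals are controlled by a pairing of that of \<open>f\<close> with functions \<open>S\<close> with bounded slice integrals.\<close>

definition OP_dominated
 where "OP_dominated \<tau> go gi \<phi> \<sigma> A N \<longleftrightarrow> (\<exists>C<top. \<exists>\<theta>\<in>schwartz. \<forall>f\<in>schwartz. \<forall>B.
  (\<forall>S\<in>borel_measurable borel. slice gi S A \<longrightarrow> (\<integral>w. S w * stft_abs \<theta> (fun_distr f) w) \<le> B) \<longrightarrow>
  (\<exists>H\<in>borel_measurable borel. slice go H B \<and> (\<forall>z. stft_abs \<phi> (OP \<tau> \<sigma> f) z \<le> C * conv N H z)))"

text \<open>The transform of the Wigner distribution is a product of two. The factor with the test
  window is localised at (x, \<xi>) and becomes the smoothing kernel, the other one is that of f
  with the window \<theta>. The variable u consists of the output frequency and the input position,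
  which decides the two slice directions.\<close>

lemma OP_dominated_0:
 assumes \<phi>: "\<phi> \<in> schwartz" and x0: "\<phi> x0 \<noteq> 0" and \<Phi>: "\<Phi> \<in> schwartz" and p0: "\<Phi> p0 \<noteq> 0"
  and \<sigma>: "\<sigma> \<in> tempered" and A: "\<And>\<zeta>. (\<integral>z. stft_abs \<Phi> \<sigma> (\<zeta>, z)) \<le> A"
 shows "OP_dominated 0 id prod.swap \<phi> \<sigma> A N"
proof -
 obtain \<gamma>1 \<gamma>2 :: "'a => complex" where \<gamma>: "\<gamma>1 \<in> schwartz" "\<gamma>2 \<in> schwartz"
  and \<gamma>r: "\<And>x. cnj (\<gamma>1 x) = \<gamma>1 x" "\<And>x. cnj (\<gamma>2 x) = \<gamma>2 x"
  and nz: "(LINT p|lborel. \<Phi> p * cnj (chirp (- 1) \<gamma>1 \<gamma>2 p)) \<noteq> 0"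
  by (rule chirp_window[OF \<Phi> p0 \<phi> x0, where e="- 1"]) (rule that)
 obtain C T where C: "C < top" and T[measurable]: "T \<in> \<B>" and TA: "\<And>\<zeta>. (\<integral>u. T (\<zeta>, u)) \<le> A"
  and WK: "\<forall>W\<in>schwartz. \<forall>K\<in>borel_measurable borel.
   (\<forall>\<zeta> z. stft_abs (chirp (- 1) \<gamma>1 \<gamma>2) (fun_distr W) (\<zeta>, z) \<le> K (\<zeta>, prod.swap \<zeta> - (- 1) *\<^sub>R z)) \<longrightarrow>
   ennreal (cmod (\<sigma> W)) \<le> C * (\<integral>p. K p * T p)"
  by (rule symbol_kernel[OF \<Phi> schwartz_chirp[OF \<gamma>] nz \<sigma> A, where e="- 1"]) (simp, rule that)
 obtain D where D: "D \<ge> 0" "\<And>x \<xi>. ennreal (cmod (stft \<gamma>1 (fun_distr \<phi>) x \<xi>)) \<le> ennreal D * (jp (- N) x * jp (- N) \<xi>)"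
  by (rule stft_jp_bound[OF \<phi> \<gamma>(1), where N=N]) (rule that)
 define \<theta> where "\<theta> = (\<lambda>x. cnj (ft \<gamma>2 x))"
 have \<theta>: "\<theta> \<in> schwartz" unfolding \<theta>_def by (intro schwartz_cnj schwartz_ft \<gamma>)
 show ?thesis
  unfolding OP_dominated_def
 proof (intro exI[of _ "C * ennreal D"] conjI bexI[OF _ \<theta>] ballI allI impI)
  show "C * ennreal D < top" using C by (simp add: ennreal_mult_less_top)
  fix f B assume f: "f \<in> schwartz" and B: "\<forall>S\<in>borel_measurable borel. slice prod.swap S A \<longrightarrow>
   (\<integral>w. S w * stft_abs \<theta> (fun_distr f) w) \<le> B"
  define F where "F = stft_abs \<theta> (fun_distr f)"
  have F[measurable]: "F \<in> \<B>"
   unfolding F_def by (rule measurable_stft_tempered[OF tempered_fun_distr_schwartz[OF f] \<theta>])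
  have BF: "(\<integral>w. S w * F w) \<le> B" if "S \<in> \<B>" "slice prod.swap S A" for S
   using B that by (simp add: F_def)
  obtain H where H: "H \<in> \<B>" "slice id H B" and HN:
   "\<And>x \<xi>. (\<integral>p. jp (- N) (x - fst (fst p)) * jp (- N) (\<xi> - fst (snd p)) * F (snd (snd p), snd (fst p)) * T p) = conv N H (x, \<xi>)"
   by (rule kernel_duality_0[OF T F TA BF]) (assumption, assumption, rule that)
  have "stft_abs \<phi> (OP 0 \<sigma> f) (x, \<xi>) \<le> C * ennreal D * conv N H (x, \<xi>)" for x \<xi>
  proof -
   define M where "M = (\<lambda>t. cis (2 * pi * (t \<bullet> \<xi>)) * \<phi> (t - x))"
   have M: "M \<in> schwartz" unfolding M_def by (rule schwartz_modulate_translate[OF \<phi>])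
   define K where "K p = jp (- N) (x - fst (fst p)) * jp (- N) (\<xi> - fst (snd p)) * F (snd (snd p), snd (fst p))" for p :: "('a \<times> 'a) \<times> 'a \<times> 'a"
   have [measurable]: "K \<in> \<B>" unfolding K_def[abs_def] by measurable
   have W: "wigner 0 M f \<in> schwartz"
    unfolding wigner_0[OF f] by (intro schwartz_chirp M schwartz_cnj schwartz_ft f)
   have le: "stft_abs (chirp (- 1) \<gamma>1 \<gamma>2) (fun_distr (wigner 0 M f)) (\<zeta>, z) \<le> ennreal D * K (\<zeta>, prod.swap \<zeta> - (- 1) *\<^sub>R z)" for \<zeta> z
   proof -
    obtain y \<eta> z1 z2 where z: "\<zeta> = (y, \<eta>)" "z = (z1, z2)" by (metis surj_pair)
    have "stft_abs (chirp (- 1) \<gamma>1 \<gamma>2) (fun_distr (wigner 0 M f)) (\<zeta>, z)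
      = ennreal (cmod (stft \<gamma>1 (fun_distr \<phi>) (y - x) (z1 + \<eta> - \<xi>)) * cmod (stft \<theta> (fun_distr f) (z2 + y) \<eta>))"
     unfolding stft_abs_def z fst_conv snd_conv wigner_0[OF f]
      stft_chirp[OF M schwartz_cnj[OF schwartz_ft[OF f]] \<gamma>]
      stft_cnj[OF \<gamma>r(2)] stft_ft[OF f \<gamma>(2) \<gamma>r(2)] \<theta>_def
     unfolding M_def norm_stft_modulate_translate[OF \<phi> \<gamma>(1)] by (simp add: add.commute)
    also have "\<dots> \<le> (ennreal D * (jp (- N) (y - x) * jp (- N) (z1 + \<eta> - \<xi>))) * F (z2 + y, \<eta>)"
     unfolding F_def stft_abs_def fst_conv snd_conv by (simp add: ennreal_mult mult_right_mono D)
    finally show ?thesis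
     by (simp add: K_def z jp_commute[of _ y x] jp_commute[of _ _ \<xi>] mult_ac add_ac)
   qed
   have "stft_abs \<phi> (OP 0 \<sigma> f) (x, \<xi>) = ennreal (cmod (\<sigma> (wigner 0 M f)))"
    by (simp add: stft_abs_def stft_def OP_def M_def)
   also have "\<dots> \<le> C * (\<integral>p. ennreal D * K p * T p)" by (rule WK[rule_format, OF W _ le]) measurable
   also have "(\<integral>p. ennreal D * K p * T p) = ennreal D * conv N H (x, \<xi>)"
    unfolding HN[symmetric] K_def[symmetric] by (subst nn_integral_cmult[symmetric]) (simp_all add: mult.assoc)
   finally show ?thesis by (simp only: mult.assoc)
  qed
  then show "\<exists>H\<in>borel_measurable borel. slice id H B \<and> (\<forall>z. stft_abs \<phi> (OP 0 \<sigma> f) z \<le> C * ennreal D * conv N H z)"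
   using H by (intro bexI[of _ H]) auto
 qed
qed

text \<open>Here u consists of the input frequency and the output position, so both slice directions
  are exchanged in comparison with the other case.\<close>

lemma OP_dominated_1:
 assumes \<phi>: "\<phi> \<in> schwartz" and x0: "\<phi> x0 \<noteq> 0" and \<Phi>: "\<Phi> \<in> schwartz" and p0: "\<Phi> p0 \<noteq> 0"
  and \<sigma>: "\<sigma> \<in> tempered" and A: "\<And>\<zeta>. (\<integral>z. stft_abs \<Phi> \<sigma> (\<zeta>, z)) \<le> A"
 shows "OP_dominated 1 prod.swap id \<phi> \<sigma> A N"
proof -
 obtain \<gamma>1 \<gamma>2 :: "'a => complex" where \<gamma>: "\<gamma>1 \<in> schwartz" "\<gamma>2 \<in> schwartz"
  and \<gamma>r: "\<And>x. cnj (\<gamma>1 x) = \<gamma>1 x" "\<And>x. cnj (\<gamma>2 x) = \<gamma>2 x"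
  and nz: "(LINT p|lborel. \<Phi> p * cnj (chirp 1 \<gamma>1 \<gamma>2 p)) \<noteq> 0"
  by (rule chirp_window[OF \<Phi> p0 \<phi> x0, where e=1]) (rule that)
 obtain C T where C: "C < top" and T[measurable]: "T \<in> \<B>" and TA: "\<And>\<zeta>. (\<integral>u. T (\<zeta>, u)) \<le> A"
  and WK: "\<forall>W\<in>schwartz. \<forall>K\<in>borel_measurable borel.
   (\<forall>\<zeta> z. stft_abs (chirp 1 \<gamma>1 \<gamma>2) (fun_distr W) (\<zeta>, z) \<le> K (\<zeta>, prod.swap \<zeta> - 1 *\<^sub>R z)) \<longrightarrow>
   ennreal (cmod (\<sigma> W)) \<le> C * (\<integral>p. K p * T p)"
  by (rule symbol_kernel[OF \<Phi> schwartz_chirp[OF \<gamma>] nz \<sigma> A, where e=1]) (simp, rule that)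
 define \<theta> where "\<theta> = (\<lambda>x. cnj (ft \<gamma>2 x))"
 have \<theta>: "\<theta> \<in> schwartz" unfolding \<theta>_def by (intro schwartz_cnj schwartz_ft \<gamma>)
 obtain D where D: "D \<ge> 0" "\<And>x \<xi>. ennreal (cmod (stft \<theta> (fun_distr \<phi>) x \<xi>)) \<le> ennreal D * (jp (- N) x * jp (- N) \<xi>)"
  by (rule stft_jp_bound[OF \<phi> \<theta>, where N=N]) (rule that)
 show ?thesis
  unfolding OP_dominated_def
 proof (intro exI[of _ "C * ennreal D"] conjI bexI[OF _ \<gamma>(1)] ballI allI impI)
  show "C * ennreal D < top" using C by (simp add: ennreal_mult_less_top)
  fix f B assume f: "f \<in> schwartz" and B: "\<forall>S\<in>borel_measurable borel. slice id S A \<longrightarrow>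
   (\<integral>w. S w * stft_abs \<gamma>1 (fun_distr f) w) \<le> B"
  define F where "F = stft_abs \<gamma>1 (fun_distr f)"
  have F[measurable]: "F \<in> \<B>"
   unfolding F_def by (rule measurable_stft_tempered[OF tempered_fun_distr_schwartz[OF f] \<gamma>(1)])
  have BF: "(\<integral>w. S w * F w) \<le> B" if "S \<in> \<B>" "slice id S A" for S
   using B that by (simp add: F_def)
  obtain H where H: "H \<in> \<B>" "slice prod.swap H B" and HN:
   "\<And>x \<xi>. (\<integral>p. jp (- N) (x - snd (snd p)) * jp (- N) (\<xi> - snd (fst p)) * F (fst (fst p), fst (snd p)) * T p) = conv N H (x, \<xi>)"
   by (rule kernel_duality_1[OF T F TA BF]) (assumption, assumption, rule that)
  have "stft_abs \<phi> (OP 1 \<sigma> f) (x, \<xi>) \<le> C * ennreal D * conv N H (x, \<xi>)" for x \<xi>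
  proof -
   define M where "M = (\<lambda>t. cis (2 * pi * (t \<bullet> \<xi>)) * \<phi> (t - x))"
   have M: "M \<in> schwartz" unfolding M_def by (rule schwartz_modulate_translate[OF \<phi>])
   define K where "K p = jp (- N) (x - snd (snd p)) * jp (- N) (\<xi> - snd (fst p)) * F (fst (fst p), fst (snd p))" for p :: "('a \<times> 'a) \<times> 'a \<times> 'a"
   have [measurable]: "K \<in> \<B>" unfolding K_def[abs_def] by measurable
   have W: "wigner 1 M f \<in> schwartz"
    unfolding wigner_1[OF M] by (intro schwartz_chirp M schwartz_cnj schwartz_ft f)
   have le: "stft_abs (chirp 1 \<gamma>1 \<gamma>2) (fun_distr (wigner 1 M f)) (\<zeta>, z) \<le> ennreal D * K (\<zeta>, prod.swap \<zeta> - 1 *\<^sub>R z)" for \<zeta> z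
   proof -
    obtain y \<eta> z1 z2 where z: "\<zeta> = (y, \<eta>)" "z = (z1, z2)" by (metis surj_pair)
    have "stft_abs (chirp 1 \<gamma>1 \<gamma>2) (fun_distr (wigner 1 M f)) (\<zeta>, z)
      = ennreal (cmod (stft \<gamma>1 (fun_distr f) y (\<eta> - z1)) * cmod (stft \<theta> (fun_distr \<phi>) (y - z2 - x) (\<eta> - \<xi>)))"
     unfolding stft_abs_def z fst_conv snd_conv wigner_1[OF M]
      stft_chirp[OF schwartz_cnj[OF f] schwartz_ft[OF M] \<gamma>]
      stft_cnj[OF \<gamma>r(1)] stft_ft[OF M \<gamma>(2) \<gamma>r(2)] \<theta>_def[symmetric]
     unfolding M_def norm_stft_modulate_translate[OF \<phi> \<theta>] by simp
    also have "\<dots> \<le> F (y, \<eta> - z1) * (ennreal D * (jp (- N) (y - z2 - x) * jp (- N) (\<eta> - \<xi>)))"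
     unfolding F_def stft_abs_def fst_conv snd_conv by (simp add: ennreal_mult mult_left_mono D)
    finally show ?thesis
     by (simp add: K_def z jp_commute[of _ x] jp_commute[of _ \<xi>] mult_ac)
   qed
   have "stft_abs \<phi> (OP 1 \<sigma> f) (x, \<xi>) = ennreal (cmod (\<sigma> (wigner 1 M f)))"
    by (simp add: stft_abs_def stft_def OP_def M_def)
   also have "\<dots> \<le> C * (\<integral>p. ennreal D * K p * T p)" by (rule WK[rule_format, OF W _ le]) measurable
   also have "(\<integral>p. ennreal D * K p * T p) = ennreal D * conv N H (x, \<xi>)"
    unfolding HN[symmetric] K_def[symmetric] by (subst nn_integral_cmult[symmetric]) (simp_all add: mult.assoc)
   finally show ?thesis by (simp only: mult.assoc)
  qed
  then show "\<exists>H\<in>borel_measurable borel. slice prod.swap H B \<and> (\<forall>z. stft_abs \<phi> (OP 1 \<sigma> f) z \<le> C * ennreal D * conv N H z)"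
   using H by (intro bexI[of _ H]) auto
 qed
qed

text \<open>By duality \<open>inp\<close> bounds the pairings of the input with functions of bounded
  slices; \<open>dom\<close> converts this into a bound on the slices of \<open>H\<close>, whose
  smoothing is estimated by \<open>out\<close>. The window \<theta> of the domination is exchanged
  for \<phi> at the price of another smoothing.\<close>

lemma OP_boundedI:
 assumes \<phi>: "\<phi> \<in> schwartz" and x0: "\<phi> x0 \<noteq> 0" and \<Phi>: "\<Phi> \<in> schwartz" and \<tau>: "\<tau> \<in> {0, 1}"
  and pq: "1 \<le> p1" "1 \<le> q1" "1 \<le> p2" "1 \<le> q2"
  and p': "1 \<le> p'" "recip p' = 1 - recip p1" and q': "1 \<le> q'" "recip q' = 1 - recip q1"
  and out: "conv_bounded go p2 q2 s2 t2" and inp: "conv_bounded gi p' q' (- s1) (- t1)"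
  and dom: "\<And>\<sigma> A N. \<sigma> \<in> tempered ==> (\<And>\<zeta>. (\<integral>z. stft_abs \<Phi> \<sigma> (\<zeta>, z)) \<le> A) ==>
   OP_dominated \<tau> go gi \<phi> \<sigma> A N"
 shows "OP_bounded \<tau> (wiener_amalgam \<Phi> 1 \<infinity>) \<phi> p1 q1 (weight s1 t1) p2 q2 (weight s2 t2)"
 unfolding OP_bounded_def modulation_norm_eq
proof
 fix \<sigma> assume \<sigma>W: "\<sigma> \<in> wiener_amalgam \<Phi> 1 \<infinity>"
 then have \<sigma>: "\<sigma> \<in> tempered" by (simp add: wiener_amalgam_def)
 obtain A where A: "A < top" "\<And>\<zeta>. (\<integral>z. stft_abs \<Phi> \<sigma> (\<zeta>, z)) \<le> A"
  by (rule wiener_amalgamD[OF \<sigma>W \<Phi>]) (rule that)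
 obtain L1 where L1: "\<And>N. L1 \<le> N ==> \<exists>C<top. \<forall>S\<in>borel_measurable borel. \<forall>A. slice go S A \<longrightarrow> wnorm p2 q2 s2 t2 (conv N S) \<le> C * A"
  using out unfolding conv_bounded_def by blast
 obtain L2 where L2: "\<And>N. L2 \<le> N ==> \<exists>C<top. \<forall>S\<in>borel_measurable borel. \<forall>A. slice gi S A \<longrightarrow> wnorm p' q' (- s1) (- t1) (conv N S) \<le> C * A"
  using inp unfolding conv_bounded_def by blast
 \<comment> \<open>The same kernel has to decay fast enough for the output and for the dual input
   estimate.\<close>
 define N where "N = max L1 L2"
 obtain C1 where C1: "C1 < top" "\<And>S A. S \<in> \<B> ==> slice go S A ==> wnorm p2 q2 s2 t2 (conv N S) \<le> C1 * A"
  using L1[of N] by (auto simp: N_def)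
 obtain C2 where C2: "C2 < top" "\<And>S A. S \<in> \<B> ==> slice gi S A ==> wnorm p' q' (- s1) (- t1) (conv N S) \<le> C2 * A"
  using L2[of N] by (auto simp: N_def)
 obtain C3 \<theta> where C3: "C3 < top" "\<theta> \<in> schwartz" and dom': "\<And>f B. f \<in> schwartz ==>
   (\<forall>S\<in>borel_measurable borel. slice gi S A \<longrightarrow> (\<integral>w. S w * stft_abs \<theta> (fun_distr f) w) \<le> B) ==>
   (\<exists>H\<in>borel_measurable borel. slice go H B \<and> (\<forall>z. stft_abs \<phi> (OP \<tau> \<sigma> f) z \<le> C3 * conv N H z))"
  using dom[OF \<sigma> A(2), of N] unfolding OP_dominated_def by blast
 obtain C4 where C4: "C4 > 0" "\<And>u z. u \<in> tempered ==> stft_abs \<theta> u z \<le> ennreal C4 * conv N (stft_abs \<phi> u) z"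
  by (rule stft_window_change[OF \<phi> x0 C3(2), where N=N]) (rule that)
 define K where "K = C3 * (C1 * (ennreal C4 * (C2 * A)))"
 have K: "K < top" using A(1) C1(1) C2(1) C3(1) by (simp add: K_def ennreal_mult_less_top)
 show "\<exists>C. \<forall>f\<in>schwartz. wnorm p2 q2 s2 t2 (stft_abs \<phi> (OP \<tau> \<sigma> f)) \<le> ennreal C * wnorm p1 q1 s1 t1 (stft_abs \<phi> (fun_distr f))"
 proof (rule exI[of _ "enn2real K"], rule ballI)
  fix f :: "'a => complex" assume f: "f \<in> schwartz"
  note tf = tempered_fun_distr_schwartz[OF f]
  define R where "R = wnorm p1 q1 s1 t1 (stft_abs \<phi> (fun_distr f))"
  have F[measurable]: "stft_abs \<phi> (fun_distr f) \<in> \<B>" "stft_abs \<theta> (fun_distr f) \<in> \<B>"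
   by (rule measurable_stft_tempered[OF tf]; fact \<phi> C3(2))+
  have "(\<integral>w. S w * stft_abs \<theta> (fun_distr f) w) \<le> ennreal C4 * (R * (C2 * A))"
   if S[measurable]: "S \<in> \<B>" and P: "slice gi S A" for S
  proof -
   have "(\<integral>w. S w * stft_abs \<theta> (fun_distr f) w) \<le> (\<integral>w. S w * (ennreal C4 * conv N (stft_abs \<phi> (fun_distr f)) w))"
    by (intro nn_integral_mono mult_left_mono C4(2) tf) simp
   also have "\<dots> = ennreal C4 * (\<integral>w. S w * conv N (stft_abs \<phi> (fun_distr f)) w)"
    unfolding mult.left_commute[of "S _"] by (rule nn_integral_cmult) measurable
   also have "\<dots> \<le> ennreal C4 * (R * (C2 * A))"
    unfolding R_def by (rule mult_left_mono[OF pairing_bound[OF pq(1) p' pq(2) q' C2(2) S F(1) P]]) simp_all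
   finally show ?thesis .
  qed
  then obtain H where H[measurable]: "H \<in> \<B>" and sl: "slice go H (ennreal C4 * (R * (C2 * A)))"
   and Hb: "\<And>z. stft_abs \<phi> (OP \<tau> \<sigma> f) z \<le> C3 * conv N H z"
   using dom'[OF f] by blast
  have "wnorm p2 q2 s2 t2 (stft_abs \<phi> (OP \<tau> \<sigma> f)) \<le> wnorm p2 q2 s2 t2 (\<lambda>z. C3 * conv N H z)"
   by (rule wnorm_mono[OF pq(3,4) measurable_stft_abs[OF OP_continuous[OF \<sigma> \<phi> x0 f \<tau>]] Hb])
  also have "\<dots> \<le> C3 * wnorm p2 q2 s2 t2 (conv N H)" by (rule wnorm_cmult_le[OF pq(3,4)]) measurable
  also have "\<dots> \<le> C3 * (C1 * (ennreal C4 * (R * (C2 * A))))" by (rule mult_left_mono[OF C1(2)[OF H sl]]) simp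
  also have "\<dots> = ennreal (enn2real K) * R" using K by (simp only: K_def mult_ac ennreal_enn2real)
  finally show "wnorm p2 q2 s2 t2 (stft_abs \<phi> (OP \<tau> \<sigma> f)) \<le> ennreal (enn2real K) * wnorm p1 q1 s1 t1 (stft_abs \<phi> (fun_distr f))"
   by (simp only: R_def)
 qed
qed

text \<open>For the conjugate exponent and the reciprocal weight the strict inequality reads 1/q' -
  t/DIM < 0, the criterion of \<open>Lp_norm_japanese\<close>; the exceptional case becomes q' =
  \<infinity> with t = 0.\<close>

lemma conjugate_decay:
 assumes "1 \<le> q" "1 \<le> q'" "recip q' = 1 - recip q" "1 < recip q + t / DIM('a::euclidean_space) \<or> q = 1 \<and> t = 0"
 shows "Lp_norm q' (jp (- t) :: 'a => ennreal) < top"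
proof -
 have "recip q' + (- t) / DIM('a) < 0 \<or> (q' = \<infinity> \<and> - t = 0)"
  using assms recip_cases(3)[OF assms(2)] recip_cases(4)[OF assms(1)] by auto
 then show ?thesis using Lp_norm_japanese[OF assms(2), of "- t", where 'a='a] by (simp add: jp_def[abs_def])
qed

lemma OP_0_sufficient:
 fixes \<phi> :: "'a::euclidean_space => complex" and \<Phi> :: "'a \<times> 'a => complex"
 assumes \<phi>: "\<phi> \<in> schwartz" "\<phi> \<noteq> (\<lambda>_. 0)" and \<Phi>: "\<Phi> \<in> schwartz" "\<Phi> \<noteq> (\<lambda>_. 0)"
  and pq: "1 \<le> p1" "1 \<le> q1" "1 \<le> p2" "1 \<le> q2"
  and st: "s2 \<le> 0" "t2 \<le> 0" "0 \<le> s1"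
  and p2: "recip p2 + s2 / DIM('a) < 0 \<or> p2 = \<infinity> \<and> s2 = 0"
  and q1: "1 < recip q1 + t1 / DIM('a) \<or> q1 = 1 \<and> t1 = 0"
  and q2: "recip q2 + (s2 + t2) / DIM('a) < 0 \<or> q2 = \<infinity>"
 shows "OP_bounded 0 (wiener_amalgam \<Phi> 1 \<infinity>) \<phi> p1 q1 (weight s1 t1) p2 q2 (weight s2 t2)"
proof -
 obtain x0 p0 where nz: "\<phi> x0 \<noteq> 0" "\<Phi> p0 \<noteq> 0" using \<phi>(2) \<Phi>(2) by (auto simp: fun_eq_iff)
 obtain p' where p': "1 \<le> p'" "recip p' = 1 - recip p1" using conjugate_exponent[OF pq(1)] .
 obtain q' where q': "1 \<le> q'" "recip q' = 1 - recip q1" using conjugate_exponent[OF pq(2)] .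
 show ?thesis
 proof (rule OP_boundedI[OF \<phi>(1) nz(1) \<Phi>(1) _ pq p' q' _ _ OP_dominated_0[OF \<phi>(1) nz(1) \<Phi>(1) nz(2)]])
  show "conv_bounded (id :: 'a \<times> 'a => _) p2 q2 s2 t2"
   using p2 q2 by (intro conv_bounded_fst pq st) auto
  show "conv_bounded (prod.swap :: 'a \<times> 'a => _) p' q' (- s1) (- t1)"
   using st by (intro conv_bounded_snd p'(1) q'(1) conjugate_decay[OF pq(2) q' q1]) simp
 qed simp
qed

lemma OP_1_sufficient:
 fixes \<phi> :: "'a::euclidean_space => complex" and \<Phi> :: "'a \<times> 'a => complex"
 assumes \<phi>: "\<phi> \<in> schwartz" "\<phi> \<noteq> (\<lambda>_. 0)" and \<Phi>: "\<Phi> \<in> schwartz" "\<Phi> \<noteq> (\<lambda>_. 0)"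
  and pq: "1 \<le> p1" "1 \<le> q1" "1 \<le> p2" "1 \<le> q2"
  and st: "s2 \<le> 0" "0 \<le> s1" "0 \<le> t1"
  and p1: "1 < recip p1 + s1 / DIM('a) \<or> p1 = 1 \<and> s1 = 0"
  and q1: "1 < recip q1 + (s1 + t1) / DIM('a) \<or> q1 = 1"
  and q2: "recip q2 + t2 / DIM('a) < 0 \<or> q2 = \<infinity> \<and> t2 = 0"
 shows "OP_bounded 1 (wiener_amalgam \<Phi> 1 \<infinity>) \<phi> p1 q1 (weight s1 t1) p2 q2 (weight s2 t2)"
proof -
 obtain x0 p0 where nz: "\<phi> x0 \<noteq> 0" "\<Phi> p0 \<noteq> 0" using \<phi>(2) \<Phi>(2) by (auto simp: fun_eq_iff)
 obtain p' where p': "1 \<le> p'" "recip p' = 1 - recip p1" using conjugate_exponent[OF pq(1)] .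
 obtain q' where q': "1 \<le> q'" "recip q' = 1 - recip q1" using conjugate_exponent[OF pq(2)] .
 have q0: "Lp_norm q2 (jp t2 :: 'a => ennreal) < top"
  using Lp_norm_japanese[OF pq(4), of t2, where 'a='a] q2 by (simp add: jp_def[abs_def])
 show ?thesis
 proof (rule OP_boundedI[OF \<phi>(1) nz(1) \<Phi>(1) _ pq p' q' _ _ OP_dominated_1[OF \<phi>(1) nz(1) \<Phi>(1) nz(2)]])
  show "conv_bounded (prod.swap :: 'a \<times> 'a => _) p2 q2 s2 t2"
   by (intro conv_bounded_snd pq st q0)
  show "conv_bounded (id :: 'a \<times> 'a => _) p' q' (- s1) (- t1)"
  proof (rule conv_bounded_fst[OF p'(1) q'(1)])
   show "recip p' + - s1 / real DIM('a) < 0 \<or> p' = \<infinity>"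
    using p1 p' recip_cases(3)[OF p'(1)] recip_cases(4)[OF pq(1)] by auto
   show "recip q' + (- s1 + - t1) / real DIM('a) < 0 \<or> q' = \<infinity>"
    using q1 q' recip_cases(3)[OF q'(1)] recip_cases(4)[OF pq(2)] by (auto simp: diff_divide_distrib add_divide_distrib)
  qed (use st in auto)
 qed simp
qed

section \<open>Symbols of rank one operators\<close>

text \<open>The geometric coefficients make the series converge absolutely whatever the frequencies
  are, so the frequencies may grow at will.\<close>

definition cser :: "(nat => 'a::euclidean_space) => 'a => complex"
 where "cser l t = (\<Sum>n. (1/2) ^ n * cis (2 * pi * (t \<bullet> l n)))"

lemma cser_term_norm: "cmod ((1/2) ^ n * cis x) = (1/2) ^ n"
 by (simp add: norm_mult norm_power)

lemma cser_summable: "summable (\<lambda>n. (1/2) ^ n * cis (2 * pi * (t \<bullet> l n)))"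
 by (rule summable_comparison_test'[OF summable_geometric[of "1/2 :: real"]]) (auto simp: norm_mult norm_power)

lemma measurable_cser [measurable]: "cser l \<in> \<B>"
 unfolding cser_def[abs_def]
 by (intro borel_measurable_suminf borel_measurable_continuous_onI continuous_intros)

lemma geometric_half: "(\<Sum>n. (1/2) ^ n :: real) = 2"
 using suminf_geometric[of "1/2 :: real"] by simp

lemma cmod_cser_le: "cmod (cser l t) \<le> 2"
proof -
 have s: "summable (\<lambda>n. cmod ((1/2) ^ n * cis (2 * pi * (t \<bullet> l n))))"
  unfolding cser_term_norm by (rule summable_geometric) simp
 show ?thesis unfolding cser_def
  by (rule order_trans[OF summable_norm[OF s]]) (simp only: cser_term_norm geometric_half)
qed

lemma cser_0: "cser (\<lambda>_. 0) t = 2"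
 using suminf_geometric[of "1/2 :: complex"] by (simp add: cser_def)

lemma integral_cser:
 assumes h: "integrable lborel h"
 shows "(LINT t|lborel. cser l t * h t) = (\<Sum>n. (1/2) ^ n * ft h (- l n))"
  and "summable (\<lambda>n. (1/2) ^ n * ft h (- l n))"
  and "summable (\<lambda>n. cmod ((1/2) ^ n * ft h (- l n)))"
proof -
 define I where "I = (LINT t|lborel. cmod (h t))"
 have [measurable]: "h \<in> \<B>" using h by simp
 have nrm: "cmod ((1/2) ^ n * cis (2 * pi * (t \<bullet> l n)) * h t) = (1/2) ^ n * cmod (h t)" for n t
  by (simp add: norm_mult norm_power)
 have int: "integrable lborel (\<lambda>t. (1/2) ^ n * cis (2 * pi * (t \<bullet> l n)) * h t)" for n
 proof (rule Bochner_Integration.integrable_bound[OF h])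
  have "(\<lambda>t. (1/2) ^ n * cis (2 * pi * (t \<bullet> l n))) \<in> \<B>"
   by (intro borel_measurable_continuous_onI continuous_intros)
  then show "(\<lambda>t. (1/2) ^ n * cis (2 * pi * (t \<bullet> l n)) * h t) \<in> borel_measurable lborel" by measurable
  show "AE t in lborel. cmod ((1/2) ^ n * cis (2 * pi * (t \<bullet> l n)) * h t) \<le> cmod (h t)"
   unfolding nrm by (simp add: mult_left_le_one_le power_le_one)
 qed
 have s1: "summable (\<lambda>n. (1/2) ^ n * c)" for c :: real by (intro summable_mult2 summable_geometric) simp
 have AEs: "AE t in lborel. summable (\<lambda>n. cmod ((1/2) ^ n * cis (2 * pi * (t \<bullet> l n)) * h t))"
  unfolding nrm using s1 by simp
 have sI: "summable (\<lambda>n. LINT t|lborel. cmod ((1/2) ^ n * cis (2 * pi * (t \<bullet> l n)) * h t))"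
  unfolding nrm using s1 by simp
 have eq: "(LINT t|lborel. (1/2) ^ n * cis (2 * pi * (t \<bullet> l n)) * h t) = (1/2) ^ n * ft h (- l n)" for n
  unfolding ft_def by (subst Bochner_Integration.integral_mult_right_zero[symmetric]) (simp add: mult_ac)
 have "(LINT t|lborel. cser l t * h t) = (LINT t|lborel. (\<Sum>n. (1/2) ^ n * cis (2 * pi * (t \<bullet> l n)) * h t))"
  unfolding cser_def by (subst suminf_mult2[OF cser_summable]) simp
 also have "\<dots> = (\<Sum>n. LINT t|lborel. (1/2) ^ n * cis (2 * pi * (t \<bullet> l n)) * h t)"
  by (rule integral_suminf[OF int AEs sI])
 finally show "(LINT t|lborel. cser l t * h t) = (\<Sum>n. (1/2) ^ n * ft h (- l n))" unfolding eq .
 show "summable (\<lambda>n. (1/2) ^ n * ft h (- l n))"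
  using summable_integral[OF int AEs sI] unfolding eq .
 have "cmod (ft h z) \<le> I" for z unfolding ft_def I_def
  by (rule order_trans[OF Bochner_Integration.integral_norm_bound]) (simp add: norm_mult)
 then show "summable (\<lambda>n. cmod ((1/2) ^ n * ft h (- l n)))"
  by (intro summable_comparison_test'[OF s1[of I]]) (simp add: norm_mult norm_power)
qed

definition quad :: "real => real => 'a::euclidean_space \<times> 'a => complex"
 where "quad e k p = cis (2 * pi * e * (fst p \<bullet> snd p)) * cis (pi * k * (fst p \<bullet> fst p))"

lemma slow_quad: "quad e k \<in> slow"
 unfolding quad_def[abs_def]
 by (intro slow_mult slow_cis_inner bounded_linear_fst bounded_linear_snd)

lemma cmod_quad [simp]: "cmod (quad e k p) = 1"
 by (simp add: quad_def norm_mult)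

lemma quad_add: "quad e k (p + q) = cis (2 * pi * (p \<bullet> (e *\<^sub>R snd q + k *\<^sub>R fst q, e *\<^sub>R fst q))) * (quad e k p * quad e k q)"
 unfolding quad_def cis_mult
 by (rule arg_cong[where f=cis]) (simp add: inner_Pair_0 inner_prod_def inner_add inner_commute algebra_simps)

text \<open>A translation changes a quadratic phase only by a character and a constant. Moving the
  window therefore merely translates the Fourier transform, and its integral in z does not depend on
  the position q.\<close>

lemma quad_ft:
 assumes G: "G \<in> schwartz"
 shows "cmod (ft (\<lambda>p. quad e k p * G (p - q)) z)
  = cmod (ft (\<lambda>p. quad e k p * G p) (z - (e *\<^sub>R snd q + k *\<^sub>R fst q, e *\<^sub>R fst q)))"
proof -
 define H where "H p = quad e k q * (cis (2 * pi * (p \<bullet> (e *\<^sub>R snd q + k *\<^sub>R fst q, e *\<^sub>R fst q))) * (quad e k p * G p))" for p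
 have "H = (\<lambda>p. G p * ((quad e k p * cis (2 * pi * (p \<bullet> (e *\<^sub>R snd q + k *\<^sub>R fst q, e *\<^sub>R fst q)))) * quad e k q))"
  by (rule ext) (simp add: H_def)
 also have "\<dots> \<in> schwartz"
  by (intro schwartz_mult_slow slow_mult G slow_quad slow_cis_inner_const bounded_linear_ident slow_const)
 finally have H: "H \<in> schwartz" .
 have "quad e k p * G (p - q) = H (p + - q)" for p
  using quad_add[of e k "p - q" q] by (simp add: H_def mult_ac)
 then have "cmod (ft (\<lambda>p. quad e k p * G (p - q)) z) = cmod (ft H z)"
  by (simp only: ft_translate[OF H]) (simp add: norm_mult)
 also have "ft H z = quad e k q * ft (\<lambda>p. cis (2 * pi * (p \<bullet> (e *\<^sub>R snd q + k *\<^sub>R fst q, e *\<^sub>R fst q))) * (quad e k p * G p)) z"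
  by (simp add: H_def ft_def mult.assoc)
 finally show ?thesis by (simp only: ft_modulate norm_mult cmod_quad mult_1)
qed

definition symb :: "real => real => (nat => 'a::euclidean_space \<times> 'a) => 'a \<times> 'a => complex"
 where "symb e k l p = cser l p * quad e k p"

lemma measurable_quad [measurable]: "quad e k \<in> \<B>"
 unfolding quad_def[abs_def] by (intro borel_measurable_continuous_onI continuous_intros)

lemma tempered_symb: "fun_distr (symb e k l) \<in> tempered"
proof (rule tempered_fun_distr)
 show "symb e k l \<in> \<B>" unfolding symb_def[abs_def] by measurable
 show "cmod (symb e k l p) \<le> 2" for p using cmod_cser_le[of l p] by (simp add: symb_def norm_mult)
qed

lemma nn_integral_schwartz_finite: "f \<in> schwartz ==> (\<integral>x. ennreal (cmod (f x))) < \<infinity>"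
 using schwartz_integrable[of f] by (simp add: integrable_iff_bounded)

text \<open>For each \<zeta> the transform is dominated by translates of one integrable function h
  with coefficients 2^-n. The integral over z is at most 2 A, independently of \<zeta> and of the
  frequencies.\<close>

lemma symb_in_wiener_amalgam:
 assumes \<Phi>: "\<Phi> \<in> schwartz"
 shows "fun_distr (symb e k l) \<in> wiener_amalgam \<Phi> 1 \<infinity>"
proof -
 define G where "G p = quad e k p * cnj (\<Phi> p)" for p
 have "(\<lambda>p. cnj (\<Phi> p) * quad e k p) \<in> schwartz"
  by (intro schwartz_mult_slow schwartz_cnj \<Phi> slow_quad)
 then have G: "G \<in> schwartz" by (simp add: G_def[abs_def] mult.commute)
 define h where "h p = ennreal (cmod (ft G p))" for p
 have h[measurable]: "h \<in> \<B>"
  unfolding h_def using schwartz_measurable[OF schwartz_ft[OF G]] by measurable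
 define A where "A = (\<integral>z. h z)"
 have A: "A < \<infinity>" unfolding A_def h_def by (rule nn_integral_schwartz_finite[OF schwartz_ft[OF G]])
 define L where "L \<zeta> = (e *\<^sub>R snd \<zeta> + k *\<^sub>R fst \<zeta>, e *\<^sub>R fst \<zeta>)" for \<zeta> :: "'a \<times> 'a"
 have le: "ennreal (cmod (stft \<Phi> (fun_distr (symb e k l)) \<zeta> (- z))) \<le> (\<Sum>n. ennreal ((1/2) ^ n) * h (- (l n) - L \<zeta> - z))" for \<zeta> z
 proof -
  define F where "F p = quad e k p * cnj (\<Phi> (p - \<zeta>)) * cis (2 * pi * (p \<bullet> z))" for p
  have "(\<lambda>p. cnj (\<Phi> (p + - \<zeta>)) * (quad e k p * cis (2 * pi * (p \<bullet> z)))) \<in> schwartz"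
   by (intro schwartz_mult_slow slow_mult schwartz_cnj schwartz_translate \<Phi> slow_quad slow_cis_inner_const bounded_linear_ident)
  then have F: "F \<in> schwartz" by (simp add: F_def[abs_def] mult_ac)
  have ftF: "cmod (ft F (- l n)) = cmod (ft G (- l n - L \<zeta> - z))" for n
  proof -
   have "ft F (- l n) = ft (\<lambda>p. quad e k p * cnj (\<Phi> (p - \<zeta>))) (- l n - z)"
    unfolding F_def[abs_def] using ft_modulate[of z "\<lambda>p. quad e k p * cnj (\<Phi> (p - \<zeta>))" "- l n"] by (simp only: mult.commute)
   also have "cmod \<dots> = cmod (ft G (- l n - z - L \<zeta>))"
    unfolding G_def[abs_def] L_def by (rule quad_ft[OF schwartz_cnj[OF \<Phi>]])
   finally show ?thesis by (simp add: algebra_simps)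
  qed
  have "stft \<Phi> (fun_distr (symb e k l)) \<zeta> (- z) = (LINT p|lborel. cser l p * F p)"
   unfolding stft_fun_distr ft_def by (simp add: symb_def F_def mult_ac)
  also have "\<dots> = (\<Sum>n. (1/2) ^ n * ft F (- l n))" by (rule integral_cser(1)[OF schwartz_integrable[OF F]])
  finally have "cmod (stft \<Phi> (fun_distr (symb e k l)) \<zeta> (- z)) \<le> (\<Sum>n. cmod ((1/2) ^ n * ft F (- l n)))"
   using summable_norm[OF integral_cser(3)[OF schwartz_integrable[OF F]]] by simp
  then have "ennreal (cmod (stft \<Phi> (fun_distr (symb e k l)) \<zeta> (- z))) \<le> ennreal (\<Sum>n. cmod ((1/2) ^ n * ft F (- l n)))"
   by (rule ennreal_leI)
  also have "\<dots> = (\<Sum>n. ennreal (cmod ((1/2) ^ n * ft F (- l n))))"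
   by (rule suminf_ennreal2[symmetric]) (auto intro: integral_cser(3)[OF schwartz_integrable[OF F]])
  also have "\<dots> = (\<Sum>n. ennreal ((1/2) ^ n) * h (- (l n) - L \<zeta> - z))"
   by (simp add: norm_mult norm_power ftF h_def ennreal_mult)
  finally show ?thesis .
 qed
 have "(\<integral>z. ennreal (cmod (stft \<Phi> (fun_distr (symb e k l)) \<zeta> (- z)))) \<le> 2 * A" for \<zeta>
 proof -
  have "(\<integral>z. ennreal (cmod (stft \<Phi> (fun_distr (symb e k l)) \<zeta> (- z))))
    \<le> (\<integral>z. (\<Sum>n. ennreal ((1/2) ^ n) * h (- (l n) - L \<zeta> - z)))"
   by (intro nn_integral_mono le)
  also have "\<dots> = (\<Sum>n. (\<integral>z. ennreal ((1/2) ^ n) * h (- (l n) - L \<zeta> - z)))"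
   by (intro nn_integral_suminf) measurable
  also have "\<dots> = (\<Sum>n. ennreal ((1/2) ^ n) * A)"
  proof (intro arg_cong[where f=suminf] ext)
   fix n
   have "(\<integral>z. ennreal ((1/2) ^ n) * h (- (l n) - L \<zeta> - z))
     = ennreal ((1/2) ^ n) * (\<integral>z. h (- (l n) - L \<zeta> - z))"
    by (intro nn_integral_cmult) measurable
   then show "(\<integral>z. ennreal ((1/2) ^ n) * h (- (l n) - L \<zeta> - z)) = ennreal ((1/2) ^ n) * A"
    using nn_integral_lborel_reflect[OF h, of "- l n - L \<zeta>"] by (simp add: A_def)
  qed
  also have "\<dots> = (\<Sum>n. ennreal ((1/2) ^ n)) * A" by (rule ennreal_suminf_multc)
  also have "(\<Sum>n. ennreal ((1/2) ^ n)) = 2"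
  proof -
   have "(\<Sum>n. ennreal ((1/2) ^ n)) = ennreal (\<Sum>n. (1/2) ^ n)"
    by (rule suminf_ennreal2) (auto intro: summable_geometric)
   then show ?thesis by (simp only: geometric_half ennreal_numeral)
  qed
  finally show ?thesis .
 qed
 then have le: "(\<integral>z. stft_abs \<Phi> (fun_distr (symb e k l)) (\<zeta>, - z)) \<le> 2 * A" for \<zeta>
  by (simp add: stft_abs_def)
 note [measurable] = measurable_stft_tempered[OF tempered_symb \<Phi>]
 have "esssup lborel (\<lambda>\<zeta>. \<integral>z. stft_abs \<Phi> (fun_distr (symb e k l)) (\<zeta>, - z)) \<le> 2 * A"
  by (intro esssup_I AE_I2 le) measurable
 also have "\<dots> < \<infinity>" using A by (simp add: ennreal_mult_less_top)
 finally have "esssup lborel (\<lambda>\<zeta>. \<integral>z. ennreal (cmod (stft \<Phi> (fun_distr (symb e k l)) \<zeta> (- z)))) < \<infinity>"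
  by (simp add: stft_abs_def)
 then show ?thesis
  unfolding wiener_amalgam_def wiener_amalgam_norm_def Lp_norm_1 Lp_norm_top using tempered_symb by simp
qed

text \<open>The conjugate chirp cancels the bilinear phase of the symbol. What is left is a tensor
  product, so each character of the series contributes a product of two Fourier transforms.\<close>

lemma symb_chirp:
 assumes ab: "a \<in> schwartz" "b \<in> schwartz"
 shows "(LINT p|lborel. symb e k l p * cnj (chirp e a b p))
  = (\<Sum>n. (1/2) ^ n * (ft (\<lambda>x. cis (pi * k * (x \<bullet> x)) * cnj (a x)) (- fst (l n)) * ft (\<lambda>\<xi>. cnj (b \<xi>)) (- snd (l n))))"
  (is "_ = (\<Sum>n. (1/2) ^ n * (ft ?A _ * ft ?B _))")
proof -
 have "(\<lambda>x. cnj (a x) * cis (pi * k * (x \<bullet> x))) \<in> schwartz"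
  by (intro schwartz_mult_slow schwartz_cnj ab slow_cis_inner bounded_linear_ident)
 then have A: "?A \<in> schwartz" by (simp add: mult.commute)
 have B: "?B \<in> schwartz" by (intro schwartz_cnj ab)
 have S: "(\<lambda>p. ?A (fst p) * ?B (snd p)) \<in> schwartz" by (rule schwartz_tensor[OF A B])
 have "ft (\<lambda>p. ?A (fst p) * ?B (snd p)) z = ft ?A (fst z) * ft ?B (snd z)" for z
 proof -
  define a' b' where "a' x = ?A x * cis (- (2 * pi) * (x \<bullet> fst z))" and "b' x = ?B x * cis (- (2 * pi) * (x \<bullet> snd z))" for x
  have ab': "a' \<in> schwartz" "b' \<in> schwartz" unfolding a'_def b'_def
   by (intro schwartz_mult_slow A B slow_cis_inner_const bounded_linear_ident)+
  have "ft (\<lambda>p. ?A (fst p) * ?B (snd p)) z = (LINT p|lborel. a' (fst p) * b' (snd p))"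
   unfolding ft_def a'_def b'_def inner_prod_def
   by (rule Bochner_Integration.integral_cong) (simp_all only: distrib_left cis_mult[symmetric] mult_ac refl)
  also have "\<dots> = (LINT x|lborel. a' x) * (LINT y|lborel. b' y)"
   using schwartz_Fubini(1)[OF schwartz_tensor[OF ab']] by simp
  finally show ?thesis by (simp add: ft_def a'_def b'_def)
 qed
 then show ?thesis
  using integral_cser(1)[OF schwartz_integrable[OF S], of l]
  by (simp add: symb_def quad_def chirp_def cis_cnj cis_mult mult_ac)
qed

section \<open>Norms of test functions\<close>

lemma Lp_norm_jp_shift:
 assumes M: "real DIM('a::euclidean_space) < M"
 obtains K where "K < top" "\<And>p x. 1 \<le> p ==> Lp_norm p (\<lambda>y::'a. jp (- M) (x - y)) \<le> K"
proof -
 define K where "K = max 1 (jint TYPE('a) (- M))"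
 have K: "K < top" "1 \<le> K" unfolding K_def using jint_finite[where 'a='a, of "- M"] M by auto
 have le1: "jp (- M) (x - y) \<le> 1" for x y :: 'a using M by (intro jp_le_1) simp
 have "Lp_norm p (\<lambda>y. jp (- M) (x - y)) \<le> K" if p: "1 \<le> p" for p and x :: 'a
 proof (cases "p = \<infinity>")
  case True
  have "esssup lborel (\<lambda>y. jp (- M) (x - y)) \<le> K"
   using order_trans[OF le1 K(2)] by (intro esssup_I) auto
  then show ?thesis unfolding True Lp_norm_top .
 next
  case False
  then obtain r where r: "1 \<le> r" "enn2real p = r" "recip p = 1 / r" using exponent_finite[OF p] by metis
  have "(\<integral>y. epowr (jp (- M) (x - y)) r) \<le> (\<integral>y. jp (- M) (x - y))"
   using r by (intro nn_integral_mono epowr_le_self le1)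
  also have "\<dots> \<le> K" by (simp add: nn_integral_jp_shift K_def)
  finally have "epowr (\<integral>y. epowr (jp (- M) (x - y)) r) (1 / r) \<le> epowr K (1 / r)"
   using r by (intro epowr_mono) auto
  also have "\<dots> \<le> K"
  proof -
   obtain k where k: "K = ennreal k" "1 \<le> k" using K by (cases K) auto
   then have "k powr (1 / r) \<le> k powr 1" using r by (intro powr_mono) auto
   then show ?thesis using k by (simp add: epowr_ennreal ennreal_leI)
  qed
  finally show ?thesis by (simp add: Lp_norm_finite[OF False] r)
 qed
 then show ?thesis by (rule that[OF K(1)])
qed

lemma mixed_norm_tensor:
 fixes u :: "'a::euclidean_space => ennreal" and v :: "'b::euclidean_space => ennreal"
 assumes pq: "1 \<le> p" "1 \<le> q" and [measurable]: "u \<in> \<B>" "v \<in> \<B>"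
 shows "mixed_norm p q (\<lambda>z. u (fst z) * v (snd z)) \<le> Lp_norm p u * Lp_norm q v"
proof -
 have "mixed_norm p q (\<lambda>z. u (fst z) * v (snd z)) \<le> Lp_norm q (\<lambda>\<xi>. Lp_norm p u * v \<xi>)"
  unfolding mixed_norm_def fst_conv snd_conv
 proof (rule Lp_norm_mono[OF pq(2)])
  show "(\<lambda>\<xi>. Lp_norm p (\<lambda>x. u x * v \<xi>)) \<in> \<B>"
   by (rule measurable_Lp_norm[where F="\<lambda>x \<xi>. u x * v \<xi>"]) measurable
  show "Lp_norm p (\<lambda>x. u x * v \<xi>) \<le> Lp_norm p u * v \<xi>" for \<xi>
   using Lp_norm_cmult_le[OF pq(1) assms(3), of "v \<xi>"] by (simp add: mult.commute)
 qed
 also have "\<dots> \<le> Lp_norm p u * Lp_norm q v" by (rule Lp_norm_cmult_le[OF pq(2) assms(4)])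
 finally show ?thesis .
qed

lemma mixed_norm_jp_shift:
 assumes M: "real DIM('a::euclidean_space) < M"
 obtains K where "K < top" "\<And>p q x \<xi>. 1 \<le> p ==> 1 \<le> q ==>
  mixed_norm p q (\<lambda>w::'a \<times> 'a. jp (- M) (x - fst w) * jp (- M) (\<xi> - snd w)) \<le> K"
proof -
 obtain K where K: "K < top" "\<And>p x. 1 \<le> p ==> Lp_norm p (\<lambda>y::'a. jp (- M) (x - y)) \<le> K"
  by (rule Lp_norm_jp_shift[OF M]) (rule that)
 show ?thesis
 proof (rule that[of "K * K"])
  show "K * K < top" using K(1) by (simp add: ennreal_mult_less_top)
  fix p q :: ennreal and x \<xi> :: 'a assume pq: "1 \<le> p" "1 \<le> q"
  have "mixed_norm p q (\<lambda>w. jp (- M) (x - fst w) * jp (- M) (\<xi> - snd w))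
    \<le> Lp_norm p (\<lambda>y. jp (- M) (x - y)) * Lp_norm q (\<lambda>y. jp (- M) (\<xi> - y))"
   by (rule mixed_norm_tensor[OF pq]) measurable
  also have "\<dots> \<le> K * K" by (intro mult_mono K pq) auto
  finally show "mixed_norm p q (\<lambda>w. jp (- M) (x - fst w) * jp (- M) (\<xi> - snd w)) \<le> K * K" .
 qed
qed

lemma jp_peetre_pair:
 assumes N: "M + \<bar>s\<bar> + \<bar>t\<bar> \<le> N"
 shows "jp (- N) (x - a) * jp (- N) (\<xi> - b) * (jp s x * jp t \<xi>)
  \<le> ennreal (2 powr \<bar>s\<bar> * 2 powr \<bar>t\<bar>) * (jp s a * jp t b * (jp (- M) (x - a) * jp (- M) (\<xi> - b)))"
proof -
 have *: "jp (- N) (y - d) * jp r y \<le> ennreal (2 powr \<bar>r\<bar>) * (jp r d * jp (- M) (y - d))"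
  if "r = s \<or> r = t" for r and y d :: "'c::euclidean_space"
  by (rule order_trans[OF jp_peetre_factor]) (use that N in \<open>intro mult_left_mono jp_mono, auto\<close>)
 have "jp (- N) (x - a) * jp (- N) (\<xi> - b) * (jp s x * jp t \<xi>) = (jp (- N) (x - a) * jp s x) * (jp (- N) (\<xi> - b) * jp t \<xi>)"
  by (simp only: mult_ac)
 also have "\<dots> \<le> (ennreal (2 powr \<bar>s\<bar>) * (jp s a * jp (- M) (x - a))) * (ennreal (2 powr \<bar>t\<bar>) * (jp t b * jp (- M) (\<xi> - b)))"
  by (intro mult_mono *) auto
 finally show ?thesis by (simp add: ennreal_mult mult_ac)
qed

lemma modulation_norm_le:
 assumes pq: "1 \<le> p" "1 \<le> q" and f: "f \<in> schwartz" and \<phi>: "\<phi> \<in> schwartz" and F: "F \<in> \<B>"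
  and le: "\<And>x \<xi>. stft_abs \<phi> (fun_distr f) (x, \<xi>) * (jp s x * jp t \<xi>) \<le> C * F (x, \<xi>)"
 shows "modulation_norm \<phi> p q (weight s t) (fun_distr f) \<le> C * mixed_norm p q F"
proof -
 note [measurable] = measurable_stft_tempered[OF tempered_fun_distr_schwartz[OF f] \<phi>]
 have "modulation_norm \<phi> p q (weight s t) (fun_distr f) \<le> mixed_norm p q (\<lambda>z. C * F z)"
  unfolding modulation_norm_eq wnorm_def
 proof (rule mixed_norm_mono[OF pq])
  show "stft_abs \<phi> (fun_distr f) z * (jp s (fst z) * jp t (snd z)) \<le> C * F z" for z
   using le[of "fst z" "snd z"] by simp
 qed measurable
 also have "\<dots> \<le> C * mixed_norm p q F" by (rule mixed_norm_cmult_le[OF pq F])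
 finally show ?thesis .
qed

text \<open>Every modulation norm controls the weighted supremum of the transform, for any window:
  after the change of window, Hoelder's inequality is applied to a kernel whose mixed norms are
  bounded uniformly in its centre.\<close>

lemma modulation_norm_pointwise:
 assumes \<phi>: "\<phi> \<in> schwartz" and nz: "\<phi> x0 \<noteq> 0" and \<theta>: "\<theta> \<in> schwartz" and pq: "1 \<le> p" "1 \<le> q"
 obtains C where "C < top" "\<And>u x \<xi>. u \<in> tempered ==>
  stft_abs \<theta> u (x, \<xi>) * (jp s x * jp t \<xi>) \<le> C * modulation_norm \<phi> p q (weight s t) u"
proof -
 obtain p' where p': "1 \<le> p'" "recip p' = 1 - recip p" using conjugate_exponent[OF pq(1)] .
 obtain q' where q': "1 \<le> q'" "recip q' = 1 - recip q" using conjugate_exponent[OF pq(2)] .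
 define M where "M = real DIM('a) + 1"
 \<comment> \<open>\<open>M\<close> is kept for integrability, the other two summands pay for moving
   both weights by Peetre's inequality.\<close>
 define N where "N = M + \<bar>s\<bar> + \<bar>t\<bar>"
 obtain C where C: "C > 0" "\<And>u z. u \<in> tempered ==> stft_abs \<theta> u z \<le> ennreal C * conv N (stft_abs \<phi> u) z"
  by (rule stft_window_change[OF \<phi> nz \<theta>, where N=N]) (rule that)
 have "real DIM('a) < M" by (simp add: M_def)
 then obtain K where K: "K < top" "\<And>p q x \<xi>. 1 \<le> p ==> 1 \<le> q ==>
  mixed_norm p q (\<lambda>w::'a \<times> 'a. jp (- M) (x - fst w) * jp (- M) (\<xi> - snd w)) \<le> K"
  by (rule mixed_norm_jp_shift) (rule that)
 define c where "c = ennreal (2 powr \<bar>s\<bar> * 2 powr \<bar>t\<bar>)"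
 show ?thesis
 proof (rule that[of "ennreal C * (c * K)"])
  show "ennreal C * (c * K) < top" using K(1) by (simp add: c_def ennreal_mult_less_top)
  fix u :: "'a functional" and x \<xi> :: 'a assume u: "u \<in> tempered"
  note [measurable] = measurable_stft_tempered[OF u \<phi>]
  define V where "V w = stft_abs \<phi> u w * (jp s (fst w) * jp t (snd w))" for w
  have V[measurable]: "V \<in> \<B>" unfolding V_def[abs_def] by measurable
  define G where "G w = jp (- M) (x - fst w) * jp (- M) (\<xi> - snd w)" for w
  have G[measurable]: "G \<in> \<B>" unfolding G_def[abs_def] by measurable
  have "conv N (stft_abs \<phi> u) (x, \<xi>) * (jp s x * jp t \<xi>)
    = (\<integral>w. jp (- N) (x - fst w) * jp (- N) (\<xi> - snd w) * stft_abs \<phi> u w * (jp s x * jp t \<xi>))"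
   unfolding conv_def fst_conv snd_conv by (rule nn_integral_multc[symmetric]) measurable
  also have "\<dots> \<le> (\<integral>w. c * (V w * G w))"
  proof (rule nn_integral_mono)
   fix w
   have "M + \<bar>s\<bar> + \<bar>t\<bar> \<le> N" by (simp add: N_def)
   from mult_right_mono[OF jp_peetre_pair[OF this, of x "fst w" \<xi> "snd w"], of "stft_abs \<phi> u w"]
   show "jp (- N) (x - fst w) * jp (- N) (\<xi> - snd w) * stft_abs \<phi> u w * (jp s x * jp t \<xi>) \<le> c * (V w * G w)"
    by (simp add: V_def G_def c_def mult_ac)
  qed
  also have "\<dots> = c * (\<integral>w. V w * G w)" by (rule nn_integral_cmult) measurable
  also have "(\<integral>w. V w * G w) \<le> mixed_norm p q V * mixed_norm p' q' G"
   by (rule mixed_Holder[OF pq(1) p' pq(2) q' V G])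
  also have "mixed_norm p' q' G \<le> K" unfolding G_def by (rule K(2)[OF p'(1) q'(1)])
  also have "mixed_norm p q V = modulation_norm \<phi> p q (weight s t) u"
   by (simp add: modulation_norm_eq wnorm_def V_def[abs_def])
  finally have 1: "conv N (stft_abs \<phi> u) (x, \<xi>) * (jp s x * jp t \<xi>) \<le> c * (modulation_norm \<phi> p q (weight s t) u * K)"
   by (simp add: mult_left_mono)
  have "stft_abs \<theta> u (x, \<xi>) * (jp s x * jp t \<xi>) \<le> (ennreal C * conv N (stft_abs \<phi> u) (x, \<xi>)) * (jp s x * jp t \<xi>)"
   by (intro mult_right_mono C u) simp
  also have "\<dots> \<le> ennreal C * (c * (modulation_norm \<phi> p q (weight s t) u * K))"
   unfolding mult.assoc[of "ennreal C"] by (intro mult_left_mono 1) simp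
  finally show "stft_abs \<theta> u (x, \<xi>) * (jp s x * jp t \<xi>) \<le> ennreal C * (c * K) * modulation_norm \<phi> p q (weight s t) u"
   by (simp only: mult_ac)
 qed
qed

text \<open>Hoelder's inequality against the indicator of B. Since B has measure at most 1, the dual
  norm of the indicator is at most 1, so one argument covers all exponents.\<close>

lemma Lp_norm_lower:
 fixes g :: "'a::euclidean_space => ennreal"
 assumes p: "1 \<le> p" and [measurable]: "g \<in> \<B>" "B \<in> sets borel"
  and B: "emeasure lborel B \<le> 1" and v: "\<And>x. x \<in> B ==> v \<le> g x"
 shows "v * emeasure lborel B \<le> Lp_norm p g"
proof -
 obtain p' where p': "1 \<le> p'" "recip p' = 1 - recip p" using conjugate_exponent[OF p] .
 have "v * emeasure lborel B = (\<integral>x. v * indicator B x)" by (simp add: nn_integral_cmult_indicator)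
 also have "\<dots> \<le> (\<integral>x. g x * indicator B x)"
  by (intro nn_integral_mono) (auto simp: v split: split_indicator)
 also have "\<dots> \<le> Lp_norm p g * Lp_norm p' (indicator B)" by (rule Lp_Holder[OF p p']) auto
 also have "\<dots> \<le> Lp_norm p g * 1"
 proof (rule mult_left_mono)
  show "Lp_norm p' (indicator B) \<le> 1"
   using B by (intro Lp_norm_le_1 p') (auto split: split_indicator)
 qed simp
 finally show ?thesis by simp
qed

lemma small_ball:
 assumes r0: "0 < r0"
 obtains r :: real and v :: real where "0 < r" "r \<le> r0" "0 < v" "v \<le> 1" "\<And>x::'a::euclidean_space. emeasure lborel (ball x r) = ennreal v"
proof -
 define V where "V = unit_ball_vol (real DIM('a))"
 have V: "V > 0" by (simp add: V_def)
 define r where "r = min r0 (min 1 (1 / V))"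
 have r: "0 < r" "r \<le> r0" "r \<le> 1" "r \<le> 1 / V" using r0 V by (auto simp: r_def)
 have "r ^ DIM('a) \<le> r" using power_decreasing[of 1 "DIM('a)" r] r by (simp add: Suc_leI)
 then have "V * r ^ DIM('a) \<le> V * (1 / V)" using V r by (intro mult_left_mono) auto
 then have v: "V * r ^ DIM('a) \<le> 1" using V by simp
 have "emeasure lborel (ball x r) = ennreal (V * r ^ DIM('a))" for x :: 'a
  using r by (simp add: emeasure_ball V_def)
 then show ?thesis using that[of r "V * r ^ DIM('a)"] r v V by simp
qed

lemma modulation_norm_shift_le:
 assumes \<phi>: "\<phi> \<in> schwartz" and \<theta>: "\<theta> \<in> schwartz" and pq: "1 \<le> p" "1 \<le> q"
 obtains C where "C < top" "\<And>w \<eta>. modulation_norm \<phi> p q (weight s t) (fun_distr (\<lambda>u. cis (2 * pi * (u \<bullet> \<eta>)) * \<theta> (u - w)))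
  \<le> C * (jp s w * jp t \<eta>)"
proof -
 define M where "M = real DIM('a) + 1"
 define N where "N = M + \<bar>s\<bar> + \<bar>t\<bar>"
 obtain D where D: "D \<ge> 0" "\<And>x \<xi>. ennreal (cmod (stft \<phi> (fun_distr \<theta>) x \<xi>)) \<le> ennreal D * (jp (- N) x * jp (- N) \<xi>)"
  by (rule stft_jp_bound[OF \<theta> \<phi>, where N=N]) (rule that)
 have "real DIM('a) < M" by (simp add: M_def)
 then obtain K where K: "K < top" "\<And>p q x \<xi>. 1 \<le> p ==> 1 \<le> q ==>
  mixed_norm p q (\<lambda>w::'a \<times> 'a. jp (- M) (x - fst w) * jp (- M) (\<xi> - snd w)) \<le> K"
  by (rule mixed_norm_jp_shift) (rule that)
 define c where "c = ennreal (2 powr \<bar>s\<bar> * 2 powr \<bar>t\<bar>)"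
 show ?thesis
 proof (rule that[of "ennreal D * c * K"])
  show "ennreal D * c * K < top" using K(1) by (simp add: c_def ennreal_mult_less_top)
  fix w \<eta> :: 'a
  define f where "f u = cis (2 * pi * (u \<bullet> \<eta>)) * \<theta> (u - w)" for u
  have f: "f \<in> schwartz" unfolding f_def by (rule schwartz_modulate_translate[OF \<theta>])
  define G where "G z = jp (- M) (w - fst z) * jp (- M) (\<eta> - snd z)" for z
  have G: "G \<in> \<B>" unfolding G_def[abs_def] by measurable
  have "modulation_norm \<phi> p q (weight s t) (fun_distr f) \<le> (ennreal D * c * (jp s w * jp t \<eta>)) * mixed_norm p q G"
  proof (rule modulation_norm_le[OF pq f \<phi> G])
   fix x \<xi> :: 'a
   have "stft_abs \<phi> (fun_distr f) (x, \<xi>) \<le> ennreal D * (jp (- N) (x - w) * jp (- N) (\<xi> - \<eta>))"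
    unfolding stft_abs_def f_def[abs_def] fst_conv snd_conv norm_stft_modulate_translate[OF \<theta> \<phi>] by (rule D)
   then have "stft_abs \<phi> (fun_distr f) (x, \<xi>) * (jp s x * jp t \<xi>)
     \<le> ennreal D * (jp (- N) (x - w) * jp (- N) (\<xi> - \<eta>)) * (jp s x * jp t \<xi>)"
    by (rule mult_right_mono) simp
   also have "\<dots> \<le> ennreal D * (c * (jp s w * jp t \<eta> * (jp (- M) (x - w) * jp (- M) (\<xi> - \<eta>))))"
    unfolding mult.assoc[of "ennreal D"] c_def by (rule mult_left_mono[OF jp_peetre_pair]) (simp_all add: N_def)
   finally show "stft_abs \<phi> (fun_distr f) (x, \<xi>) * (jp s x * jp t \<xi>) \<le> ennreal D * c * (jp s w * jp t \<eta>) * G (x, \<xi>)"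
    by (simp add: G_def mult_ac jp_commute[of _ w] jp_commute[of _ \<eta>])
  qed
  also have "\<dots> \<le> (ennreal D * c * (jp s w * jp t \<eta>)) * K" unfolding G_def by (intro mult_left_mono K(2) pq) simp
  finally show "modulation_norm \<phi> p q (weight s t) (fun_distr (\<lambda>u. cis (2 * pi * (u \<bullet> \<eta>)) * \<theta> (u - w)))
    \<le> ennreal D * c * K * (jp s w * jp t \<eta>)" by (simp only: f_def[abs_def] mult_ac)
 qed
qed

text \<open>The functions p (1 + |x|^2)^e with slow p and \<open>e \<le> 0\<close> form an invariant
  set: a derivative lowers e by 1, and the term in which p is differentiated is brought to the same
  exponent by a factor 1 + |x|^2. The power itself stays bounded by 1.\<close>

lemma slow_japanese_powr:
 assumes a: "a \<le> 0" shows "(\<lambda>x::'a::euclidean_space. complex_of_real (japanese x powr a)) \<in> slow"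
proof -
 define J where "J e x = complex_of_real ((1 + x \<bullet> x) powr e)" for e and x :: 'a
 let ?X = "{\<lambda>x. p x * J e x | p e. p \<in> slow \<and> e \<le> 0}"
 have DJ: "(J e has_derivative (\<lambda>h. complex_of_real (2 * e * (x \<bullet> h)) * J (e - 1) x)) (at x)" for e x
 proof -
  have pos: "1 + x \<bullet> x > 0" by (simp add: add_pos_nonneg)
  have 1: "((\<lambda>x. 1 + x \<bullet> x) has_derivative (\<lambda>h. x \<bullet> h + h \<bullet> x)) (at x)"
   by (auto intro!: derivative_eq_intros)
  have 2: "((\<lambda>y. y powr e) has_derivative (*) (e * (1 + x \<bullet> x) powr (e - 1))) (at (1 + x \<bullet> x))"
   using has_real_derivative_powr[OF pos, of e] by (simp add: has_field_derivative_def)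
  have "((\<lambda>x. (1 + x \<bullet> x) powr e) has_derivative (\<lambda>h. e * (1 + x \<bullet> x) powr (e - 1) * (x \<bullet> h + h \<bullet> x))) (at x)"
   by (rule has_derivative_compose[OF 1 2])
  from bounded_linear.has_derivative[OF bounded_linear_of_real[where 'a=complex] this]
  show ?thesis unfolding J_def[abs_def] by (simp add: inner_commute mult_ac)
 qed
 have D: "((\<lambda>x. p x * J e x) has_derivative (\<lambda>h. p x * (complex_of_real (2 * e * (x \<bullet> h)) * J (e - 1) x)
   + frechet_derivative p (at x) h * J e x)) (at x)" if "p \<in> slow" for p e x
  by (rule has_derivative_mult[OF slow_has_derivative[OF that] DJ])
 have J1: "J e x = complex_of_real (1 + x \<bullet> x) * J (e - 1) x" for e x
 proof -
  have "1 + x \<bullet> x > 0" by (simp add: add_pos_nonneg)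
  then have "(1 + x \<bullet> x) powr e = (1 + x \<bullet> x) * (1 + x \<bullet> x) powr (e - 1)"
   by (simp add: powr_diff)
  then show ?thesis by (simp only: J_def of_real_mult)
 qed
 have nsq: "(\<lambda>x::'a. complex_of_real (1 + x \<bullet> x)) \<in> slow"
 proof -
  have "(\<lambda>x::'a. 1 + (\<Sum>i\<in>Basis. complex_of_real (x \<bullet> i) * complex_of_real (x \<bullet> i))) \<in> slow"
  proof (rule slow_add[OF slow_const])
   have "(\<lambda>x::'a. \<Sum>i\<in>S. complex_of_real (x \<bullet> i) * complex_of_real (x \<bullet> i)) \<in> slow" if "finite S" for S
    using that
   proof induction
    case empty
    show ?case using slow_const[of 0] by simp
   next
    case (insert i S)
    then show ?case
     by (simp add: slow_add slow_mult slow_linear bounded_linear_inner_left)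
   qed
   then show "(\<lambda>x::'a. \<Sum>i\<in>Basis. complex_of_real (x \<bullet> i) * complex_of_real (x \<bullet> i)) \<in> slow" by simp
  qed
  moreover have "complex_of_real (1 + x \<bullet> x) = 1 + (\<Sum>i\<in>Basis. complex_of_real (x \<bullet> i) * complex_of_real (x \<bullet> i))" for x :: 'a
   by (subst euclidean_inner) simp
  ultimately show ?thesis by (simp del: of_real_add)
 qed
 have main: "(\<lambda>x. 1 * J (a / 2) x) \<in> slow"
 proof (rule slow_coinduct[where X="?X"])
  show "(\<lambda>x. 1 * J (a / 2) x) \<in> ?X" by (intro CollectI exI[of _ "\<lambda>_. 1"] exI[of _ "a / 2"] conjI refl slow_const) (use a in simp)
  show "pd b g \<in> ?X" if g: "g \<in> ?X" and b: "b \<in> Basis" for g and b :: 'a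
  proof -
   obtain p e where p: "p \<in> slow" "e \<le> 0" "g = (\<lambda>x. p x * J e x)" using g by blast
   define r where "r x = p x * complex_of_real (2 * e * (x \<bullet> b)) + pd b p x * complex_of_real (1 + x \<bullet> x)" for x
   have lin: "bounded_linear (\<lambda>x::'a. 2 * e * (x \<bullet> b))"
    by (intro bounded_linear_const_mult bounded_linear_inner_left)
   have r: "r \<in> slow" unfolding r_def
    by (intro slow_add slow_mult p slow_pd b nsq slow_linear[OF lin])
   have "pd b g = (\<lambda>x. r x * J (e - 1) x)"
    unfolding p(3) pd_eqI[OF D[OF p(1)], where b=b] r_def
    by (rule ext) (subst J1[of e], simp add: algebra_simps)
   then show ?thesis using r p(2) by (intro CollectI exI[of _ r] exI[of _ "e - 1"]) auto
  qed
  show "g differentiable (at x)" if "g \<in> ?X" for g x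
   using that D by (auto simp: differentiable_def)
  show "polyb g" if g: "g \<in> ?X" for g
  proof -
   obtain p e where p: "p \<in> slow" "e \<le> 0" "g = (\<lambda>x. p x * J e x)" using g by blast
   have "cmod (J e x) \<le> 1" for x
    using powr_mono2'[OF p(2), of 1 "1 + x \<bullet> x"] by (simp add: J_def)
   then show ?thesis unfolding p(3) by (rule polyb_mult[OF slow_polyb[OF p(1)] polybI_bounded])
  qed
 qed
 have "J (a / 2) x = complex_of_real (japanese x powr a)" for x
  by (simp add: J_def japanese_def powr_half_sqrt[symmetric] powr_powr power2_norm_eq_inner)
 then show ?thesis using main by simp
qed

text \<open>Young's inequality with an integrable kernel. For 1 < p < \<infinity> the kernel is
  split into its powers \<theta> = 1/p and 1 - \<theta>; Hoelder's inequality leaves a p-th power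
  under the kernel, to which the case p = 1 applies.\<close>

lemma Young_japanese:
 fixes h :: "'a::euclidean_space => ennreal"
 assumes p: "1 \<le> p" and [measurable]: "h \<in> \<B>"
 shows "Lp_norm p (\<lambda>x. \<integral>y. h y * jp s (x - y)) \<le> jint TYPE('a) s * Lp_norm p h"
proof -
 let ?J = "jint TYPE('a) s"
 have L1: "(\<integral>x. \<integral>y. F y * jp s (x - y)) = ?J * (\<integral>y. F y)"
  if [measurable]: "F \<in> \<B>" for F :: "'a => ennreal"
 proof -
  have "(\<integral>x. \<integral>y. F y * jp s (x - y)) = (\<integral>y. \<integral>x. F y * jp s (x - y))"
   by (rule lborel_pair.Fubini'[symmetric]) measurable
  also have "\<dots> = (\<integral>y. ?J * F y)"
   by (intro nn_integral_cong) (simp add: nn_integral_cmult nn_integral_jp_shift mult.commute)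
  finally show ?thesis by (simp add: nn_integral_cmult)
 qed
 consider "p = 1" | "p = \<infinity>" | "p \<noteq> 1" "p \<noteq> \<infinity>" by blast
 then show ?thesis
 proof cases
  case 1
  show ?thesis unfolding 1 Lp_norm_1 L1[OF assms(2)] ..
 next
  case 2
  have "(\<integral>y. h y * jp s (x - y)) \<le> ?J * esssup lborel h" for x
  proof -
   have "AE y in lborel. h y * jp s (x - y) \<le> esssup lborel h * jp s (x - y)"
    using esssup_AE[of h lborel] by (rule eventually_mono) (auto intro: mult_right_mono)
   then have "(\<integral>y. h y * jp s (x - y)) \<le> (\<integral>y. esssup lborel h * jp s (x - y))"
    by (rule nn_integral_mono_AE)
   then show ?thesis by (simp add: nn_integral_cmult nn_integral_jp_shift mult.commute)
  qed
  then show ?thesis unfolding 2 Lp_norm_top by (intro esssup_I AE_I2) simp_all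
 next
  case 3
  then obtain r where r: "1 \<le> r" "enn2real p = r" "recip p = 1 / r" using exponent_finite[OF p] by metis
  define \<theta> where "\<theta> = 1 / r"
  have "r \<noteq> 1" using recip_cases(4)[OF p] 3 r by auto
  then have \<theta>: "0 < \<theta>" "\<theta> < 1" "\<theta> * r = 1" "(1 - \<theta>) * r = r - 1" "(r - 1) * \<theta> = 1 - \<theta>"
   using r by (auto simp: \<theta>_def field_simps)
  have split: "epowr y \<theta> * epowr y (1 - \<theta>) = y" for y
   using epowr_add[of \<theta> "1 - \<theta>" y] \<theta> by simp
  have pw: "epowr (\<integral>y. h y * jp s (x - y)) r
    \<le> (\<integral>y. epowr (h y) r * jp s (x - y)) * epowr ?J (r - 1)" for x
  proof -
   have e: "epowr (epowr (h y) r * jp s (x - y)) \<theta> * epowr (jp s (x - y)) (1 - \<theta>) = h y * jp s (x - y)" for y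
    using \<theta> split[of "jp s (x - y)"] by (simp add: epowr_mult epowr_epowr mult.assoc mult.commute[of r])
   have "(\<integral>y. h y * jp s (x - y))
     \<le> epowr (\<integral>y. epowr (h y) r * jp s (x - y)) \<theta> * epowr (\<integral>y. jp s (x - y)) (1 - \<theta>)"
    unfolding e[symmetric] by (rule nn_integral_Holder_exponent[OF \<theta>(1,2)]) measurable
   then have "epowr (\<integral>y. h y * jp s (x - y)) r
     \<le> epowr (epowr (\<integral>y. epowr (h y) r * jp s (x - y)) \<theta> * epowr ?J (1 - \<theta>)) r"
    unfolding nn_integral_jp_shift using r by (intro epowr_mono) auto
   then show ?thesis using r \<theta> by (simp add: epowr_mult epowr_epowr)
  qed
  have "Lp_norm p (\<lambda>x. \<integral>y. h y * jp s (x - y))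
    \<le> epowr (\<integral>x. (\<integral>y. epowr (h y) r * jp s (x - y)) * epowr ?J (r - 1)) \<theta>"
   unfolding Lp_norm_finite[OF 3(2)] r \<theta>_def using r by (intro epowr_mono nn_integral_mono pw) auto
  also have "(\<integral>x. (\<integral>y. epowr (h y) r * jp s (x - y)) * epowr ?J (r - 1))
    = (?J * (\<integral>y. epowr (h y) r)) * epowr ?J (r - 1)"
   by (simp add: nn_integral_multc L1)
  also have "epowr \<dots> \<theta> = (epowr ?J \<theta> * epowr ?J (1 - \<theta>)) * epowr (\<integral>y. epowr (h y) r) \<theta>"
   using \<theta> by (simp add: epowr_mult epowr_epowr mult_ac)
  also have "\<dots> = ?J * Lp_norm p h" unfolding split Lp_norm_finite[OF 3(2)] r by (simp add: \<theta>_def)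
  finally show ?thesis .
 qed
qed

text \<open>A translate of |\<phi>|^2, normalised. Nonnegative values exclude cancellation in the
  series and superpositions of the necessity part.\<close>

lemma nonneg_schwartz:
 fixes \<phi> :: "'a::euclidean_space => complex"
 assumes \<phi>: "\<phi> \<in> schwartz" and nz: "\<phi> x0 \<noteq> 0"
 obtains \<gamma> :: "'a => complex" where "\<gamma> \<in> schwartz" "\<And>y. \<gamma> y = complex_of_real (cmod (\<gamma> y))" "\<And>y. cmod (\<gamma> y) \<le> 1" "\<gamma> 0 \<noteq> 0"
proof -
 obtain B where B: "\<And>x. cmod (\<phi> x) \<le> B" using schwartz_bounded[OF \<phi>] by metis
 have B0: "B > 0" using B[of x0] nz by (meson less_le_trans zero_less_norm_iff)
 define \<gamma> where "\<gamma> y = complex_of_real (1 / B\<^sup>2) * (\<phi> (y + x0) * cnj (\<phi> (y + x0)))" for y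
 have eq: "\<gamma> y = complex_of_real ((cmod (\<phi> (y + x0)))\<^sup>2 / B\<^sup>2)" for y
  by (simp add: \<gamma>_def complex_norm_square[symmetric])
 have cm: "cmod (\<gamma> y) = (cmod (\<phi> (y + x0)))\<^sup>2 / B\<^sup>2" for y
  unfolding eq norm_of_real by simp
 show ?thesis
 proof (rule that[of \<gamma>])
  show "\<gamma> \<in> schwartz" unfolding \<gamma>_def[abs_def]
   by (intro schwartz_cmult schwartz_mult schwartz_cnj schwartz_translate \<phi>)
  show "\<gamma> y = complex_of_real (cmod (\<gamma> y))" for y unfolding cm by (rule eq)
  show "cmod (\<gamma> y) \<le> 1" for y
   using B0 B[of "y + x0"] by (simp add: cm power_mono)
  show "\<gamma> 0 \<noteq> 0" using nz B0 by (simp add: \<gamma>_def)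
 qed
qed

lemma small_japanese_powr:
 assumes w: "w < 0" and e: "0 < e"
 obtains y :: "'a::euclidean_space" where "japanese y powr w < e"
proof -
 obtain b :: 'a where b: "b \<in> Basis" using nonempty_Basis by blast
 define R where "R = (e / 2) powr (1 / w)"
 have R: "R > 0" using e by (simp add: R_def)
 have "japanese (R *\<^sub>R b) powr w \<le> R powr w"
  using norm_le_japanese[of "R *\<^sub>R b"] b R w by (intro powr_mono2') auto
 also have "R powr w = e / 2" using w e by (simp add: R_def powr_powr)
 finally show ?thesis using e by (intro that[of "R *\<^sub>R b"]) simp
qed

text \<open>A converse of Hoelder's inequality that tests with nonnegative Schwartz functions only.
  For r = 1 a bump moved to infinity shows \<open>w \<ge> 0\<close>. For r > 1 the borderline
  function \<open>japanese y powr (- d)\<close>, which is not integrable, is cut off at larger and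
  larger scales.\<close>

lemma functional_bound_exponent:
 fixes \<phi> :: "'a::euclidean_space => complex"
 assumes \<phi>: "\<phi> \<in> schwartz" and nz: "\<phi> x0 \<noteq> 0" and r: "1 \<le> r"
  and H: "\<And>c :: 'a => complex. c \<in> schwartz ==> (\<And>y. c y = complex_of_real (cmod (c y))) ==>
   (\<integral>y. ennreal (cmod (c y))) \<le> ennreal C * Lp_norm r (\<lambda>y. ennreal (cmod (c y)) * jp w y)"
 shows "1 < recip r + w / DIM('a) \<or> r = 1 \<and> w = 0"
proof -
 obtain \<gamma> :: "'a => complex" where \<gamma>: "\<gamma> \<in> schwartz" and \<gamma>n: "\<And>y. \<gamma> y = complex_of_real (cmod (\<gamma> y))"
  and \<gamma>1: "\<And>y. cmod (\<gamma> y) \<le> 1" and \<gamma>0: "\<gamma> 0 \<noteq> 0"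
  using nonneg_schwartz[OF \<phi> nz] by metis
 define d where "d = real DIM('a)"
 have d: "d > 0" by (simp add: d_def)
 define g where "g y = ennreal (cmod (\<gamma> y))" for y
 have [measurable]: "g \<in> \<B>" unfolding g_def using schwartz_measurable[OF \<gamma>] by measurable
 show ?thesis
 proof (cases "r = 1")
  case r1: True
  have "w \<ge> 0"
  proof (rule ccontr)
   assume "\<not> w \<ge> 0"
   then have w: "w < 0" by simp
   define N where "N = d + 1 + \<bar>w\<bar>"
   obtain D where D: "D \<ge> 0" "\<And>y. g y \<le> ennreal D * jp (- N) y"
   proof -
    obtain n :: nat where n: "N \<le> real n" using real_arch_simple by blast
    obtain D where D: "D \<ge> 0" "\<And>y. cmod (\<gamma> y) \<le> D / japanese y ^ n"
     using rapidD[OF schwartz_rapid[OF \<gamma>]] by metis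
    have "g y \<le> ennreal D * jp (- N) y" for y
    proof -
     have "g y \<le> ennreal (D * japanese y powr (- real n))"
      unfolding g_def using D(2)[of y] by (intro ennreal_leI) (simp add: powr_minus_divide powr_realpow)
     also have "\<dots> = ennreal D * jp (- real n) y" using D by (simp add: jp_def ennreal_mult)
     also have "\<dots> \<le> ennreal D * jp (- N) y" using n by (intro mult_left_mono jp_mono) auto
     finally show ?thesis .
    qed
    then show ?thesis using D that by blast
   qed
   have "jint TYPE('a) (- (N - \<bar>w\<bar>)) < top" by (rule jint_finite) (simp add: N_def d_def)
   then obtain J where J: "jint TYPE('a) (- (N - \<bar>w\<bar>)) = ennreal J" "0 \<le> J" by (cases "jint TYPE('a) (- (N - \<bar>w\<bar>))") auto
   define E where "E = \<bar>C\<bar> * (D * 2 powr \<bar>w\<bar> * J)"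
   have E0: "E \<ge> 0" using D J by (simp add: E_def)
   have up: "(\<integral>y. g y) \<le> ennreal (E * japanese y powr w)" for y :: 'a
   proof -
    define c where "c u = \<gamma> (u + - y)" for u
    have cS: "c \<in> schwartz" unfolding c_def[abs_def] by (rule schwartz_translate[OF \<gamma>])
    have cn: "c u = complex_of_real (cmod (c u))" for u unfolding c_def by (rule \<gamma>n)
    have "(\<integral>u. g u) = (\<integral>u. g (u + - y))" by (rule nn_integral_lborel_shift[symmetric]) simp
    also have "\<dots> \<le> ennreal C * (\<integral>u. g (u + - y) * jp w u)"
     using H[OF cS cn] unfolding r1 Lp_norm_1 c_def g_def .
    also have "\<dots> \<le> ennreal \<bar>C\<bar> * (\<integral>u. ennreal D * (ennreal (2 powr \<bar>w\<bar>) * (jp w y * jp (- (N - \<bar>w\<bar>)) (u - y))))"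
    proof (rule mult_mono[OF ennreal_leI nn_integral_mono])
     fix u :: 'a
     have "g (u + - y) * jp w u \<le> (ennreal D * jp (- N) (u - y)) * jp w u"
      using D(2)[of "u - y"] by (intro mult_right_mono) auto
     also have "\<dots> \<le> ennreal D * (ennreal (2 powr \<bar>w\<bar>) * (jp w y * jp (- (N - \<bar>w\<bar>)) (u - y)))"
      unfolding mult.assoc[of "ennreal D"] by (intro mult_left_mono jp_peetre_factor) simp
     finally show "g (u + - y) * jp w u \<le> ennreal D * (ennreal (2 powr \<bar>w\<bar>) * (jp w y * jp (- (N - \<bar>w\<bar>)) (u - y)))" .
    qed auto
    also have "(\<integral>u. ennreal D * (ennreal (2 powr \<bar>w\<bar>) * (jp w y * jp (- (N - \<bar>w\<bar>)) (u - y))))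
      = ennreal D * (ennreal (2 powr \<bar>w\<bar>) * (jp w y * ennreal J))"
     by (simp add: nn_integral_cmult nn_integral_jp_shift J(1) del: minus_diff_eq)
    also have "ennreal \<bar>C\<bar> * \<dots> = ennreal (E * japanese y powr w)"
     using D J by (simp add: E_def jp_def ennreal_mult mult_ac)
    finally show ?thesis .
   qed
   have pos: "(\<integral>y. g y) \<noteq> 0"
   proof
    assume "(\<integral>y. g y) = 0"
    then have "AE y in lborel. g y = 0" by (subst (asm) nn_integral_0_iff_AE) auto
    then have "AE y in lborel. \<gamma> y * cnj (\<gamma> y) = 0" by (rule eventually_mono) (simp add: g_def)
    then have "(LINT y|lborel. \<gamma> y * cnj (\<gamma> y)) = 0" by (rule integral_eq_zero_AE)
    then show False using schwartz_norm_sq_pos[OF \<gamma> \<gamma>0] by simp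
   qed
   obtain I where I: "(\<integral>y. g y) = ennreal I" "I > 0"
    using nn_integral_schwartz_finite[OF \<gamma>] pos unfolding g_def
    by (cases "\<integral>y. ennreal (cmod (\<gamma> y))") (auto simp: less_le)
   obtain y :: 'a where y: "japanese y powr w < I / (E + 1)"
    using small_japanese_powr[OF w, of "I / (E + 1)"] I E0 by auto
   have "I \<le> E * japanese y powr w" using up[of y] I by (simp add: ennreal_le_iff2)
   also have "\<dots> \<le> (E + 1) * japanese y powr w" by (intro mult_right_mono) auto
   also have "\<dots> < I" using y E0 by (simp add: pos_less_divide_eq mult.commute)
   finally show False by simp
  qed
  then show ?thesis using r1 d by (auto simp: d_def)
 next
  case r1: False
  show ?thesis
  proof (rule ccontr)
   assume "\<not> ?thesis"
   then have "recip r + w / d \<le> 1" using r1 by (auto simp: d_def)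
   then have wd: "w - d \<le> - (d * recip r)" using d by (simp add: field_simps)
   \<comment> \<open>If the condition fails, the r-th power of the weighted function is dominated by
     the function itself, so the integrals satisfy I \<le> C I^(1/r) and stay bounded; for r =
     \<infinity> they are at most C. By Fatou's lemma this contradicts the divergence of the
     limit.\<close>
   define c where "c n y = complex_of_real (japanese y powr (- d)) * \<gamma> ((1 / real (Suc n)) *\<^sub>R y)" for n y
   have cn: "c n y = complex_of_real (cmod (c n y))" for n y
    using \<gamma>n[of "(1 / real (Suc n)) *\<^sub>R y"] by (simp add: c_def norm_mult)
   have cS: "c n \<in> schwartz" for n
   proof -
    have "(\<lambda>y. \<gamma> ((1 / real (Suc n)) *\<^sub>R y) * complex_of_real (japanese y powr (- d))) \<in> schwartz"
     by (intro schwartz_mult_slow schwartz_scale \<gamma> slow_japanese_powr) (use d in auto)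
    then show ?thesis by (simp add: c_def[abs_def] mult.commute)
   qed
   define G where "G n y = ennreal (cmod (c n y))" for n y
   have [measurable]: "G n \<in> \<B>" for n
    unfolding G_def using schwartz_measurable[OF cS] by measurable
   have G: "G n y = jp (- d) y * g ((1 / real (Suc n)) *\<^sub>R y)" for n y
    by (simp add: G_def c_def g_def norm_mult jp_def ennreal_mult)
   have g1: "g y \<le> 1" for y unfolding g_def using \<gamma>1[of y] by simp
   define I where "I n = (\<integral>y. G n y)" for n
   have I_fin: "I n < \<infinity>" for n unfolding I_def G_def by (rule nn_integral_schwartz_finite[OF cS])
   have bound: "I n \<le> ennreal C * (if r = \<infinity> then 1 else epowr (I n) (recip r))" for n
   proof -
    have HI: "I n \<le> ennreal C * Lp_norm r (\<lambda>y. G n y * jp w y)"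
     unfolding I_def G_def by (rule H[OF cS cn])
    have Gw: "G n y * jp w y = jp (w - d) y * g ((1 / real (Suc n)) *\<^sub>R y)" for y
     unfolding G by (simp add: mult_ac flip: jp_add) (simp add: mult.assoc[symmetric] flip: jp_add)
    have "Lp_norm r (\<lambda>y. G n y * jp w y) \<le> (if r = \<infinity> then 1 else epowr (I n) (recip r))"
    proof (cases "r = \<infinity>")
     case True
     have "G n y * jp w y \<le> 1" for y
     proof -
      have "G n y * jp w y \<le> 1 * 1" unfolding Gw using wd True by (intro mult_mono jp_le_1 g1) auto
      then show ?thesis by simp
     qed
     then show ?thesis unfolding True Lp_norm_top by (simp, intro esssup_I AE_I2) auto
    next
     case False
     then obtain q where q: "1 \<le> q" "enn2real r = q" "recip r = 1 / q" using exponent_finite[OF r] by metis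
     have le: "epowr (G n y * jp w y) q \<le> G n y" for y
     proof -
      have "epowr (G n y * jp w y) q = jp ((w - d) * q) y * epowr (g ((1 / real (Suc n)) *\<^sub>R y)) q"
       unfolding Gw using q by (simp add: epowr_mult jp_epowr)
      also have "\<dots> \<le> jp (- d) y * g ((1 / real (Suc n)) *\<^sub>R y)"
      proof (intro mult_mono jp_mono epowr_le_self g1 q)
       have "(w - d) * q \<le> - (d * recip r) * q" using wd q by (intro mult_right_mono) auto
       then show "(w - d) * q \<le> - d" using q by simp
      qed auto
      finally show ?thesis by (simp add: G)
     qed
     show ?thesis unfolding Lp_norm_finite[OF False] q using False q
      by (simp add: I_def) (intro epowr_mono nn_integral_mono le, auto)
    qed
    then show ?thesis using HI by (meson mult_left_mono order_trans zero_le)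
   qed
   \<comment> \<open>The largest solution of i \<le> |C| i^(1/r), enlarged so as to serve for r =
     \<infinity> as well.\<close>
   define B where "B = max \<bar>C\<bar> (max 1 \<bar>C\<bar> powr (1 / (1 - recip r)))"
   have IB: "I n \<le> ennreal B" for n
   proof -
    obtain i where i: "I n = ennreal i" "i \<ge> 0" using I_fin[of n] by (cases "I n") auto
    have C1: "ennreal C \<le> ennreal \<bar>C\<bar>" by (intro ennreal_leI) simp
    show ?thesis
    proof (cases "r = \<infinity> \<or> i = 0")
     case True
     then show ?thesis
     proof
      assume "r = \<infinity>"
      then have "I n \<le> ennreal C" using bound[of n] by simp
      also have "\<dots> \<le> ennreal B" by (intro ennreal_leI) (simp add: B_def)
      finally show ?thesis .
     qed (simp add: i)
    next
     case False
     have th: "recip r < 1" using recip_cases(2,4)[OF r] r1 by linarith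
     have i0: "i > 0" using i False by simp
     have "ennreal i \<le> ennreal \<bar>C\<bar> * ennreal (i powr recip r)"
      using bound[of n] False i mult_right_mono[OF C1, of "ennreal (i powr recip r)"] by (simp add: epowr_ennreal)
     then have "i \<le> \<bar>C\<bar> * i powr recip r"
      using i by (simp flip: ennreal_mult)
     then have "i * i powr (- recip r) \<le> \<bar>C\<bar> * i powr recip r * i powr (- recip r)" by (intro mult_right_mono) auto
     also have "\<dots> = \<bar>C\<bar>" using i0 by (simp add: mult.assoc flip: powr_add)
     also have "i * i powr (- recip r) = i powr (1 - recip r)" using i0 by (simp add: powr_diff powr_minus field_simps)
     finally have "(i powr (1 - recip r)) powr (1 / (1 - recip r)) \<le> (max 1 \<bar>C\<bar>) powr (1 / (1 - recip r))"
      using th by (intro powr_mono2) auto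
     then have "i \<le> B" using th i0 by (simp add: powr_powr B_def)
     then show ?thesis using i by (simp add: ennreal_leI)
    qed
   qed
   have "g 0 * (\<integral>\<^sup>+y. jp (- d) y \<partial>(lborel::'a measure)) = (\<integral>\<^sup>+y. jp (- d) y * g 0 \<partial>(lborel::'a measure))"
    by (simp add: nn_integral_cmult mult.commute)
   also have "\<dots> = (\<integral>y. liminf (\<lambda>n. G n y))"
   proof (rule nn_integral_cong)
    fix y :: 'a
    have "(\<lambda>n. (1 / real (Suc n)) *\<^sub>R y) \<longlonglongrightarrow> 0 *\<^sub>R y"
     by (intro tendsto_scaleR tendsto_const LIMSEQ_Suc[OF lim_1_over_n])
    then have l0: "(\<lambda>n. (1 / real (Suc n)) *\<^sub>R y) \<longlonglongrightarrow> 0" by simp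
    have "isCont \<gamma> 0" using schwartz_continuous[OF \<gamma>, of UNIV] by (simp add: continuous_on_eq_continuous_at)
    from isCont_tendsto_compose[OF this l0]
    have "(\<lambda>n. g ((1 / real (Suc n)) *\<^sub>R y)) \<longlonglongrightarrow> g 0"
     unfolding g_def by (intro tendsto_ennrealI tendsto_norm)
    then have "(\<lambda>n. jp (- d) y * g ((1 / real (Suc n)) *\<^sub>R y)) \<longlonglongrightarrow> jp (- d) y * g 0"
     by (intro ennreal_tendsto_cmult) auto
    then have "liminf (\<lambda>n. G n y) = jp (- d) y * g 0"
     unfolding G by (intro lim_imp_Liminf) auto
    then show "jp (- d) y * g 0 = liminf (\<lambda>n. G n y)" by simp
   qed
   also have "\<dots> \<le> liminf I" unfolding I_def[abs_def] by (rule nn_integral_liminf) simp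
   also have "\<dots> \<le> ennreal B"
    by (rule order_trans[OF Liminf_le_Limsup]) (auto intro!: Limsup_bounded always_eventually IB)
   finally have "g 0 * (\<integral>y. jp (- d) (y::'a)) \<le> ennreal B" .
   moreover have "(\<integral>y. jp (- d) (y::'a)) = top"
    using nn_integral_japanese_infinite[where 'a='a, of d] by (simp add: jp_def d_def)
   moreover have "g 0 \<noteq> 0" using \<gamma>0 by (simp add: g_def)
   ultimately show False by (simp add: ennreal_mult_top top_unique)
  qed
 qed
qed

section \<open>Superpositions of time-frequency shifts\<close>

definition superpose :: "real => real => ('a::euclidean_space => complex) => ('a => complex) => 'a => complex"
 where "superpose \<alpha> \<beta> \<gamma> c t = (LINT y|lborel. c y * (cis (2 * pi * (t \<bullet> \<beta> *\<^sub>R y)) * \<gamma> (t - \<alpha> *\<^sub>R y)))"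

lemma schwartz_superpose_kernel:
 assumes \<gamma>: "\<gamma> \<in> schwartz" and c: "c \<in> schwartz"
 shows "(\<lambda>p. c (snd p) * (cis (2 * pi * (fst p \<bullet> \<beta> *\<^sub>R snd p)) * \<gamma> (fst p - \<alpha> *\<^sub>R snd p))) \<in> schwartz"
proof -
 define L where "L p = (fst p - \<alpha> *\<^sub>R snd p, snd p)" for p :: "'a \<times> 'a"
 have L: "bounded_linear L" unfolding L_def
  by (intro bounded_linear_Pair bounded_linear_sub bounded_linear_fst bounded_linear_snd bounded_linear_compose[OF bounded_linear_scaleR_right])
 have "norm p \<le> (\<bar>\<alpha>\<bar> + 2) * norm (L p)" for p
 proof -
  have "norm p \<le> norm (fst p) + norm (snd p)" using norm_Pair_le[of "fst p" "snd p"] by simp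
  also have "norm (fst p) \<le> norm (fst p - \<alpha> *\<^sub>R snd p) + norm (\<alpha> *\<^sub>R snd p)"
   using norm_triangle_ineq[of "fst p - \<alpha> *\<^sub>R snd p" "\<alpha> *\<^sub>R snd p"] by simp
  also have "norm (fst p - \<alpha> *\<^sub>R snd p) \<le> norm (L p)" unfolding L_def by (rule norm_fst_le)
  finally have 1: "norm p \<le> norm (L p) + (\<bar>\<alpha>\<bar> + 1) * norm (snd p)" by (simp add: algebra_simps)
  have "norm (snd p) \<le> norm (L p)" unfolding L_def by (rule norm_snd_le)
  then have "(\<bar>\<alpha>\<bar> + 1) * norm (snd p) \<le> (\<bar>\<alpha>\<bar> + 1) * norm (L p)" by (intro mult_left_mono) auto
  then show ?thesis using 1 by (simp add: algebra_simps)
 qed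
 from schwartz_linear[OF schwartz_tensor[OF \<gamma> c] L this]
 have "(\<lambda>p. \<gamma> (fst p - \<alpha> *\<^sub>R snd p) * c (snd p)) \<in> schwartz" by (simp add: L_def)
 then have "(\<lambda>p. \<gamma> (fst p - \<alpha> *\<^sub>R snd p) * c (snd p) * cis (2 * pi * (fst p \<bullet> \<beta> *\<^sub>R snd p))) \<in> schwartz"
  by (rule schwartz_mult_slow) (intro slow_cis_inner bounded_linear_fst bounded_linear_compose[OF bounded_linear_scaleR_right] bounded_linear_snd)
 then show ?thesis by (simp add: mult_ac)
qed

lemma schwartz_superpose:
 assumes "\<gamma> \<in> schwartz" "c \<in> schwartz" shows "superpose \<alpha> \<beta> \<gamma> c \<in> schwartz"
 using schwartz_integral_snd[OF schwartz_superpose_kernel[OF assms, of \<beta> \<alpha>]]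
 by (simp add: superpose_def[abs_def])

lemma slow_compose_fst:
 assumes \<gamma>: "\<gamma> \<in> schwartz" and c: "c \<in> schwartz" and m: "\<And>t. cmod (m t) \<le> B" and mm: "m \<in> \<B>"
 shows "integrable (lborel \<Otimes>\<^sub>M lborel) (\<lambda>(t, y). m t * (c y * (cis (2 * pi * (t \<bullet> \<beta> *\<^sub>R y)) * \<gamma> (t - \<alpha> *\<^sub>R y))))"
proof -
 define P where "P p = c (snd p) * (cis (2 * pi * (fst p \<bullet> \<beta> *\<^sub>R snd p)) * \<gamma> (fst p - \<alpha> *\<^sub>R snd p))" for p
 have P: "P \<in> schwartz" unfolding P_def[abs_def] by (rule schwartz_superpose_kernel[OF \<gamma> c])
 have Pi: "integrable lborel (\<lambda>p. complex_of_real \<bar>B\<bar> * P p)"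
  by (intro Bochner_Integration.integrable_mult_right schwartz_integrable P)
 have [measurable]: "P \<in> \<B>" by (rule schwartz_measurable[OF P])
 have "integrable lborel (\<lambda>p. m (fst p) * P p)"
 proof (rule Bochner_Integration.integrable_bound[OF Pi])
  show "(\<lambda>p. m (fst p) * P p) \<in> borel_measurable lborel" using mm by measurable
  show "AE p in lborel. norm (m (fst p) * P p) \<le> norm (complex_of_real \<bar>B\<bar> * P p)"
   using order_trans[OF m abs_ge_self] by (intro AE_I2) (simp add: norm_mult mult_right_mono)
 qed
 then show ?thesis by (simp add: lborel_prod P_def case_prod_unfold)
qed

lemma integral_superpose:
 assumes \<gamma>: "\<gamma> \<in> schwartz" and c: "c \<in> schwartz" and m: "\<And>t. cmod (m t) \<le> B" and mm: "m \<in> \<B>"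
 shows "(LINT t|lborel. m t * superpose \<alpha> \<beta> \<gamma> c t)
  = (LINT y|lborel. c y * (LINT t|lborel. m t * (cis (2 * pi * (t \<bullet> \<beta> *\<^sub>R y)) * \<gamma> (t - \<alpha> *\<^sub>R y))))"
proof -
 have "(LINT t|lborel. m t * superpose \<alpha> \<beta> \<gamma> c t)
   = (LINT t|lborel. LINT y|lborel. m t * (c y * (cis (2 * pi * (t \<bullet> \<beta> *\<^sub>R y)) * \<gamma> (t - \<alpha> *\<^sub>R y))))"
  unfolding superpose_def by simp
 also have "\<dots> = (LINT y|lborel. LINT t|lborel. m t * (c y * (cis (2 * pi * (t \<bullet> \<beta> *\<^sub>R y)) * \<gamma> (t - \<alpha> *\<^sub>R y))))"
  by (rule lborel_pair.Fubini_integral[symmetric]) (rule slow_compose_fst[OF assms])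
 also have "\<dots> = (LINT y|lborel. c y * (LINT t|lborel. m t * (cis (2 * pi * (t \<bullet> \<beta> *\<^sub>R y)) * \<gamma> (t - \<alpha> *\<^sub>R y))))"
  by (simp add: mult.left_commute[of _ "c _"])
 finally show ?thesis .
qed

lemma stft_superpose_bound:
 assumes \<gamma>: "\<gamma> \<in> schwartz" and \<phi>: "\<phi> \<in> schwartz"
 obtains D :: real where "0 \<le> D" "\<And>c x \<xi> \<alpha> \<beta>. c \<in> schwartz ==> stft_abs \<phi> (fun_distr (superpose \<alpha> \<beta> \<gamma> c)) (x, \<xi>)
  \<le> ennreal D * (\<integral>y. ennreal (cmod (c y)) * (jp (- N) (x - \<alpha> *\<^sub>R y) * jp (- N) (\<xi> - \<beta> *\<^sub>R y)))"
proof -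
 obtain D where D: "D \<ge> 0" "\<And>x \<xi>. ennreal (cmod (stft \<phi> (fun_distr \<gamma>) x \<xi>)) \<le> ennreal D * (jp (- N) x * jp (- N) \<xi>)"
  using stft_jp_bound[OF \<gamma> \<phi>] by blast
 have "stft_abs \<phi> (fun_distr (superpose \<alpha> \<beta> \<gamma> c)) (x, \<xi>)
  \<le> ennreal D * (\<integral>y. ennreal (cmod (c y)) * (jp (- N) (x - \<alpha> *\<^sub>R y) * jp (- N) (\<xi> - \<beta> *\<^sub>R y)))"
  if c: "c \<in> schwartz" for c and x \<xi> :: 'a and \<alpha> \<beta> :: real
 proof -
  define m where "m t = cnj (cis (2 * pi * (t \<bullet> \<xi>)) * \<phi> (t - x))" for t
  have mS: "m \<in> schwartz" unfolding m_def by (intro schwartz_cnj schwartz_modulate_translate \<phi>)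
  obtain B where B: "\<And>t. cmod (m t) \<le> B" using schwartz_bounded[OF mS] by metis
  define V where "V y = (LINT t|lborel. m t * (cis (2 * pi * (t \<bullet> \<beta> *\<^sub>R y)) * \<gamma> (t - \<alpha> *\<^sub>R y)))" for y
  have V: "cmod (V y) = cmod (stft \<phi> (fun_distr \<gamma>) (x - \<alpha> *\<^sub>R y) (\<xi> - \<beta> *\<^sub>R y))" for y
  proof -
   have "V y = stft \<phi> (fun_distr (\<lambda>t. cis (2 * pi * (t \<bullet> \<beta> *\<^sub>R y)) * \<gamma> (t - \<alpha> *\<^sub>R y))) x \<xi>"
    unfolding V_def stft_def fun_distr_def m_def by (simp only: mult.commute)
   then show ?thesis by (simp only: norm_stft_modulate_translate[OF \<gamma> \<phi>])
  qed
  have "stft \<phi> (fun_distr (superpose \<alpha> \<beta> \<gamma> c)) x \<xi> = (LINT t|lborel. m t * superpose \<alpha> \<beta> \<gamma> c t)"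
   unfolding stft_def fun_distr_def m_def by (simp only: mult.commute)
  also have "\<dots> = (LINT y|lborel. c y * V y)"
   unfolding V_def by (rule integral_superpose[OF \<gamma> c B schwartz_measurable[OF mS]])
  finally have "stft_abs \<phi> (fun_distr (superpose \<alpha> \<beta> \<gamma> c)) (x, \<xi>) = ennreal (cmod (LINT y|lborel. c y * V y))"
   by (simp add: stft_abs_def)
  also have "\<dots> \<le> (\<integral>y. ennreal (cmod (c y * V y)))"
  proof (cases "integrable lborel (\<lambda>y. c y * V y)")
   case True
   then show ?thesis by (rule Bochner_Integration.integral_norm_bound_ennreal)
  qed (simp add: not_integrable_integral_eq)
  also have "\<dots> \<le> (\<integral>y. ennreal D * (ennreal (cmod (c y)) * (jp (- N) (x - \<alpha> *\<^sub>R y) * jp (- N) (\<xi> - \<beta> *\<^sub>R y))))"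
  proof (rule nn_integral_mono)
   fix y
   have "ennreal (cmod (c y * V y)) = ennreal (cmod (c y)) * ennreal (cmod (V y))" by (simp add: norm_mult ennreal_mult)
   also have "\<dots> \<le> ennreal (cmod (c y)) * (ennreal D * (jp (- N) (x - \<alpha> *\<^sub>R y) * jp (- N) (\<xi> - \<beta> *\<^sub>R y)))"
    unfolding V by (intro mult_left_mono D) simp
   finally show "ennreal (cmod (c y * V y)) \<le> ennreal D * (ennreal (cmod (c y)) * (jp (- N) (x - \<alpha> *\<^sub>R y) * jp (- N) (\<xi> - \<beta> *\<^sub>R y)))"
    by (simp add: mult_ac)
  qed
  also have "\<dots> = ennreal D * (\<integral>y. ennreal (cmod (c y)) * (jp (- N) (x - \<alpha> *\<^sub>R y) * jp (- N) (\<xi> - \<beta> *\<^sub>R y)))"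
  proof -
   note [measurable] = schwartz_measurable[OF c]
   show ?thesis by (rule nn_integral_cmult) measurable
  qed
  finally show ?thesis .
 qed
 then show ?thesis using D that by blast
qed

text \<open>Peetre's inequality moves the weight onto \<open>h\<close>.\<close>

lemma Young_japanese_weighted:
 fixes h :: "'a::euclidean_space => ennreal"
 assumes p: "1 \<le> p" and [measurable]: "h \<in> \<B>"
 shows "Lp_norm p (\<lambda>x. (\<integral>y. h y * jp (- N) (x - y)) * jp s x)
  \<le> ennreal (2 powr \<bar>s\<bar>) * (jint TYPE('a) (- (N - \<bar>s\<bar>)) * Lp_norm p (\<lambda>y. h y * jp s y))"
proof -
 have "Lp_norm p (\<lambda>x. (\<integral>y. h y * jp (- N) (x - y)) * jp s x)
   \<le> Lp_norm p (\<lambda>x. ennreal (2 powr \<bar>s\<bar>) * (\<integral>y. (h y * jp s y) * jp (- (N - \<bar>s\<bar>)) (x - y)))"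
 proof (rule Lp_norm_mono[OF p])
  fix x :: 'a
  have "(\<integral>y. h y * jp (- N) (x - y)) * jp s x = (\<integral>y. h y * (jp (- N) (x - y) * jp s x))"
   by (subst nn_integral_multc[symmetric]) (simp_all add: mult.assoc)
  also have "\<dots> \<le> (\<integral>y. h y * (ennreal (2 powr \<bar>s\<bar>) * (jp s y * jp (- (N - \<bar>s\<bar>)) (x - y))))"
   by (intro nn_integral_mono mult_left_mono jp_peetre_factor) simp
  also have "\<dots> = ennreal (2 powr \<bar>s\<bar>) * (\<integral>y. (h y * jp s y) * jp (- (N - \<bar>s\<bar>)) (x - y))"
   by (subst nn_integral_cmult[symmetric]) (simp_all add: mult_ac)
  finally show "(\<integral>y. h y * jp (- N) (x - y)) * jp s x
    \<le> ennreal (2 powr \<bar>s\<bar>) * (\<integral>y. (h y * jp s y) * jp (- (N - \<bar>s\<bar>)) (x - y))" .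
 qed measurable
 also have "\<dots> \<le> ennreal (2 powr \<bar>s\<bar>) * Lp_norm p (\<lambda>x. \<integral>y. (h y * jp s y) * jp (- (N - \<bar>s\<bar>)) (x - y))"
  by (rule Lp_norm_cmult_le[OF p]) measurable
 also have "\<dots> \<le> ennreal (2 powr \<bar>s\<bar>) * (jint TYPE('a) (- (N - \<bar>s\<bar>)) * Lp_norm p (\<lambda>y. h y * jp s y))"
  by (intro mult_left_mono Young_japanese p) simp_all
 finally show ?thesis .
qed

text \<open>The position and the frequency of the shift with parameter \<open>y\<close> are \<open>\<alpha> y\<close> and \<open>\<beta> y\<close>; \<open>g\<close> picks the
 variable that is close to \<open>y\<close>.\<close>

lemma superpose_norm:
 fixes \<gamma> \<phi> :: "'a::euclidean_space => complex" and g :: "'a \<times> 'a => 'a" and G :: "'a \<times> 'a => ennreal"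
 assumes \<gamma>: "\<gamma> \<in> schwartz" and \<phi>: "\<phi> \<in> schwartz" and pq: "1 \<le> p" "1 \<le> q" and r: "1 \<le> r"
  and [measurable]: "g \<in> \<B>" "G \<in> \<B>"
  and L: "real DIM('a) + \<bar>w\<bar> < L" and E: "E < top" and K: "K < top"
  and kern: "\<And>x \<xi> y. jp (- N) (x - \<alpha> *\<^sub>R y) * jp (- N) (\<xi> - \<beta> *\<^sub>R y) * (jp s x * jp t \<xi>) \<le> E * (jp (- L) (g (x, \<xi>) - y) * G (x, \<xi>))"
  and mix: "\<And>u. u \<in> \<B> ==> mixed_norm p q (\<lambda>z. u (g z) * G z) \<le> K * Lp_norm r (\<lambda>x. u x * jp w x)"
 obtains C where "C < top" "\<And>c. c \<in> schwartz ==>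
  modulation_norm \<phi> p q (weight s t) (fun_distr (superpose \<alpha> \<beta> \<gamma> c)) \<le> C * Lp_norm r (\<lambda>y. ennreal (cmod (c y)) * jp w y)"
proof -
 obtain D where D: "0 \<le> D" "\<And>c x \<xi> \<alpha> \<beta>. c \<in> schwartz ==> stft_abs \<phi> (fun_distr (superpose \<alpha> \<beta> \<gamma> c)) (x, \<xi>)
  \<le> ennreal D * (\<integral>y. ennreal (cmod (c y)) * (jp (- N) (x - \<alpha> *\<^sub>R y) * jp (- N) (\<xi> - \<beta> *\<^sub>R y)))"
  by (rule stft_superpose_bound[OF \<gamma> \<phi>, where N=N]) (rule that)
 define C where "C = ennreal D * E * (K * (ennreal (2 powr \<bar>w\<bar>) * jint TYPE('a) (- (L - \<bar>w\<bar>))))"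
 show ?thesis
 proof (rule that[of C])
  show "C < top" unfolding C_def using E K jint_finite[where 'a='a, of "- (L - \<bar>w\<bar>)"] L by (simp add: ennreal_mult_less_top)
  fix c :: "'a => complex" assume c: "c \<in> schwartz"
  note [measurable] = schwartz_measurable[OF c]
  define u where "u x = (\<integral>y. ennreal (cmod (c y)) * jp (- L) (x - y))" for x
  have u[measurable]: "u \<in> \<B>" unfolding u_def[abs_def] by measurable
  have F: "(\<lambda>z. u (g z) * G z) \<in> \<B>" by measurable
  have "modulation_norm \<phi> p q (weight s t) (fun_distr (superpose \<alpha> \<beta> \<gamma> c)) \<le> ennreal D * E * mixed_norm p q (\<lambda>z. u (g z) * G z)"
  proof (rule modulation_norm_le[OF pq schwartz_superpose[OF \<gamma> c] \<phi> F])
   fix x \<xi> :: 'a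
   define I where "I y = jp (- N) (x - \<alpha> *\<^sub>R y) * jp (- N) (\<xi> - \<beta> *\<^sub>R y)" for y
   have [measurable]: "I \<in> \<B>" unfolding I_def[abs_def] by measurable
   have "stft_abs \<phi> (fun_distr (superpose \<alpha> \<beta> \<gamma> c)) (x, \<xi>) * (jp s x * jp t \<xi>)
     \<le> ennreal D * (\<integral>y. ennreal (cmod (c y)) * I y) * (jp s x * jp t \<xi>)"
    unfolding I_def by (rule mult_right_mono[OF D(2)[OF c]]) simp
   also have "\<dots> = ennreal D * (\<integral>y. ennreal (cmod (c y)) * (I y * (jp s x * jp t \<xi>)))"
    by (simp add: nn_integral_multc[symmetric] mult.assoc)
   also have "\<dots> \<le> ennreal D * (\<integral>y. ennreal (cmod (c y)) * (E * (jp (- L) (g (x, \<xi>) - y) * G (x, \<xi>))))"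
    unfolding I_def by (intro mult_left_mono nn_integral_mono kern) auto
   also have "\<dots> = ennreal D * (\<integral>y. (E * G (x, \<xi>)) * (ennreal (cmod (c y)) * jp (- L) (g (x, \<xi>) - y)))"
    by (simp only: mult_ac)
   also have "\<dots> = ennreal D * ((E * G (x, \<xi>)) * u (g (x, \<xi>)))"
    unfolding u_def by (subst nn_integral_cmult) simp_all
   finally show "stft_abs \<phi> (fun_distr (superpose \<alpha> \<beta> \<gamma> c)) (x, \<xi>) * (jp s x * jp t \<xi>) \<le> ennreal D * E * (u (g (x, \<xi>)) * G (x, \<xi>))"
    by (simp only: mult_ac)
  qed
  also have "\<dots> \<le> ennreal D * E * (K * (ennreal (2 powr \<bar>w\<bar>) * (jint TYPE('a) (- (L - \<bar>w\<bar>)) * Lp_norm r (\<lambda>y. ennreal (cmod (c y)) * jp w y))))"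
   unfolding u_def
   by (rule mult_left_mono[OF order_trans[OF mix mult_left_mono[OF Young_japanese_weighted[OF r]]]]) simp_all
  finally show "modulation_norm \<phi> p q (weight s t) (fun_distr (superpose \<alpha> \<beta> \<gamma> c)) \<le> C * Lp_norm r (\<lambda>y. ennreal (cmod (c y)) * jp w y)"
   by (simp only: C_def mult_ac)
 qed
qed

text \<open>Translates stay near frequency 0, so the outer norm contributes a constant, and only the
  inner exponent and the weight in x are felt. For modulations, treated next, it is the other way
  round.\<close>

lemma superpose_translates_norm:
 assumes \<gamma>: "\<gamma> \<in> schwartz" and \<phi>: "\<phi> \<in> schwartz" and pq: "1 \<le> p" "1 \<le> q"
 obtains C where "C < top" "\<And>c. c \<in> schwartz ==>
  modulation_norm \<phi> p q (weight s t) (fun_distr (superpose 1 0 \<gamma> c)) \<le> C * Lp_norm p (\<lambda>y. ennreal (cmod (c y)) * jp s y)"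
proof -
 define M where "M = real DIM('a) + 1"
 define N where "N = M + \<bar>s\<bar> + \<bar>t\<bar>"
 have NM: "real DIM('a) + \<bar>s\<bar> < N" "real DIM('a) < M" by (simp_all add: N_def M_def)
 obtain K where K: "K < top" "\<And>p x. 1 \<le> p ==> Lp_norm p (\<lambda>y::'a. jp (- M) (x - y)) \<le> K"
  by (rule Lp_norm_jp_shift[OF NM(2)]) (rule that)
 show ?thesis
 proof (rule superpose_norm[OF \<gamma> \<phi> pq pq(1) _ _ NM(1) _ K(1)])
  fix x \<xi> y :: 'a
  have "jp (- N) \<xi> * jp t \<xi> \<le> jp (- M) (0 - \<xi>)"
   unfolding jp_add[symmetric] diff_0 jp_minus by (rule jp_mono) (simp add: N_def)
  from mult_left_mono[OF this, of "jp (- N) (x - y) * jp s x"]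
  show "jp (- N) (x - 1 *\<^sub>R y) * jp (- N) (\<xi> - 0 *\<^sub>R y) * (jp s x * jp t \<xi>)
    \<le> 1 * (jp (- N) (fst (x, \<xi>) - y) * (jp s (fst (x, \<xi>)) * jp (- M) (0 - snd (x, \<xi>))))" by (simp add: mult_ac)
 next
  fix u :: "'a => ennreal" assume [measurable]: "u \<in> \<B>"
  have "mixed_norm p q (\<lambda>z::'a\<times>'a. (u (fst z) * jp s (fst z)) * jp (- M) (0 - snd z)) \<le> Lp_norm p (\<lambda>x. u x * jp s x) * Lp_norm q (\<lambda>y::'a. jp (- M) (0 - y))"
   by (rule mixed_norm_tensor[OF pq, where u="\<lambda>x. u x * jp s x" and v="\<lambda>\<xi>. jp (- M) (0 - \<xi>)"]) measurable
  also have "\<dots> \<le> Lp_norm p (\<lambda>x. u x * jp s x) * K" by (intro mult_left_mono K(2) pq) simp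
  finally show "mixed_norm p q (\<lambda>z::'a\<times>'a. u (fst z) * (jp s (fst z) * jp (- M) (0 - snd z))) \<le> K * Lp_norm p (\<lambda>x. u x * jp s x)"
   by (simp only: mult_ac)
 qed (measurable, measurable, use ennreal_one_less_top in simp, erule that, assumption)
qed

lemma superpose_modulations_norm:
 assumes \<gamma>: "\<gamma> \<in> schwartz" and \<phi>: "\<phi> \<in> schwartz" and pq: "1 \<le> p" "1 \<le> q"
 obtains C where "C < top" "\<And>c. c \<in> schwartz ==>
  modulation_norm \<phi> p q (weight s t) (fun_distr (superpose 0 1 \<gamma> c)) \<le> C * Lp_norm q (\<lambda>y. ennreal (cmod (c y)) * jp t y)"
proof -
 define M where "M = real DIM('a) + 1"
 define N where "N = M + \<bar>s\<bar> + \<bar>t\<bar>"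
 have NM: "real DIM('a) + \<bar>t\<bar> < N" "real DIM('a) < M" by (simp_all add: N_def M_def)
 obtain K where K: "K < top" "\<And>p x. 1 \<le> p ==> Lp_norm p (\<lambda>y::'a. jp (- M) (x - y)) \<le> K"
  by (rule Lp_norm_jp_shift[OF NM(2)]) (rule that)
 show ?thesis
 proof (rule superpose_norm[OF \<gamma> \<phi> pq pq(2) _ _ NM(1) _ K(1)])
  fix x \<xi> y :: 'a
  have "jp (- N) x * jp s x \<le> jp (- M) (0 - x)"
   unfolding jp_add[symmetric] diff_0 jp_minus by (rule jp_mono) (simp add: N_def)
  from mult_left_mono[OF this, of "jp (- N) (\<xi> - y) * jp t \<xi>"]
  show "jp (- N) (x - 0 *\<^sub>R y) * jp (- N) (\<xi> - 1 *\<^sub>R y) * (jp s x * jp t \<xi>)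
    \<le> 1 * (jp (- N) (snd (x, \<xi>) - y) * (jp (- M) (0 - fst (x, \<xi>)) * jp t (snd (x, \<xi>))))" by (simp add: mult_ac)
 next
  fix u :: "'a => ennreal" assume [measurable]: "u \<in> \<B>"
  have "mixed_norm p q (\<lambda>z::'a\<times>'a. jp (- M) (0 - fst z) * (u (snd z) * jp t (snd z))) \<le> Lp_norm p (\<lambda>x::'a. jp (- M) (0 - x)) * Lp_norm q (\<lambda>\<xi>. u \<xi> * jp t \<xi>)"
   by (rule mixed_norm_tensor[OF pq, where u="\<lambda>x. jp (- M) (0 - x)" and v="\<lambda>\<xi>. u \<xi> * jp t \<xi>"]) measurable
  also have "\<dots> \<le> K * Lp_norm q (\<lambda>\<xi>. u \<xi> * jp t \<xi>)" by (intro mult_right_mono K(2) pq) simp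
  finally show "mixed_norm p q (\<lambda>z::'a\<times>'a. u (snd z) * (jp (- M) (0 - fst z) * jp t (snd z))) \<le> K * Lp_norm q (\<lambda>\<xi>. u \<xi> * jp t \<xi>)"
   by (simp only: mult_ac)
 qed (measurable, measurable, use ennreal_one_less_top in simp, erule that, assumption)
qed

text \<open>The shifts lie on the line \<xi> = -x, where a function must live in order to pair
  without conjugation with the phase exp (pi i |t|^2). There both weights are powers of the same
  size, hence the exponent s + t; for fixed \<xi> the inner norm sees a bump near -\<xi>, and the
  outer exponent alone remains.\<close>

lemma superpose_chirps_norm:
 assumes \<gamma>: "\<gamma> \<in> schwartz" and \<phi>: "\<phi> \<in> schwartz" and pq: "1 \<le> p" "1 \<le> q"
 obtains C where "C < top" "\<And>c. c \<in> schwartz ==>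
  modulation_norm \<phi> p q (weight s t) (fun_distr (superpose (- 1) 1 \<gamma> c)) \<le> C * Lp_norm q (\<lambda>y. ennreal (cmod (c y)) * jp (s + t) y)"
proof -
 define M where "M = real DIM('a) + 1"
 define N where "N = M + \<bar>s\<bar> + \<bar>s + t\<bar>"
 have N0: "N > 0" by (simp add: N_def M_def add_pos_nonneg)
 have NM: "real DIM('a) + \<bar>s + t\<bar> < N" "real DIM('a) < M" by (simp_all add: N_def M_def)
 obtain K where K: "K < top" "\<And>p x. 1 \<le> p ==> Lp_norm p (\<lambda>y::'a. jp (- M) (x - y)) \<le> K"
  by (rule Lp_norm_jp_shift[OF NM(2)]) (rule that)
 define E where "E = ennreal (2 powr N) * ennreal (2 powr \<bar>s\<bar>)"
 show ?thesis
 \<comment> \<open>The doubled decay allows one half of the factor in \<xi> - y to be combined with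
   the factor in x + y into decay in x + \<xi>, while the other half is kept for the convolution in
   y.\<close>
 proof (rule superpose_norm[OF \<gamma> \<phi> pq pq(2) _ _ NM(1) _ K(1), where N="N + N"])
  show "E < top" by (simp add: E_def ennreal_mult_less_top)
  fix x \<xi> y :: 'a
  have a: "jp (- N) (x + y) * jp (- N) (\<xi> - y) \<le> ennreal (2 powr N) * jp (- N) (x + \<xi>)"
   using jp_peetre_factor[of N "x + y" "x + \<xi>" "- N"] N0 by (simp add: jp_commute[of _ y] mult.commute)
  have b: "jp (- N) (x + \<xi>) * jp s x \<le> ennreal (2 powr \<bar>s\<bar>) * (jp s \<xi> * jp (- M) (x + \<xi>))"
  proof -
   have "jp (- N) (x - - \<xi>) * jp s x \<le> ennreal (2 powr \<bar>s\<bar>) * (jp s (- \<xi>) * jp (- M) (x - - \<xi>))"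
    by (rule order_trans[OF jp_peetre_factor]) (intro mult_left_mono jp_mono, auto simp: N_def)
   then show ?thesis by simp
  qed
  have "jp (- (N + N)) (x + y) \<le> jp (- N) (x + y)" using N0 by (intro jp_mono) simp
  then have "jp (- (N + N)) (x + y) * jp (- (N + N)) (\<xi> - y) * (jp s x * jp t \<xi>)
    \<le> jp (- N) (x + y) * (jp (- N) (\<xi> - y) * jp (- N) (\<xi> - y)) * (jp s x * jp t \<xi>)"
   by (intro mult_mono) (auto simp flip: jp_add)
  also have "\<dots> = (jp (- N) (\<xi> - y) * jp t \<xi> * jp s x) * (jp (- N) (x + y) * jp (- N) (\<xi> - y))" by (simp only: mult_ac)
  also have "\<dots> \<le> (jp (- N) (\<xi> - y) * jp t \<xi> * jp s x) * (ennreal (2 powr N) * jp (- N) (x + \<xi>))"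
   by (intro mult_left_mono a) auto
  also have "\<dots> = (ennreal (2 powr N) * (jp (- N) (\<xi> - y) * jp t \<xi>)) * (jp (- N) (x + \<xi>) * jp s x)" by (simp only: mult_ac)
  also have "\<dots> \<le> (ennreal (2 powr N) * (jp (- N) (\<xi> - y) * jp t \<xi>)) * (ennreal (2 powr \<bar>s\<bar>) * (jp s \<xi> * jp (- M) (x + \<xi>)))"
   by (intro mult_left_mono b) auto
  also have "\<dots> = E * (jp (- N) (\<xi> - y) * (jp (s + t) \<xi> * jp (- M) (- \<xi> - x)))"
   using jp_commute[of "- M" "- \<xi>" x] by (simp add: E_def jp_add mult_ac)
  finally show "jp (- (N + N)) (x - (- 1) *\<^sub>R y) * jp (- (N + N)) (\<xi> - 1 *\<^sub>R y) * (jp s x * jp t \<xi>)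
    \<le> E * (jp (- N) (snd (x, \<xi>) - y) * (jp (s + t) (snd (x, \<xi>)) * jp (- M) (- snd (x, \<xi>) - fst (x, \<xi>))))" by simp
 next
  fix u :: "'a => ennreal" assume [measurable]: "u \<in> \<B>"
  have "mixed_norm p q (\<lambda>z. u (snd z) * (jp (s + t) (snd z) * jp (- M) (- snd z - fst z))) \<le> Lp_norm q (\<lambda>\<xi>. K * (u \<xi> * jp (s + t) \<xi>))"
   unfolding mixed_norm_def fst_conv snd_conv
  proof (rule Lp_norm_mono[OF pq(2)])
   show "(\<lambda>\<xi>. Lp_norm p (\<lambda>x. u \<xi> * (jp (s + t) \<xi> * jp (- M) (- \<xi> - x)))) \<in> \<B>"
    by (rule measurable_Lp_norm[where F="\<lambda>x \<xi>. u \<xi> * (jp (s + t) \<xi> * jp (- M) (- \<xi> - x))"]) measurable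
   fix \<xi> :: 'a
   have "Lp_norm p (\<lambda>x. (u \<xi> * jp (s + t) \<xi>) * jp (- M) (- \<xi> - x)) \<le> (u \<xi> * jp (s + t) \<xi>) * Lp_norm p (\<lambda>x. jp (- M) (- \<xi> - x))"
    by (rule Lp_norm_cmult_le[OF pq(1)]) measurable
   also have "\<dots> \<le> (u \<xi> * jp (s + t) \<xi>) * K" by (intro mult_left_mono K(2) pq) simp
   finally show "Lp_norm p (\<lambda>x. u \<xi> * (jp (s + t) \<xi> * jp (- M) (- \<xi> - x))) \<le> K * (u \<xi> * jp (s + t) \<xi>)" by (simp only: mult_ac)
  qed
  also have "\<dots> \<le> K * Lp_norm q (\<lambda>\<xi>. u \<xi> * jp (s + t) \<xi>)" by (rule Lp_norm_cmult_le[OF pq(2)]) measurable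
  finally show "mixed_norm p q (\<lambda>z. u (snd z) * (jp (s + t) (snd z) * jp (- M) (- snd z - fst z))) \<le> K * Lp_norm q (\<lambda>\<xi>. u \<xi> * jp (s + t) \<xi>)" .
 qed (measurable, measurable, rule that)
qed

text \<open>The constant of Fourier inversion, made nameable by choice; being nonzero is all that is
  known and used about its value.\<close>

definition ftc :: "'a::euclidean_space itself => complex"
 where "ftc _ = (SOME c. c \<noteq> 0 \<and> (\<forall>f\<in>schwartz. \<forall>x::'a. ft (ft f) x = c * f (- x)))"

lemma ft_ft: "ftc TYPE('a::euclidean_space) \<noteq> 0"
  "f \<in> schwartz ==> ft (ft f) x = ftc TYPE('a) * f (- x :: 'a)"
proof -
 obtain c where c: "c \<noteq> 0" "\<And>f x. f \<in> schwartz ==> (LINT z|lborel. ft f z * cis (2 * pi * (x \<bullet> (z::'a)))) = c * f x"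
  using fourier_inversion[where 'a='a] by blast
 have "ft (ft f) x = c * f (- x)" if "f \<in> schwartz" for f and x :: 'a
  using c(2)[OF that, of "- x"] unfolding ft_def[of "ft f"] by (simp add: inner_commute)
 then have "\<exists>c. c \<noteq> 0 \<and> (\<forall>f\<in>schwartz. \<forall>x::'a. ft (ft f) x = c * f (- x))" using c(1) by blast
 from someI_ex[OF this] show "ftc TYPE('a) \<noteq> 0" "f \<in> schwartz ==> ft (ft f) x = ftc TYPE('a) * f (- x :: 'a)"
  unfolding ftc_def by blast+
qed

lemma ft_cnj: "ft (\<lambda>t. cnj (h t)) (- z) = cnj (ft h z)"
 unfolding ft_def by (subst Bochner_Integration.integral_cnj[symmetric]) (simp add: cis_cnj)

section \<open>The rank one operators and their two factors\<close>

lemma OP_0_symb: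
 assumes f: "f \<in> schwartz" and g: "g \<in> schwartz"
 shows "OP 0 (fun_distr (symb (- 1) k l)) f g
  = (\<Sum>n. (1/2) ^ n * (ft (\<lambda>x. cis (pi * k * (x \<bullet> x)) * cnj (g x)) (- fst (l n)) * ft (ft f) (- snd (l n))))"
 unfolding OP_def fun_distr_def wigner_0[OF f]
 using symb_chirp[OF g schwartz_cnj[OF schwartz_ft[OF f]], of "- 1" k l] by simp

lemma OP_1_symb:
 assumes f: "f \<in> schwartz" and g: "g \<in> schwartz"
 shows "OP 1 (fun_distr (symb 1 k l)) f g
  = (\<Sum>n. (1/2) ^ n * (ft (\<lambda>x. cis (pi * k * (x \<bullet> x)) * f x) (- fst (l n)) * cnj (ft (ft g) (snd (l n)))))"
 unfolding OP_def fun_distr_def wigner_1[OF g]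
 using symb_chirp[OF schwartz_cnj[OF f] schwartz_ft[OF g], of 1 k l] by (simp add: ft_cnj)

lemma schwartz_quadratic_phase: "f \<in> schwartz ==> (\<lambda>x. cis (pi * k * (x \<bullet> x)) * f x) \<in> schwartz"
 using schwartz_mult_slow[OF _ slow_cis_inner[OF bounded_linear_ident bounded_linear_ident], of f "pi * k"]
 by (simp add: mult.commute)

lemma modulation_norm_scale:
 assumes \<phi>: "\<phi> \<in> schwartz" and pq: "1 \<le> p" "1 \<le> q" and D: "D \<in> tempered" and eq: "\<And>g. g \<in> schwartz ==> u g = a * D g"
 shows "ennreal (cmod a) * modulation_norm \<phi> p q (weight s t) D \<le> modulation_norm \<phi> p q (weight s t) u"
proof (cases "a = 0")
 case False
 note [measurable] = measurable_stft_tempered[OF D \<phi>]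
 have uF: "stft_abs \<phi> u = (\<lambda>z. ennreal (cmod a) * stft_abs \<phi> D z)"
  unfolding stft_abs_def stft_def eq[OF schwartz_modulate_translate[OF \<phi>]] by (simp add: norm_mult ennreal_mult)
 have id: "ennreal (1 / cmod a) * (ennreal (cmod a) * y) = y" "ennreal (cmod a) * (ennreal (1 / cmod a) * y) = y" for y
  using False by (simp_all add: mult.assoc[symmetric] flip: ennreal_mult)
 have "modulation_norm \<phi> p q (weight s t) D = wnorm p q s t (\<lambda>z. ennreal (1 / cmod a) * stft_abs \<phi> u z)"
  unfolding modulation_norm_eq uF id ..
 also have "\<dots> \<le> ennreal (1 / cmod a) * modulation_norm \<phi> p q (weight s t) u"
  unfolding modulation_norm_eq uF by (rule wnorm_cmult_le[OF pq]) measurable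
 finally have "ennreal (cmod a) * modulation_norm \<phi> p q (weight s t) D
   \<le> ennreal (cmod a) * (ennreal (1 / cmod a) * modulation_norm \<phi> p q (weight s t) u)"
  by (intro mult_left_mono) auto
 then show ?thesis unfolding id .
qed simp

lemma modulation_norm_finite:
 assumes \<phi>: "\<phi> \<in> schwartz" and f: "f \<in> schwartz" and pq: "1 \<le> p" "1 \<le> q"
 shows "modulation_norm \<phi> p q (weight s t) (fun_distr f) < top"
proof -
 obtain C where C: "C < top" "\<And>w \<eta>. modulation_norm \<phi> p q (weight s t) (fun_distr (\<lambda>u. cis (2 * pi * (u \<bullet> \<eta>)) * f (u - w)))
  \<le> C * (jp s w * jp t \<eta>)"
  by (rule modulation_norm_shift_le[OF \<phi> f pq, where s=s and t=t]) (rule that)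
 have "modulation_norm \<phi> p q (weight s t) (fun_distr f) \<le> C * (jp s (0::'a) * jp t (0::'a))"
  using C(2)[of 0 0] by simp
 also have "\<dots> < top" using C(1) by (simp add: ennreal_mult_less_top)
 finally show ?thesis .
qed

lemma modulation_norm_nonzero:
 assumes \<phi>: "\<phi> \<in> schwartz" "\<phi> x0 \<noteq> 0" and \<theta>: "\<theta> \<in> schwartz" and pq: "1 \<le> p" "1 \<le> q" and D: "D \<in> tempered" "D \<theta> \<noteq> 0"
 shows "modulation_norm \<phi> p q (weight s t) D \<noteq> 0"
proof
 assume 0: "modulation_norm \<phi> p q (weight s t) D = 0"
 obtain C where C: "C < top" "\<And>u x \<xi>. u \<in> tempered ==>
  stft_abs \<theta> u (x, \<xi>) * (jp s x * jp t \<xi>) \<le> C * modulation_norm \<phi> p q (weight s t) u"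
  by (rule modulation_norm_pointwise[OF \<phi> \<theta> pq, where s=s and t=t]) (rule that)
 have "stft_abs \<theta> D (0, 0) * (jp s (0::'a) * jp t (0::'a)) = 0" using C(2)[OF D(1), of 0 0] 0 by simp
 moreover have "jp s (0::'a) \<noteq> 0" "jp t (0::'a) \<noteq> 0" using less_imp_neq[OF jp_pos[of s "0::'a"]] less_imp_neq[OF jp_pos[of t "0::'a"]] by auto
 ultimately show False using D(2) by (simp add: stft_abs_def stft_def)
qed

text \<open>Multiplying the symbol by a series of characters in one of its two variables
 keeps the operator of rank one.\<close>

lemma OP_0_symb_fst:
 assumes f: "f \<in> schwartz" and g: "g \<in> schwartz"
 shows "OP 0 (fun_distr (symb (- 1) k (\<lambda>n. (R n, 0)))) f g = ft (ft f) 0 * fun_distr (\<lambda>x. cser R x * cis (pi * k * (x \<bullet> x))) g"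
proof -
 have h: "integrable lborel (\<lambda>x. cis (pi * k * (x \<bullet> x)) * cnj (g x))"
  by (intro schwartz_integrable schwartz_quadratic_phase schwartz_cnj g)
 show ?thesis unfolding OP_0_symb[OF f g] fst_conv snd_conv unfolding fun_distr_def
  using integral_cser(1)[OF h, of R] suminf_mult2[OF integral_cser(2)[OF h, of R], of "ft (ft f) 0"]
  by (simp add: mult_ac)
qed

lemma OP_0_symb_snd:
 assumes f: "f \<in> schwartz" and g: "g \<in> schwartz"
 shows "OP 0 (fun_distr (symb (- 1) 0 (\<lambda>n. (0, X n)))) f g = (\<Sum>n. (1/2) ^ n * ft (ft f) (- X n)) * fun_distr (\<lambda>_. 1) g"
proof -
 have h: "integrable lborel (ft f)" by (intro schwartz_integrable schwartz_ft f)
 have "ft (\<lambda>x. cnj (g x)) 0 = fun_distr (\<lambda>_. 1) g" by (simp add: ft_def fun_distr_def)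
 then show ?thesis unfolding OP_0_symb[OF f g] fst_conv snd_conv
  using suminf_mult2[OF integral_cser(2)[OF h, of X], of "fun_distr (\<lambda>_. 1) g"]
  by (simp add: mult_ac)
qed

lemma OP_1_symb_fst:
 assumes f: "f \<in> schwartz" and g: "g \<in> schwartz"
 shows "OP 1 (fun_distr (symb 1 k (\<lambda>n. (R n, 0)))) f g = (LINT x|lborel. cser R x * (cis (pi * k * (x \<bullet> x)) * f x)) * cnj (ft (ft g) 0)"
proof -
 have h: "integrable lborel (\<lambda>x. cis (pi * k * (x \<bullet> x)) * f x)"
  by (intro schwartz_integrable schwartz_quadratic_phase f)
 show ?thesis unfolding OP_1_symb[OF f g] fst_conv snd_conv integral_cser(1)[OF h, of R]
  by (subst suminf_mult2[OF integral_cser(2)[OF h, of R]]) (simp add: mult_ac)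
qed

lemma OP_1_symb_snd:
 assumes f: "f \<in> schwartz" and g: "g \<in> schwartz"
 shows "OP 1 (fun_distr (symb 1 0 (\<lambda>n. (0, X n)))) f g = (LINT x|lborel. f x) * (\<Sum>n. (1/2) ^ n * cnj (ft (ft g) (X n)))"
proof -
 have h: "integrable lborel (\<lambda>z. cnj (ft g z))" by (intro schwartz_integrable schwartz_cnj schwartz_ft g)
 have "ft f 0 = (LINT x|lborel. f x)" by (simp add: ft_def)
 then show ?thesis unfolding OP_1_symb[OF f g] fst_conv snd_conv
  using suminf_mult[OF integral_cser(2)[OF h, of X], of "ft f 0"]
  by (simp add: ft_cnj mult_ac)
qed

lemma nonneg_integral_norm:
 assumes c: "c \<in> schwartz" and r: "\<And>y. c y = complex_of_real (cmod (c y))"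
 shows "(\<integral>y. ennreal (cmod (c y))) = ennreal (cmod (LINT y|lborel. c y))"
proof -
 have i: "integrable lborel (\<lambda>y. cmod (c y))" using schwartz_integrable[OF c] by simp
 have "(LINT y|lborel. c y) = complex_of_real (LINT y|lborel. cmod (c y))"
  by (subst r) (rule integral_complex_of_real)
 then have "cmod (LINT y|lborel. c y) = (LINT y|lborel. cmod (c y))" by simp
 then show ?thesis using nn_integral_eq_integral[OF i] by simp
qed

lemma ft_nonzero:
 assumes G: "G \<in> schwartz" and nz: "G x \<noteq> 0" obtains y where "ft G y \<noteq> 0"
proof -
 have "\<exists>y. ft G y \<noteq> 0"
 proof (rule ccontr)
  assume "\<not> (\<exists>y. ft G y \<noteq> 0)"
  then have "ft (ft G) (- x) = 0" by (simp add: ft_def[of "ft G"])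
  then show False using ft_ft(1)[where 'a='a] ft_ft(2)[OF G, of "- x"] nz by simp
 qed
 then show ?thesis using that by blast
qed

section \<open>Lower bounds for output norms and gliding humps\<close>

lemma schwartz_ball_lower:
 fixes F :: "'a::euclidean_space => complex"
 assumes F: "F \<in> schwartz" and nz: "F y0 \<noteq> 0"
 obtains r v \<delta> :: real where "0 < r" "0 < v" "v \<le> 1" "0 < \<delta>" "\<And>y. y \<in> ball y0 r ==> \<delta> \<le> cmod (F y)"
  "\<And>x::'a. emeasure lborel (ball x r) = ennreal v"
proof -
 define \<delta> where "\<delta> = cmod (F y0) / 2"
 have \<delta>: "\<delta> > 0" using nz by (simp add: \<delta>_def)
 have "isCont F y0" using schwartz_continuous[OF F, of UNIV] by (simp add: continuous_on_eq_continuous_at)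
 then obtain r0 where r0: "r0 > 0" "\<And>y. dist y y0 < r0 ==> dist (F y) (F y0) < \<delta>"
  using \<delta> unfolding continuous_at_eps_delta by metis
 obtain r v where r: "0 < r" "r \<le> r0" "0 < v" "v \<le> 1" "\<And>x::'a. emeasure lborel (ball x r) = ennreal v"
  using small_ball[OF r0(1), where 'a='a] by metis
 have "\<delta> \<le> cmod (F y)" if "y \<in> ball y0 r" for y
 proof -
  have "cmod (F y - F y0) < \<delta>" using r0(2)[of y] that r(2) by (simp add: dist_norm norm_minus_commute)
  moreover have "cmod (F y0) \<le> cmod (F y) + cmod (F y - F y0)"
   using norm_triangle_ineq4[of "F y" "F y - F y0"] by simp
  ultimately show ?thesis by (simp add: \<delta>_def)
 qed
 then show ?thesis using that r \<delta> by blast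
qed

lemma jp_near:
 obtains e :: real where "0 < e" "\<And>x y::'a::euclidean_space. norm (x - y) \<le> \<rho> ==> ennreal e * jp s y \<le> jp s x"
proof -
 define K where "K = 2 powr \<bar>s\<bar> * (1 + \<bar>\<rho>\<bar>) powr \<bar>s\<bar>"
 have K: "K > 0" by (simp add: K_def)
 have "ennreal (1 / K) * jp s y \<le> jp s x" if d: "norm (x - y) \<le> \<rho>" for x y :: 'a
 proof -
  have "japanese (y - x) \<le> 1 + \<bar>\<rho>\<bar>" using japanese_le[of "y - x"] d by (simp add: norm_minus_commute)
  then have "jp \<bar>s\<bar> (y - x) \<le> ennreal ((1 + \<bar>\<rho>\<bar>) powr \<bar>s\<bar>)"
   unfolding jp_def by (intro ennreal_leI powr_mono2) auto
  then have "jp s y \<le> ennreal (2 powr \<bar>s\<bar>) * (jp s x * ennreal ((1 + \<bar>\<rho>\<bar>) powr \<bar>s\<bar>))"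
   by (intro order_trans[OF jp_peetre[of s y x]] mult_left_mono) auto
  also have "\<dots> = ennreal K * jp s x" by (simp add: K_def ennreal_mult mult_ac)
  finally have "ennreal (1 / K) * jp s y \<le> ennreal (1 / K) * (ennreal K * jp s x)" by (rule mult_left_mono) simp
  also have "\<dots> = jp s x" using K by (simp add: mult.assoc[symmetric] flip: ennreal_mult)
  finally show ?thesis .
 qed
 then show ?thesis using K by (intro that[of "1 / K"]) auto
qed

text \<open>The modulus of the transform does not depend on x, so the inner norm is a multiple of
  the norm of the weight in x alone. Averaging over a small ball around \<xi>0, where h stays away
  from 0, shows that this norm is finite.\<close>

lemma output_decay_fst:
 fixes \<phi> :: "'a::euclidean_space => complex"
 assumes \<phi>: "\<phi> \<in> schwartz" and pq: "1 \<le> p" "1 \<le> q" and D: "D \<in> tempered"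
  and fin: "modulation_norm \<phi> p q (weight s t) D < top"
  and h: "\<And>x \<xi>. cmod (stft \<phi> D x \<xi>) = cmod (h \<xi>)" and hS: "h \<in> schwartz" and nz: "h \<xi>0 \<noteq> 0"
 shows "recip p + s / DIM('a) < 0 \<or> p = \<infinity> \<and> s = 0"
proof -
 obtain r v \<delta> :: real where r: "0 < r" "0 < v" "v \<le> 1" "0 < \<delta>" "\<And>y. y \<in> ball \<xi>0 r ==> \<delta> \<le> cmod (h y)"
  "\<And>x::'a. emeasure lborel (ball x r) = ennreal v"
  by (rule schwartz_ball_lower[OF hS nz]) (rule that)
 obtain e where e: "0 < e" "\<And>x y::'a. norm (x - y) \<le> r ==> ennreal e * jp t y \<le> jp t x"
  by (rule jp_near[where s=t and \<rho>=r]) (rule that)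
 define F where "F z = stft_abs \<phi> D z * (jp s (fst z) * jp t (snd z))" for z
 note [measurable] = measurable_stft_tempered[OF D \<phi>]
 have F[measurable]: "F \<in> \<B>" unfolding F_def[abs_def] by measurable
 define a where "a = \<delta> * (e * japanese \<xi>0 powr t)"
 have a: "a > 0" using r e by (simp add: a_def)
 define L where "L = Lp_norm p (jp s :: 'a => ennreal)"
 have inner: "ennreal a * L \<le> Lp_norm p (\<lambda>x. F (x, \<xi>))" if \<xi>: "\<xi> \<in> ball \<xi>0 r" for \<xi>
 proof -
  have j: "ennreal e * jp t \<xi>0 \<le> jp t \<xi>" using e(2)[of \<xi> \<xi>0] \<xi> by (simp add: dist_norm norm_minus_commute)
  have l: "ennreal a * jp s x \<le> F (x, \<xi>)" for x
  proof -
   have "ennreal a * jp s x = ennreal \<delta> * (jp s x * (ennreal e * jp t \<xi>0))"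
    using r e by (simp add: a_def jp_def ennreal_mult mult_ac)
   also have "\<dots> \<le> ennreal (cmod (h \<xi>)) * (jp s x * jp t \<xi>)"
    by (intro mult_mono mult_left_mono j ennreal_leI r(5) \<xi>) auto
   finally show ?thesis by (simp add: F_def stft_abs_def h)
  qed
  have "Lp_norm p (\<lambda>x::'a. ennreal a * jp s x) \<le> Lp_norm p (\<lambda>x. F (x, \<xi>))"
   by (rule Lp_norm_mono[OF pq(1) _ l]) measurable
  then show ?thesis using Lp_norm_cmult[OF pq(1) measurable_jp[where 'a='a and s=s] a] by (simp add: L_def)
 qed
 have "(ennreal a * L) * emeasure lborel (ball \<xi>0 r) \<le> Lp_norm q (\<lambda>\<xi>. Lp_norm p (\<lambda>x. F (x, \<xi>)))"
  by (rule Lp_norm_lower[OF pq(2)]) (use F inner r in \<open>auto intro!: measurable_Lp_norm simp: ennreal_le_1\<close>)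
 also have "\<dots> < top" using fin unfolding modulation_norm_eq wnorm_def mixed_norm_def F_def .
 finally have "L < top" using a r by (cases "L = top") (auto simp: ennreal_mult_top less_top)
 then show ?thesis using Lp_norm_japanese[OF pq(1), of s, where 'a='a] by (simp add: L_def jp_def[abs_def])
qed

text \<open>For each \<xi> the transform is large on a ball of fixed size around
  \<open>Y \<xi>\<close>, so the inner norm is at least a multiple of the weight of exponent w in
  \<xi>. It is applied to a quadratic phase, where \<open>Y\<close> follows \<xi> and w = s2, and to
  a point evaluation, where \<open>Y\<close> is constant and w = 0.\<close>

lemma output_decay_snd:
 fixes \<phi> :: "'a::euclidean_space => complex"
 assumes \<phi>: "\<phi> \<in> schwartz" and pq: "1 \<le> p" "1 \<le> q" and D: "D \<in> tempered"
  and fin: "modulation_norm \<phi> p q (weight s t) D < top"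
  and r: "0 < v" "v \<le> 1" "\<And>x::'a. emeasure lborel (ball x r) = ennreal v" and e: "0 < e"
  and low: "\<And>x \<xi>. x \<in> ball (Y \<xi>) r ==> ennreal e * jp w \<xi> \<le> stft_abs \<phi> D (x, \<xi>) * jp s x"
 shows "recip q + (w + t) / DIM('a) < 0 \<or> q = \<infinity> \<and> w + t = 0"
proof -
 define F where "F z = stft_abs \<phi> D z * (jp s (fst z) * jp t (snd z))" for z
 note [measurable] = measurable_stft_tempered[OF D \<phi>]
 have F[measurable]: "F \<in> \<B>" unfolding F_def[abs_def] by measurable
 have inner: "ennreal (e * v) * jp (w + t) \<xi> \<le> Lp_norm p (\<lambda>x. F (x, \<xi>))" for \<xi>
 proof -
  have "(ennreal e * jp (w + t) \<xi>) * emeasure lborel (ball (Y \<xi>) r) \<le> Lp_norm p (\<lambda>x. F (x, \<xi>))"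
  proof (rule Lp_norm_lower[OF pq(1)])
   show "(\<lambda>x. F (x, \<xi>)) \<in> \<B>" by measurable
   fix x assume "x \<in> ball (Y \<xi>) r"
   from mult_right_mono[OF low[OF this], of "jp t \<xi>"]
   show "ennreal e * jp (w + t) \<xi> \<le> F (x, \<xi>)" by (simp add: F_def jp_add mult.assoc)
  qed (use r in \<open>auto simp: ennreal_le_1\<close>)
  then show ?thesis using e r by (simp add: ennreal_mult mult_ac)
 qed
 have "ennreal (e * v) * Lp_norm q (jp (w + t) :: 'a => ennreal) = Lp_norm q (\<lambda>\<xi>::'a. ennreal (e * v) * jp (w + t) \<xi>)"
  by (rule Lp_norm_cmult[symmetric, OF pq(2) measurable_jp]) (use e r in simp)
 also have "\<dots> \<le> Lp_norm q (\<lambda>\<xi>. Lp_norm p (\<lambda>x. F (x, \<xi>)))"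
  by (intro Lp_norm_mono pq inner) measurable
 also have "\<dots> < top" using fin unfolding modulation_norm_eq wnorm_def mixed_norm_def F_def .
 finally have "Lp_norm q (jp (w + t) :: 'a => ennreal) < top"
  using e r by (cases "Lp_norm q (jp (w + t) :: 'a => ennreal) = top") (auto simp: ennreal_mult_top less_top)
 then show ?thesis using Lp_norm_japanese[OF pq(2), of "w + t", where 'a='a] by (simp add: jp_def[abs_def])
qed

text \<open>The growth 4^n is chosen to beat the coefficients 2^-n of the series and still leave the
  unbounded factor 2^n.\<close>

lemma lacunary_points:
 assumes w: "0 < w"
 obtains X :: "nat => 'a::euclidean_space" where "\<And>n. 4 ^ n \<le> japanese (X n) powr w"
proof -
 obtain b :: 'a where b: "b \<in> Basis" using nonempty_Basis by blast
 define X where "X n = ((4 ^ n) powr (1 / w)) *\<^sub>R b" for n :: nat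
 have "4 ^ n \<le> japanese (X n) powr w" for n
 proof -
  have "(4 ^ n :: real) = ((4 ^ n) powr (1 / w)) powr w" using w by (simp add: powr_powr)
  also have "\<dots> \<le> japanese (X n) powr w"
   using norm_le_japanese[of "X n"] b w by (intro powr_mono2) (auto simp: X_def)
  finally show ?thesis .
 qed
 then show ?thesis by (rule that)
qed

lemma geometric_unbounded:
 assumes \<delta>: "0 < \<delta>" and le: "\<And>n::nat. \<delta> * 2 ^ n \<le> (K::real)"
 shows False
proof -
 obtain n where "K / \<delta> < 2 ^ n" using real_arch_pow[of 2 "K / \<delta>"] by auto
 then show False using le[of n] \<delta> by (simp add: pos_divide_less_eq mult.commute)
qed

text \<open>The terms are nonnegative multiples of one number, so nothing cancels and the series is
  at least its n-th term. The points of the series need not be separated for this reason.\<close>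

lemma geometric_sum_lower:
 fixes a :: "nat => complex"
 assumes a: "\<And>m. a m = complex_of_real (cmod (a m))" and B: "\<And>m. cmod (a m) \<le> B"
 shows "(1/2) ^ n * (cmod c * cmod (a n)) \<le> cmod (\<Sum>m. (1/2) ^ m * (c * a m))"
proof -
 have s: "summable (\<lambda>m. (1/2) ^ m * cmod (a m))"
  by (rule summable_comparison_test'[where g="\<lambda>m. (1/2) ^ m * B"])
   (auto intro!: summable_mult2 summable_geometric mult_left_mono B)
 have e: "(1/2) ^ m * (c * a m) = c * complex_of_real ((1/2) ^ m * cmod (a m))" for m
  by (subst a) simp
 have "(1/2) ^ n * cmod (a n) \<le> (\<Sum>m. (1/2) ^ m * cmod (a m))"
  using sum_le_suminf[OF s, of "{n}"] by simp
 then have "cmod c * ((1/2) ^ n * cmod (a n)) \<le> cmod c * \<bar>\<Sum>m. (1/2) ^ m * cmod (a m)\<bar>"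
  by (intro mult_left_mono) auto
 also have "\<dots> = cmod (\<Sum>m. (1/2) ^ m * (c * a m))"
  unfolding e suminf_mult[OF summable_of_real[OF s]] suminf_of_real[OF s, symmetric] by (simp add: norm_mult)
 finally show ?thesis by (simp add: mult_ac)
qed

lemma lacunary_output:
 assumes \<delta>: "0 < \<delta>" and N: "N < top" and X: "\<And>n. 4 ^ n \<le> japanese (X n :: 'a::euclidean_space) powr w"
  and le: "\<And>n::nat. ennreal ((1/2) ^ n * \<delta>) * jp w (X n) \<le> N"
 shows False
proof -
 obtain M where M: "N = ennreal M" "M \<ge> 0" using N by (cases N) auto
 have "\<delta> * 2 ^ n \<le> M" for n :: nat
 proof -
 have "\<delta> * 2 ^ n = ((1/2) ^ n * \<delta>) * 4 ^ n" by (simp add: power_divide field_simps flip: power_mult_distrib)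
 also have "\<dots> \<le> ((1/2) ^ n * \<delta>) * japanese (X n) powr w" using \<delta> by (intro mult_left_mono X) auto
 also have "\<dots> \<le> M" using le[of n] \<delta> M by (simp add: jp_def flip: ennreal_mult)
 finally show ?thesis .
 qed
 then show ?thesis by (rule geometric_unbounded[OF \<delta>])
qed

lemma lacunary_input:
 assumes \<delta>: "0 < \<delta>" and C: "C < top" and X: "\<And>n. 4 ^ n \<le> japanese (X n :: 'a::euclidean_space) powr (- w)"
  and le: "\<And>n::nat. ennreal ((1/2) ^ n * \<delta>) \<le> C * jp w (X n)"
 shows False
proof (rule lacunary_output[OF \<delta> C X])
 fix n :: nat
 have "ennreal ((1/2) ^ n * \<delta>) * jp (- w) (X n) \<le> C * jp w (X n) * jp (- w) (X n)"
  by (rule mult_right_mono[OF le]) simp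
 also have "\<dots> = C" by (simp add: mult.assoc flip: jp_add)
 finally show "ennreal ((1/2) ^ n * \<delta>) * jp (- w) (X n) \<le> C" .
qed

section \<open>Necessity\<close>

abbreviation "cser_distr R k \<equiv> fun_distr (\<lambda>x. cser R x * cis (pi * k * (x \<bullet> x)))"

lemma tempered_cser: "cser_distr R k \<in> tempered"
proof (rule tempered_fun_distr)
 have "(\<lambda>x. cis (pi * k * (x \<bullet> x))) \<in> \<B>"
  by (intro borel_measurable_continuous_onI continuous_intros)
 then show "(\<lambda>x. cser R x * cis (pi * k * (x \<bullet> x))) \<in> \<B>" by measurable
 show "cmod (cser R x * cis (pi * k * (x \<bullet> x))) \<le> 2" for x using cmod_cser_le[of R x] by (simp add: norm_mult)
qed

lemma geometric_const: "(\<Sum>n. (1/2) ^ n * a) = 2 * (a :: complex)"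
 using suminf_mult2[OF summable_geometric[of "1/2::complex"], of a] suminf_geometric[of "1/2 :: complex"] by simp

text \<open>Up to a constant this is a series of evaluations at the points \<open>- X n\<close>,
  since a double Fourier transform is a reflection. The supremum norm controls it, so no decay and
  no derivatives enter the bound.\<close>

lemma tempered_cser_ft: "(\<lambda>g. \<Sum>n. (1/2) ^ n * cnj (ft (ft g) (X n :: 'a::euclidean_space))) \<in> tempered"
proof -
 define c where "c = ftc TYPE('a)"
 note c = ft_ft[where 'a='a, folded c_def]
 have s: "summable (\<lambda>n. cmod ((1/2) ^ n * cnj (g (- X n))))" if g: "g \<in> schwartz" for g :: "'a => complex"
 proof -
  obtain B where B: "\<And>x. cmod (g x) \<le> B" using schwartz_bounded[OF g] by metis
  show ?thesis
   by (rule summable_comparison_test'[where g="\<lambda>n. (1/2) ^ n * B"])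
    (auto intro!: summable_mult2 summable_geometric mult_left_mono B simp: norm_mult norm_power)
 qed
 have eq: "(\<Sum>n. (1/2) ^ n * cnj (ft (ft g) (X n))) = cnj c * (\<Sum>n. (1/2) ^ n * cnj (g (- X n)))" if g: "g \<in> schwartz" for g
  using suminf_mult[OF summable_norm_cancel[OF s[OF g]], of "cnj c"] by (simp add: c(2)[OF g] mult_ac)
 show ?thesis
 proof (rule temperedI[where N=0 and C="2 * cmod c"])
  fix f g :: "'a => complex" assume fg: "f \<in> schwartz" "g \<in> schwartz"
  show "(\<Sum>n. (1/2) ^ n * cnj (ft (ft (\<lambda>x. f x + g x)) (X n)))
    = (\<Sum>n. (1/2) ^ n * cnj (ft (ft f) (X n))) + (\<Sum>n. (1/2) ^ n * cnj (ft (ft g) (X n)))"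
   unfolding eq[OF fg(1)] eq[OF fg(2)] eq[OF schwartz_add[OF fg]]
   using arg_cong[OF suminf_add[OF summable_norm_cancel[OF s[OF fg(1)]] summable_norm_cancel[OF s[OF fg(2)]]], where f="(*) (cnj c)"]
   by (simp only: complex_cnj_add distrib_left)
 next
  fix a and f :: "'a => complex" assume f: "f \<in> schwartz"
  show "(\<Sum>n. (1/2) ^ n * cnj (ft (ft (\<lambda>x. a * f x)) (X n))) = cnj a * (\<Sum>n. (1/2) ^ n * cnj (ft (ft f) (X n)))"
   unfolding eq[OF f] eq[OF schwartz_cmult[OF f]]
   using suminf_mult[OF summable_norm_cancel[OF s[OF f]], of "cnj a"] by (simp add: mult_ac)
 next
  fix f :: "'a => complex" and M assume f: "f \<in> schwartz" and M: "\<And>x. japanese x ^ 0 * cmod (f x) \<le> M"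
  have "cmod (\<Sum>n. (1/2) ^ n * cnj (f (- X n))) \<le> (\<Sum>n. cmod ((1/2) ^ n * cnj (f (- X n))))"
   by (rule summable_norm[OF s[OF f]])
  also have "\<dots> \<le> (\<Sum>n. (1/2) ^ n * M)"
   by (rule suminf_le[OF _ s[OF f]]) (use M in \<open>auto intro!: summable_mult2 summable_geometric mult_left_mono simp: norm_mult norm_power\<close>)
  also have "\<dots> = 2 * M"
   using suminf_mult2[OF summable_geometric[of "1/2 :: real"], of M] geometric_half by simp
  finally show "cmod (\<Sum>n. (1/2) ^ n * cnj (ft (ft f) (X n))) \<le> 2 * cmod c * M"
   unfolding eq[OF f] norm_mult complex_mod_cnj by (simp add: mult.left_commute mult_left_mono mult.assoc)
 qed
qed

text \<open>Besides the boundedness assumption the locale carries the inversion constant c and a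
  nonnegative test function \<gamma>, which does not vanish at 0; the window \<phi> of the norms is
  not suitable for arguments that must avoid cancellation.\<close>

locale bounded_OP =
 fixes \<tau> :: real and c :: complex and \<phi> \<gamma> :: "'a::euclidean_space => complex" and x0 and \<Phi> :: "'a \<times> 'a => complex"
  and p1 q1 p2 q2 :: ennreal and s1 t1 s2 t2 :: real
 assumes \<phi>: "\<phi> \<in> schwartz" "\<phi> x0 \<noteq> 0" and \<Phi>: "\<Phi> \<in> schwartz" and pq: "1 \<le> p1" "1 \<le> q1" "1 \<le> p2" "1 \<le> q2"
  and bdd: "OP_bounded \<tau> (wiener_amalgam \<Phi> 1 \<infinity>) \<phi> p1 q1 (weight s1 t1) p2 q2 (weight s2 t2)"
  and c: "c \<noteq> 0" "\<And>f x. f \<in> schwartz ==> ft (ft f) x = c * f (- x :: 'a)"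
  and \<gamma>: "\<gamma> \<in> schwartz" "\<And>y. \<gamma> y = complex_of_real (cmod (\<gamma> y))" "\<And>y. cmod (\<gamma> y) \<le> 1" "\<gamma> 0 \<noteq> 0"
begin

abbreviation "Nin f \<equiv> modulation_norm \<phi> p1 q1 (weight s1 t1) (fun_distr f)"
abbreviation "Nout \<equiv> modulation_norm \<phi> p2 q2 (weight s2 t2)"

lemma rank_one:
 assumes D: "D \<in> tempered"
  and eq: "\<And>f g. f \<in> schwartz ==> g \<in> schwartz ==> OP \<tau> (fun_distr (symb e k l)) f g = \<Lambda> f * D g"
 obtains C where "C < top" "\<And>f. f \<in> schwartz ==> ennreal (cmod (\<Lambda> f)) * Nout D \<le> C * Nin f"
proof -
 obtain C where C: "\<And>f. f \<in> schwartz ==> Nout (OP \<tau> (fun_distr (symb e k l)) f) \<le> ennreal C * Nin f"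
  using bdd symb_in_wiener_amalgam[OF \<Phi>] unfolding OP_bounded_def by blast
 show ?thesis
  by (rule that[OF ennreal_less_top order_trans[OF modulation_norm_scale[OF \<phi>(1) pq(3,4) D eq] C]])
qed

lemma rank_one_output:
 assumes D: "D \<in> tempered"
  and eq: "\<And>f g. f \<in> schwartz ==> g \<in> schwartz ==> OP \<tau> (fun_distr (symb e k l)) f g = \<Lambda> f * D g"
  and f: "f \<in> schwartz" "\<Lambda> f \<noteq> 0"
 shows "Nout D < top"
proof -
 obtain C where C: "C < top" "\<And>f. f \<in> schwartz ==> ennreal (cmod (\<Lambda> f)) * Nout D \<le> C * Nin f"
  by (rule rank_one[OF D eq]) (assumption, assumption, rule that)
 have "C * Nin f < top" using C(1) modulation_norm_finite[OF \<phi>(1) f(1) pq(1,2), of s1 t1] by (simp add: ennreal_mult_less_top)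
 with C(2)[OF f(1)] have "ennreal (cmod (\<Lambda> f)) * Nout D < top" by (rule order.strict_trans1)
 then show ?thesis using f(2) by (cases "Nout D = top") (simp_all add: ennreal_mult_top less_top)
qed

lemma rank_one_input:
 assumes D: "D \<in> tempered"
  and eq: "\<And>f g. f \<in> schwartz ==> g \<in> schwartz ==> OP \<tau> (fun_distr (symb e k l)) f g = \<Lambda> f * D g"
  and g: "g \<in> schwartz" "D g \<noteq> 0"
 obtains C where "C < top" "\<And>f. f \<in> schwartz ==> ennreal (cmod (\<Lambda> f)) \<le> C * Nin f"
proof -
 obtain C where C: "C < top" "\<And>f. f \<in> schwartz ==> ennreal (cmod (\<Lambda> f)) * Nout D \<le> C * Nin f"
  by (rule rank_one[OF D eq]) (assumption, assumption, rule that)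
 have N: "Nout D \<noteq> 0" by (rule modulation_norm_nonzero[OF \<phi> g(1) pq(3,4) D g(2)])
 \<comment> \<open>The norm of \<open>D\<close> may be infinite here, so a positive real number
   below it is used for the division.\<close>
 obtain v where v: "v > 0" "ennreal v \<le> Nout D"
 proof (cases "Nout D")
  case (real r)
  then show ?thesis using N that[of r] by (cases "r = 0") auto
 next
  case top
  then show ?thesis using that[of 1] by simp
 qed
 show ?thesis
 proof (rule that[of "ennreal (1 / v) * C"])
  show "ennreal (1 / v) * C < top" using C(1) by (simp add: ennreal_mult_less_top)
  fix f :: "'a => complex" assume f: "f \<in> schwartz"
  have "ennreal (cmod (\<Lambda> f)) = ennreal (1 / v) * (ennreal (cmod (\<Lambda> f)) * ennreal v)"
   using v by (simp flip: ennreal_mult)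
  also have "\<dots> \<le> ennreal (1 / v) * (C * Nin f)"
   by (intro mult_left_mono order_trans[OF mult_left_mono[OF v(2)] C(2)[OF f]]) auto
  finally show "ennreal (cmod (\<Lambda> f)) \<le> ennreal (1 / v) * C * Nin f" by (simp only: mult.assoc)
 qed
qed

lemma OP_0_output: "\<tau> = 0 ==> Nout (cser_distr R k) < top"
proof (rule rank_one_output[where \<Lambda>="\<lambda>f. ft (ft f) 0", OF tempered_cser _ \<gamma>(1)])
 show "OP \<tau> (fun_distr (symb (- 1) k (\<lambda>n. (R n, 0)))) f g = ft (ft f) 0 * cser_distr R k g"
  if "\<tau> = 0" "f \<in> schwartz" "g \<in> schwartz" for f g unfolding that(1) by (rule OP_0_symb_fst[OF that(2,3)])
 show "ft (ft \<gamma>) 0 \<noteq> 0" using c \<gamma> by simp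
qed

lemma OP_0_input:
 assumes \<tau>: "\<tau> = 0"
 obtains C where "C < top" "\<And>f. f \<in> schwartz ==> ennreal (cmod (\<Sum>n. (1/2) ^ n * ft (ft f) (- X n))) \<le> C * Nin f"
proof (rule rank_one_input[where \<Lambda>="\<lambda>f. \<Sum>n. (1/2) ^ n * ft (ft f) (- X n)" and D="fun_distr (\<lambda>_. 1)" and g="\<lambda>t. \<phi> t * cnj (\<phi> t)"])
 show "fun_distr (\<lambda>_::'a. 1) \<in> tempered" by (rule tempered_fun_distr[where B=1]) auto
 show "OP \<tau> (fun_distr (symb (- 1) 0 (\<lambda>n. (0, X n)))) f g = (\<Sum>n. (1/2) ^ n * ft (ft f) (- X n)) * fun_distr (\<lambda>_. 1) g"
  if "f \<in> schwartz" "g \<in> schwartz" for f g unfolding \<tau> by (rule OP_0_symb_snd[OF that])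
 show "(\<lambda>t. \<phi> t * cnj (\<phi> t)) \<in> schwartz" by (intro schwartz_mult schwartz_cnj \<phi>)
 show "fun_distr (\<lambda>_. 1) (\<lambda>t. \<phi> t * cnj (\<phi> t)) \<noteq> 0"
  using schwartz_norm_sq_pos[OF \<phi>] by (simp add: fun_distr_def mult.commute)
qed (rule that)

lemma OP_1_output: "\<tau> = 1 ==> Nout (\<lambda>g. \<Sum>n. (1/2) ^ n * cnj (ft (ft g) (X n))) < top"
proof (rule rank_one_output[where \<Lambda>="\<lambda>f. LINT x|lborel. f x", OF tempered_cser_ft])
 show "OP \<tau> (fun_distr (symb 1 0 (\<lambda>n. (0, X n)))) f g = (LINT x|lborel. f x) * (\<Sum>n. (1/2) ^ n * cnj (ft (ft g) (X n)))"
  if "\<tau> = 1" "f \<in> schwartz" "g \<in> schwartz" for f g unfolding that(1) by (rule OP_1_symb_snd[OF that(2,3)])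
 show "(\<lambda>t. \<phi> t * cnj (\<phi> t)) \<in> schwartz" by (intro schwartz_mult schwartz_cnj \<phi>)
qed (rule schwartz_norm_sq_pos[OF \<phi>])

lemma OP_1_input:
 assumes \<tau>: "\<tau> = 1"
 obtains C where "C < top"
  "\<And>f. f \<in> schwartz ==> ennreal (cmod (LINT x|lborel. cser R x * (cis (pi * k * (x \<bullet> x)) * f x))) \<le> C * Nin f"
proof (rule rank_one_input[where \<Lambda>="\<lambda>f. LINT x|lborel. cser R x * (cis (pi * k * (x \<bullet> x)) * f x)" and D="\<lambda>g. cnj (ft (ft g) 0)", OF _ _ \<gamma>(1)])
 show "(\<lambda>g. cnj (ft (ft g) 0)) \<in> (tempered :: 'a functional set)"
 proof (rule temperedI[where N=0 and C="cmod c"])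
  show "cnj (ft (ft (\<lambda>x. f x + g x)) 0) = cnj (ft (ft f) (0::'a)) + cnj (ft (ft g) 0)" if "f \<in> schwartz" "g \<in> schwartz" for f g
   using that schwartz_add[OF that] by (simp add: c ring_distribs)
  show "cnj (ft (ft (\<lambda>x. a * f x)) 0) = cnj a * cnj (ft (ft f) (0::'a))" if "f \<in> schwartz" for a f
   using that schwartz_cmult[OF that, of a] by (simp add: c)
  show "cmod (cnj (ft (ft f) (0::'a))) \<le> cmod c * M" if "f \<in> schwartz" "\<And>x. japanese x ^ 0 * cmod (f x) \<le> M" for f M
   using that(1) that(2)[of 0] by (simp add: c norm_mult mult_left_mono)
 qed
 show "OP \<tau> (fun_distr (symb 1 k (\<lambda>n. (R n, 0)))) f g = (LINT x|lborel. cser R x * (cis (pi * k * (x \<bullet> x)) * f x)) * cnj (ft (ft g) 0)"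
  if "f \<in> schwartz" "g \<in> schwartz" for f g unfolding \<tau> by (rule OP_1_symb_fst[OF that])
 show "cnj (ft (ft \<gamma>) 0) \<noteq> 0" using c \<gamma> by simp
qed (rule that)

text \<open>Turns a bound obtained by inserting a superposition into a rank one functional, where
  the functional returns a multiple of the integral of b, into the exponent condition.\<close>

lemma functional_exponent:
 assumes r: "1 \<le> r" and a: "0 < a" and C: "C < top" "B < top"
  and le: "\<And>b. b \<in> schwartz ==> ennreal (a * cmod (LINT y|lborel. b (y::'a))) \<le> C * (B * Lp_norm r (\<lambda>y. ennreal (cmod (b y)) * jp w y))"
 shows "1 < recip r + w / DIM('a) \<or> r = 1 \<and> w = 0"
proof (rule functional_bound_exponent[OF \<phi> r, where C="enn2real (ennreal (1 / a) * (C * B))"])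
 fix b :: "'a => complex" assume b: "b \<in> schwartz" "\<And>y. b y = complex_of_real (cmod (b y))"
 have "(\<integral>y. ennreal (cmod (b y))) = ennreal (1 / a) * ennreal (a * cmod (LINT y|lborel. b y))"
  unfolding nonneg_integral_norm[OF b] using a by (simp flip: ennreal_mult)
 also have "\<dots> \<le> ennreal (1 / a) * (C * (B * Lp_norm r (\<lambda>y. ennreal (cmod (b y)) * jp w y)))"
  by (intro mult_left_mono le b(1)) simp
 finally show "(\<integral>y. ennreal (cmod (b y))) \<le> ennreal (enn2real (ennreal (1 / a) * (C * B))) * Lp_norm r (\<lambda>y. ennreal (cmod (b y)) * jp w y)"
  using C by (simp add: ennreal_enn2real ennreal_mult_less_top mult.assoc)
qed

end

text \<open>A translation by x modulates exp (pi i k |t|^2) by k x, so the modulus depends on \<xi>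
  - k x only: for k = 0 it is constant in x, for k = 1 it is concentrated along the diagonal. The
  factor 2 is the value of the series at frequency 0.\<close>

lemma stft_quadratic_phase:
 assumes \<phi>: "\<phi> \<in> schwartz"
 shows "cmod (stft \<phi> (cser_distr (\<lambda>_. 0) k) x \<xi>)
  = cmod (ft (\<lambda>t. 2 * (cis (pi * k * (t \<bullet> t)) * cnj (\<phi> t))) (\<xi> - k *\<^sub>R x))"
proof -
 define G where "G t = 2 * (cis (pi * k * (t \<bullet> t)) * cnj (\<phi> t))" for t
 define H where "H t = cis (pi * k * (x \<bullet> x)) * (cis (2 * pi * (t \<bullet> k *\<^sub>R x)) * G t)" for t
 have G: "G \<in> schwartz" unfolding G_def by (intro schwartz_cmult schwartz_quadratic_phase schwartz_cnj \<phi>)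
 have H: "H \<in> schwartz" unfolding H_def
  using schwartz_cmult[OF schwartz_modulate_translate[OF G, of "k *\<^sub>R x" 0]] by simp
 have "cser (\<lambda>_. 0) t * cis (pi * k * (t \<bullet> t)) * cnj (\<phi> (t - x)) = H (t + - x)" for t
 proof -
  have "cis (pi * k * (t \<bullet> t)) = cis (pi * k * (x \<bullet> x)) * (cis (2 * pi * ((t - x) \<bullet> k *\<^sub>R x)) * cis (pi * k * ((t - x) \<bullet> (t - x))))"
   unfolding cis_mult by (rule arg_cong[where f=cis]) (simp add: inner_diff inner_commute algebra_simps)
  then show ?thesis by (simp add: cser_0 H_def G_def mult_ac)
 qed
 then have "stft \<phi> (cser_distr (\<lambda>_. 0) k) x \<xi> = ft (\<lambda>t. H (t + - x)) \<xi>"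
  unfolding stft_fun_distr by simp
 also have "\<dots> = cis (2 * pi * (- x \<bullet> \<xi>)) * ft H \<xi>" by (rule ft_translate[OF H])
 also have "ft H \<xi> = cis (pi * k * (x \<bullet> x)) * ft (\<lambda>t. cis (2 * pi * (t \<bullet> k *\<^sub>R x)) * G t) \<xi>"
  by (simp add: H_def ft_def mult.assoc)
 finally show ?thesis by (simp only: ft_modulate norm_mult norm_cis mult_1 G_def[abs_def])
qed

context bounded_OP
begin

text \<open>The outputs are a constant, a quadratic phase and a series of characters. On the
  diagonal, where the quadratic phase lives, x and \<xi> have comparable weights, whence the sum of
  s2 and t2. The characters place humps at the frequencies \<open>R n\<close>.\<close>

lemma OP_0_necessary_output:
 assumes \<tau>: "\<tau> = 0"
 shows "recip p2 + s2 / DIM('a) < 0 \<or> p2 = \<infinity> \<and> s2 = 0"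
  and "recip q2 + (s2 + t2) / DIM('a) < 0 \<or> q2 = \<infinity> \<and> s2 + t2 = 0"
  and "t2 \<le> 0"
proof -
 define G where "G k t = 2 * (cis (pi * k * (t \<bullet> t)) * cnj (\<phi> t))" for k t
 have G: "G k \<in> schwartz" for k unfolding G_def by (intro schwartz_cmult schwartz_quadratic_phase schwartz_cnj \<phi>)
 have Gnz: "G k x0 \<noteq> 0" for k using \<phi>(2) cis_neq_zero by (simp add: G_def)
 note st = stft_quadratic_phase[OF \<phi>(1), folded G_def]
 show "recip p2 + s2 / DIM('a) < 0 \<or> p2 = \<infinity> \<and> s2 = 0"
 proof -
  obtain y where y: "ft (G 0) y \<noteq> 0" by (rule ft_nonzero[OF G Gnz])
  show ?thesis
   by (rule output_decay_fst[OF \<phi>(1) pq(3,4) tempered_cser OP_0_output[OF \<tau>, where R="\<lambda>_. 0" and k=0] _ schwartz_ft[OF G] y])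
    (use st[of 0] in simp)
 qed
 show "recip q2 + (s2 + t2) / DIM('a) < 0 \<or> q2 = \<infinity> \<and> s2 + t2 = 0"
 proof -
  obtain y0 where y0: "ft (G 1) y0 \<noteq> 0" by (rule ft_nonzero[OF G Gnz])
  obtain r v \<delta> :: real where r: "0 < r" "0 < v" "v \<le> 1" "0 < \<delta>" "\<And>y. y \<in> ball y0 r ==> \<delta> \<le> cmod (ft (G 1) y)"
   "\<And>x::'a. emeasure lborel (ball x r) = ennreal v"
   by (rule schwartz_ball_lower[OF schwartz_ft[OF G] y0]) (rule that)
  obtain e where e: "0 < e" "\<And>x y::'a. norm (x - y) \<le> norm y0 + r ==> ennreal e * jp s2 y \<le> jp s2 x"
   by (rule jp_near[where s=s2 and \<rho>="norm y0 + r"]) (rule that)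
  show ?thesis
  proof (rule output_decay_snd[OF \<phi>(1) pq(3,4) tempered_cser OP_0_output[OF \<tau>, where R="\<lambda>_. 0" and k=1] r(2,3,6), where Y="\<lambda>\<xi>. \<xi> - y0" and e="\<delta> * e"])
   show "0 < \<delta> * e" using r e by simp
   fix x \<xi> :: 'a assume x: "x \<in> ball (\<xi> - y0) r"
   then have b: "\<xi> - x \<in> ball y0 r" by (simp add: dist_norm norm_minus_commute algebra_simps)
   have "norm (x - \<xi>) \<le> norm y0 + norm (\<xi> - y0 - x)"
    using norm_triangle_ineq[of y0 "\<xi> - y0 - x"] by (simp add: norm_minus_commute)
   also have "norm (\<xi> - y0 - x) \<le> r" using x by (simp add: dist_norm)
   finally have "ennreal e * jp s2 \<xi> \<le> jp s2 x" by (intro e) simp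
   then have "ennreal \<delta> * (ennreal e * jp s2 \<xi>) \<le> ennreal (cmod (ft (G 1) (\<xi> - x))) * jp s2 x"
    by (intro mult_mono ennreal_leI r(5) b) auto
   then show "ennreal (\<delta> * e) * jp s2 \<xi> \<le> stft_abs \<phi> (cser_distr (\<lambda>_. 0) 1) (x, \<xi>) * jp s2 x"
    unfolding stft_abs_def fst_conv snd_conv st using r e by (simp add: ennreal_mult mult.assoc)
  qed
 qed
 show "t2 \<le> 0"
 proof (rule ccontr)
  assume "\<not> t2 \<le> 0"
  then have t2: "t2 > 0" by simp
  obtain R :: "nat => 'a" where R: "\<And>n. 4 ^ n \<le> japanese (R n) powr t2" by (rule lacunary_points[OF t2]) (rule that)
  \<comment> \<open>With this window the transform of the series at (0, R n) is the series with
    terms c \<gamma> (R m - R n), nonnegative up to the factor c.\<close>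
  define \<theta> where "\<theta> t = cnj (ft \<gamma> t)" for t
  have \<theta>: "\<theta> \<in> schwartz" unfolding \<theta>_def by (intro schwartz_cnj schwartz_ft \<gamma>)
  obtain C where C: "C < top" "\<And>u x \<xi>. u \<in> tempered ==>
    stft_abs \<theta> u (x, \<xi>) * (jp s2 x * jp t2 \<xi>) \<le> C * Nout u"
   by (rule modulation_norm_pointwise[OF \<phi> \<theta> pq(3,4), where s=s2 and t=t2]) (rule that)
  define D where "D = cser_distr R 0"
  have low: "(1/2) ^ n * (cmod c * cmod (\<gamma> 0)) \<le> cmod (stft \<theta> D 0 (R n))" for n
  proof -
   define h where "h t = cis (2 * pi * (t \<bullet> - R n)) * ft \<gamma> t" for t
   have h: "h \<in> schwartz" unfolding h_def
    using schwartz_modulate_translate[OF schwartz_ft[OF \<gamma>(1)], of "- R n" 0] by simp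
   have fth: "ft h z = c * \<gamma> (- (z + R n))" for z
    unfolding h_def[abs_def] ft_modulate using c(2)[OF \<gamma>(1), of "z + R n"] by simp
   have "stft \<theta> D 0 (R n) = (LINT t|lborel. cser R t * h t)"
    unfolding D_def stft_fun_distr ft_def by (simp add: \<theta>_def h_def mult_ac)
   also have "\<dots> = (\<Sum>m. (1/2) ^ m * (c * \<gamma> (R m - R n)))"
    unfolding integral_cser(1)[OF schwartz_integrable[OF h]] fth by simp
   finally show ?thesis
    using geometric_sum_lower[where a="\<lambda>m. \<gamma> (R m - R n)", OF \<gamma>(2,3), of n c] by simp
  qed
  show False
  proof (rule lacunary_output[OF _ _ R])
   show "0 < cmod c * cmod (\<gamma> 0)" using c \<gamma> by simp
   show "C * Nout D < top" using C(1) OP_0_output[OF \<tau>, of R 0] by (simp add: D_def ennreal_mult_less_top)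
   fix n
   have "ennreal ((1/2) ^ n * (cmod c * cmod (\<gamma> 0))) * jp t2 (R n) \<le> stft_abs \<theta> D (0, R n) * (jp s2 (0::'a) * jp t2 (R n))"
    using mult_right_mono[OF ennreal_leI[OF low[of n]], of "jp t2 (R n)"] by (simp add: stft_abs_def jp_def[of s2] japanese_def)
   also have "\<dots> \<le> C * Nout D" by (rule C(2)) (simp only: D_def tempered_cser)
   finally show "ennreal ((1/2) ^ n * (cmod c * cmod (\<gamma> 0))) * jp t2 (R n) \<le> C * Nout D" .
  qed
 qed
qed

text \<open>By inversion the functional is a weighted sum of point evaluations of f. Superposed
  modulations of \<gamma> test the evaluation at 0, translates of \<gamma> to the points
  \<open>X n\<close> test the whole series.\<close>

lemma OP_0_necessary_input:
 assumes \<tau>: "\<tau> = 0"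
 shows "1 < recip q1 + t1 / DIM('a) \<or> q1 = 1 \<and> t1 = 0"
  and "0 \<le> s1"
proof -
 show "1 < recip q1 + t1 / DIM('a) \<or> q1 = 1 \<and> t1 = 0"
 proof -
  obtain C where C: "C < top" "\<And>f. f \<in> schwartz ==> ennreal (cmod (\<Sum>n. (1/2) ^ n * ft (ft f) (- (0::'a)))) \<le> C * Nin f"
   by (rule OP_0_input[OF \<tau>, where X="\<lambda>_. 0"]) (rule that)
  obtain B where B: "B < top" "\<And>b. b \<in> schwartz ==> Nin (superpose 0 1 \<gamma> b) \<le> B * Lp_norm q1 (\<lambda>y. ennreal (cmod (b y)) * jp t1 y)"
   by (rule superpose_modulations_norm[OF \<gamma>(1) \<phi>(1) pq(1,2), where s=s1 and t=t1]) (rule that)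
  show ?thesis
  proof (rule functional_exponent[OF pq(2) _ C(1) B(1), where a="2 * cmod c * cmod (\<gamma> 0)"])
   show "0 < 2 * cmod c * cmod (\<gamma> 0)" using c \<gamma> by simp
   fix b :: "'a => complex" assume b: "b \<in> schwartz"
   note S = schwartz_superpose[OF \<gamma>(1) b, where \<alpha>=0 and \<beta>=1]
   \<comment> \<open>At the origin every modulation equals 1, so the superposition takes the value
     \<gamma> (0) times the integral of b; the factor 2 is the sum of the geometric series.\<close>
   have "(\<Sum>n. (1/2) ^ n * ft (ft (superpose 0 1 \<gamma> b)) (- (0::'a))) = 2 * (c * (\<gamma> 0 * (LINT y|lborel. b y)))"
    unfolding geometric_const by (simp add: c(2)[OF S] superpose_def mult_ac)
   then have "ennreal (2 * cmod c * cmod (\<gamma> 0) * cmod (LINT y|lborel. b y)) \<le> C * Nin (superpose 0 1 \<gamma> b)"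
    using C(2)[OF S] by (simp add: norm_mult mult.assoc)
   also have "\<dots> \<le> C * (B * Lp_norm q1 (\<lambda>y. ennreal (cmod (b y)) * jp t1 y))"
    by (intro mult_left_mono B(2) b) simp
   finally show "ennreal (2 * cmod c * cmod (\<gamma> 0) * cmod (LINT y|lborel. b y)) \<le> C * (B * Lp_norm q1 (\<lambda>y. ennreal (cmod (b y)) * jp t1 y))" .
  qed
 qed
 show "0 \<le> s1"
 proof (rule ccontr)
  assume "\<not> 0 \<le> s1"
  then have s1: "- s1 > 0" by simp
  obtain X :: "nat => 'a" where X: "\<And>n. 4 ^ n \<le> japanese (X n) powr (- s1)" by (rule lacunary_points[OF s1]) (rule that)
  obtain C where C: "C < top" "\<And>f. f \<in> schwartz ==> ennreal (cmod (\<Sum>n. (1/2) ^ n * ft (ft f) (- X n))) \<le> C * Nin f"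
   by (rule OP_0_input[OF \<tau>, where X=X]) (rule that)
  obtain B where B: "B < top" "\<And>w \<eta>. Nin (\<lambda>u. cis (2 * pi * (u \<bullet> \<eta>)) * \<gamma> (u - w)) \<le> B * (jp s1 w * jp t1 \<eta>)"
   by (rule modulation_norm_shift_le[OF \<phi>(1) \<gamma>(1) pq(1,2), where s=s1 and t=t1]) (rule that)
  show False
  proof (rule lacunary_input[OF _ _ X])
   show "0 < cmod c * cmod (\<gamma> 0)" using c \<gamma> by simp
   show "C * B < top" using C(1) B(1) by (simp add: ennreal_mult_less_top)
   fix n
   define f where "f u = \<gamma> (u + - X n)" for u
   have f: "f \<in> schwartz" unfolding f_def by (rule schwartz_translate[OF \<gamma>(1)])
   have "(1/2) ^ n * (cmod c * cmod (\<gamma> (X n - X n))) \<le> cmod (\<Sum>m. (1/2) ^ m * (c * \<gamma> (X m - X n)))"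
    by (rule geometric_sum_lower[OF \<gamma>(2,3)])
   then have "ennreal ((1/2) ^ n * (cmod c * cmod (\<gamma> 0))) \<le> ennreal (cmod (\<Sum>m. (1/2) ^ m * ft (ft f) (- X m)))"
    by (intro ennreal_leI) (simp add: c(2)[OF f] f_def)
   also have "\<dots> \<le> C * Nin f" by (rule C(2)[OF f])
   also have "\<dots> \<le> C * (B * (jp s1 (X n) * jp t1 (0::'a)))"
    using B(2)[of 0 "X n"] by (intro mult_left_mono) (simp_all add: f_def[abs_def])
   finally show "ennreal ((1/2) ^ n * (cmod c * cmod (\<gamma> 0))) \<le> C * B * jp s1 (X n)"
    by (simp add: jp_def[of t1] japanese_def mult.assoc)
  qed
 qed
qed

end

context bounded_OP
begin

text \<open>The outputs are sums of point evaluations. A single one has no decay in \<xi>, which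
  exposes q2 and t2; a series of them places humps at the positions \<open>- X n\<close>, which
  exposes the sign of s2.\<close>

lemma OP_1_necessary_output:
 assumes \<tau>: "\<tau> = 1"
 shows "recip q2 + t2 / DIM('a) < 0 \<or> q2 = \<infinity> \<and> t2 = 0"
  and "s2 \<le> 0"
proof -
 show "recip q2 + t2 / DIM('a) < 0 \<or> q2 = \<infinity> \<and> t2 = 0"
 proof -
  define D where "D g = (\<Sum>n. (1/2) ^ n * cnj (ft (ft g) (0::'a)))" for g
  have D: "D \<in> tempered" unfolding D_def[abs_def] by (rule tempered_cser_ft[where X="\<lambda>_. 0"])
  have fin: "Nout D < top"
   unfolding D_def[abs_def] by (rule OP_1_output[OF \<tau>, where X="\<lambda>_. 0"])
  \<comment> \<open>\<open>D\<close> is a multiple of the evaluation at 0, so only the value of the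
    shifted window there is seen and the modulation drops out.\<close>
  have st: "cmod (stft \<phi> D x \<xi>) = 2 * cmod c * cmod (\<phi> (- x))" for x \<xi>
   unfolding stft_def D_def geometric_const c(2)[OF schwartz_modulate_translate[OF \<phi>(1)]]
   by (simp add: norm_mult)
  obtain r v \<delta> :: real where r: "0 < r" "0 < v" "v \<le> 1" "0 < \<delta>" "\<And>y. y \<in> ball x0 r ==> \<delta> \<le> cmod (\<phi> y)"
   "\<And>x::'a. emeasure lborel (ball x r) = ennreal v"
   by (rule schwartz_ball_lower[OF \<phi>]) (rule that)
  obtain e where e: "0 < e" "\<And>x y::'a. norm (x - y) \<le> r ==> ennreal e * jp s2 y \<le> jp s2 x"
   by (rule jp_near[where s=s2 and \<rho>=r]) (rule that)
  define a where "a = (2 * cmod c * \<delta>) * (e * japanese x0 powr s2)"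
  have "recip q2 + (0 + t2) / DIM('a) < 0 \<or> q2 = \<infinity> \<and> 0 + t2 = 0"
  proof (rule output_decay_snd[OF \<phi>(1) pq(3,4) D fin r(2,3,6), where Y="\<lambda>_. - x0" and e=a])
   show "0 < a" using r e c by (simp add: a_def)
   fix x \<xi> :: 'a assume x: "x \<in> ball (- x0) r"
   then have b: "- x \<in> ball x0 r" by (simp add: dist_norm norm_minus_commute) (metis add.commute diff_minus_eq_add minus_add_distrib norm_minus_cancel)
   have "norm (x - - x0) \<le> r" using x by (simp add: dist_norm norm_minus_commute)
   from e(2)[OF this] have j: "ennreal e * jp s2 x0 \<le> jp s2 x" by simp
   have "ennreal a * jp 0 \<xi> = ennreal (2 * cmod c * \<delta>) * (ennreal e * jp s2 x0)"
    using r e by (simp add: a_def jp_def[of s2] ennreal_mult)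
   also have "\<dots> \<le> ennreal (2 * cmod c * cmod (\<phi> (- x))) * jp s2 x"
    by (intro mult_mono ennreal_leI mult_left_mono r(5) b j) auto
   finally show "ennreal a * jp 0 \<xi> \<le> stft_abs \<phi> D (x, \<xi>) * jp s2 x"
    by (simp add: stft_abs_def st)
  qed
  then show ?thesis by simp
 qed
 show "s2 \<le> 0"
 proof (rule ccontr)
  assume "\<not> s2 \<le> 0"
  then have s2: "s2 > 0" by simp
  obtain X :: "nat => 'a" where X: "\<And>n. 4 ^ n \<le> japanese (X n) powr s2" by (rule lacunary_points[OF s2]) (rule that)
  obtain C where C: "C < top" "\<And>u x \<xi>. u \<in> tempered ==>
    stft_abs \<gamma> u (x, \<xi>) * (jp s2 x * jp t2 \<xi>) \<le> C * Nout u"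
   by (rule modulation_norm_pointwise[OF \<phi> \<gamma>(1) pq(3,4), where s=s2 and t=t2]) (rule that)
  define D where "D g = (\<Sum>n. (1/2) ^ n * cnj (ft (ft g) (X n)))" for g
  have D: "D \<in> tempered" unfolding D_def[abs_def] by (rule tempered_cser_ft)
  have fin: "Nout D < top"
   unfolding D_def[abs_def] by (rule OP_1_output[OF \<tau>])
  have low: "(1/2) ^ n * (cmod c * cmod (\<gamma> 0)) \<le> cmod (stft \<gamma> D (- X n) 0)" for n
  proof -
   define f where "f t = cis (2 * pi * (t \<bullet> 0)) * \<gamma> (t - - X n)" for t
   have f: "f \<in> schwartz" unfolding f_def by (rule schwartz_modulate_translate[OF \<gamma>(1)])
   have g: "cnj (\<gamma> y) = \<gamma> y" for y using \<gamma>(2)[of y] complex_cnj_complex_of_real by metis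
   have t: "cnj (ft (ft f) (X m)) = cnj c * \<gamma> (X n - X m)" for m
    by (simp add: c(2)[OF f] f_def g algebra_simps)
   have "stft \<gamma> D (- X n) 0 = (\<Sum>m. (1/2) ^ m * (cnj c * \<gamma> (X n - X m)))" unfolding stft_def f_def[symmetric] D_def t ..
   then show ?thesis
    using geometric_sum_lower[where a="\<lambda>m. \<gamma> (X n - X m)", OF \<gamma>(2,3), of n "cnj c"] by simp
  qed
  show False
  proof (rule lacunary_output[OF _ _ X])
   show "0 < cmod c * cmod (\<gamma> 0)" using c \<gamma> by simp
   show "C * Nout D < top" using C(1) fin by (simp add: ennreal_mult_less_top)
   fix n
   have "ennreal ((1/2) ^ n * (cmod c * cmod (\<gamma> 0))) * jp s2 (X n) \<le> stft_abs \<gamma> D (- X n, 0) * (jp s2 (- X n) * jp t2 (0::'a))"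
    using mult_right_mono[OF ennreal_leI[OF low[of n]], of "jp s2 (X n)"] by (simp add: stft_abs_def jp_def[of t2] japanese_def)
   also have "\<dots> \<le> C * Nout D" by (rule C(2)[OF D])
   finally show "ennreal ((1/2) ^ n * (cmod c * cmod (\<gamma> 0))) * jp s2 (X n) \<le> C * Nout D" .
  qed
 qed
qed

text \<open>The functional integrates f against a bounded function: against a constant it is tested
  on superposed translates, against a quadratic phase on shifts along \<xi> = -x, and against a
  series of characters on modulations of one function.\<close>

lemma OP_1_necessary_input:
 assumes \<tau>: "\<tau> = 1"
 shows "1 < recip p1 + s1 / DIM('a) \<or> p1 = 1 \<and> s1 = 0"
  and "1 < recip q1 + (s1 + t1) / DIM('a) \<or> q1 = 1 \<and> s1 + t1 = 0"
  and "0 \<le> t1"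
proof -
 define \<kappa> where "\<kappa> t = \<phi> t * cnj (\<phi> t)" for t
 have \<kappa>: "\<kappa> \<in> schwartz" unfolding \<kappa>_def by (intro schwartz_mult schwartz_cnj \<phi>)
 define I where "I = (LINT t|lborel. \<kappa> t)"
 have I: "I \<noteq> 0" unfolding I_def \<kappa>_def by (rule schwartz_norm_sq_pos[OF \<phi>])
 have I_shift: "(LINT t|lborel. \<kappa> (t + y)) = I" for y
  unfolding I_def by (rule integral_lborel_shift[OF schwartz_measurable[OF \<kappa>]])
 have a: "2 * cmod I > 0" using I by simp
 show "1 < recip p1 + s1 / DIM('a) \<or> p1 = 1 \<and> s1 = 0"
 proof -
  obtain C where C: "C < top" "\<And>f. f \<in> schwartz ==>
   ennreal (cmod (LINT x|lborel. cser (\<lambda>_. 0) x * (cis (pi * 0 * (x \<bullet> x)) * f x))) \<le> C * Nin f"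
   by (rule OP_1_input[OF \<tau>, where R="\<lambda>_. 0" and k=0]) (rule that)
  obtain B where B: "B < top" "\<And>b. b \<in> schwartz ==>
    Nin (superpose 1 0 \<kappa> b) \<le> B * Lp_norm p1 (\<lambda>y. ennreal (cmod (b y)) * jp s1 y)"
   by (rule superpose_translates_norm[OF \<kappa> \<phi>(1) pq(1,2), where s=s1 and t=t1]) (rule that)
  show ?thesis
  proof (rule functional_exponent[OF pq(1) a C(1) B(1)])
   fix b :: "'a => complex" assume b: "b \<in> schwartz"
   have "(LINT x|lborel. 2 * superpose 1 0 \<kappa> b x) = (LINT y|lborel. b y * (LINT t|lborel. 2 * (cis (2 * pi * (t \<bullet> 0 *\<^sub>R y)) * \<kappa> (t - 1 *\<^sub>R y))))"
    by (rule integral_superpose[OF \<kappa> b, where m="\<lambda>_. 2" and B=2]) auto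
   also have "\<dots> = (LINT y|lborel. b y * (2 * I))"
    using I_shift[of "- _"] by simp
   finally have "(LINT x|lborel. cser (\<lambda>_. 0) x * (cis (pi * 0 * (x \<bullet> x)) * superpose 1 0 \<kappa> b x)) = (LINT y|lborel. b y) * (2 * I)"
    by (simp add: cser_0)
   then have "ennreal (2 * cmod I * cmod (LINT y|lborel. b y)) \<le> C * Nin (superpose 1 0 \<kappa> b)"
    using C(2)[OF schwartz_superpose[OF \<kappa> b, where \<alpha>=1 and \<beta>=0]] by (simp add: norm_mult mult_ac)
   also have "\<dots> \<le> C * (B * Lp_norm p1 (\<lambda>y. ennreal (cmod (b y)) * jp s1 y))"
    by (rule mult_left_mono[OF B(2)[OF b]]) simp
   finally show "ennreal (2 * cmod I * cmod (LINT y|lborel. b y)) \<le> C * (B * Lp_norm p1 (\<lambda>y. ennreal (cmod (b y)) * jp s1 y))" .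
  qed
 qed
 show "1 < recip q1 + (s1 + t1) / DIM('a) \<or> q1 = 1 \<and> s1 + t1 = 0"
 proof -
  \<comment> \<open>The phase of \<mu> and the phase inserted into b below are chosen so that |y|^2
    + |t|^2 + 2 t \<bullet> y - |t + y|^2 = 0 removes every phase from the pairing. Neither changes
    a modulus of b.\<close>
  define \<mu> where "\<mu> t = cis (pi * (- 1) * (t \<bullet> t)) * \<kappa> t" for t
  have \<mu>: "\<mu> \<in> schwartz" unfolding \<mu>_def by (rule schwartz_quadratic_phase[OF \<kappa>])
  obtain C where C: "C < top" "\<And>f. f \<in> schwartz ==>
   ennreal (cmod (LINT x|lborel. cser (\<lambda>_. 0) x * (cis (pi * 1 * (x \<bullet> x)) * f x))) \<le> C * Nin f"
   by (rule OP_1_input[OF \<tau>, where R="\<lambda>_. 0" and k=1]) (rule that)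
  obtain B where B: "B < top" "\<And>b. b \<in> schwartz ==>
    Nin (superpose (- 1) 1 \<mu> b) \<le> B * Lp_norm q1 (\<lambda>y. ennreal (cmod (b y)) * jp (s1 + t1) y)"
   by (rule superpose_chirps_norm[OF \<mu> \<phi>(1) pq(1,2), where s=s1 and t=t1]) (rule that)
  show ?thesis
  proof (rule functional_exponent[OF pq(2) a C(1) B(1)])
   fix b :: "'a => complex" assume b: "b \<in> schwartz"
   define b' where "b' y = cis (pi * 1 * (y \<bullet> y)) * b y" for y
   have b': "b' \<in> schwartz" unfolding b'_def by (rule schwartz_quadratic_phase[OF b])
   have nb: "cmod (b' y) = cmod (b y)" for y by (simp add: b'_def norm_mult)
   define m where "m t = 2 * cis (pi * 1 * (t \<bullet> t))" for t :: 'a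
   have mm: "m \<in> \<B>" unfolding m_def
    by (intro borel_measurable_continuous_onI continuous_intros)
   have m2: "cmod (m t) \<le> 2" for t by (simp add: m_def norm_mult)
   have inner: "b' y * (m t * (cis (2 * pi * (t \<bullet> 1 *\<^sub>R y)) * \<mu> (t - (- 1) *\<^sub>R y))) = b y * (2 * \<kappa> (t + y))" for t y
   proof -
    have "cis (pi * (y \<bullet> y)) * (cis (pi * (t \<bullet> t)) * (cis (2 * pi * (t \<bullet> y)) * cis (- (pi * ((t + y) \<bullet> (t + y)))))) = 1"
     unfolding cis_mult by (simp add: inner_add inner_commute algebra_simps)
    then have "cis (pi * (y \<bullet> y)) * (cis (pi * (t \<bullet> t)) * (cis (2 * pi * (t \<bullet> y)) * cis (- (pi * ((t + y) \<bullet> (t + y)))))) * (b y * (2 * \<kappa> (t + y))) = b y * (2 * \<kappa> (t + y))"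
     by (simp only: mult_1)
    then show ?thesis by (simp add: b'_def m_def \<mu>_def mult_ac)
   qed
   have "(LINT x|lborel. m x * superpose (- 1) 1 \<mu> b' x)
     = (LINT y|lborel. b' y * (LINT t|lborel. m t * (cis (2 * pi * (t \<bullet> 1 *\<^sub>R y)) * \<mu> (t - (- 1) *\<^sub>R y))))"
    by (rule integral_superpose[OF \<mu> b' m2 mm])
   also have "\<dots> = (LINT y|lborel. LINT t|lborel. b y * (2 * \<kappa> (t + y)))"
    unfolding Bochner_Integration.integral_mult_right_zero[symmetric] inner ..
   also have "\<dots> = (LINT y|lborel. b y) * (2 * I)" by (simp add: I_shift)
   finally have "(LINT x|lborel. cser (\<lambda>_. 0) x * (cis (pi * 1 * (x \<bullet> x)) * superpose (- 1) 1 \<mu> b' x)) = (LINT y|lborel. b y) * (2 * I)"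
    by (simp add: cser_0 m_def mult.assoc)
   then have "ennreal (2 * cmod I * cmod (LINT y|lborel. b y)) \<le> C * Nin (superpose (- 1) 1 \<mu> b')"
    using C(2)[OF schwartz_superpose[OF \<mu> b', where \<alpha>="- 1" and \<beta>=1]] by (simp add: norm_mult mult_ac)
   also have "\<dots> \<le> C * (B * Lp_norm q1 (\<lambda>y. ennreal (cmod (b y)) * jp (s1 + t1) y))"
    by (rule mult_left_mono[OF B(2)[OF b', unfolded nb]]) simp
   finally show "ennreal (2 * cmod I * cmod (LINT y|lborel. b y)) \<le> C * (B * Lp_norm q1 (\<lambda>y. ennreal (cmod (b y)) * jp (s1 + t1) y))" .
  qed
 qed
 show "0 \<le> t1"
 proof (rule ccontr)
  assume "\<not> 0 \<le> t1"
  then have t1: "- t1 > 0" by simp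
  obtain R :: "nat => 'a" where R: "\<And>n. 4 ^ n \<le> japanese (R n) powr (- t1)" by (rule lacunary_points[OF t1]) (rule that)
  obtain C where C: "C < top" "\<And>f. f \<in> schwartz ==>
   ennreal (cmod (LINT x|lborel. cser R x * (cis (pi * 0 * (x \<bullet> x)) * f x))) \<le> C * Nin f"
   by (rule OP_1_input[OF \<tau>, where R=R and k=0]) (rule that)
  \<comment> \<open>A Fourier transform is used as test function so that, by inversion, the
    functional returns the values \<gamma> (R m - R n), which are nonnegative.\<close>
  define \<theta> where "\<theta> = ft \<gamma>"
  have \<theta>: "\<theta> \<in> schwartz" unfolding \<theta>_def by (rule schwartz_ft[OF \<gamma>(1)])
  obtain B where B: "B < top" "\<And>w \<eta>. Nin (\<lambda>u. cis (2 * pi * (u \<bullet> \<eta>)) * \<theta> (u - w))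
   \<le> B * (jp s1 w * jp t1 \<eta>)"
   by (rule modulation_norm_shift_le[OF \<phi>(1) \<theta> pq(1,2), where s=s1 and t=t1]) (rule that)
  show False
  proof (rule lacunary_input[OF _ _ R])
   show "0 < cmod c * cmod (\<gamma> 0)" using c \<gamma> by simp
   show "C * B < top" using C(1) B(1) by (simp add: ennreal_mult_less_top)
   fix n
   define f where "f u = cis (2 * pi * (u \<bullet> - R n)) * \<theta> (u - 0)" for u
   have f: "f \<in> schwartz" unfolding f_def by (rule schwartz_modulate_translate[OF \<theta>])
   have ftf: "ft f z = c * \<gamma> (- (z + R n))" for z
    unfolding f_def[abs_def] ft_modulate using c(2)[OF \<gamma>(1), of "z + R n"] by (simp add: \<theta>_def)
   have "(1/2) ^ n * (cmod c * cmod (\<gamma> (R n - R n))) \<le> cmod (\<Sum>m. (1/2) ^ m * (c * \<gamma> (R m - R n)))"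
    by (rule geometric_sum_lower[OF \<gamma>(2,3)])
   then have "ennreal ((1/2) ^ n * (cmod c * cmod (\<gamma> 0))) \<le> ennreal (cmod (LINT x|lborel. cser R x * f x))"
    unfolding integral_cser(1)[OF schwartz_integrable[OF f]] ftf by (intro ennreal_leI) simp
   also have "\<dots> \<le> C * Nin f" using C(2)[OF f] by simp
   also have "\<dots> \<le> C * (B * (jp s1 (0::'a) * jp t1 (- R n)))"
    unfolding f_def[abs_def] by (intro mult_left_mono B(2)) simp
   finally show "ennreal ((1/2) ^ n * (cmod c * cmod (\<gamma> 0))) \<le> C * B * jp t1 (R n)"
    by (simp add: jp_def[of s1] japanese_def mult.assoc)
  qed
 qed
qed

end

section \<open>The two equivalences\<close>

lemma bounded_OP_exists:
 assumes \<phi>: "\<phi> \<in> schwartz" "\<phi> \<noteq> (\<lambda>_. 0)" and "\<Phi> \<in> schwartz" "1 \<le> p1" "1 \<le> q1" "1 \<le> p2" "1 \<le> q2"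
  and "OP_bounded \<tau> (wiener_amalgam \<Phi> 1 \<infinity>) \<phi> p1 q1 (weight s1 t1) p2 q2 (weight s2 t2)"
 obtains c \<gamma> x0 where "bounded_OP \<tau> c \<phi> \<gamma> x0 \<Phi> p1 q1 p2 q2 s1 t1 s2 t2"
proof -
 obtain x0 where x0: "\<phi> x0 \<noteq> 0" using \<phi>(2) by (auto simp: fun_eq_iff)
 obtain \<gamma> :: "'a => complex" where \<gamma>: "\<gamma> \<in> schwartz" "\<And>y. \<gamma> y = complex_of_real (cmod (\<gamma> y))" "\<And>y. cmod (\<gamma> y) \<le> 1" "\<gamma> 0 \<noteq> 0"
  by (rule nonneg_schwartz[OF \<phi>(1) x0]) (rule that)
 have "bounded_OP \<tau> (ftc TYPE('a)) \<phi> \<gamma> x0 \<Phi> p1 q1 p2 q2 s1 t1 s2 t2"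
  by (rule bounded_OP.intro) (fact assms x0 \<gamma> ft_ft)+
 then show ?thesis by (rule that)
qed

text \<open>The further inequalities in the theorem are consequences of these and of 0 \<le> 1/p
  \<le> 1: for instance 1 < 1/q1 + t1/d forces t1 > 0, and s2 + t2 = 0 together with s2, t2 \<le> 0
  forces both to vanish.\<close>

lemma OP_0_bounded_iff:
 fixes \<phi> :: "'a::euclidean_space => complex" and \<Phi> :: "'a \<times> 'a => complex"
 assumes \<phi>: "\<phi> \<in> schwartz" "\<phi> \<noteq> (\<lambda>_. 0)" and \<Phi>: "\<Phi> \<in> schwartz" "\<Phi> \<noteq> (\<lambda>_. 0)"
  and pq: "1 \<le> p1" "1 \<le> q1" "1 \<le> p2" "1 \<le> q2"
 shows "OP_bounded 0 (wiener_amalgam \<Phi> 1 \<infinity>) \<phi> p1 q1 (weight s1 t1) p2 q2 (weight s2 t2) \<longleftrightarrow>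
  t2 \<le> 0 \<and> 0 \<le> s1 \<and> (recip p2 + s2 / DIM('a) < 0 \<or> p2 = \<infinity> \<and> s2 = 0) \<and>
  (1 < recip q1 + t1 / DIM('a) \<or> q1 = 1 \<and> t1 = 0) \<and>
  (recip q2 + (s2 + t2) / DIM('a) < 0 \<or> q2 = \<infinity> \<and> s2 + t2 = 0)"
  (is "?B \<longleftrightarrow> ?R")
proof
 assume B: ?B
 obtain c \<gamma> x0 where "bounded_OP 0 c \<phi> \<gamma> x0 \<Phi> p1 q1 p2 q2 s1 t1 s2 t2"
  by (rule bounded_OP_exists[OF \<phi> \<Phi>(1) pq B]) (rule that)
 then interpret bounded_OP 0 c \<phi> \<gamma> x0 \<Phi> p1 q1 p2 q2 s1 t1 s2 t2 .
 show ?R using OP_0_necessary_output OP_0_necessary_input by simp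
next
 assume R: ?R
 have "s2 \<le> 0"
 proof (rule ccontr)
  assume "\<not> s2 \<le> 0"
  then have "0 < s2 / DIM('a)" by simp
  moreover have "recip p2 + s2 / DIM('a) < 0" using R \<open>\<not> s2 \<le> 0\<close> by auto
  ultimately show False using recip_cases(1)[OF pq(3)] by linarith
 qed
 then show ?B using R by (intro OP_0_sufficient \<phi> \<Phi> pq) auto
qed

lemma OP_1_bounded_iff:
 fixes \<phi> :: "'a::euclidean_space => complex" and \<Phi> :: "'a \<times> 'a => complex"
 assumes \<phi>: "\<phi> \<in> schwartz" "\<phi> \<noteq> (\<lambda>_. 0)" and \<Phi>: "\<Phi> \<in> schwartz" "\<Phi> \<noteq> (\<lambda>_. 0)"
  and pq: "1 \<le> p1" "1 \<le> q1" "1 \<le> p2" "1 \<le> q2"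
 shows "OP_bounded 1 (wiener_amalgam \<Phi> 1 \<infinity>) \<phi> p1 q1 (weight s1 t1) p2 q2 (weight s2 t2) \<longleftrightarrow>
  s2 \<le> 0 \<and> 0 \<le> t1 \<and> (1 < recip p1 + s1 / DIM('a) \<or> p1 = 1 \<and> s1 = 0) \<and>
  (recip q2 + t2 / DIM('a) < 0 \<or> q2 = \<infinity> \<and> t2 = 0) \<and>
  (1 < recip q1 + (s1 + t1) / DIM('a) \<or> q1 = 1 \<and> s1 + t1 = 0)"
  (is "?B \<longleftrightarrow> ?R")
proof
 assume B: ?B
 obtain c \<gamma> x0 where "bounded_OP 1 c \<phi> \<gamma> x0 \<Phi> p1 q1 p2 q2 s1 t1 s2 t2"
  by (rule bounded_OP_exists[OF \<phi> \<Phi>(1) pq B]) (rule that)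
 then interpret bounded_OP 1 c \<phi> \<gamma> x0 \<Phi> p1 q1 p2 q2 s1 t1 s2 t2 .
 show ?R using OP_1_necessary_output OP_1_necessary_input by simp
next
 assume R: ?R
 have "0 \<le> s1"
 proof (rule ccontr)
  assume "\<not> 0 \<le> s1"
  then have "s1 / DIM('a) < 0" by (simp add: divide_neg_pos)
  moreover have "1 < recip p1 + s1 / DIM('a)" using R \<open>\<not> 0 \<le> s1\<close> by auto
  ultimately show False using recip_cases(2)[OF pq(1)] by linarith
 qed
 then show ?B using R by (intro OP_1_sufficient \<phi> \<Phi> pq) auto
qed

theorem theorem6p11:
  fixes \<phi> :: "real ^ 'd \<Rightarrow> complex"
    and \<Phi> :: "(real ^ 'd) \<times> (real ^ 'd) \<Rightarrow> complex"
    and p1 p2 q1 q2 :: ennreal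
    and s1 s2 t1 t2 \<tau> d :: real
  assumes "\<phi> \<in> schwartz" and "\<phi> \<noteq> (\<lambda>_. 0)"
    and "\<Phi> \<in> schwartz" and "\<Phi> \<noteq> (\<lambda>_. 0)"
    and "1 \<le> p1" and "1 \<le> p2" and "1 \<le> q1" and "1 \<le> q2"
    and "\<tau> \<in> {0, 1}"
    and d: "d = real CARD('d)"
  defines "star \<equiv> OP_bounded \<tau> (wiener_amalgam \<Phi> 1 \<infinity>) \<phi>
             p1 q1 (weight s1 t1) p2 q2 (weight s2 t2)"
  shows "(\<tau> = 0 \<longrightarrow> (star \<longleftrightarrow>
        s2 \<le> 0 \<and> t2 \<le> 0 \<and> 0 \<le> s1 \<and> 0 \<le> t1 \<and>
        (0 < recip p1 + s1 / d \<or> (p1, s1) = (\<infinity>, 0)) \<and>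
        (recip p2 + s2 / d < 0 \<or> (p2, s2) = (\<infinity>, 0)) \<and>
        (1 < recip q1 + t1 / d \<or> (q1, t1) = (1, 0)) \<and>
        (recip q2 + t2 / d < 1 \<or> (q2, t2) = (1, 0)) \<and>
        (recip q2 + (s2 + t2) / d < 0 \<or> (q2, s2, t2) = (\<infinity>, 0, 0)))) \<and>
    (\<tau> = 1 \<longrightarrow> (star \<longleftrightarrow>
        s2 \<le> 0 \<and> t2 \<le> 0 \<and> 0 \<le> s1 \<and> 0 \<le> t1 \<and>
        (1 < recip p1 + s1 / d \<or> (p1, s1) = (1, 0)) \<and>
        (recip p2 + s2 / d < 1 \<or> (p2, s2) = (1, 0)) \<and>
        (0 < recip q1 + t1 / d \<or> (q1, t1) = (\<infinity>, 0)) \<and>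
        (recip q2 + t2 / d < 0 \<or> (q2, t2) = (\<infinity>, 0)) \<and>
        (1 < recip q1 + (s1 + t1) / d \<or> (q1, s1, t1) = (1, 0, 0)))) \<and>
    (s1 = 0 \<and> t1 = 0 \<and> s2 = 0 \<and> t2 = 0 \<longrightarrow>
        (\<tau> = 0 \<longrightarrow> (star \<longleftrightarrow> q1 = 1 \<and> p2 = \<infinity> \<and> q2 = \<infinity>)) \<and>
        (\<tau> = 1 \<longrightarrow> (star \<longleftrightarrow> q2 = \<infinity> \<and> p1 = 1 \<and> q1 = 1)))"
proof -
 let ?B = "\<lambda>\<tau>. OP_bounded \<tau> (wiener_amalgam \<Phi> 1 \<infinity>) \<phi> p1 q1 (weight s1 t1) p2 q2 (weight s2 t2)"
 note pq = \<open>1 \<le> p1\<close> \<open>1 \<le> q1\<close> \<open>1 \<le> p2\<close> \<open>1 \<le> q2\<close>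
 have D: "real DIM(real ^ 'd) = d" and d0: "d > 0" by (simp_all add: d)
 have star0: "?B 0 \<longleftrightarrow>
   t2 \<le> 0 \<and> 0 \<le> s1 \<and> (recip p2 + s2 / d < 0 \<or> p2 = \<infinity> \<and> s2 = 0) \<and>
   (1 < recip q1 + t1 / d \<or> q1 = 1 \<and> t1 = 0) \<and>
   (recip q2 + (s2 + t2) / d < 0 \<or> q2 = \<infinity> \<and> s2 + t2 = 0)"
  using OP_0_bounded_iff[OF assms(1-4) pq] unfolding D .
 have star1: "?B 1 \<longleftrightarrow>
   s2 \<le> 0 \<and> 0 \<le> t1 \<and> (1 < recip p1 + s1 / d \<or> p1 = 1 \<and> s1 = 0) \<and>
   (recip q2 + t2 / d < 0 \<or> q2 = \<infinity> \<and> t2 = 0) \<and>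
   (1 < recip q1 + (s1 + t1) / d \<or> q1 = 1 \<and> s1 + t1 = 0)"
  using OP_1_bounded_iff[OF assms(1-4) pq] unfolding D .
 note r = recip_cases[OF \<open>1 \<le> p1\<close>] recip_cases[OF \<open>1 \<le> q1\<close>] recip_cases[OF \<open>1 \<le> p2\<close>] recip_cases[OF \<open>1 \<le> q2\<close>]
 \<comment> \<open>Naming the quotients by d makes all conditions linear; the signs collected in
   \<open>sg\<close> are the only link between the quotients and the exponents that is called
   for.\<close>
 define S1 S2 T1 T2 where ST: "S1 = s1 / d" "S2 = s2 / d" "T1 = t1 / d" "T2 = t2 / d"
 have sg: "(S1 \<le> 0 \<longleftrightarrow> s1 \<le> 0) \<and> (0 \<le> S1 \<longleftrightarrow> 0 \<le> s1)" "(S2 \<le> 0 \<longleftrightarrow> s2 \<le> 0) \<and> (0 \<le> S2 \<longleftrightarrow> 0 \<le> s2)"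
  "(T1 \<le> 0 \<longleftrightarrow> t1 \<le> 0) \<and> (0 \<le> T1 \<longleftrightarrow> 0 \<le> t1)" "(T2 \<le> 0 \<longleftrightarrow> t2 \<le> 0) \<and> (0 \<le> T2 \<longleftrightarrow> 0 \<le> t2)"
  using d0 by (auto simp: ST divide_le_0_iff zero_le_divide_iff)
 have main0: "?B 0 \<longleftrightarrow>
    s2 \<le> 0 \<and> t2 \<le> 0 \<and> 0 \<le> s1 \<and> 0 \<le> t1 \<and>
    (0 < recip p1 + s1 / d \<or> (p1, s1) = (\<infinity>, 0)) \<and>
    (recip p2 + s2 / d < 0 \<or> (p2, s2) = (\<infinity>, 0)) \<and>
    (1 < recip q1 + t1 / d \<or> (q1, t1) = (1, 0)) \<and>
    (recip q2 + t2 / d < 1 \<or> (q2, t2) = (1, 0)) \<and>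
    (recip q2 + (s2 + t2) / d < 0 \<or> (q2, s2, t2) = (\<infinity>, 0, 0))"
  unfolding star0 prod.inject add_divide_distrib ST[symmetric] using r sg by (smt (verit))
 have main1: "?B 1 \<longleftrightarrow>
    s2 \<le> 0 \<and> t2 \<le> 0 \<and> 0 \<le> s1 \<and> 0 \<le> t1 \<and>
    (1 < recip p1 + s1 / d \<or> (p1, s1) = (1, 0)) \<and>
    (recip p2 + s2 / d < 1 \<or> (p2, s2) = (1, 0)) \<and>
    (0 < recip q1 + t1 / d \<or> (q1, t1) = (\<infinity>, 0)) \<and>
    (recip q2 + t2 / d < 0 \<or> (q2, t2) = (\<infinity>, 0)) \<and>
    (1 < recip q1 + (s1 + t1) / d \<or> (q1, s1, t1) = (1, 0, 0))"
  unfolding star1 prod.inject add_divide_distrib ST[symmetric] using r sg by (smt (verit))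
 have special: "s1 = 0 \<and> t1 = 0 \<and> s2 = 0 \<and> t2 = 0 ==>
   ?B 0 \<longleftrightarrow> q1 = 1 \<and> p2 = \<infinity> \<and> q2 = \<infinity>"
  "s1 = 0 \<and> t1 = 0 \<and> s2 = 0 \<and> t2 = 0 ==>
   ?B 1 \<longleftrightarrow> q2 = \<infinity> \<and> p1 = 1 \<and> q1 = 1"
  unfolding star0 star1 using r by (simp_all, (smt (verit))+)
 show ?thesis
  unfolding star_def using main0 main1 special by (intro conjI impI) (simp_all only: )
qed

end
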